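(* Let $\mathcal C$ be a strongly semi-abelian category and $n\ge2$. Let $\Pi\colon\mathbf{XExt}^n(\mathcal C)\to\mathbf{Mod}(\mathcal C)$ be the forgetful functor that sends a crossed $n$-fold extension $0\to B\to G_n\to\cdots\to G_1\to C\to1$ to the $C$-module $B$, let $(\underline{\ })_0\colon\mathbf{Mod}(\mathcal C)\to\mathcal C$ be the functor that assigns to the $C$-module $B$ the object $C$, and let $\Pi_0=(\underline{\ })_0\cdot\Pi$. Then the morphism $\Pi\colon(\mathbf{XExt}^n(\mathcal C),\Pi_0)\to(\mathbf{Mod}(\mathcal C),(\underline{\ })_0)$ is an opfibration in the 2-category $\mathbf{Fib}(\mathcal C)$.
   Context: A category is strongly semi-abelian if it is pointed, finitely complete, Barr-exact, has coproducts (finite ones, as usual for semi-abelian categories), and is strongly protomodular. Strong protomodularity means here: for any morphism $(1_B,\varphi,\psi)$ of split short exact sequences over the same $B$, from $X\xrightarrow{\kappa}A\rightleftarrows B$ to $X'\xrightarrow{\kappa'}A'\rightleftarrows B$, if $\psi$ is an isomorphism then so is $\varphi$, and if $\psi$ is a normal monomorphism then so is $\varphi\cdot\kappa=\kappa'\cdot\psi$. Internal actions: for objects $B,X$, let $\kappa_{B,X}\colon B\flat X\to B+X$ be the kernel of $[1,0]\colon B+X\to B$. $B\flat(-)$ is a monad on $\mathcal C$, and its algebras $\xi\colon B\flat X\to X$ are the internal actions of $B$ on $X$. The conjugation action of $X$ is $\chi=[1,1]\cdot\kappa_{X,X}\colon X\flat X\to X$. A morphism of actions from $\xi\colon B\flat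 X\to X$ to $\xi'\colon B'\flat X'\to X'$ is a pair $(f,h)$ with $h\cdot\xi=\xi'\cdot(f\flat h)$; if $f=1_B$, $h$ is called $B$-equivariant. A $C$-module is an abelian object $B$ with an internal $C$-action. $\mathbf{Mod}(\mathcal C)$ has as objects pairs ($C$, $C$-module $B$) and as morphisms the morphisms of actions $(\gamma,\beta)$. An internal crossed module is a map $\partial\colon G_2\to G_1$ with an action $\xi\colon G_1\flat G_2\to G_2$ such that $\partial\cdot\xi=\chi\cdot(1\flat\partial)$ and $\xi\cdot(\partial\flat1)=\chi$. If $p\colon G_1\to C$ is the cokernel of $\partial$ and $k\colon K\to G_2$ its kernel, $K$ has an induced $C$-module structure $\phi\colon C\flat K\to K$ determined by $k\cdot\phi\cdot(p\flat1)=\xi\cdot(1\flat k)$. A crossed $n$-fold extension is an exact sequence in $\mathcal C$ $$0\to B\xrightarrow{j}G_n\xrightarrow{d_{n-1}}\cdots\xrightarrow{d_2}G_2\xrightarrow{\partial}G_1\xrightarrow{p}C\to1$$ where $\partial$ is an internal crossed module, $B,G_n,\dots,G_3$ are $C$-modules and $j,d_{n-1},\dots,d_2$ are $C$-equivariant; for the map into $G_2$ ($d_2$, or $j$ if $n=2$) this means equivariance of its corestriction to its image $\ker\partial$, with the induced $C$-action. A morphism of crossed $n$-fold extensions is a morphism $(\gamma,f_1,f_2,\dots,f_n,\beta)$ of exact sequences such that $(f_1,f_2)$ is a morphism of actions and $f_3,\dots,f_n,\beta$ are equivariant with respect to $\gamma\colon C\to C'$. These form $\mathbf{XExt}^n(\mathcal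 C)$. $\mathbf{Fib}(\mathcal A)$ is the 2-category whose objects are Grothendieck fibrations $(\mathcal X,F)$ over $\mathcal A$ (assumed to admit cleavages, as are all opfibrations); 1-cells are functors over $\mathcal A$ preserving cartesian arrows; 2-cells are natural transformations with vertical components. A 1-cell $p\colon E\to B$ of a 2-category with comma objects is an opfibration if the canonical 1-cell $r\colon E\downarrow E\to p\downarrow B$ between comma objects has a left adjoint with identity unit. In $\mathbf{Fib}(\mathcal A)$, for $P\colon(\mathcal X,F)\to(\mathcal M,G)$: the objects of $P\downarrow(\mathcal M,G)$ are triples $(x,\beta\colon Px\to m,m)$ with $G\beta=1_{Fx}$, with arrows pairs forming commutative squares. The objects of $(\mathcal X,F)\downarrow(\mathcal X,F)$ are triples $(x_0,\nu\colon x_0\to x_1,x_1)$ with $F\nu=1$, with arrows the commutative squares, and $r(x_0,\nu,x_1)=(x_0,P\nu,Px_1)$; the adjunction must live in $\mathbf{Fib}(\mathcal A)$. *)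

theory Defs
  imports "HOL-Library.FuncSet"
begin

section \<open>Categories, functors, natural transformations\<close>

text \<open>Objects and arrows form sets inside arbitrary types; the operations are total functions whose
  values are only meaningful on these sets.\<close>

record ('o, 'm) category =
  Obj :: "'o set"
  Arr :: "'m set"
  Dom :: "'m \<Rightarrow> 'o"
  Cod :: "'m \<Rightarrow> 'o"
  Ident :: "'o \<Rightarrow> 'm"
  Comp :: "'m \<Rightarrow> 'm \<Rightarrow> 'm" (infixl "\<cdot>\<index>" 70)

definition Hom :: "('o, 'm) category \<Rightarrow> 'o \<Rightarrow> 'o \<Rightarrow> 'm set" where
  "Hom C A B = {f \<in> Arr C. Dom C f = A \<and> Cod C f = B}"

definition is_category :: "('o, 'm) category \<Rightarrow> bool" where
  "is_category C \<longleftrightarrow>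
     (\<forall>f\<in>Arr C. Dom C f \<in> Obj C \<and> Cod C f \<in> Obj C) \<and>
     (\<forall>A\<in>Obj C. Ident C A \<in> Hom C A A) \<and>
     (\<forall>f\<in>Arr C. \<forall>g\<in>Arr C. Cod C f = Dom C g \<longrightarrow> g \<cdot>\<^bsub>C\<^esub> f \<in> Hom C (Dom C f) (Cod C g)) \<and>
     (\<forall>f\<in>Arr C. f \<cdot>\<^bsub>C\<^esub> Ident C (Dom C f) = f \<and> Ident C (Cod C f) \<cdot>\<^bsub>C\<^esub> f = f) \<and>
     (\<forall>f\<in>Arr C. \<forall>g\<in>Arr C. \<forall>h\<in>Arr C. Cod C f = Dom C g \<longrightarrow> Cod C g = Dom C h \<longrightarrow>
        h \<cdot>\<^bsub>C\<^esub> (g \<cdot>\<^bsub>C\<^esub> f) = (h \<cdot>\<^bsub>C\<^esub> g) \<cdot>\<^bsub>C\<^esub> f)"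

record ('o, 'm, 'p, 'n) fctr =
  omap :: "'o \<Rightarrow> 'p"
  amap :: "'m \<Rightarrow> 'n"

definition is_functor ::
    "('o, 'm) category \<Rightarrow> ('p, 'n) category \<Rightarrow> ('o, 'm, 'p, 'n) fctr \<Rightarrow> bool" where
  "is_functor X Y F \<longleftrightarrow>
     (\<forall>x\<in>Obj X. omap F x \<in> Obj Y) \<and>
     (\<forall>f\<in>Arr X. amap F f \<in> Hom Y (omap F (Dom X f)) (omap F (Cod X f))) \<and>
     (\<forall>x\<in>Obj X. amap F (Ident X x) = Ident Y (omap F x)) \<and>
     (\<forall>f\<in>Arr X. \<forall>g\<in>Arr X. Cod X f = Dom X g \<longrightarrow>
        amap F (g \<cdot>\<^bsub>X\<^esub> f) = amap F g \<cdot>\<^bsub>Y\<^esub> amap F f)"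

definition id_fctr :: "('o, 'm, 'o, 'm) fctr" where
  "id_fctr = \<lparr>omap = (\<lambda>x. x), amap = (\<lambda>f. f)\<rparr>"

definition comp_fctr ::
    "('p, 'n, 'q, 'k) fctr \<Rightarrow> ('o, 'm, 'p, 'n) fctr \<Rightarrow> ('o, 'm, 'q, 'k) fctr"
    (infixl "\<circ>\<^sub>F" 55) where
  "G \<circ>\<^sub>F F = \<lparr>omap = omap G \<circ> omap F, amap = amap G \<circ> amap F\<rparr>"

definition is_nat_trans ::
    "('o, 'm) category \<Rightarrow> ('p, 'n) category \<Rightarrow> ('o, 'm, 'p, 'n) fctr \<Rightarrow> ('o, 'm, 'p, 'n) fctr \<Rightarrow>
     ('o \<Rightarrow> 'n) \<Rightarrow> bool" where
  "is_nat_trans X Y F G \<tau> \<longleftrightarrow>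
     (\<forall>x\<in>Obj X. \<tau> x \<in> Hom Y (omap F x) (omap G x)) \<and>
     (\<forall>f\<in>Arr X. \<tau> (Cod X f) \<cdot>\<^bsub>Y\<^esub> amap F f = amap G f \<cdot>\<^bsub>Y\<^esub> \<tau> (Dom X f))"


section \<open>Limits and colimits\<close>

definition is_cone ::
    "('i, 'j) category \<Rightarrow> ('o, 'm) category \<Rightarrow> ('i, 'j, 'o, 'm) fctr \<Rightarrow> 'o \<Rightarrow> ('i \<Rightarrow> 'm) \<Rightarrow> bool" where
  "is_cone J C D L \<pi> \<longleftrightarrow> L \<in> Obj C \<and>
     (\<forall>i\<in>Obj J. \<pi> i \<in> Hom C L (omap D i)) \<and>
     (\<forall>u\<in>Arr J. amap D u \<cdot>\<^bsub>C\<^esub> \<pi> (Dom J u) = \<pi> (Cod J u))"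

definition is_limit ::
    "('i, 'j) category \<Rightarrow> ('o, 'm) category \<Rightarrow> ('i, 'j, 'o, 'm) fctr \<Rightarrow> 'o \<Rightarrow> ('i \<Rightarrow> 'm) \<Rightarrow> bool" where
  "is_limit J C D L \<pi> \<longleftrightarrow> is_cone J C D L \<pi> \<and>
     (\<forall>T \<tau>. is_cone J C D T \<tau> \<longrightarrow>
        (\<exists>!h. h \<in> Hom C T L \<and> (\<forall>i\<in>Obj J. \<pi> i \<cdot>\<^bsub>C\<^esub> h = \<tau> i)))"

text \<open>Every finite category is isomorphic to one whose objects and arrows are natural numbers, so
  these suffice as diagram shapes.\<close>

definition finitely_complete :: "('o, 'm) category \<Rightarrow> bool" where
  "finitely_complete C \<longleftrightarrow>
     (\<forall>(J :: (nat, nat) category) D. is_category J \<longrightarrow> finite (Obj J) \<longrightarrow> finite (Arr J) \<longrightarrow>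
        is_functor J C D \<longrightarrow> (\<exists>L \<pi>. is_limit J C D L \<pi>))"

definition is_coproduct ::
    "('o, 'm) category \<Rightarrow> 'i set \<Rightarrow> ('i \<Rightarrow> 'o) \<Rightarrow> 'o \<Rightarrow> ('i \<Rightarrow> 'm) \<Rightarrow> bool" where
  "is_coproduct C I X S \<iota> \<longleftrightarrow> S \<in> Obj C \<and>
     (\<forall>i\<in>I. \<iota> i \<in> Hom C (X i) S) \<and>
     (\<forall>T\<in>Obj C. \<forall>f. (\<forall>i\<in>I. f i \<in> Hom C (X i) T) \<longrightarrow>
        (\<exists>!h. h \<in> Hom C S T \<and> (\<forall>i\<in>I. h \<cdot>\<^bsub>C\<^esub> \<iota> i = f i)))"

definition has_finite_coproducts :: "('o, 'm) category \<Rightarrow> bool" where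
  "has_finite_coproducts C \<longleftrightarrow>
     (\<forall>(I :: nat set) X. finite I \<longrightarrow> (\<forall>i\<in>I. X i \<in> Obj C) \<longrightarrow> (\<exists>S \<iota>. is_coproduct C I X S \<iota>))"

definition is_binary_coproduct ::
    "('o, 'm) category \<Rightarrow> 'o \<Rightarrow> 'o \<Rightarrow> 'o \<Rightarrow> 'm \<Rightarrow> 'm \<Rightarrow> bool" where
  "is_binary_coproduct C A B S i j \<longleftrightarrow> i \<in> Hom C A S \<and> j \<in> Hom C B S \<and>
     (\<forall>T f g. f \<in> Hom C A T \<longrightarrow> g \<in> Hom C B T \<longrightarrow>
        (\<exists>!h. h \<in> Hom C S T \<and> h \<cdot>\<^bsub>C\<^esub> i = f \<and> h \<cdot>\<^bsub>C\<^esub> j = g))"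

definition is_binary_product ::
    "('o, 'm) category \<Rightarrow> 'o \<Rightarrow> 'o \<Rightarrow> 'o \<Rightarrow> 'm \<Rightarrow> 'm \<Rightarrow> bool" where
  "is_binary_product C A B P p q \<longleftrightarrow> p \<in> Hom C P A \<and> q \<in> Hom C P B \<and>
     (\<forall>T f g. f \<in> Hom C T A \<longrightarrow> g \<in> Hom C T B \<longrightarrow>
        (\<exists>!h. h \<in> Hom C T P \<and> p \<cdot>\<^bsub>C\<^esub> h = f \<and> q \<cdot>\<^bsub>C\<^esub> h = g))"

text \<open>\<open>is_pullback C f g P p q\<close>: the square \<open>f \<cdot> p = g \<cdot> q\<close> with vertex \<open>P\<close> is a pullback.\<close>

definition is_pullback ::
    "('o, 'm) category \<Rightarrow> 'm \<Rightarrow> 'm \<Rightarrow> 'o \<Rightarrow> 'm \<Rightarrow> 'm \<Rightarrow> bool" where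
  "is_pullback C f g P p q \<longleftrightarrow>
     f \<in> Arr C \<and> g \<in> Arr C \<and> Cod C f = Cod C g \<and>
     p \<in> Hom C P (Dom C f) \<and> q \<in> Hom C P (Dom C g) \<and> f \<cdot>\<^bsub>C\<^esub> p = g \<cdot>\<^bsub>C\<^esub> q \<and>
     (\<forall>T a b. a \<in> Hom C T (Dom C f) \<longrightarrow> b \<in> Hom C T (Dom C g) \<longrightarrow> f \<cdot>\<^bsub>C\<^esub> a = g \<cdot>\<^bsub>C\<^esub> b \<longrightarrow>
        (\<exists>!h. h \<in> Hom C T P \<and> p \<cdot>\<^bsub>C\<^esub> h = a \<and> q \<cdot>\<^bsub>C\<^esub> h = b))"

definition is_coequalizer :: "('o, 'm) category \<Rightarrow> 'm \<Rightarrow> 'm \<Rightarrow> 'm \<Rightarrow> bool" where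
  "is_coequalizer C f g q \<longleftrightarrow>
     f \<in> Arr C \<and> g \<in> Hom C (Dom C f) (Cod C f) \<and> q \<in> Arr C \<and> Dom C q = Cod C f \<and>
     q \<cdot>\<^bsub>C\<^esub> f = q \<cdot>\<^bsub>C\<^esub> g \<and>
     (\<forall>T t. t \<in> Hom C (Cod C f) T \<longrightarrow> t \<cdot>\<^bsub>C\<^esub> f = t \<cdot>\<^bsub>C\<^esub> g \<longrightarrow>
        (\<exists>!h. h \<in> Hom C (Cod C q) T \<and> h \<cdot>\<^bsub>C\<^esub> q = t))"

definition is_iso :: "('o, 'm) category \<Rightarrow> 'm \<Rightarrow> bool" where
  "is_iso C f \<longleftrightarrow> f \<in> Arr C \<and>
     (\<exists>g. g \<in> Hom C (Cod C f) (Dom C f) \<and>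
          g \<cdot>\<^bsub>C\<^esub> f = Ident C (Dom C f) \<and> f \<cdot>\<^bsub>C\<^esub> g = Ident C (Cod C f))"

definition regular_epi :: "('o, 'm) category \<Rightarrow> 'm \<Rightarrow> bool" where
  "regular_epi C q \<longleftrightarrow> (\<exists>f g. is_coequalizer C f g q)"


section \<open>Barr-exact categories\<close>

definition regular_category :: "('o, 'm) category \<Rightarrow> bool" where
  "regular_category C \<longleftrightarrow> is_category C \<and> finitely_complete C \<and>
     (\<forall>f P p q. is_pullback C f f P p q \<longrightarrow> (\<exists>e. is_coequalizer C p q e)) \<and>
     (\<forall>f g P p q. is_pullback C f g P p q \<longrightarrow> regular_epi C f \<longrightarrow> regular_epi C q)"

definition internal_equivalence_relation ::
    "('o, 'm) category \<Rightarrow> 'o \<Rightarrow> 'o \<Rightarrow> 'm \<Rightarrow> 'm \<Rightarrow> bool" where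
  "internal_equivalence_relation C X R r s \<longleftrightarrow>
     r \<in> Hom C R X \<and> s \<in> Hom C R X \<and>
     (\<forall>T a b. a \<in> Hom C T R \<longrightarrow> b \<in> Hom C T R \<longrightarrow>
        r \<cdot>\<^bsub>C\<^esub> a = r \<cdot>\<^bsub>C\<^esub> b \<longrightarrow> s \<cdot>\<^bsub>C\<^esub> a = s \<cdot>\<^bsub>C\<^esub> b \<longrightarrow> a = b) \<and>
     (\<exists>\<delta>\<in>Hom C X R. r \<cdot>\<^bsub>C\<^esub> \<delta> = Ident C X \<and> s \<cdot>\<^bsub>C\<^esub> \<delta> = Ident C X) \<and>
     (\<exists>\<sigma>\<in>Hom C R R. r \<cdot>\<^bsub>C\<^esub> \<sigma> = s \<and> s \<cdot>\<^bsub>C\<^esub> \<sigma> = r) \<and>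
     (\<forall>P p q. is_pullback C s r P p q \<longrightarrow>
        (\<exists>\<theta>\<in>Hom C P R. r \<cdot>\<^bsub>C\<^esub> \<theta> = r \<cdot>\<^bsub>C\<^esub> p \<and> s \<cdot>\<^bsub>C\<^esub> \<theta> = s \<cdot>\<^bsub>C\<^esub> q))"

definition barr_exact :: "('o, 'm) category \<Rightarrow> bool" where
  "barr_exact C \<longleftrightarrow> regular_category C \<and>
     (\<forall>X R r s. internal_equivalence_relation C X R r s \<longrightarrow> (\<exists>f. is_pullback C f f R r s))"


section \<open>Pointed categories, kernels, exact sequences\<close>

definition is_zero_object :: "('o, 'm) category \<Rightarrow> 'o \<Rightarrow> bool" where
  "is_zero_object C Z \<longleftrightarrow> Z \<in> Obj C \<and>
     (\<forall>A\<in>Obj C. (\<exists>!f. f \<in> Hom C A Z) \<and> (\<exists>!f. f \<in> Hom C Z A))"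

definition pointed :: "('o, 'm) category \<Rightarrow> bool" where
  "pointed C \<longleftrightarrow> (\<exists>Z. is_zero_object C Z)"

definition zero_obj :: "('o, 'm) category \<Rightarrow> 'o" where
  "zero_obj C = (SOME Z. is_zero_object C Z)"

definition zero_mor :: "('o, 'm) category \<Rightarrow> 'o \<Rightarrow> 'o \<Rightarrow> 'm" where
  "zero_mor C A B = (THE f. \<exists>g h. g \<in> Hom C A (zero_obj C) \<and> h \<in> Hom C (zero_obj C) B \<and> f = h \<cdot>\<^bsub>C\<^esub> g)"

definition is_kernel :: "('o, 'm) category \<Rightarrow> 'm \<Rightarrow> 'o \<Rightarrow> 'm \<Rightarrow> bool" where
  "is_kernel C f K k \<longleftrightarrow> f \<in> Arr C \<and> k \<in> Hom C K (Dom C f) \<and>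
     f \<cdot>\<^bsub>C\<^esub> k = zero_mor C K (Cod C f) \<and>
     (\<forall>T t. t \<in> Hom C T (Dom C f) \<longrightarrow> f \<cdot>\<^bsub>C\<^esub> t = zero_mor C T (Cod C f) \<longrightarrow>
        (\<exists>!h. h \<in> Hom C T K \<and> k \<cdot>\<^bsub>C\<^esub> h = t))"

definition normal_mono :: "('o, 'm) category \<Rightarrow> 'm \<Rightarrow> bool" where
  "normal_mono C k \<longleftrightarrow> (\<exists>f. is_kernel C f (Dom C k) k)"

text \<open>Exactness of \<open>f\<close>, \<open>g\<close> at \<open>Cod f = Dom g\<close>: the regular image of \<open>f\<close> is the kernel of \<open>g\<close>.\<close>

definition exact_at :: "('o, 'm) category \<Rightarrow> 'm \<Rightarrow> 'm \<Rightarrow> bool" where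
  "exact_at C f g \<longleftrightarrow> f \<in> Arr C \<and> g \<in> Arr C \<and> Cod C f = Dom C g \<and>
     (\<exists>K k e. is_kernel C g K k \<and> e \<in> Hom C (Dom C f) K \<and> regular_epi C e \<and> f = k \<cdot>\<^bsub>C\<^esub> e)"


section \<open>Strongly semi-abelian categories\<close>

text \<open>In \<open>split_ses C X \<kappa> A p s B\<close> nothing is required beyond \<open>\<kappa> = ker p\<close> and \<open>p \<cdot> s = 1\<close>: in a
  protomodular category \<open>p\<close> is then automatically the cokernel of \<open>\<kappa>\<close>. Demanding the latter here
  would weaken protomodularity (pointed sets would satisfy it).\<close>

definition split_ses ::
    "('o, 'm) category \<Rightarrow> 'o \<Rightarrow> 'm \<Rightarrow> 'o \<Rightarrow> 'm \<Rightarrow> 'm \<Rightarrow> 'o \<Rightarrow> bool" where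
  "split_ses C X \<kappa> A p s B \<longleftrightarrow>
     p \<in> Hom C A B \<and> s \<in> Hom C B A \<and> p \<cdot>\<^bsub>C\<^esub> s = Ident C B \<and> is_kernel C p X \<kappa>"

definition strongly_protomodular :: "('o, 'm) category \<Rightarrow> bool" where
  "strongly_protomodular C \<longleftrightarrow>
     (\<forall>B X \<kappa> A p s X' \<kappa>' A' p' s' \<phi> \<psi>.
        split_ses C X \<kappa> A p s B \<longrightarrow> split_ses C X' \<kappa>' A' p' s' B \<longrightarrow>
        \<phi> \<in> Hom C A A' \<longrightarrow> \<psi> \<in> Hom C X X' \<longrightarrow>
        \<phi> \<cdot>\<^bsub>C\<^esub> \<kappa> = \<kappa>' \<cdot>\<^bsub>C\<^esub> \<psi> \<longrightarrow> p' \<cdot>\<^bsub>C\<^esub> \<phi> = p \<longrightarrow> \<phi> \<cdot>\<^bsub>C\<^esub> s = s' \<longrightarrow>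
        (is_iso C \<psi> \<longrightarrow> is_iso C \<phi>) \<and>
        (normal_mono C \<psi> \<longrightarrow> normal_mono C (\<phi> \<cdot>\<^bsub>C\<^esub> \<kappa>)))"

definition strongly_semi_abelian :: "('o, 'm) category \<Rightarrow> bool" where
  "strongly_semi_abelian C \<longleftrightarrow> is_category C \<and> pointed C \<and> finitely_complete C \<and> barr_exact C \<and>
     has_finite_coproducts C \<and> strongly_protomodular C"


section \<open>Internal actions\<close>

text \<open>A fixed choice \<open>(A + B, in\<^sub>1, in\<^sub>2)\<close> of binary coproducts and \<open>(B \<flat> X, \<kappa>)\<close> of the kernels
  of \<open>[1,0] : B + X \<rightarrow> B\<close>.\<close>

definition csum :: "('o, 'm) category \<Rightarrow> 'o \<Rightarrow> 'o \<Rightarrow> 'o \<times> 'm \<times> 'm" where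
  "csum C A B = (SOME (S, i, j). is_binary_coproduct C A B S i j)"

definition sum_obj :: "('o, 'm) category \<Rightarrow> 'o \<Rightarrow> 'o \<Rightarrow> 'o" where
  "sum_obj C A B = fst (csum C A B)"

definition in1 :: "('o, 'm) category \<Rightarrow> 'o \<Rightarrow> 'o \<Rightarrow> 'm" where
  "in1 C A B = fst (snd (csum C A B))"

definition in2 :: "('o, 'm) category \<Rightarrow> 'o \<Rightarrow> 'o \<Rightarrow> 'm" where
  "in2 C A B = snd (snd (csum C A B))"

definition copair :: "('o, 'm) category \<Rightarrow> 'm \<Rightarrow> 'm \<Rightarrow> 'm" where
  "copair C f g = (let A = Dom C f; B = Dom C g in
     THE h. h \<in> Hom C (sum_obj C A B) (Cod C f) \<and>
            h \<cdot>\<^bsub>C\<^esub> in1 C A B = f \<and> h \<cdot>\<^bsub>C\<^esub> in2 C A B = g)"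

definition sum_mor :: "('o, 'm) category \<Rightarrow> 'm \<Rightarrow> 'm \<Rightarrow> 'm" where
  "sum_mor C f g =
     copair C (in1 C (Cod C f) (Cod C g) \<cdot>\<^bsub>C\<^esub> f) (in2 C (Cod C f) (Cod C g) \<cdot>\<^bsub>C\<^esub> g)"

definition cflat :: "('o, 'm) category \<Rightarrow> 'o \<Rightarrow> 'o \<Rightarrow> 'o \<times> 'm" where
  "cflat C B X = (SOME (K, k). is_kernel C (copair C (Ident C B) (zero_mor C X B)) K k)"

definition flat_obj :: "('o, 'm) category \<Rightarrow> 'o \<Rightarrow> 'o \<Rightarrow> 'o" where
  "flat_obj C B X = fst (cflat C B X)"

definition flat_ker :: "('o, 'm) category \<Rightarrow> 'o \<Rightarrow> 'o \<Rightarrow> 'm" where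
  "flat_ker C B X = snd (cflat C B X)"

definition flat_mor :: "('o, 'm) category \<Rightarrow> 'm \<Rightarrow> 'm \<Rightarrow> 'm" where
  "flat_mor C f g =
     (THE h. h \<in> Hom C (flat_obj C (Dom C f) (Dom C g)) (flat_obj C (Cod C f) (Cod C g)) \<and>
        flat_ker C (Cod C f) (Cod C g) \<cdot>\<^bsub>C\<^esub> h = sum_mor C f g \<cdot>\<^bsub>C\<^esub> flat_ker C (Dom C f) (Dom C g))"

text \<open>Unit and multiplication of the monad \<open>B \<flat> (-)\<close>.\<close>

definition flat_unit :: "('o, 'm) category \<Rightarrow> 'o \<Rightarrow> 'o \<Rightarrow> 'm" where
  "flat_unit C B X =
     (THE h. h \<in> Hom C X (flat_obj C B X) \<and> flat_ker C B X \<cdot>\<^bsub>C\<^esub> h = in2 C B X)"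

definition flat_mult :: "('o, 'm) category \<Rightarrow> 'o \<Rightarrow> 'o \<Rightarrow> 'm" where
  "flat_mult C B X =
     (THE h. h \<in> Hom C (flat_obj C B (flat_obj C B X)) (flat_obj C B X) \<and>
        flat_ker C B X \<cdot>\<^bsub>C\<^esub> h =
          copair C (in1 C B X) (flat_ker C B X) \<cdot>\<^bsub>C\<^esub> flat_ker C B (flat_obj C B X))"

definition internal_action :: "('o, 'm) category \<Rightarrow> 'o \<Rightarrow> 'o \<Rightarrow> 'm \<Rightarrow> bool" where
  "internal_action C B X \<xi> \<longleftrightarrow> B \<in> Obj C \<and> X \<in> Obj C \<and>
     \<xi> \<in> Hom C (flat_obj C B X) X \<and>
     \<xi> \<cdot>\<^bsub>C\<^esub> flat_unit C B X = Ident C X \<and>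
     \<xi> \<cdot>\<^bsub>C\<^esub> flat_mult C B X = \<xi> \<cdot>\<^bsub>C\<^esub> flat_mor C (Ident C B) \<xi>"

definition conjugation :: "('o, 'm) category \<Rightarrow> 'o \<Rightarrow> 'm" where
  "conjugation C X = copair C (Ident C X) (Ident C X) \<cdot>\<^bsub>C\<^esub> flat_ker C X X"

text \<open>\<open>action_morphism C (B, X, \<xi>) (f, h) (B', X', \<xi>')\<close>: compatibility of the pair \<open>(f, h)\<close> with the
  actions \<open>\<xi>\<close> of \<open>B\<close> on \<open>X\<close> and \<open>\<xi>'\<close> of \<open>B'\<close> on \<open>X'\<close>.\<close>

definition action_morphism ::
    "('o, 'm) category \<Rightarrow> 'o \<times> 'o \<times> 'm \<Rightarrow> 'm \<times> 'm \<Rightarrow> 'o \<times> 'o \<times> 'm \<Rightarrow> bool" where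
  "action_morphism C = (\<lambda>(B, X, \<xi>) (f, h) (B', X', \<xi>').
     f \<in> Hom C B B' \<and> h \<in> Hom C X X' \<and> h \<cdot>\<^bsub>C\<^esub> \<xi> = \<xi>' \<cdot>\<^bsub>C\<^esub> flat_mor C f h)"

definition equivariant ::
    "('o, 'm) category \<Rightarrow> 'o \<Rightarrow> 'o \<Rightarrow> 'm \<Rightarrow> 'm \<Rightarrow> 'o \<Rightarrow> 'm \<Rightarrow> bool" where
  "equivariant C B X \<xi> h X' \<xi>' \<longleftrightarrow> action_morphism C (B, X, \<xi>) (Ident C B, h) (B, X', \<xi>')"


section \<open>Modules\<close>

text \<open>An abelian object is one that carries an internal abelian group structure, with multiplication
  \<open>m\<close>, unit \<open>u\<close> and inversion \<open>i\<close>; the axioms are stated on generalized elements \<open>T \<rightarrow> X\<close>.\<close>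

definition abelian_object :: "('o, 'm) category \<Rightarrow> 'o \<Rightarrow> bool" where
  "abelian_object C X \<longleftrightarrow> X \<in> Obj C \<and>
     (\<exists>P p q m u i. is_binary_product C X X P p q \<and>
        m \<in> Hom C P X \<and> u \<in> Hom C (zero_obj C) X \<and> i \<in> Hom C X X \<and>
        (\<forall>T\<in>Obj C.
           let mul = (\<lambda>a b. m \<cdot>\<^bsub>C\<^esub> (THE h. h \<in> Hom C T P \<and> p \<cdot>\<^bsub>C\<^esub> h = a \<and> q \<cdot>\<^bsub>C\<^esub> h = b));
               e = u \<cdot>\<^bsub>C\<^esub> zero_mor C T (zero_obj C)
           in (\<forall>a\<in>Hom C T X. \<forall>b\<in>Hom C T X. \<forall>c\<in>Hom C T X. mul (mul a b) c = mul a (mul b c)) \<and>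
              (\<forall>a\<in>Hom C T X. \<forall>b\<in>Hom C T X. mul a b = mul b a) \<and>
              (\<forall>a\<in>Hom C T X. mul e a = a) \<and>
              (\<forall>a\<in>Hom C T X. mul (i \<cdot>\<^bsub>C\<^esub> a) a = e)))"

definition is_module :: "('o, 'm) category \<Rightarrow> 'o \<Rightarrow> 'o \<Rightarrow> 'm \<Rightarrow> bool" where
  "is_module C A B \<xi> \<longleftrightarrow> abelian_object C B \<and> internal_action C A B \<xi>"

text \<open>In the categories constructed below an arrow is a triple (source, data, target).\<close>

type_synonym ('o, 'm) module_obj = "'o \<times> 'o \<times> 'm"
type_synonym ('o, 'm) module_arr = "('o, 'm) module_obj \<times> ('m \<times> 'm) \<times> ('o, 'm) module_obj"

definition Mod_cat ::
    "('o, 'm) category \<Rightarrow> (('o, 'm) module_obj, ('o, 'm) module_arr) category" where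
  "Mod_cat C =
     (let Ob = {(A, B, \<xi>). is_module C A B \<xi>} in
      \<lparr>Obj = Ob,
       Arr = {(M, f, M'). M \<in> Ob \<and> M' \<in> Ob \<and> action_morphism C M f M'},
       Dom = (\<lambda>(M, f, M'). M),
       Cod = (\<lambda>(M, f, M'). M'),
       Ident = (\<lambda>M. (M, (Ident C (fst M), Ident C (fst (snd M))), M)),
       Comp = (\<lambda>(_, (\<gamma>', \<beta>'), M'') (M, (\<gamma>, \<beta>), _). (M, (\<gamma>' \<cdot>\<^bsub>C\<^esub> \<gamma>, \<beta>' \<cdot>\<^bsub>C\<^esub> \<beta>), M''))\<rparr>)"

definition Mod_base :: "(('o, 'm) module_obj, ('o, 'm) module_arr, 'o, 'm) fctr" where
  "Mod_base = \<lparr>omap = (\<lambda>(A, B, \<xi>). A), amap = (\<lambda>(M, (\<gamma>, \<beta>), M'). \<gamma>)\<rparr>"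


section \<open>Crossed n-fold extensions\<close>

definition internal_crossed_module ::
    "('o, 'm) category \<Rightarrow> 'o \<Rightarrow> 'o \<Rightarrow> 'm \<Rightarrow> 'm \<Rightarrow> bool" where
  "internal_crossed_module C G2 G1 d \<xi> \<longleftrightarrow>
     d \<in> Hom C G2 G1 \<and> internal_action C G1 G2 \<xi> \<and>
     d \<cdot>\<^bsub>C\<^esub> \<xi> = conjugation C G1 \<cdot>\<^bsub>C\<^esub> flat_mor C (Ident C G1) d \<and>
     \<xi> \<cdot>\<^bsub>C\<^esub> flat_mor C d (Ident C G2) = conjugation C G2"

text \<open>The sequence \<open>0 \<rightarrow> B \<rightarrow> G\<^sub>n \<rightarrow> \<dots> \<rightarrow> G\<^sub>2 \<rightarrow> G\<^sub>1 \<rightarrow> C \<rightarrow> 1\<close> is stored as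
  objects \<open>xob 0 = C\<close>, \<open>xob i = G\<^sub>i\<close> for \<open>1 \<le> i \<le> n\<close>, \<open>xob (n+1) = B\<close> and
  arrows \<open>xd i : xob (i+1) \<rightarrow> xob i\<close> for \<open>i \<le> n\<close>, i.e. \<open>xd 0 = p\<close>, \<open>xd 1 = \<partial>\<close>,
  \<open>xd i = d\<^sub>i\<close> for \<open>2 \<le> i < n\<close> and \<open>xd n = j\<close>;
  \<open>xact 2\<close> is the action of \<open>G\<^sub>1\<close> on \<open>G\<^sub>2\<close>, and \<open>xact i\<close> for \<open>3 \<le> i \<le> n+1\<close> is the action
  of \<open>C\<close> on \<open>xob i\<close>. Outside these index ranges the three functions are \<open>undefined\<close>.\<close>

record ('o, 'm) xext =
  xob :: "nat \<Rightarrow> 'o"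
  xd :: "nat \<Rightarrow> 'm"
  xact :: "nat \<Rightarrow> 'm"

text \<open>Equivariance of a map \<open>c : B \<rightarrow> G\<^sub>2\<close> into the crossed module \<open>d : G\<^sub>2 \<rightarrow> G\<^sub>1\<close>, with
  cokernel \<open>p : G\<^sub>1 \<rightarrow> A\<close>, means equivariance of its
  corestriction \<open>e\<close> to \<open>k = ker d\<close>, for the action \<open>\<phi>\<close> induced on the kernel.\<close>

definition corestriction_equivariant ::
    "('o, 'm) category \<Rightarrow> 'o \<Rightarrow> 'o \<Rightarrow> 'm \<Rightarrow> 'm \<Rightarrow> 'm \<Rightarrow> 'o \<Rightarrow> 'm \<Rightarrow> 'm \<Rightarrow> bool" where
  "corestriction_equivariant C A G1 p d \<xi> B \<beta> c \<longleftrightarrow>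
     (\<exists>K k \<phi> e. is_kernel C d K k \<and> is_module C A K \<phi> \<and>
        k \<cdot>\<^bsub>C\<^esub> \<phi> \<cdot>\<^bsub>C\<^esub> flat_mor C p (Ident C K) = \<xi> \<cdot>\<^bsub>C\<^esub> flat_mor C (Ident C G1) k \<and>
        k \<cdot>\<^bsub>C\<^esub> e = c \<and> equivariant C A B \<beta> e K \<phi>)"

definition is_xext :: "('o, 'm) category \<Rightarrow> nat \<Rightarrow> ('o, 'm) xext \<Rightarrow> bool" where
  "is_xext C n E \<longleftrightarrow>
     xob E \<in> extensional {0..n+1} \<and> xd E \<in> extensional {0..n} \<and> xact E \<in> extensional {2..n+1} \<and>
     (\<forall>i\<in>{0..n+1}. xob E i \<in> Obj C) \<and>
     (\<forall>i\<in>{0..n}. xd E i \<in> Hom C (xob E (i+1)) (xob E i)) \<and>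
     exact_at C (zero_mor C (zero_obj C) (xob E (n+1))) (xd E n) \<and>
     (\<forall>i\<in>{1..n}. exact_at C (xd E i) (xd E (i-1))) \<and>
     exact_at C (xd E 0) (zero_mor C (xob E 0) (zero_obj C)) \<and>
     internal_crossed_module C (xob E 2) (xob E 1) (xd E 1) (xact E 2) \<and>
     (\<forall>i\<in>{3..n+1}. is_module C (xob E 0) (xob E i) (xact E i)) \<and>
     corestriction_equivariant C (xob E 0) (xob E 1) (xd E 0) (xd E 1) (xact E 2)
       (xob E 3) (xact E 3) (xd E 2) \<and>
     (\<forall>i\<in>{3..n}. equivariant C (xob E 0) (xob E (i+1)) (xact E (i+1)) (xd E i) (xob E i) (xact E i))"

text \<open>A morphism \<open>(\<gamma>, f\<^sub>1, \<dots>, f\<^sub>n, \<beta>)\<close> is a family indexed by \<open>{0..n+1}\<close>.\<close>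

definition xext_morphism ::
    "('o, 'm) category \<Rightarrow> nat \<Rightarrow> ('o, 'm) xext \<Rightarrow> (nat \<Rightarrow> 'm) \<Rightarrow> ('o, 'm) xext \<Rightarrow> bool" where
  "xext_morphism C n E f E' \<longleftrightarrow>
     f \<in> extensional {0..n+1} \<and>
     (\<forall>i\<in>{0..n+1}. f i \<in> Hom C (xob E i) (xob E' i)) \<and>
     (\<forall>i\<in>{0..n}. f i \<cdot>\<^bsub>C\<^esub> xd E i = xd E' i \<cdot>\<^bsub>C\<^esub> f (i+1)) \<and>
     action_morphism C (xob E 1, xob E 2, xact E 2) (f 1, f 2) (xob E' 1, xob E' 2, xact E' 2) \<and>
     (\<forall>i\<in>{3..n+1}. action_morphism C (xob E 0, xob E i, xact E i) (f 0, f i)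
                                     (xob E' 0, xob E' i, xact E' i))"

type_synonym ('o, 'm) xext_arr = "('o, 'm) xext \<times> (nat \<Rightarrow> 'm) \<times> ('o, 'm) xext"

definition XExt_cat ::
    "('o, 'm) category \<Rightarrow> nat \<Rightarrow> (('o, 'm) xext, ('o, 'm) xext_arr) category" where
  "XExt_cat C n =
     \<lparr>Obj = {E. is_xext C n E},
      Arr = {(E, f, E'). is_xext C n E \<and> is_xext C n E' \<and> xext_morphism C n E f E'},
      Dom = (\<lambda>(E, f, E'). E),
      Cod = (\<lambda>(E, f, E'). E'),
      Ident = (\<lambda>E. (E, (\<lambda>i\<in>{0..n+1}. Ident C (xob E i)), E)),
      Comp = (\<lambda>(_, g, E'') (E, f, _). (E, (\<lambda>i\<in>{0..n+1}. g i \<cdot>\<^bsub>C\<^esub> f i), E''))\<rparr>"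

definition xext_module :: "nat \<Rightarrow> ('o, 'm) xext \<Rightarrow> ('o, 'm) module_obj" where
  "xext_module n E = (xob E 0, xob E (n+1), xact E (n+1))"

definition XExt_Pi ::
    "nat \<Rightarrow> (('o, 'm) xext, ('o, 'm) xext_arr, ('o, 'm) module_obj, ('o, 'm) module_arr) fctr" where
  "XExt_Pi n =
     \<lparr>omap = xext_module n,
      amap = (\<lambda>(E, f, E'). (xext_module n E, (f 0, f (n+1)), xext_module n E'))\<rparr>"


section \<open>The 2-category of fibrations over a category\<close>

definition cartesian ::
    "('o, 'm) category \<Rightarrow> ('x, 'y) category \<times> ('x, 'y, 'o, 'm) fctr \<Rightarrow> 'y \<Rightarrow> bool" where
  "cartesian A = (\<lambda>(X, F) f. f \<in> Arr X \<and>
     (\<forall>g\<in>Arr X. Cod X g = Cod X f \<longrightarrow>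
        (\<forall>u\<in>Hom A (omap F (Dom X g)) (omap F (Dom X f)). amap F f \<cdot>\<^bsub>A\<^esub> u = amap F g \<longrightarrow>
           (\<exists>!h. h \<in> Hom X (Dom X g) (Dom X f) \<and> f \<cdot>\<^bsub>X\<^esub> h = g \<and> amap F h = u))))"

definition fib_object ::
    "('o, 'm) category \<Rightarrow> ('x, 'y) category \<times> ('x, 'y, 'o, 'm) fctr \<Rightarrow> bool" where
  "fib_object A = (\<lambda>(X, F). is_category A \<and> is_category X \<and> is_functor X A F \<and>
     (\<forall>y\<in>Obj X. \<forall>a\<in>Arr A. Cod A a = omap F y \<longrightarrow>
        (\<exists>f. cartesian A (X, F) f \<and> Cod X f = y \<and> amap F f = a)))"

definition fib_1cell ::
    "('o, 'm) category \<Rightarrow> ('x, 'y) category \<times> ('x, 'y, 'o, 'm) fctr \<Rightarrow>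
     ('u, 'v) category \<times> ('u, 'v, 'o, 'm) fctr \<Rightarrow> ('x, 'y, 'u, 'v) fctr \<Rightarrow> bool" where
  "fib_1cell A = (\<lambda>(X, F) (M, G) P. is_functor X M P \<and>
     (\<forall>x\<in>Obj X. omap G (omap P x) = omap F x) \<and>
     (\<forall>f\<in>Arr X. amap G (amap P f) = amap F f) \<and>
     (\<forall>f. cartesian A (X, F) f \<longrightarrow> cartesian A (M, G) (amap P f)))"

definition fib_2cell ::
    "('o, 'm) category \<Rightarrow> ('x, 'y) category \<times> ('x, 'y, 'o, 'm) fctr \<Rightarrow>
     ('u, 'v) category \<times> ('u, 'v, 'o, 'm) fctr \<Rightarrow> ('x, 'y, 'u, 'v) fctr \<Rightarrow>
     ('x, 'y, 'u, 'v) fctr \<Rightarrow> ('x \<Rightarrow> 'v) \<Rightarrow> bool" where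
  "fib_2cell A = (\<lambda>(X, F) (M, G) P Q \<tau>. is_nat_trans X M P Q \<tau> \<and>
     (\<forall>x\<in>Obj X. amap G (\<tau> x) = Ident A (omap F x)))"

text \<open>\<open>l \<stileturn> r\<close> in the 2-category, with unit \<open>\<eta>\<close> and counit \<open>\<epsilon>\<close>.\<close>

definition fib_adjunction ::
    "('o, 'm) category \<Rightarrow> ('x, 'y) category \<times> ('x, 'y, 'o, 'm) fctr \<Rightarrow>
     ('u, 'v) category \<times> ('u, 'v, 'o, 'm) fctr \<Rightarrow> ('u, 'v, 'x, 'y) fctr \<Rightarrow> ('x, 'y, 'u, 'v) fctr \<Rightarrow>
     ('u \<Rightarrow> 'v) \<Rightarrow> ('x \<Rightarrow> 'y) \<Rightarrow> bool" where
  "fib_adjunction A E D l r \<eta> \<epsilon> \<longleftrightarrow>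
     fib_object A E \<and> fib_object A D \<and> fib_1cell A D E l \<and> fib_1cell A E D r \<and>
     fib_2cell A D D id_fctr (r \<circ>\<^sub>F l) \<eta> \<and> fib_2cell A E E (l \<circ>\<^sub>F r) id_fctr \<epsilon> \<and>
     (\<forall>x\<in>Obj (fst E). amap r (\<epsilon> x) \<cdot>\<^bsub>fst D\<^esub> \<eta> (omap r x) = Ident (fst D) (omap r x)) \<and>
     (\<forall>d\<in>Obj (fst D). \<epsilon> (omap l d) \<cdot>\<^bsub>fst E\<^esub> amap l (\<eta> d) = Ident (fst E) (omap l d))"

type_synonym ('x, 'y, 'u, 'v) comma_obj = "'x \<times> 'v \<times> 'u"
type_synonym ('x, 'y, 'u, 'v) comma_arr = "('x \<times> 'v \<times> 'u) \<times> ('y \<times> 'v) \<times> ('x \<times> 'v \<times> 'u)"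

text \<open>The comma object of \<open>P : (X, F) \<rightarrow> (M, G)\<close> and the identity of \<open>(M, G)\<close>; in particular
  \<open>fib_comma A (X, F) (X, F) id_fctr\<close> is the comma object of \<open>(X, F)\<close> with itself.\<close>

definition fib_comma ::
    "('o, 'm) category \<Rightarrow> ('x, 'y) category \<times> ('x, 'y, 'o, 'm) fctr \<Rightarrow>
     ('u, 'v) category \<times> ('u, 'v, 'o, 'm) fctr \<Rightarrow> ('x, 'y, 'u, 'v) fctr \<Rightarrow>
     (('x, 'y, 'u, 'v) comma_obj, ('x, 'y, 'u, 'v) comma_arr) category \<times>
     (('x, 'y, 'u, 'v) comma_obj, ('x, 'y, 'u, 'v) comma_arr, 'o, 'm) fctr" where
  "fib_comma A = (\<lambda>(X, F) (M, G) P.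
     (let Ob = {(x, \<beta>, m). x \<in> Obj X \<and> m \<in> Obj M \<and> \<beta> \<in> Hom M (omap P x) m \<and>
                 amap G \<beta> = Ident A (omap F x)} in
      (\<lparr>Obj = Ob,
        Arr = {((x, \<beta>, m), (a, b), (x', \<beta>', m')) | x \<beta> m a b x' \<beta>' m'.
                 (x, \<beta>, m) \<in> Ob \<and> (x', \<beta>', m') \<in> Ob \<and> a \<in> Hom X x x' \<and> b \<in> Hom M m m' \<and>
                 \<beta>' \<cdot>\<^bsub>M\<^esub> amap P a = b \<cdot>\<^bsub>M\<^esub> \<beta>},
        Dom = (\<lambda>(s, h, t). s),
        Cod = (\<lambda>(s, h, t). t),
        Ident = (\<lambda>(x, \<beta>, m). ((x, \<beta>, m), (Ident X x, Ident M m), (x, \<beta>, m))),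
        Comp = (\<lambda>(_, (a', b'), t) (s, (a, b), _). (s, (a' \<cdot>\<^bsub>X\<^esub> a, b' \<cdot>\<^bsub>M\<^esub> b), t))\<rparr>,
       \<lparr>omap = (\<lambda>(x, \<beta>, m). omap F x), amap = (\<lambda>(s, (a, b), t). amap F a)\<rparr>)))"

text \<open>The canonical 1-cell from the comma object of \<open>(X, F)\<close> with itself to that of \<open>P\<close> and \<open>(M, G)\<close>.\<close>

definition fib_comma_r ::
    "('x, 'y, 'u, 'v) fctr \<Rightarrow>
     (('x, 'y, 'x, 'y) comma_obj, ('x, 'y, 'x, 'y) comma_arr,
      ('x, 'y, 'u, 'v) comma_obj, ('x, 'y, 'u, 'v) comma_arr) fctr" where
  "fib_comma_r P =
     (let r = (\<lambda>(x0, \<nu>, x1). (x0, amap P \<nu>, omap P x1)) in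
      \<lparr>omap = r, amap = (\<lambda>(s, (a, b), t). (r s, (a, amap P b), r t))\<rparr>)"

text \<open>That the unit \<open>\<eta> : 1 \<Rightarrow> r l\<close> has identity components forces \<open>r l = 1\<close>, so this says that the
  unit is an identity 2-cell.\<close>

definition opfibration_in_Fib ::
    "('o, 'm) category \<Rightarrow> ('x, 'y) category \<times> ('x, 'y, 'o, 'm) fctr \<Rightarrow>
     ('u, 'v) category \<times> ('u, 'v, 'o, 'm) fctr \<Rightarrow> ('x, 'y, 'u, 'v) fctr \<Rightarrow> bool" where
  "opfibration_in_Fib A E B P \<longleftrightarrow> fib_object A E \<and> fib_object A B \<and> fib_1cell A E B P \<and>
     (\<exists>l \<eta> \<epsilon>. fib_adjunction A (fib_comma A E E id_fctr) (fib_comma A E B P) l (fib_comma_r P) \<eta> \<epsilon> \<and>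
        (\<forall>d\<in>Obj (fst (fib_comma A E B P)). \<eta> d = Ident (fst (fib_comma A E B P)) d))"

end

theory Submission
  imports Defs
begin

text \<open>Reindexing an extension along \<open>\<gamma> : C' \<rightarrow> C\<close> pulls \<open>p\<close> back along \<open>\<gamma>\<close> and leaves all terms of degree
  at least 2 unchanged; hence \<open>\<Pi>\<^sub>0\<close> is a fibration whose cartesian arrows are invertible in these degrees,
  and \<open>\<Pi>\<close> preserves them. A map of \<open>C\<close>-modules \<open>\<beta> : B \<rightarrow> B'\<close> is lifted by replacing \<open>G\<^sub>n\<close> with the
  quotient of \<open>G\<^sub>n \<times> B'\<close> by the antidiagonal \<open>(j, - \<beta>)\<close>, which is normal because \<open>j\<close> is central; strong
  protomodularity lets the action (and, for \<open>n = 2\<close>, the crossed module structure) descend to this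
  quotient. By the short five lemma every morphism of extensions over \<open>1\<^sub>C\<close> that is invertible below
  degree \<open>n\<close> is such a lift up to isomorphism. So these morphisms are cocartesian and stable
  under reindexing, which is what an opfibration in \<open>Fib(\<C>)\<close> needs.\<close>

section \<open>Pointed exact protomodular categories\<close>

text \<open>Arguments inside \<open>C\<close> are made on generalized elements T \<rightarrow> A,
  with covers as local surjections and with protomodularity in the form: a subobject containing the
  kernel and a section of a split epimorphism is everything. For an action on Y to descend to the
  quotient of Y by N, it is not enough that N be normal in Y; N has to be normal in the semidirect
  product of Y with the acting object, and exactly this is supplied by strong protomodularity.
  Equivariance and the crossed module identities then descend because f \<flat> g is a cover
  whenever f and g are. The obstacle in the universal property of the pushforward is that the
  addition X \<times> B \<rightarrow> X along a central arrow must be equivariant; this is derived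
  from the difference map, which is a cokernel. For n = 2 the top term is acted on by
  \<open>G1\<close>, for n > 2 by the cokernel object; restricting the actions on modules along the
  projection lets one construction serve both cases. Composition in these locales is associative
  without typing conditions, so that composites can be normalised by rewriting.\<close>

locale partial_category =
  fixes ob :: "'o set" and hom :: "'o => 'o => 'a set"
    and cmp :: "'a => 'a => 'a" (infixr "**" 70) and idn :: "'o => 'a"
  assumes assoc [simp]: "(h ** g) ** f = h ** g ** f"
    and comp_in [intro]: "f \<in> hom A B ==> g \<in> hom B D ==> g ** f \<in> hom A D"
    and hom_ob: "f \<in> hom A B ==> A \<in> ob \<and> B \<in> ob"
    and hom_unique: "f \<in> hom A B ==> f \<in> hom A' B' ==> A = A' \<and> B = B'"
    and id_in [intro]: "A \<in> ob ==> idn A \<in> hom A A"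
    and id_l: "f \<in> hom A B ==> idn B ** f = f"
    and id_r: "f \<in> hom A B ==> f ** idn A = f"
begin

text \<open>Simplification nests composites to the right, so an equation for \<open>g ** f\<close>
  no longer matches inside a longer composite; the version with a trailing \<open>x\<close> restores
  the match.\<close>

lemma reassoc: "g ** f = h ==> g ** f ** x = h ** x"
  by (metis assoc)

section \<open>Monomorphisms, isomorphisms, covers and pullbacks on generalized elements\<close>

definition monic :: "'a => 'o => 'o => bool" where
  "monic m M A \<longleftrightarrow> m \<in> hom M A \<and>
     (\<forall>T x y. x \<in> hom T M --> y \<in> hom T M --> m ** x = m ** y --> x = y)"

definition isom :: "'a => 'o => 'o => bool" where
  "isom f A B \<longleftrightarrow> f \<in> hom A B \<and> (\<exists>g\<in>hom B A. g ** f = idn A \<and> f ** g = idn B)"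

text \<open>In a regular category the covers are exactly the regular epimorphisms; the formulation avoids
  mentioning the kernel pair.\<close>

definition cover :: "'a => 'o => 'o => bool" where
  "cover e A B \<longleftrightarrow> e \<in> hom A B \<and>
     (\<forall>T x y. x \<in> hom B T --> y \<in> hom B T --> x ** e = y ** e --> x = y) \<and>
     (\<forall>T t. t \<in> hom A T -->
        (\<forall>S x y. x \<in> hom S A --> y \<in> hom S A --> e ** x = e ** y --> t ** x = t ** y) -->
        (\<exists>h\<in>hom B T. h ** e = t))"

definition pullback :: "'a => 'a => 'o => 'o => 'o => 'o => 'a => 'a => bool" where
  "pullback f g A B D P p q \<longleftrightarrow>
     f \<in> hom A D \<and> g \<in> hom B D \<and> p \<in> hom P A \<and> q \<in> hom P B \<and> f ** p = g ** q \<and>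
     (\<forall>T a b. a \<in> hom T A --> b \<in> hom T B --> f ** a = g ** b -->
        (\<exists>h\<in>hom T P. p ** h = a \<and> q ** h = b)) \<and>
     (\<forall>T x y. x \<in> hom T P --> y \<in> hom T P --> p ** x = p ** y --> q ** x = q ** y --> x = y)"

lemma monic_in: "monic m M A ==> m \<in> hom M A"
  by (simp add: monic_def)

lemma monicD: "monic m M A ==> m ** x = m ** y ==> x \<in> hom T M ==> y \<in> hom T M ==> x = y"
  by (auto simp: monic_def)

lemma cover_in: "cover e A B ==> e \<in> hom A B"
  by (simp add: cover_def)

lemma coverD: "cover e A B ==> x ** e = y ** e ==> x \<in> hom B T ==> y \<in> hom B T ==> x = y"
  unfolding cover_def by blast

lemma cover_factor:
  assumes "cover e A B" "t \<in> hom A T"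
    and "\<And>S x y. x \<in> hom S A ==> y \<in> hom S A ==> e ** x = e ** y ==> t ** x = t ** y"
  obtains h where "h \<in> hom B T" "h ** e = t" using assms unfolding cover_def by (metis (no_types, lifting))

lemma isom_in: "isom f A B ==> f \<in> hom A B"
  by (simp add: isom_def)

lemma isom_inverse:
  assumes "isom f A B"
  obtains g where "g \<in> hom B A" "g ** f = idn A" "f ** g = idn B" "isom g B A" using assms by (auto simp: isom_def)

lemma isom_id: "A \<in> ob ==> isom (idn A) A A"
  unfolding isom_def by (metis id_in id_l)

lemma isom_comp:
  assumes "isom f A B" "isom g B D"
  shows "isom (g ** f) A D"
proof -
  obtain f' where f: "f \<in> hom A B" "f' \<in> hom B A" "f' ** f = idn A" "f ** f' = idn B"
    using assms by (auto simp: isom_def)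
  obtain g' where g: "g \<in> hom B D" "g' \<in> hom D B" "g' ** g = idn B" "g ** g' = idn D"
    using assms by (auto simp: isom_def)
  have "(f' ** g') ** (g ** f) = idn A" "(g ** f) ** (f' ** g') = idn D"
    using f g by (simp_all add: reassoc[OF g(3)] reassoc[OF f(4)] id_l[OF f(1)] id_l[OF g(2)])
  then show ?thesis unfolding isom_def using f g by (meson comp_in)
qed

lemma isom_cancel_left:
  assumes "isom (g ** f) A D" "isom g B D" "f \<in> hom A B"
  shows "isom f A B"
proof -
  obtain g' where g: "g \<in> hom B D" "g' ** g = idn B" "isom g' D B" using assms(2) by (auto simp: isom_def)
  have "g' ** g ** f = f" using reassoc[OF g(2)] id_l[OF assms(3)] by simp
  then show ?thesis using isom_comp[OF assms(1) g(3)] by simp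
qed

lemma isom_cancel_right:
  assumes "isom (g ** f) A D" "isom f A B" "g \<in> hom B D"
  shows "isom g B D"
proof -
  obtain f' where f: "f \<in> hom A B" "f ** f' = idn B" "isom f' B A" using assms(2) by (auto simp: isom_def)
  have "(g ** f) ** f' = g" using f id_r[OF assms(3)] by simp
  then show ?thesis using isom_comp[OF f(3) assms(1)] by simp
qed

lemma monic_split_isom:
  assumes "monic m M A" "g \<in> hom A M" "m ** g = idn A"
  shows "isom m M A"
proof -
  have m: "m \<in> hom M A" using assms(1) by (rule monic_in)
  have "m ** g ** m = m ** idn M" by (simp add: reassoc[OF assms(3)] id_l[OF m] id_r[OF m])
  then have "g ** m = idn M" by (rule monicD[OF assms(1)]) (use m assms(2) hom_ob in blast)+
  then show ?thesis using m assms by (auto simp: isom_def)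
qed

lemma isom_monic: "isom f A B ==> monic f A B"
  unfolding isom_def monic_def by (metis assoc id_l)

lemma isom_cover:
  assumes "isom f A B" shows "cover f A B"
proof -
  obtain g where g: "f \<in> hom A B" "g \<in> hom B A" "g ** f = idn A" "f ** g = idn B"
    using assms by (auto simp: isom_def)
  have "x = y" if "x \<in> hom B T" "y \<in> hom B T" "x ** f = y ** f" for T x y using that g by (metis assoc id_r)
  moreover have "\<exists>h\<in>hom B T. h ** f = t" if "t \<in> hom A T" for t T
    using that g id_r[OF that] by (intro bexI[of _ "t ** g"]) auto
  ultimately show ?thesis unfolding cover_def using g(1) by blast
qed

lemma cover_comp_isom:
  assumes e: "cover e A B" and i: "isom i B D"
  shows "cover (i ** e) A D"
proof -
  obtain g where g: "i \<in> hom B D" "g \<in> hom D B" "g ** i = idn B" "i ** g = idn D" using i by (auto simp: isom_def)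
  have eh: "e \<in> hom A B" using e by (rule cover_in)
  have 1: "x = y" if x: "x \<in> hom D T" and y: "y \<in> hom D T" and eq: "x ** i ** e = y ** i ** e" for T x y
  proof -
    have "x ** i = y ** i" by (rule coverD[OF e, of _ _ T]) (use eq x y g in auto)
    then show ?thesis using x y g by (metis assoc id_r)
  qed
  have 2: "\<exists>h\<in>hom D T. h ** i ** e = t"
    if t: "t \<in> hom A T" and r: "\<And>S x y. x \<in> hom S A ==> y \<in> hom S A ==> i ** e ** x = i ** e ** y ==> t ** x = t ** y"
    for T t
  proof -
    obtain h where h: "h \<in> hom B T" "h ** e = t" using cover_factor[OF e t] r by metis
    have "(h ** g) ** i ** e = t" using h reassoc[OF g(3)] id_l[OF eh] by simp
    then show ?thesis using h g by blast
  qed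
  show ?thesis unfolding cover_def
  proof (intro conjI allI impI)
    show "i ** e \<in> hom A D" using eh g by blast
    show "x = y" if "x \<in> hom D T" "y \<in> hom D T" "x ** i ** e = y ** i ** e" for T x y
      using 1 that .
    show "\<exists>h\<in>hom D T. h ** i ** e = t"
      if "t \<in> hom A T" "\<forall>S x y. x \<in> hom S A --> y \<in> hom S A --> (i ** e) ** x = (i ** e) ** y --> t ** x = t ** y"
      for T t using 2[OF that(1)] that(2) assoc by metis
  qed
qed

lemma pullbackE:
  assumes "pullback f g A B D P p q" "a \<in> hom T A" "b \<in> hom T B" "f ** a = g ** b"
  obtains h where "h \<in> hom T P" "p ** h = a" "q ** h = b" using assms unfolding pullback_def by blast

lemma pullback_eqI:
  assumes "pullback f g A B D P p q" "p ** x = p ** y" "q ** x = q ** y" "x \<in> hom T P" "y \<in> hom T P"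
  shows "x = y"
  using assms unfolding pullback_def by blast

lemma pullback_in:
  assumes "pullback f g A B D P p q"
  shows "f \<in> hom A D" "g \<in> hom B D" "p \<in> hom P A" "q \<in> hom P B" "f ** p = g ** q" "P \<in> ob"
  using assms hom_ob unfolding pullback_def by auto

end

text \<open>The axioms speak of generalized elements only. \<open>coimages\<close> is the
  coequalizer of the kernel pair of \<open>f\<close>, described by the fact that it identifies the
  same elements as \<open>f\<close>. \<open>effective\<close> is Barr exactness: a jointly monic
  pair that is reflexive, symmetric and transitive on elements is the kernel pair of some
  arrow.\<close>

locale pointed_exact = partial_category ob hom cmp idn
  for ob :: "'o set" and hom :: "'o => 'o => 'a set" and cmp (infixr "**" 70) and idn +
  fixes Z :: 'o and z :: "'o => 'o => 'a"
  assumes z_in [intro]: "A \<in> ob ==> B \<in> ob ==> z A B \<in> hom A B"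
    and Z_ob [intro, simp]: "Z \<in> ob"
    and z_l': "f \<in> hom A B ==> D \<in> ob ==> z B D ** f = z A D"
    and z_r': "f \<in> hom B D ==> A \<in> ob ==> f ** z A B = z A D"
    and Z_initial: "f \<in> hom Z A ==> f = z Z A"
    and Z_terminal: "f \<in> hom A Z ==> f = z A Z"
    and pullbacks: "f \<in> hom A D ==> g \<in> hom B D ==> \<exists>P p q. pullback f g A B D P p q"
    and coimages: "f \<in> hom A B ==> \<exists>I e. cover e A I \<and>
      (\<forall>S x y. x \<in> hom S A --> y \<in> hom S A --> (e ** x = e ** y \<longleftrightarrow> f ** x = f ** y))"
    and cover_pullback: "pullback f g A B D P p q ==> cover f A D ==> cover q P B"
    and effective: "r \<in> hom R X ==> s \<in> hom R X ==>
      (\<And>T x y. x \<in> hom T R ==> y \<in> hom T R ==> r ** x = r ** y ==> s ** x = s ** y ==> x = y) ==>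
      (\<And>T x. x \<in> hom T X ==> \<exists>t\<in>hom T R. r ** t = x \<and> s ** t = x) ==>
      (\<And>T t. t \<in> hom T R ==> \<exists>t'\<in>hom T R. r ** t' = s ** t \<and> s ** t' = r ** t) ==>
      (\<And>T t t'. t \<in> hom T R ==> t' \<in> hom T R ==> s ** t = r ** t' ==>
         \<exists>u\<in>hom T R. r ** u = r ** t \<and> s ** u = s ** t') ==>
      \<exists>Y f. f \<in> hom X Y \<and> (\<forall>T x y. x \<in> hom T X --> y \<in> hom T X -->
        (f ** x = f ** y \<longleftrightarrow> (\<exists>t\<in>hom T R. r ** t = x \<and> s ** t = y)))"
begin

definition kernel :: "'a => 'o => 'o => 'o => 'a => bool" where
  "kernel f A B K k \<longleftrightarrow> f \<in> hom A B \<and> monic k K A \<and> f ** k = z K B \<and>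
     (\<forall>T t. t \<in> hom T A --> f ** t = z T B --> (\<exists>h\<in>hom T K. k ** h = t))"

definition normal :: "'a => 'o => 'o => bool" where
  "normal k K A \<longleftrightarrow> (\<exists>f B. kernel f A B K k)"

definition split_ext :: "'o => 'a => 'o => 'a => 'a => 'o => bool" where
  "split_ext X k A p s B \<longleftrightarrow>
     p \<in> hom A B \<and> s \<in> hom B A \<and> p ** s = idn B \<and> kernel p A B X k"

end

locale exact_protomodular = pointed_exact ob hom cmp idn Z z
  for ob :: "'o set" and hom :: "'o => 'o => 'a set" and cmp (infixr "**" 70) and idn Z z +
  assumes protomodular: "split_ext X k A p s B ==> split_ext X' k' A' p' s' B ==>
      \<phi> \<in> hom A A' ==> \<psi> \<in> hom X X' ==> \<phi> ** k = k' ** \<psi> ==> p' ** \<phi> = p ==> \<phi> ** s = s' ==>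
      isom \<psi> X X' ==> isom \<phi> A A'"
    and strongly_protomodular: "split_ext X k A p s B ==> split_ext X' k' A' p' s' B ==>
      \<phi> \<in> hom A A' ==> \<psi> \<in> hom X X' ==> \<phi> ** k = k' ** \<psi> ==> p' ** \<phi> = p ==> \<phi> ** s = s' ==>
      normal \<psi> X X' ==> normal (\<phi> ** k) X A'"
begin

section \<open>Diagram lemmas: images, jointly epic pairs, the short five lemma, cokernels\<close>

lemma kernelE:
  assumes "kernel f A B K k" "t \<in> hom T A" "f ** t = z T B"
  obtains h where "h \<in> hom T K" "k ** h = t" using assms unfolding kernel_def by blast

lemma kernel_in:
  assumes "kernel f A B K k"
  shows "f \<in> hom A B" "k \<in> hom K A" "monic k K A" "f ** k = z K B"
  using assms unfolding kernel_def by (auto dest: monic_in)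

lemma split_ext_in:
  assumes "split_ext X k A p s B"
  shows "p \<in> hom A B" "s \<in> hom B A" "p ** s = idn B" "kernel p A B X k" "k \<in> hom X A" "monic k X A"
    "p ** k = z X B" "X \<in> ob" "A \<in> ob" "B \<in> ob"
  using assms hom_ob kernel_in[of p A B X k] unfolding split_ext_def by blast+

text \<open>Pullback stability turns a cover into a local surjection: an element of \<open>B\<close>
  lifts to \<open>A\<close> after its stage \<open>T\<close> is replaced by a cover of
  \<open>T\<close>. The element-style arguments below rest on this.\<close>

lemma cover_lift:
  assumes e: "cover e A B" and b: "b \<in> hom T B"
  obtains T' t x where "cover t T' T" "x \<in> hom T' A" "e ** x = b ** t"
  by (metis assms cover_in cover_pullback pullback_in(3) pullback_in(5) pullbacks)

lemma kernels: "f \<in> hom A B ==> \<exists>K k. kernel f A B K k"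
proof -
  assume f: "f \<in> hom A B"
  have AB: "A \<in> ob" "B \<in> ob" using hom_ob[OF f] by auto
  obtain P p q where P: "pullback f (z Z B) A Z B P p q" using pullbacks[OF f z_in[OF Z_ob AB(2)]] by blast
  note Pin = pullback_in[OF P]
  have "monic p P A" unfolding monic_def
  proof (intro conjI allI impI)
    fix T x y assume *: "x \<in> hom T P" "y \<in> hom T P" "p ** x = p ** y"
    then have "q ** x = q ** y" using Pin Z_terminal by (metis comp_in)
    then show "x = y" using pullback_eqI[OF P] * by metis
  qed (fact Pin)
  moreover have "f ** p = z P B" using Pin by (metis z_l' AB(2))
  moreover have "\<exists>h\<in>hom T P. p ** h = t" if "t \<in> hom T A" "f ** t = z T B" for T t
  proof -
    have "T \<in> ob" using hom_ob that by blast
    then have "z T Z \<in> hom T Z" by blast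
    then have "z T Z \<in> hom T Z" "z Z B ** z T Z = z T B" using z_l' AB(2) by auto
    then show ?thesis using pullbackE[OF P that(1), of "z T Z"] that by metis
  qed
  ultimately show ?thesis using f unfolding kernel_def by blast
qed

text \<open>This is the form of protomodularity used from here on. The restriction of
  \<open>p\<close> to \<open>M\<close> is split by \<open>s'\<close> and has the same kernel as
  \<open>p\<close>, so \<open>m\<close> is a map of split extensions that is the identity on
  kernels.\<close>

lemma split_cover:
  assumes m: "monic m M A" and p: "p \<in> hom A B" and s': "s' \<in> hom B M"
    and ps: "p ** m ** s' = idn B"
    and ker: "\<And>T x. x \<in> hom T A ==> p ** x = z T B ==> \<exists>y\<in>hom T M. m ** y = x"
  shows "isom m M A"
proof -
  obtain K k where k: "kernel p A B K k" using kernels[OF p] by blast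
  note kin = kernel_in[OF k]
  note mh = monic_in[OF m]
  obtain k' where k': "k' \<in> hom K M" "m ** k' = k" using ker[OF kin(2,4)] by blast
  have "kernel (p ** m) M B K k'" unfolding kernel_def
  proof (intro conjI allI impI)
    show "p ** m \<in> hom M B" using p mh by blast
    show "monic k' K M" using kin(3) k' unfolding monic_def by (metis assoc)
    show "(p ** m) ** k' = z K B" using k' kin by simp
    fix T t assume t: "t \<in> hom T M" "(p ** m) ** t = z T B"
    then obtain h where h: "h \<in> hom T K" "k ** h = m ** t" using kernelE[OF k, of "m ** t" T] mh by auto
    then have "m ** k' ** h = m ** t" using k' reassoc by metis
    then have "k' ** h = t" by (rule monicD[OF m]) (use h k' t in auto)
    then show "\<exists>h\<in>hom T K. k' ** h = t" using h by blast
  qed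
  then have 1: "split_ext K k' M (p ** m) s' B" using p mh s' ps unfolding split_ext_def by auto
  have 2: "split_ext K k A p (m ** s') B" using p mh s' ps k unfolding split_ext_def by auto
  have K: "K \<in> ob" using hom_ob kin by blast
  show ?thesis
    by (rule protomodular[OF 1 2 mh id_in[OF K]])
      (use k' kin id_r[OF kin(2)] isom_id[OF K] in auto)
qed

text \<open>Membership in a subobject is a local question: the factorization \<open>w\<close> found
  over the cover \<open>t\<close> is compatible with \<open>t\<close> because \<open>m\<close> is
  monic, and so it descends to \<open>T\<close>.\<close>

lemma monic_from_cover:
  assumes m: "monic m M A" and t: "cover t T' T" and a: "a \<in> hom T A" and w: "w \<in> hom T' M"
    and eq: "m ** w = a ** t"
  obtains v where "v \<in> hom T M" "m ** v = a"
proof -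
  note mh = monic_in[OF m]
  have "w ** x = w ** y" if "x \<in> hom S T'" "y \<in> hom S T'" "t ** x = t ** y" for S x y
  proof -
    have "m ** w ** x = m ** w ** y" using that(3) reassoc[OF eq] by simp
    then show ?thesis by (rule monicD[OF m]) (use that w in auto)
  qed
  then obtain v where v: "v \<in> hom T M" "v ** t = w" by (rule cover_factor[OF t w])
  have "(m ** v) ** t = a ** t" using v eq by simp
  then have "m ** v = a" by (rule coverD[OF t]) (use mh v a in auto)
  then show ?thesis using that v by blast
qed

lemma monic_cover_isom:
  assumes m: "monic m M A" and w: "w \<in> hom T M" and c: "cover (m ** w) T A"
  shows "isom m M A"
proof -
  have A: "idn A \<in> hom A A" using hom_ob[OF monic_in[OF m]] by blast
  have "m ** w = idn A ** m ** w" using id_l[OF cover_in[OF c]] by simp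
  from monic_from_cover[OF m c A w this] show ?thesis using monic_split_isom[OF m] by metis
qed

lemma image:
  assumes f: "f \<in> hom A B"
  obtains I e m where "cover e A I" "monic m I B" "m ** e = f"
proof -
  obtain I e where e: "cover e A I"
    and ee: "\<And>S x y. x \<in> hom S A ==> y \<in> hom S A ==> e ** x = e ** y \<longleftrightarrow> f ** x = f ** y"
    using coimages[OF f] by blast
  obtain m where m: "m \<in> hom I B" "m ** e = f" using cover_factor[OF e f] ee by metis
  \<comment> \<open>Two elements of \<open>I\<close> identified by \<open>m\<close> lift locally to
    \<open>A\<close>, where \<open>e\<close> and \<open>f\<close> identify the same elements; since
    covers are epimorphic, the original elements agree.\<close>
  have "x = y" if x: "x \<in> hom T I" and y: "y \<in> hom T I" and eq: "m ** x = m ** y" for T x y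
  proof -
    obtain T1 t1 x1 where 1: "cover t1 T1 T" "x1 \<in> hom T1 A" "e ** x1 = x ** t1" using cover_lift[OF e x] by metis
    note t1 = cover_in[OF 1(1)]
    obtain T2 t2 y2 where 2: "cover t2 T2 T1" "y2 \<in> hom T2 A" "e ** y2 = (y ** t1) ** t2"
      by (rule cover_lift[OF e comp_in[OF t1 y]])
    note t2 = cover_in[OF 2(1)]
    have "f ** x1 ** t2 = m ** x ** t1 ** t2" using 1(3) m(2) by (metis assoc)
    also have "\<dots> = f ** y2" using eq 2(3) m(2) by (metis assoc)
    finally have "e ** x1 ** t2 = e ** y2" using ee[of "x1 ** t2" T2 y2] 1(2) 2(2) t2 by auto
    then have "(x ** t1) ** t2 = (y ** t1) ** t2" using 1(3) 2(3) by (metis assoc)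
    then have "x ** t1 = y ** t1" by (rule coverD[OF 2(1)]) (use x y t1 in auto)
    then show ?thesis by (rule coverD[OF 1(1)]) (use x y in auto)
  qed
  then have "monic m I B" using m unfolding monic_def by blast
  then show ?thesis using that e m by blast
qed

lemma cover_cancel:
  assumes c: "cover (g ** f) A D" and f: "f \<in> hom A B" and g: "g \<in> hom B D"
  shows "cover g B D"
proof -
  obtain I e m where i: "cover e B I" "monic m I D" "m ** e = g" using image[OF g] .
  note eh = cover_in[OF i(1)]
  have "m ** e ** f = g ** f" by (rule reassoc[OF i(3)])
  then have "cover (m ** e ** f) A D" using c by argo
  then have "isom m I D" by (rule monic_cover_isom[OF i(2) comp_in[OF f eh]])
  from cover_comp_isom[OF i(1) this] show ?thesis unfolding i(3) .
qed

lemma split_epi_cover: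
  assumes g: "g \<in> hom B D" and f: "f \<in> hom D B" and gf: "g ** f = idn D"
  shows "cover g B D"
proof -
  have "D \<in> ob" using hom_ob[OF f] by blast
  then have c: "cover (g ** f) D D" unfolding gf by (rule isom_cover[OF isom_id])
  show ?thesis using cover_cancel[OF c f g] .
qed

text \<open>The factorization property of covers does not visibly compose, so the image of the
  composite is used: \<open>f\<close> factors through it by descent along \<open>e\<close>, and a
  subobject through which a cover factors is everything.\<close>

lemma cover_comp:
  assumes e: "cover e A B" and f: "cover f B D"
  shows "cover (f ** e) A D"
proof -
  note eh = cover_in[OF e] and fh = cover_in[OF f]
  have fe: "f ** e \<in> hom A D" using eh fh by blast
  obtain I g m where i: "cover g A I" "monic m I D" "m ** g = f ** e" using image[OF fe] .
  obtain v where v: "v \<in> hom B I" "m ** v = f" using monic_from_cover[OF i(2) e fh cover_in[OF i(1)] i(3)] .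
  have "isom m I D" by (rule monic_cover_isom[OF i(2) v(1)]) (use v f in simp)
  from cover_comp_isom[OF i(1) this] show ?thesis unfolding i(3) .
qed

lemma equalizers:
  assumes f: "f \<in> hom A B" and g: "g \<in> hom A B"
  obtains E e where "monic e E A" "f ** e = g ** e"
    "\<forall>T x. x \<in> hom T A --> f ** x = g ** x --> (\<exists>y\<in>hom T E. e ** y = x)"
proof -
  have A: "A \<in> ob" "idn A \<in> hom A A" and B: "B \<in> ob" using hom_ob[OF f] by auto
  have zz: "z A Z \<in> hom A Z" "z B Z \<in> hom B Z" using A B by auto
  \<comment> \<open>The pullback over the zero object is the product of \<open>A\<close> and
    \<open>B\<close>. Below, \<open>u\<close> and \<open>v\<close> are the graphs of
    \<open>f\<close> and \<open>g\<close>, and the equalizer is the pullback of the two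
    graphs.\<close>
  obtain P p q where P: "pullback (z A Z) (z B Z) A B Z P p q" using pullbacks[OF zz] by blast
  have "z A Z ** idn A = z B Z ** h" if "h \<in> hom A B" for h using that zz A by (metis comp_in Z_terminal)
  then obtain u v where u: "u \<in> hom A P" "p ** u = idn A" "q ** u = f"
    and v: "v \<in> hom A P" "p ** v = idn A" "q ** v = g" using pullbackE[OF P A(2)] f g by metis
  obtain E e e' where E: "pullback u v A A P E e e'" using pullbacks[OF u(1) v(1)] by blast
  note Ein = pullback_in[OF E]
  have "e = e'" using Ein(3-5) u(2) v(2) by (metis assoc id_l)
  then have E': "pullback u v A A P E e e" using E by simp
  have "monic e E A" using pullback_eqI[OF E'] Ein(3) unfolding monic_def by blast
  moreover have "f ** e = g ** e" using pullback_in(5)[OF E'] u(3) v(3) by (metis assoc)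
  moreover have "\<exists>y\<in>hom T E. e ** y = x" if x: "x \<in> hom T A" "f ** x = g ** x" for T x
  proof -
    have "u ** x = v ** x" by (rule pullback_eqI[OF P, of _ _ T])
        (use x u v in \<open>auto simp: reassoc[OF u(2)] reassoc[OF v(2)] reassoc[OF u(3)] reassoc[OF v(3)]\<close>)
    then show ?thesis using pullbackE[OF E' x(1) x(1)] by metis
  qed
  ultimately show ?thesis by (intro that[of e E]) blast+
qed

text \<open>The equalizer of \<open>u\<close> and \<open>v\<close> contains the section and the
  kernel of \<open>p\<close>, so it is all of \<open>A\<close>.\<close>

lemma split_jointly_epic:
  assumes p: "p \<in> hom A B" and s: "s \<in> hom B A" "p ** s = idn B"
    and u: "u \<in> hom A T" and v: "v \<in> hom A T" and us: "u ** s = v ** s"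
    and ker: "\<And>S x. x \<in> hom S A ==> p ** x = z S B ==> u ** x = v ** x"
  shows "u = v"
proof -
  obtain E e where e: "monic e E A" "u ** e = v ** e"
    and ee: "\<forall>T x. x \<in> hom T A --> u ** x = v ** x --> (\<exists>y\<in>hom T E. e ** y = x)"
    by (rule equalizers[OF u v])
  obtain s' where s': "s' \<in> hom B E" "e ** s' = s" using ee s(1) us by blast
  have "isom e E A" by (rule split_cover[OF e(1) p s'(1)]) (use s s' ee ker in auto)
  then have "cover e E A" by (rule isom_cover)
  from coverD[OF this e(2) u v] show ?thesis .
qed

text \<open>The first projection of the kernel pair of \<open>f\<close> is split by the diagonal,
  and its kernel consists of pairs (0, x) with f x = 0, hence x = 0. So the two projections agree on
  the section and on the kernel, and are equal.\<close>

lemma monic_if_kernel_zero: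
  assumes f: "f \<in> hom A B" and ker: "\<And>T x. x \<in> hom T A ==> f ** x = z T B ==> x = z T A"
  shows "monic f A B"
proof -
  have A: "A \<in> ob" "idn A \<in> hom A A" using hom_ob[OF f] by auto
  obtain P p q where P: "pullback f f A A B P p q" using pullbacks[OF f f] by blast
  note Pin = pullback_in[OF P]
  obtain d where d: "d \<in> hom A P" "p ** d = idn A" "q ** d = idn A" using pullbackE[OF P A(2) A(2)] by blast
  have "p = q"
  proof (rule split_jointly_epic[OF Pin(3) d(1,2) Pin(3,4)])
    fix S x assume x: "x \<in> hom S P" "p ** x = z S A"
    have S: "S \<in> ob" using hom_ob[OF x(1)] by blast
    have "f ** q ** x = f ** p ** x" by (metis Pin(5) assoc)
    then have "f ** q ** x = z S B" using x(2) z_r'[OF f S] by simp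
    then show "p ** x = q ** x" using ker[OF comp_in[OF x(1) Pin(4)]] x(2) by simp
  qed (use d in simp)
  then show ?thesis using pullbackE[OF P] f unfolding monic_def by metis
qed

text \<open>The set-theoretic content: if \<open>e a = e (m y)\<close> then \<open>a\<close> and \<open>m y\<close> differ by an element of the
  kernel of \<open>e\<close>, hence \<open>a\<close> lies in \<open>M\<close>.\<close>

lemma factor_through_subobject:
  assumes m: "monic m M A" and e: "e \<in> hom A B"
    and ker: "\<And>T x. x \<in> hom T A ==> e ** x = z T B ==> \<exists>y\<in>hom T M. m ** y = x"
    and a: "a \<in> hom T A" and y: "y \<in> hom T M" and ea: "e ** a = e ** m ** y"
  obtains w where "w \<in> hom T M" "m ** w = a"
proof -
  note mh = monic_in[OF m]
  have M: "M \<in> ob" "idn M \<in> hom M M" using hom_ob[OF mh] by auto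
  have em: "e ** m \<in> hom M B" using e mh by blast
  \<comment> \<open>\<open>P\<close> consists of the pairs (a, y) with e a = e (m y), and
    \<open>Q\<close> of those whose first entry lies in \<open>M\<close>. The projection of
    \<open>P\<close> to \<open>M\<close> is split by y \<mapsto> (m y, y), and its kernel consists
    of pairs (a, 0) with e a = 0. Both lie in \<open>Q\<close>, so \<open>Q\<close> is all of
    \<open>P\<close>.\<close>
  obtain P pA pM where P: "pullback e (e ** m) A M B P pA pM" using pullbacks[OF e em] by blast
  note Pin = pullback_in[OF P]
  obtain Q u v where Q: "pullback pA m P M A Q u v" using pullbacks[OF Pin(3) mh] by blast
  note Qin = pullback_in[OF Q]
  have u: "monic u Q P" unfolding monic_def
  proof (intro conjI allI impI)
    fix T x y assume *: "x \<in> hom T Q" "y \<in> hom T Q" "u ** x = u ** y"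
    have "m ** v ** x = m ** v ** y" using * Qin(5) by (metis assoc)
    then have "v ** x = v ** y" by (rule monicD[OF m]) (use * Qin in auto)
    then show "x = y" using pullback_eqI[OF Q] * by blast
  qed (fact Qin)
  obtain s where s: "s \<in> hom M P" "pA ** s = m" "pM ** s = idn M" using pullbackE[OF P mh M(2)] id_r[OF em] by auto
  obtain s' where s': "s' \<in> hom M Q" "u ** s' = s" "v ** s' = idn M"
    using pullbackE[OF Q s(1) M(2)] s(2) id_r[OF mh] by auto
  have "isom u Q P"
  proof (rule split_cover[OF u Pin(4) s'(1)])
    show "pM ** u ** s' = idn M" using s s' by simp
    fix T x assume x: "x \<in> hom T P" "pM ** x = z T M"
    have "T \<in> ob" using hom_ob[OF x(1)] by blast
    then have "e ** pA ** x = z T B" using x(2) reassoc[OF Pin(5)] z_r'[OF em] by simp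
    then obtain y where "y \<in> hom T M" "m ** y = pA ** x" using ker[of "pA ** x" T] x(1) Pin(3) by auto
    then show "\<exists>y\<in>hom T Q. u ** y = x" using pullbackE[OF Q x(1)] by metis
  qed
  then obtain u' where u': "u' \<in> hom P Q" "u ** u' = idn P" by (auto simp: isom_def)
  obtain h where h: "h \<in> hom T P" "pA ** h = a" "pM ** h = y" using pullbackE[OF P a y] ea by auto
  have "m ** v ** u' ** h = a" using h(2) id_l[OF h(1)] Qin(5) u'(2) by (metis assoc)
  then show ?thesis using that[of "v ** u' ** h"] Qin u' h by blast
qed

text \<open>Locally, every element of \<open>A\<close> has the same image in \<open>B\<close> as
  some element of \<open>M\<close>, and therefore lies in \<open>M\<close>.\<close>

lemma subobject_isom:
  assumes m: "monic m M A" and e: "e \<in> hom A B" and c: "cover (e ** m) M B"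
    and ker: "\<And>T x. x \<in> hom T A ==> e ** x = z T B ==> \<exists>y\<in>hom T M. m ** y = x"
  shows "isom m M A"
proof -
  obtain T t y where t: "cover t T A" "y \<in> hom T M" "(e ** m) ** y = e ** t" using cover_lift[OF c e] .
  obtain w where w: "w \<in> hom T M" "m ** w = t"
    by (rule factor_through_subobject[OF m e ker cover_in[OF t(1)] t(2)]) (use t(3) in simp_all)
  show ?thesis by (rule monic_cover_isom[OF m w(1)]) (use w t in simp)
qed

text \<open>Injectivity comes from the vanishing of the kernel of \<phi>; surjectivity holds because
  the subobject \<phi> contains the kernel of \<open>p'\<close> and maps onto
  \<open>B\<close>.\<close>

lemma short_five:
  assumes j: "kernel p A B X j" and j': "kernel p' A' B X' j'"
    and \<phi>: "\<phi> \<in> hom A A'" and \<psi>: "isom \<psi> X X'" and sq: "\<phi> ** j = j' ** \<psi>"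
    and p: "p' ** \<phi> = p" and c: "cover p A B"
  shows "isom \<phi> A A'"
proof -
  note J = kernel_in[OF j] and J' = kernel_in[OF j'] and \<psi>h = isom_in[OF \<psi>]
  have "monic \<phi> A A'"
  proof (rule monic_if_kernel_zero[OF \<phi>])
    fix T x assume x: "x \<in> hom T A" "\<phi> ** x = z T A'"
    have T: "T \<in> ob" using hom_ob[OF x(1)] by blast
    have "p ** x = z T B" using x(2) p z_r'[OF J'(1) T] by (metis assoc)
    then obtain y where y: "y \<in> hom T X" "j ** y = x" using kernelE[OF j x(1)] by metis
    have "j' ** \<psi> ** y = j' ** \<psi> ** z T X" using x(2) y(2) sq z_r'[OF \<psi>h T] z_r'[OF J'(2) T] by (metis assoc)
    then have "\<psi> ** y = \<psi> ** z T X" by (rule monicD[OF J'(3)]) (use y \<psi>h T hom_ob in blast)+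
    then have "y = z T X" by (rule monicD[OF isom_monic[OF \<psi>]]) (use y T \<psi>h hom_ob in blast)+
    then show "x = z T A" using y z_r'[OF J(2) T] by simp
  qed
  then show ?thesis
  proof (rule subobject_isom[OF _ J'(1)])
    show "cover (p' ** \<phi>) A B" using p c by simp
    fix T x assume x: "x \<in> hom T A'" "p' ** x = z T B"
    then obtain y where y: "y \<in> hom T X'" "j' ** y = x" using kernelE[OF j'] by metis
    obtain \<psi>' where "\<psi>' \<in> hom X' X" "\<psi> ** \<psi>' = idn X'" using \<psi> by (auto simp: isom_def)
    then have "\<phi> ** j ** \<psi>' ** y = x" "j ** \<psi>' ** y \<in> hom T A" using y sq J(2) id_l[OF y(1)]
      by (metis assoc, blast)
    then show "\<exists>y\<in>hom T A. \<phi> ** y = x" by blast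
  qed
qed

text \<open>A cover is the coequalizer of its kernel pair. After \<open>t\<close> the two
  projections of the kernel pair agree on the diagonal and on the kernel of the first projection,
  whose elements (0, x) have x in the kernel of \<open>q\<close>; so they agree everywhere.\<close>

lemma cover_cokernel:
  assumes q: "cover q A B" and t: "t \<in> hom A T"
    and ker: "\<And>S x. x \<in> hom S A ==> q ** x = z S B ==> t ** x = z S T"
  obtains h where "h \<in> hom B T" "h ** q = t"
proof -
  note qh = cover_in[OF q]
  have A: "A \<in> ob" "idn A \<in> hom A A" using hom_ob[OF qh] by auto
  obtain P a b where P: "pullback q q A A B P a b" using pullbacks[OF qh qh] by blast
  note Pin = pullback_in[OF P]
  obtain d where d: "d \<in> hom A P" "a ** d = idn A" "b ** d = idn A" using pullbackE[OF P A(2) A(2)] by blast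
  have ab: "t ** a = t ** b"
  proof (rule split_jointly_epic[OF Pin(3) d(1,2)])
    fix S x assume x: "x \<in> hom S P" "a ** x = z S A"
    have S: "S \<in> ob" using hom_ob[OF x(1)] by blast
    have "q ** b ** x = q ** a ** x" by (metis Pin(5) assoc)
    then have "q ** b ** x = z S B" using x(2) z_r'[OF qh S] by simp
    then have "t ** b ** x = z S T" using ker[of "b ** x" S] x Pin(4) by auto
    then show "(t ** a) ** x = (t ** b) ** x" using x(2) z_r'[OF t S] by simp
  qed (use d t Pin in auto)
  have "t ** x = t ** y" if xy: "x \<in> hom S A" "y \<in> hom S A" "q ** x = q ** y" for S x y
  proof -
    obtain h where h: "h \<in> hom S P" "a ** h = x" "b ** h = y" using pullbackE[OF P xy] .
    then show ?thesis using ab by (metis assoc)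
  qed
  then show ?thesis using cover_factor[OF q t] that by blast
qed

lemma normal_cokernel:
  assumes "normal a N A"
  obtains W w where "cover w A W" "kernel w A W N a"
proof -
  obtain f B where f: "kernel f A B N a" using assms unfolding normal_def by blast
  note fin = kernel_in[OF f]
  obtain W w where w: "cover w A W"
    and ww: "\<And>S x y. x \<in> hom S A ==> y \<in> hom S A ==> w ** x = w ** y \<longleftrightarrow> f ** x = f ** y"
    using coimages[OF fin(1)] by blast
  note wh = cover_in[OF w]
  have A: "A \<in> ob" using hom_ob[OF wh] by blast
  have 0: "w ** x = z T W \<longleftrightarrow> f ** x = z T B" if "x \<in> hom T A" for T x
  proof -
    have T: "T \<in> ob" using hom_ob[OF that] by blast
    show ?thesis using ww[OF that z_in[OF T A]] z_r'[OF wh T] z_r'[OF fin(1) T] by simp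
  qed
  have "kernel w A W N a" using f wh fin 0 unfolding kernel_def by blast
  then show ?thesis using that w by blast
qed

text \<open>The induced map \<open>w\<close> is the pullback of the cover \<open>q\<close> along
  \<open>l\<close>: an element of \<open>A\<close> whose image under \<open>q\<close> lies in the
  kernel of \<open>p\<close> lies in the kernel of \<open>p ** q\<close>.\<close>

lemma cover_of_kernels:
  assumes q: "cover q A W" and k: "kernel (p ** q) A B K k" and l: "kernel p W B L l"
    and w: "w \<in> hom K L" "l ** w = q ** k"
  shows "cover w K L"
proof -
  note qh = cover_in[OF q] and K = kernel_in[OF k] and L = kernel_in[OF l]
  have "pullback q l A L W K k w" unfolding pullback_def
  proof (intro conjI allI impI)
    fix T a b assume ab: "a \<in> hom T A" "b \<in> hom T L" "q ** a = l ** b"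
    have "p ** q ** a = (p ** l) ** b" using ab(3) by simp
    also have "\<dots> = z T B" using z_l'[OF ab(2)] L(4) hom_ob[OF L(1)] by simp
    finally have "(p ** q) ** a = z T B" by simp
    then obtain h where h: "h \<in> hom T K" "k ** h = a" using kernelE[OF k ab(1)] by blast
    have "l ** w ** h = l ** b" using h ab(3) w(2) by (metis assoc)
    then have "w ** h = b" by (rule monicD[OF L(3)]) (use h w ab in auto)
    then show "\<exists>h\<in>hom T K. k ** h = a \<and> w ** h = b" using h by blast
  qed (use qh K L w monicD[OF K(3)] in auto)
  from cover_pullback[OF this q] show ?thesis .
qed

text \<open>Protomodular categories are Mal'tsev.\<close>

lemma reflexive_euclidean:
  assumes r: "r \<in> hom R X" and s: "s \<in> hom R X"
    and jm: "\<forall>T x y. x \<in> hom T R --> y \<in> hom T R --> r ** x = r ** y --> s ** x = s ** y --> x = y"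
    and d: "d \<in> hom X R" "r ** d = idn X" "s ** d = idn X"
    and t: "t \<in> hom T R" and u: "u \<in> hom T R" and tu: "r ** t = r ** u"
  obtains v where "v \<in> hom T R" "r ** v = s ** t" "s ** v = s ** u"
proof -
  have R: "R \<in> ob" "idn R \<in> hom R R" using hom_ob[OF r] by auto
  \<comment> \<open>\<open>P\<close> consists of the pairs (t, u) of related elements with a common
    source, and \<open>E\<close> of those pairs together with a witness that the targets are
    related. The first projection of \<open>P\<close> is split by t \<mapsto> (t, t), where
    reflexivity gives a witness; for a pair (0, u) the witness is \<open>u\<close> itself. So
    \<open>E\<close> contains a section and the kernel.\<close>
  obtain P a b where P: "pullback r r R R X P a b" using pullbacks[OF r r] by blast
  note Pin = pullback_in[OF P]
  have sa: "s ** a \<in> hom P X" using s Pin by blast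
  obtain Q c e where Q: "pullback (s ** a) r P R X Q c e" using pullbacks[OF sa r] by blast
  note Qin = pullback_in[OF Q]
  have se: "s ** e \<in> hom Q X" "s ** b ** c \<in> hom Q X" using s Qin Pin by blast+
  obtain E i where i: "monic i E Q" "(s ** e) ** i = (s ** b ** c) ** i"
    and ii: "\<forall>T x. x \<in> hom T Q --> (s ** e) ** x = (s ** b ** c) ** x --> (\<exists>y\<in>hom T E. i ** y = x)"
    by (rule equalizers[OF se])
  note ih = monic_in[OF i(1)]
  have in_E: "\<exists>y\<in>hom T E. c ** i ** y = x \<and> e ** i ** y = v"
    if xv: "x \<in> hom T P" "v \<in> hom T R" "r ** v = s ** a ** x" "s ** v = s ** b ** x" for T x v
  proof -
    obtain h where h: "h \<in> hom T Q" "c ** h = x" "e ** h = v" using pullbackE[OF Q xv(1,2)] xv(3) by auto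
    then obtain y where "y \<in> hom T E" "i ** y = h" using ii xv(4) by auto
    then show ?thesis using h by auto
  qed
  have m: "monic (c ** i) E P" unfolding monic_def
  proof (intro conjI allI impI)
    show "c ** i \<in> hom E P" using ih Qin by blast
    fix T x y assume *: "x \<in> hom T E" "y \<in> hom T E" "(c ** i) ** x = (c ** i) ** y"
    have "e ** i ** x = e ** i ** y"
    proof (rule jm[rule_format, of _ T])
      show "r ** e ** i ** x = r ** e ** i ** y" using *(3) Qin(5) by (metis assoc)
      show "s ** e ** i ** x = s ** e ** i ** y" using *(3) i(2) by (metis assoc)
    qed (use * ih Qin in auto)
    moreover have "c ** i ** x = c ** i ** y" using *(3) by simp
    ultimately have "i ** x = i ** y" using pullback_eqI[OF Q] * ih by blast
    then show "x = y" by (rule monicD[OF i(1)]) (use * in auto)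
  qed
  obtain w where w: "w \<in> hom R P" "a ** w = idn R" "b ** w = idn R" using pullbackE[OF P R(2) R(2)] by blast
  have ds: "d ** s \<in> hom R R" using d s by blast
  have "r ** d ** s = s ** a ** w" "s ** d ** s = s ** b ** w"
    using w id_r[OF s] reassoc[OF d(2)] reassoc[OF d(3)] id_l[OF s] by auto
  then obtain w' where w': "w' \<in> hom R E" "c ** i ** w' = w" using in_E[OF w(1) ds] by blast
  have "isom (c ** i) E P"
  proof (rule split_cover[OF m Pin(3) w'(1)])
    show "a ** (c ** i) ** w' = idn R" using w w' by simp
    fix T x assume x: "x \<in> hom T P" "a ** x = z T R"
    have T: "T \<in> ob" using hom_ob[OF x(1)] by blast
    have "r ** b ** x = r ** a ** x" using Pin(5) by (metis assoc)
    then have "r ** b ** x = s ** a ** x" using x(2) z_r'[OF r T] z_r'[OF s T] by simp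
    then show "\<exists>y\<in>hom T E. (c ** i) ** y = x" using in_E[OF x(1), of "b ** x"] x(1) Pin(4) by force
  qed
  then obtain j where j: "j \<in> hom P E" "(c ** i) ** j = idn P" by (auto simp: isom_def)
  obtain h where h: "h \<in> hom T P" "a ** h = t" "b ** h = u" using pullbackE[OF P t u tu] .
  have ch: "c ** i ** j ** h = h" using j(2) id_l[OF h(1)] by (metis assoc)
  have "r ** e ** i ** j ** h = s ** t" using ch h Qin(5) by (metis assoc)
  moreover have "s ** e ** i ** j ** h = s ** u" using ch h i(2) by (metis assoc)
  moreover have "e ** i ** j ** h \<in> hom T R" using h j ih Qin by blast
  ultimately show ?thesis using that by blast
qed

text \<open>Symmetry is the Euclidean property against a reflexive element, transitivity the same
  property against a reversed one. The arrow supplied by exactness is replaced by its coimage in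
  order to have a cover.\<close>

lemma reflexive_effective:
  assumes r: "r \<in> hom R X" and s: "s \<in> hom R X"
    and jm: "\<forall>T x y. x \<in> hom T R --> y \<in> hom T R --> r ** x = r ** y --> s ** x = s ** y --> x = y"
    and d: "d \<in> hom X R" "r ** d = idn X" "s ** d = idn X"
  obtains Q q where "cover q X Q"
    "\<forall>T x y. x \<in> hom T X --> y \<in> hom T X -->
      (q ** x = q ** y \<longleftrightarrow> (\<exists>t\<in>hom T R. r ** t = x \<and> s ** t = y))"
proof -
  have refl: "\<exists>t\<in>hom T R. r ** t = x \<and> s ** t = x" if "x \<in> hom T X" for T x
    using that d id_l[OF that] by (intro bexI[of _ "d ** x"]) (auto simp: reassoc[OF d(2)] reassoc[OF d(3)])
  have sym: "\<exists>t'\<in>hom T R. r ** t' = s ** t \<and> s ** t' = r ** t" if t: "t \<in> hom T R" for T t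
  proof -
    obtain t0 where t0: "t0 \<in> hom T R" "r ** t0 = r ** t" "s ** t0 = r ** t" using refl[of "r ** t" T] t r by blast
    have eq: "r ** t = r ** t0" using t0 by simp
    obtain v where "v \<in> hom T R" "r ** v = s ** t" "s ** v = s ** t0"
      by (rule reflexive_euclidean[OF r s jm d t t0(1) eq])
    then show ?thesis using t0 by auto
  qed
  have trans: "\<exists>u\<in>hom T R. r ** u = r ** t \<and> s ** u = s ** t'"
    if t: "t \<in> hom T R" and t': "t' \<in> hom T R" and eq: "s ** t = r ** t'" for T t t'
  proof -
    obtain t0 where t0: "t0 \<in> hom T R" "r ** t0 = s ** t" "s ** t0 = r ** t" using sym[OF t] by blast
    have eq': "r ** t0 = r ** t'" using t0 eq by simp
    obtain v where "v \<in> hom T R" "r ** v = s ** t0" "s ** v = s ** t'"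
      by (rule reflexive_euclidean[OF r s jm d t0(1) t' eq'])
    then show ?thesis using t0 by auto
  qed
  have "\<exists>Y f. f \<in> hom X Y \<and> (\<forall>T x y. x \<in> hom T X --> y \<in> hom T X -->
        (f ** x = f ** y \<longleftrightarrow> (\<exists>t\<in>hom T R. r ** t = x \<and> s ** t = y)))"
    by (rule effective[OF r s jm[rule_format] refl sym trans])
  then obtain Y f where f: "f \<in> hom X Y" "\<forall>T x y. x \<in> hom T X --> y \<in> hom T X -->
        (f ** x = f ** y \<longleftrightarrow> (\<exists>t\<in>hom T R. r ** t = x \<and> s ** t = y))" by (elim exE conjE)
  obtain Q q where q: "cover q X Q"
    "\<forall>T x y. x \<in> hom T X --> y \<in> hom T X --> (q ** x = q ** y \<longleftrightarrow> f ** x = f ** y)"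
    using coimages[OF f(1)] by (elim exE conjE)
  show ?thesis by (rule that[OF q(1)]) (use f(2) q(2) in simp)
qed

section \<open>Binary products\<close>

definition product :: "'o => 'o => 'o \<times> 'a \<times> 'a" where
  "product A B = (SOME t. pullback (z A Z) (z B Z) A B Z (fst t) (fst (snd t)) (snd (snd t)))"

definition pd :: "'o => 'o => 'o" where "pd A B = fst (product A B)"
definition p1 :: "'o => 'o => 'a" where "p1 A B = fst (snd (product A B))"
definition p2 :: "'o => 'o => 'a" where "p2 A B = snd (snd (product A B))"

text \<open>The common domain of \<open>f\<close> and \<open>g\<close> is not an argument, hence the
  quantifier over \<open>T\<close>. An arrow has only one typing, so the description still picks out
  a single arrow.\<close>

definition pair :: "'o => 'o => 'a => 'a => 'a" where
  "pair A B f g = (THE h. \<exists>T. h \<in> hom T (pd A B) \<and> p1 A B ** h = f \<and> p2 A B ** h = g)"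

lemma product_pullback:
  assumes "A \<in> ob" "B \<in> ob"
  shows "pullback (z A Z) (z B Z) A B Z (pd A B) (p1 A B) (p2 A B)"
proof -
  have "\<exists>t. pullback (z A Z) (z B Z) A B Z (fst t) (fst (snd t)) (snd (snd t))"
    using pullbacks[OF z_in[OF assms(1) Z_ob] z_in[OF assms(2) Z_ob]] by auto
  from someI_ex[OF this] show ?thesis unfolding pd_def p1_def p2_def product_def .
qed

lemma p_in [intro]:
  assumes "A \<in> ob" "B \<in> ob"
  shows "p1 A B \<in> hom (pd A B) A" "p2 A B \<in> hom (pd A B) B" "pd A B \<in> ob"
  using pullback_in[OF product_pullback[OF assms]] by auto

lemma pd_eqI:
  assumes "x \<in> hom T (pd A B)" "y \<in> hom T (pd A B)" "A \<in> ob" "B \<in> ob"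
    "p1 A B ** x = p1 A B ** y" "p2 A B ** x = p2 A B ** y"
  shows "x = y"
  using pullback_eqI[OF product_pullback] assms by blast

lemma pair:
  assumes f: "f \<in> hom T A" and g: "g \<in> hom T B"
  shows "pair A B f g \<in> hom T (pd A B)" "p1 A B ** pair A B f g = f" "p2 A B ** pair A B f g = g"
proof -
  have AB: "A \<in> ob" "B \<in> ob" using hom_ob f g by auto
  have "z A Z ** f = z B Z ** g" using z_l'[OF f Z_ob] z_l'[OF g Z_ob] by simp
  then obtain h where h: "h \<in> hom T (pd A B)" "p1 A B ** h = f" "p2 A B ** h = g"
    using pullbackE[OF product_pullback[OF AB] f g] by metis
  have "pair A B f g = h" unfolding pair_def
  proof (rule the_equality)
    fix h' assume "\<exists>T'. h' \<in> hom T' (pd A B) \<and> p1 A B ** h' = f \<and> p2 A B ** h' = g"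
    then obtain T' where h': "h' \<in> hom T' (pd A B)" "p1 A B ** h' = f" "p2 A B ** h' = g" by blast
    have "f \<in> hom T' A" using h' p_in[OF AB] by blast
    then have "T' = T" using hom_unique f by blast
    then show "h' = h" using pd_eqI h h' AB by metis
  qed (use h in blast)
  then show "pair A B f g \<in> hom T (pd A B)" "p1 A B ** pair A B f g = f" "p2 A B ** pair A B f g = g" using h by auto
qed

lemma pair_eqI:
  assumes "h \<in> hom T (pd A B)" "A \<in> ob" "B \<in> ob" "p1 A B ** h = f" "p2 A B ** h = g"
  shows "h = pair A B f g"
proof -
  have "f \<in> hom T A" "g \<in> hom T B" using assms by blast+
  then show ?thesis using pd_eqI[OF assms(1) pair(1)] pair assms by metis
qed

lemma pair_comp:
  assumes "f \<in> hom T A" "g \<in> hom T B" "h \<in> hom S T"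
  shows "pair A B f g ** h = pair A B (f ** h) (g ** h)"
proof (rule pair_eqI)
  note pr = pair[OF assms(1,2)]
  show "pair A B f g ** h \<in> hom S (pd A B)" using pr assms by blast
  show "p1 A B ** pair A B f g ** h = f ** h" "p2 A B ** pair A B f g ** h = g ** h"
    using reassoc[OF pr(2)] reassoc[OF pr(3)] by auto
qed (use assms hom_ob in blast)+

text \<open>The first projection is split by (1, 0) and has kernel (0, 1), so an arrow out of the
  product is determined by its restrictions to the two axes. Commutativity, associativity and
  additivity are all checked in this way below.\<close>

lemma product_jointly_epic:
  assumes u: "u \<in> hom (pd X Y) T" and v: "v \<in> hom (pd X Y) T" and XY: "X \<in> ob" "Y \<in> ob"
    and 1: "u ** pair X Y (idn X) (z X Y) = v ** pair X Y (idn X) (z X Y)"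
    and 2: "u ** pair X Y (z Y X) (idn Y) = v ** pair X Y (z Y X) (idn Y)"
  shows "u = v"
proof -
  have i: "idn X \<in> hom X X" "idn Y \<in> hom Y Y" "z X Y \<in> hom X Y" "z Y X \<in> hom Y X" using XY by auto
  note pr1 = pair[OF i(1,3)] and pr2 = pair[OF i(4,2)]
  show ?thesis
  proof (rule split_jointly_epic[OF p_in(1)[OF XY] pr1(1,2) u v 1])
    fix S x assume x: "x \<in> hom S (pd X Y)" "p1 X Y ** x = z S X"
    have S: "S \<in> ob" using hom_ob[OF x(1)] by blast
    have y: "p2 X Y ** x \<in> hom S Y" using x(1) p_in[OF XY] by blast
    have "x = pair X Y (z Y X) (idn Y) ** p2 X Y ** x" by (rule pd_eqI[OF x(1) _ XY])
        (use y pr2(1) x(2) in \<open>auto simp: reassoc[OF pr2(2)] reassoc[OF pr2(3)] z_l'[OF y XY(1)] id_l[OF y]\<close>)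
    then show "u ** x = v ** x" using 2 by (metis assoc)
  qed
qed

end

section \<open>Internal actions\<close>

text \<open>\<open>sm\<close>, \<open>i1\<close>, \<open>i2\<close> and \<open>cp\<close> stand for
  the sum, its injections and copairing; \<open>fo B X\<close> is B \<flat> X, \<open>ka B X\<close>
  its inclusion in B + X, and \<open>fl f g\<close> is f \<flat> g. They are parameters so that they
  can be instantiated by the fixed choices in terms of which internal actions are defined.\<close>

locale semi_abelian = exact_protomodular ob hom cmp idn Z z
  for ob :: "'o set" and hom :: "'o => 'o => 'a set" and cmp (infixr "**" 70) and idn Z z +
  fixes sm :: "'o => 'o => 'o" and i1 i2 :: "'o => 'o => 'a" and cp :: "'a => 'a => 'a"
    and fo :: "'o => 'o => 'o" and ka :: "'o => 'o => 'a" and fl :: "'a => 'a => 'a"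
  assumes i1_in [intro]: "A \<in> ob ==> B \<in> ob ==> i1 A B \<in> hom A (sm A B)"
    and i2_in [intro]: "A \<in> ob ==> B \<in> ob ==> i2 A B \<in> hom B (sm A B)"
    and cp_in [intro]: "f \<in> hom A T ==> g \<in> hom B T ==> cp f g \<in> hom (sm A B) T"
    and cp_i1: "f \<in> hom A T ==> g \<in> hom B T ==> cp f g ** i1 A B = f"
    and cp_i2: "f \<in> hom A T ==> g \<in> hom B T ==> cp f g ** i2 A B = g"
    and sm_eqI: "x \<in> hom (sm A B) T ==> y \<in> hom (sm A B) T ==> A \<in> ob ==> B \<in> ob ==>
      x ** i1 A B = y ** i1 A B ==> x ** i2 A B = y ** i2 A B ==> x = y"
    and ka: "B \<in> ob ==> X \<in> ob ==> kernel (cp (idn B) (z X B)) (sm B X) B (fo B X) (ka B X)"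
    and fl_in [intro]: "f \<in> hom B B' ==> g \<in> hom X X' ==> fl f g \<in> hom (fo B X) (fo B' X')"
    and ka_fl: "f \<in> hom B B' ==> g \<in> hom X X' ==>
      ka B' X' ** fl f g = cp (i1 B' X' ** f) (i2 B' X' ** g) ** ka B X"
begin

lemma sm_ob: "A \<in> ob ==> B \<in> ob ==> sm A B \<in> ob"
  using hom_ob by blast

lemma cp_comp:
  assumes "f \<in> hom A T" "g \<in> hom B T" "h \<in> hom T S"
  shows "h ** cp f g = cp (h ** f) (h ** g)"
proof -
  have AB: "A \<in> ob" "B \<in> ob" using assms hom_ob by auto
  have h: "h ** f \<in> hom A S" "h ** g \<in> hom B S" using assms by auto
  show ?thesis
    by (rule sm_eqI[of _ A B S])
      (use AB assms h in \<open>auto simp: cp_i1[OF assms(1,2)] cp_i2[OF assms(1,2)] cp_i1[OF h] cp_i2[OF h]\<close>)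
qed

lemma cp_in1_in2:
  assumes "A \<in> ob" "B \<in> ob"
  shows "cp (i1 A B) (i2 A B) = idn (sm A B)"
proof -
  note i = i1_in[OF assms] i2_in[OF assms]
  show ?thesis
    by (rule sm_eqI[of _ A B "sm A B"])
      (use assms i sm_ob in \<open>auto simp: cp_i1[OF i] cp_i2[OF i] id_l[OF i(1)] id_l[OF i(2)]\<close>)
qed

lemma cp_sum:
  assumes "u \<in> hom A' T" "v \<in> hom B' T" "f \<in> hom A A'" "g \<in> hom B B'"
  shows "cp u v ** cp (i1 A' B' ** f) (i2 A' B' ** g) = cp (u ** f) (v ** g)"
proof -
  have AB: "A' \<in> ob" "B' \<in> ob" using assms hom_ob by auto
  have "i1 A' B' ** f \<in> hom A (sm A' B')" "i2 A' B' ** g \<in> hom B (sm A' B')" using AB assms by auto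
  from cp_comp[OF this cp_in[OF assms(1,2)]] show ?thesis
    by (simp add: reassoc[OF cp_i1[OF assms(1,2)]] reassoc[OF cp_i2[OF assms(1,2)]])
qed

lemma ka_in [intro]: "B \<in> ob ==> X \<in> ob ==> ka B X \<in> hom (fo B X) (sm B X)"
  using kernel_in(2)[OF ka] .

lemma fo_ob [intro]: "B \<in> ob ==> X \<in> ob ==> fo B X \<in> ob"
  using hom_ob by blast

lemma ka_eqI:
  "ka B X ** x = ka B X ** y ==> x \<in> hom T (fo B X) ==> y \<in> hom T (fo B X) ==> B \<in> ob ==> X \<in> ob ==> x = y"
  by (rule monicD[OF kernel_in(3)[OF ka]])

lemma ka_zero: "B \<in> ob ==> X \<in> ob ==> cp (idn B) (z X B) ** ka B X = z (fo B X) B"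
  using kernel_in(4)[OF ka] .

text \<open>Identities between actions become identities between copairings restricted to B \<flat>
  X; this rule moves f \<flat> g into such a copairing.\<close>

lemma cp_ka_fl:
  assumes "u \<in> hom B' T" "v \<in> hom X' T" "f \<in> hom B B'" "g \<in> hom X X'"
  shows "cp u v ** ka B' X' ** fl f g = cp (u ** f) (v ** g) ** ka B X"
  using ka_fl[OF assms(3,4)] reassoc[OF cp_sum[OF assms]] by simp

lemma fl_comp:
  assumes "f \<in> hom B B'" "g \<in> hom X X'" "f' \<in> hom B' B''" "g' \<in> hom X' X''"
  shows "fl f' g' ** fl f g = fl (f' ** f) (g' ** g)"
proof -
  have BX: "B'' \<in> ob" "X'' \<in> ob" using assms hom_ob by auto
  have i: "i1 B'' X'' ** f' \<in> hom B' (sm B'' X'')" "i2 B'' X'' ** g' \<in> hom X' (sm B'' X'')" using BX assms by auto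
  have fg: "f' ** f \<in> hom B B''" "g' ** g \<in> hom X X''" using assms by auto
  have "ka B'' X'' ** fl f' g' ** fl f g = ka B'' X'' ** fl (f' ** f) (g' ** g)"
    using reassoc[OF ka_fl[OF assms(3,4)]] cp_ka_fl[OF i assms(1,2)] ka_fl[OF fg] by simp
  then show ?thesis by (rule ka_eqI) (use assms BX fg in blast)+
qed

lemma fl_id:
  assumes "B \<in> ob" "X \<in> ob"
  shows "fl (idn B) (idn X) = idn (fo B X)"
proof -
  note i = id_in[OF assms(1)] id_in[OF assms(2)]
  have "ka B X ** fl (idn B) (idn X) = ka B X"
    using ka_fl[OF i] id_r[OF i1_in[OF assms]] id_r[OF i2_in[OF assms]] cp_in1_in2[OF assms]
      id_l[OF ka_in[OF assms]] by simp
  then have "ka B X ** fl (idn B) (idn X) = ka B X ** idn (fo B X)" using id_r[OF ka_in[OF assms]] by simp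
  then show ?thesis by (rule ka_eqI) (use assms i in blast)+
qed

lemma fl_split:
  assumes "f \<in> hom B B'" "g \<in> hom X X'"
  shows "fl f (idn X') ** fl (idn B) g = fl f g" "fl (idn B') g ** fl f (idn X) = fl f g"
proof -
  have i: "idn B \<in> hom B B" "idn B' \<in> hom B' B'" "idn X \<in> hom X X" "idn X' \<in> hom X' X'"
    using assms hom_ob by blast+
  show "fl f (idn X') ** fl (idn B) g = fl f g" "fl (idn B') g ** fl f (idn X) = fl f g"
    using fl_comp[OF i(1) assms(2) assms(1) i(4)] fl_comp[OF assms(1) i(3) i(2) assms(2)]
      id_l[OF assms(1)] id_l[OF assms(2)] id_r[OF assms(1)] id_r[OF assms(2)] by simp_all
qed

section \<open>The monad B \<flat> (-), its algebras and their morphisms\<close>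

definition eta :: "'o => 'o => 'a" where
  "eta B X = (SOME h. h \<in> hom X (fo B X) \<and> ka B X ** h = i2 B X)"

definition mu :: "'o => 'o => 'a" where
  "mu B X = (SOME h. h \<in> hom (fo B (fo B X)) (fo B X) \<and>
     ka B X ** h = cp (i1 B X) (ka B X) ** ka B (fo B X))"

lemma eta:
  assumes "B \<in> ob" "X \<in> ob"
  shows eta_in: "eta B X \<in> hom X (fo B X)" and ka_eta: "ka B X ** eta B X = i2 B X"
proof -
  have "cp (idn B) (z X B) ** i2 B X = z X B" using cp_i2 assms by blast
  then have "\<exists>h. h \<in> hom X (fo B X) \<and> ka B X ** h = i2 B X"
    using kernelE[OF ka[OF assms] i2_in[OF assms]] by metis
  from someI_ex[OF this] show "eta B X \<in> hom X (fo B X)" "ka B X ** eta B X = i2 B X" unfolding eta_def by auto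
qed

lemma mu:
  assumes "B \<in> ob" "X \<in> ob"
  shows mu_in: "mu B X \<in> hom (fo B (fo B X)) (fo B X)"
    and ka_mu: "ka B X ** mu B X = cp (i1 B X) (ka B X) ** ka B (fo B X)"
proof -
  note fo = fo_ob[OF assms]
  have i: "idn B \<in> hom B B" "z X B \<in> hom X B" using assms by auto
  have *: "cp (i1 B X) (ka B X) ** ka B (fo B X) \<in> hom (fo B (fo B X)) (sm B X)" using assms by blast
  have "cp (idn B) (z X B) ** cp (i1 B X) (ka B X) = cp (idn B) (z (fo B X) B)"
    using cp_comp[OF i1_in[OF assms] ka_in[OF assms] cp_in[OF i]] cp_i1[OF i] ka_zero[OF assms] by simp
  then have "cp (idn B) (z X B) ** cp (i1 B X) (ka B X) ** ka B (fo B X) = z (fo B (fo B X)) B"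
    using ka_zero[OF assms(1) fo] by (metis assoc)
  from kernelE[OF ka[OF assms] * this]
  have "\<exists>h. h \<in> hom (fo B (fo B X)) (fo B X) \<and> ka B X ** h = cp (i1 B X) (ka B X) ** ka B (fo B X)" by metis
  from someI_ex[OF this] show "mu B X \<in> hom (fo B (fo B X)) (fo B X)"
      "ka B X ** mu B X = cp (i1 B X) (ka B X) ** ka B (fo B X)" unfolding mu_def by auto
qed

lemma eta_natural:
  assumes "f \<in> hom B B'" "g \<in> hom X X'"
  shows "fl f g ** eta B X = eta B' X' ** g"
proof -
  have ob: "B \<in> ob" "B' \<in> ob" "X \<in> ob" "X' \<in> ob" using assms hom_ob by auto
  have i: "i1 B' X' ** f \<in> hom B (sm B' X')" "i2 B' X' ** g \<in> hom X (sm B' X')" using assms ob by auto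
  have "ka B' X' ** fl f g ** eta B X = ka B' X' ** eta B' X' ** g"
    using reassoc[OF ka_fl[OF assms]] ka_eta[OF ob(1,3)] reassoc[OF ka_eta[OF ob(2,4)]] cp_i2[OF i] by simp
  then show ?thesis by (rule ka_eqI) (use assms ob eta_in[OF ob(1,3)] eta_in[OF ob(2,4)] in blast)+
qed

lemma mu_natural:
  assumes "f \<in> hom B B'" "g \<in> hom X X'"
  shows "fl f g ** mu B X = mu B' X' ** fl f (fl f g)"
proof -
  have ob: "B \<in> ob" "B' \<in> ob" "X \<in> ob" "X' \<in> ob" using assms hom_ob by auto
  note fg = fl_in[OF assms]
  have i: "i1 B' X' ** f \<in> hom B (sm B' X')" "i2 B' X' ** g \<in> hom X (sm B' X')" using assms ob by auto
  have "ka B' X' ** mu B' X' ** fl f (fl f g) = cp (i1 B' X' ** f) (ka B' X' ** fl f g) ** ka B (fo B X)"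
    using reassoc[OF ka_mu[OF ob(2,4)]] cp_ka_fl[OF i1_in[OF ob(2,4)] ka_in[OF ob(2,4)] assms(1) fg] by simp
  also have "\<dots> = cp (i1 B' X' ** f) (i2 B' X' ** g) ** cp (i1 B X) (ka B X) ** ka B (fo B X)"
    using reassoc[OF cp_comp[OF i1_in[OF ob(1,3)] ka_in[OF ob(1,3)] cp_in[OF i]]] cp_i1[OF i] ka_fl[OF assms] by simp
  also have "\<dots> = ka B' X' ** fl f g ** mu B X" using reassoc[OF ka_fl[OF assms]] ka_mu[OF ob(1,3)] by simp
  finally have "ka B' X' ** fl f g ** mu B X = ka B' X' ** mu B' X' ** fl f (fl f g)" by simp
  then show ?thesis by (rule ka_eqI) (use assms ob fg mu_in[OF ob(1,3)] mu_in[OF ob(2,4)] in blast)+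
qed

definition act :: "'o => 'o => 'a => bool" where
  "act B X \<xi> \<longleftrightarrow> B \<in> ob \<and> X \<in> ob \<and> \<xi> \<in> hom (fo B X) X \<and>
     \<xi> ** eta B X = idn X \<and> \<xi> ** mu B X = \<xi> ** fl (idn B) \<xi>"

definition am :: "'o => 'o => 'a => 'a => 'a => 'o => 'o => 'a => bool" where
  "am B X \<xi> f h B' X' \<xi>' \<longleftrightarrow> f \<in> hom B B' \<and> h \<in> hom X X' \<and> h ** \<xi> = \<xi>' ** fl f h"

lemma actD:
  assumes "act B X \<xi>"
  shows "B \<in> ob" "X \<in> ob" "\<xi> \<in> hom (fo B X) X" "\<xi> ** eta B X = idn X" "\<xi> ** mu B X = \<xi> ** fl (idn B) \<xi>"
  using assms by (auto simp: act_def)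

lemma am_id: "act B X \<xi> ==> am B X \<xi> (idn B) (idn X) B X \<xi>"
  using actD[of B X \<xi>] fl_id[of B X] id_l[of \<xi>] id_r[of \<xi>] by (auto simp: am_def)

lemma am_comp:
  assumes "am B X \<xi> f h B' X' \<xi>'" "am B' X' \<xi>' f' h' B'' X'' \<xi>''"
  shows "am B X \<xi> (f' ** f) (h' ** h) B'' X'' \<xi>''"
proof -
  have 1: "f \<in> hom B B'" "h \<in> hom X X'" "h ** \<xi> = \<xi>' ** fl f h"
    and 2: "f' \<in> hom B' B''" "h' \<in> hom X' X''" "h' ** \<xi>' = \<xi>'' ** fl f' h'"
    using assms by (auto simp: am_def)
  have "h' ** h ** \<xi> = \<xi>'' ** fl (f' ** f) (h' ** h)" using 1(3) reassoc[OF 2(3)] fl_comp[OF 1(1,2) 2(1,2)] by simp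
  then show ?thesis using 1 2 by (auto simp: am_def)
qed

lemma am_inverse:
  assumes "am B X \<xi> f h B' X' \<xi>'" "f' \<in> hom B' B" "h' \<in> hom X' X"
    "f ** f' = idn B'" "h ** h' = idn X'" "h' ** h = idn X" "\<xi> \<in> hom (fo B X) X" "\<xi>' \<in> hom (fo B' X') X'"
  shows "am B' X' \<xi>' f' h' B X \<xi>"
proof -
  have 1: "f \<in> hom B B'" "h \<in> hom X X'" "h ** \<xi> = \<xi>' ** fl f h" using assms by (auto simp: am_def)
  have ob: "B' \<in> ob" "X' \<in> ob" using hom_ob 1 by auto
  have "h' ** \<xi>' = h' ** \<xi>' ** fl f h ** fl f' h'"
    using fl_comp[OF assms(2,3) 1(1,2)] assms(4,5) fl_id[OF ob] id_r[OF assms(8)] by simp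
  also have "\<dots> = \<xi> ** fl f' h'"
    using reassoc[OF 1(3)[symmetric]] reassoc[OF assms(6)] reassoc[OF id_l[OF assms(7)]] by simp
  finally show ?thesis using assms by (auto simp: am_def)
qed

text \<open>Both sides are compared after the monomorphism \<open>m\<close>. The later applications
  have \<open>m\<close> invertible and factor action morphisms through reindexings.\<close>

lemma am_cancel:
  assumes m: "monic m X X'" and f: "am B X \<xi> f m B' X' \<xi>'" and g: "am A W \<omega> (f ** u) (m ** h) B' X' \<xi>'"
    and u: "u \<in> hom A B" and h: "h \<in> hom W X" and \<omega>: "\<omega> \<in> hom (fo A W) W" and \<xi>: "\<xi> \<in> hom (fo B X) X"
  shows "am A W \<omega> u h B X \<xi>"
proof -
  have 1: "m ** \<xi> = \<xi>' ** fl f m" "m ** h ** \<omega> = \<xi>' ** fl (f ** u) (m ** h)" "f \<in> hom B B'" "m \<in> hom X X'"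
    using f g by (auto simp: am_def)
  have "m ** h ** \<omega> = m ** \<xi> ** fl u h" using 1(2) reassoc[OF 1(1)] fl_comp[OF u h 1(3,4)] by simp
  then have "h ** \<omega> = \<xi> ** fl u h" by (rule monicD[OF m]) (use u h \<omega> \<xi> in blast)+
  then show ?thesis using u h by (simp add: am_def)
qed

lemma act_restrict:
  assumes "act B X \<xi>" "f \<in> hom B' B"
  shows "act B' X (\<xi> ** fl f (idn X))" "am B' X (\<xi> ** fl f (idn X)) f (idn X) B X \<xi>"
proof -
  note a = actD[OF assms(1)]
  note f = assms(2)
  have i: "idn X \<in> hom X X" "idn B \<in> hom B B" "idn B' \<in> hom B' B'" and B': "B' \<in> ob" using a f hom_ob by auto
  note e = eta_in[OF a(1,2)] eta_in[OF B' a(2)]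
  let ?\<xi> = "\<xi> ** fl f (idn X)"
  have \<xi>: "?\<xi> \<in> hom (fo B' X) X" using a f by blast
  have "?\<xi> ** eta B' X = idn X" using eta_natural[OF f i(1)] a(4) id_r[OF e(1)] by simp
  moreover have "?\<xi> ** mu B' X = ?\<xi> ** fl (idn B') ?\<xi>"
  proof -
    have f1: "fl f (idn X) \<in> hom (fo B' X) (fo B X)" using f i by blast
    have "?\<xi> ** mu B' X = \<xi> ** fl (idn B) \<xi> ** fl f (fl f (idn X))"
      using mu_natural[OF f i(1)] reassoc[OF a(5)] by simp
    also have "\<dots> = \<xi> ** fl f ?\<xi>" using fl_comp[OF f f1 i(2) a(3)] id_l[OF f] by simp
    also have "\<dots> = ?\<xi> ** fl (idn B') ?\<xi>" using fl_split(1)[OF f \<xi>] by simp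
    finally show ?thesis .
  qed
  ultimately show "act B' X ?\<xi>" using \<xi> B' a by (auto simp: act_def)
  show "am B' X ?\<xi> f (idn X) B X \<xi>" using f i id_l[OF \<xi>] by (auto simp: am_def)
qed

section \<open>Actions and split extensions\<close>

text \<open>The copairing \<open>cp s k\<close> is compatible with the projections to
  \<open>B\<close>, so it sends B \<flat> X into the kernel \<open>X\<close> of \<open>p\<close>;
  the result is conjugation by the section. The algebra laws are checked after the monomorphism
  \<open>k\<close>.\<close>

lemma act_of_split_ext:
  assumes e: "split_ext X k A p s B"
  obtains \<xi> where "act B X \<xi>" "k ** \<xi> = cp s k ** ka B X"
proof -
  note E = split_ext_in[OF e]
  note ob = E(10,8)
  have "p ** cp s k = cp (idn B) (z X B)" using cp_comp[OF E(2,5,1)] E(3,7) by simp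
  then have "p ** cp s k ** ka B X = z (fo B X) B" using ka_zero[OF ob] by (metis assoc)
  then obtain \<xi> where \<xi>: "\<xi> \<in> hom (fo B X) X" "k ** \<xi> = cp s k ** ka B X"
    using kernelE[OF E(4), of "cp s k ** ka B X" "fo B X"] ka_in[OF ob] cp_in[OF E(2,5)] by blast
  have i: "idn B \<in> hom B B" using ob by blast
  have "k ** \<xi> ** eta B X = k ** idn X" using reassoc[OF \<xi>(2)] ka_eta[OF ob] cp_i2[OF E(2,5)] id_r[OF E(5)] by simp
  then have 1: "\<xi> ** eta B X = idn X" by (rule monicD[OF E(6)]) (use \<xi> eta_in[OF ob] ob in blast)+
  have "k ** \<xi> ** mu B X = cp s (k ** \<xi>) ** ka B (fo B X)"
    using reassoc[OF \<xi>(2)] ka_mu[OF ob] cp_i1[OF E(2,5)] \<xi>(2)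
      reassoc[OF cp_comp[OF i1_in[OF ob] ka_in[OF ob] cp_in[OF E(2,5)]]] by simp
  also have "\<dots> = k ** \<xi> ** fl (idn B) \<xi>"
    using reassoc[OF \<xi>(2)] cp_ka_fl[OF E(2,5) i \<xi>(1)] id_r[OF E(2)] by simp
  finally have 2: "\<xi> ** mu B X = \<xi> ** fl (idn B) \<xi>"
    by (rule monicD[OF E(6)]) (use \<xi> mu_in[OF ob] i in blast)+
  show ?thesis using that \<xi> 1 2 ob by (auto simp: act_def)
qed

lemma am_of_split_ext_map:
  assumes e: "split_ext X k A p s B" and e': "split_ext X' k' A' p' s' B'"
    and \<xi>: "\<xi> \<in> hom (fo B X) X" "k ** \<xi> = cp s k ** ka B X"
    and \<xi>': "\<xi>' \<in> hom (fo B' X') X'" "k' ** \<xi>' = cp s' k' ** ka B' X'"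
    and \<phi>: "\<phi> \<in> hom A A'" and f: "f \<in> hom B B'" and h: "h \<in> hom X X'"
    and \<phi>k: "\<phi> ** k = k' ** h" and \<phi>s: "\<phi> ** s = s' ** f"
  shows "am B X \<xi> f h B' X' \<xi>'"
proof -
  note E = split_ext_in[OF e] and E' = split_ext_in[OF e']
  have "k' ** h ** \<xi> = cp (s' ** f) (k' ** h) ** ka B X"
    using reassoc[OF \<phi>k, of \<xi>] \<xi>(2) reassoc[OF cp_comp[OF E(2,5) \<phi>]] \<phi>k \<phi>s by simp
  also have "\<dots> = k' ** \<xi>' ** fl f h" using reassoc[OF \<xi>'(2)] cp_ka_fl[OF E'(2,5) f h] by simp
  finally have "h ** \<xi> = \<xi>' ** fl f h" by (rule monicD[OF E'(6)]) (use h f \<xi> \<xi>' in blast)+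
  then show ?thesis using f h by (simp add: am_def)
qed

text \<open>The semidirect product is the quotient of \<open>B + X\<close> by the image of the reflexive pair
  \<open>[in\<^sub>1, \<kappa>], 1 + \<xi> : B + (B \<flat> X) \<rightarrow> B + X\<close>; that its kernel is \<open>X\<close> holds because \<open>\<xi>\<close> is
  the split coequalizer of the multiplication and \<open>1 \<flat> \<xi>\<close>.\<close>

lemma semidirect_product:
  assumes "act B X \<xi>"
  obtains A p s k where "split_ext X k A p s B" "k ** \<xi> = cp s k ** ka B X"
    "\<forall>T u v. u \<in> hom B T --> v \<in> hom X T --> cp u v ** ka B X = v ** \<xi> -->
       (\<exists>w\<in>hom A T. w ** s = u \<and> w ** k = v)"
proof -
  note a = actD[OF assms]
  note ob = a(1,2)
  let ?Y = "fo B X" and ?S = "sm B X" and ?S2 = "sm B (fo B X)"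
  note Y = fo_ob[OF ob]
  note ii = i1_in[OF ob] i2_in[OF ob] and ii2 = i1_in[OF ob(1) Y] i2_in[OF ob(1) Y]
  note kk = ka_in[OF ob]
  have S: "?S \<in> ob" "?S2 \<in> ob" using sm_ob ob by auto
  have iB: "idn B \<in> hom B B" using ob by blast
  \<comment> \<open>\<open>d\<close> and \<open>c\<close> are the two arrows of the reflexive pair
    and \<open>e0\<close> is 1 + \<eta>, their common section.\<close>
  define d where "d = cp (i1 B X) (ka B X)"
  define c where "c = cp (i1 B X) (i2 B X ** \<xi>)"
  define e0 where "e0 = cp (i1 B ?Y) (i2 B ?Y ** eta B X)"
  have i2\<xi>: "i2 B X ** \<xi> \<in> hom ?Y ?S" using a by blast
  have i2\<eta>: "i2 B ?Y ** eta B X \<in> hom X ?S2" using ii2 eta_in[OF ob] by blast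
  have d: "d \<in> hom ?S2 ?S" and c: "c \<in> hom ?S2 ?S" unfolding d_def c_def using ii kk i2\<xi> by blast+
  have e0: "e0 \<in> hom ?S ?S2" unfolding e0_def using ii2 i2\<eta> by blast
  have d1: "d ** i1 B ?Y = i1 B X" "d ** i2 B ?Y = ka B X" "c ** i1 B ?Y = i1 B X" "c ** i2 B ?Y = i2 B X ** \<xi>"
    unfolding d_def c_def using cp_i1[OF ii(1) kk] cp_i2[OF ii(1) kk] cp_i1[OF ii(1) i2\<xi>] cp_i2[OF ii(1) i2\<xi>] by auto
  have de0: "d ** e0 = idn ?S"
    using cp_comp[OF ii2(1) i2\<eta> d] d1(1) reassoc[OF d1(2)] ka_eta[OF ob] cp_in1_in2[OF ob] by (simp add: e0_def)
  have ce0: "c ** e0 = idn ?S"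
    using cp_comp[OF ii2(1) i2\<eta> c] d1(3) reassoc[OF d1(4)] a(4) id_r[OF ii(2)] cp_in1_in2[OF ob] by (simp add: e0_def)
  \<comment> \<open>The relation \<open>R\<close> on B + X is the image of (d, c). It is reflexive
    because of \<open>e0\<close>, hence effective, and since \<open>e\<close> is epimorphic an arrow
    factors through the quotient \<open>Q\<close> as soon as it identifies \<open>d\<close> and
    \<open>c\<close>.\<close>
  note dc = pair[OF d c]
  obtain R e m where e: "cover e ?S2 R" and m: "monic m R (pd ?S ?S)" and me: "m ** e = pair ?S ?S d c"
    using image[OF dc(1)] .
  note eh = cover_in[OF e] and mh = monic_in[OF m]
  define r where "r = p1 ?S ?S ** m"
  define s where "s = p2 ?S ?S ** m"
  have rs: "r \<in> hom R ?S" "s \<in> hom R ?S" unfolding r_def s_def using mh p_in[OF S(1) S(1)] by blast+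
  have re: "r ** e = d" "s ** e = c" unfolding r_def s_def using me dc(2,3) by auto
  have jm: "\<forall>T x y. x \<in> hom T R --> y \<in> hom T R --> r ** x = r ** y --> s ** x = s ** y --> x = y"
  proof (intro allI impI)
    fix T x y assume *: "x \<in> hom T R" "y \<in> hom T R" "r ** x = r ** y" "s ** x = s ** y"
    have "m ** x = m ** y" by (rule pd_eqI[of _ T]) (use * mh S in \<open>auto simp: r_def s_def\<close>)
    then show "x = y" by (rule monicD[OF m]) (use * in auto)
  qed
  have \<delta>: "e ** e0 \<in> hom ?S R" "r ** e ** e0 = idn ?S" "s ** e ** e0 = idn ?S"
    using eh e0 reassoc[OF re(1)] reassoc[OF re(2)] de0 ce0 by auto
  obtain Q q where q: "cover q ?S Q" and qq: "\<forall>T x y. x \<in> hom T ?S --> y \<in> hom T ?S -->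
      (q ** x = q ** y \<longleftrightarrow> (\<exists>t\<in>hom T R. r ** t = x \<and> s ** t = y))"
    using reflexive_effective[OF rs jm \<delta>] .
  note qh = cover_in[OF q]
  have qdc: "q ** d = q ** c" using qq d c eh re by blast
  have factor: "\<exists>w\<in>hom Q T. w ** q = t" if t: "t \<in> hom ?S T" "t ** d = t ** c" for T t
  proof -
    have "(t ** r) ** e = (t ** s) ** e" using t re by simp
    then have tr: "t ** r = t ** s" by (rule coverD[OF e]) (use t rs in blast)+
    have "t ** x = t ** y" if xy: "x \<in> hom U ?S" "y \<in> hom U ?S" "q ** x = q ** y" for U x y
    proof -
      obtain u where "r ** u = x" "s ** u = y" using qq xy by blast
      then show ?thesis using tr by (metis assoc)
    qed
    then obtain w where "w \<in> hom Q T" "w ** q = t" by (rule cover_factor[OF q t(1)])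
    then show ?thesis by blast
  qed
  define \<pi> where "\<pi> = cp (idn B) (z X B)"
  have zX: "z X B \<in> hom X B" "z ?Y B \<in> hom ?Y B" using ob by auto
  have \<pi>: "\<pi> \<in> hom ?S B" "\<pi> ** i1 B X = idn B" "\<pi> ** i2 B X = z X B" "\<pi> ** ka B X = z ?Y B"
    unfolding \<pi>_def using cp_in[OF iB zX(1)] cp_i1[OF iB zX(1)] cp_i2[OF iB zX(1)] ka_zero[OF ob] by auto
  have \<pi>d: "\<pi> ** d = cp (idn B) (z ?Y B)" "\<pi> ** c = cp (idn B) (z ?Y B)"
    using cp_comp[OF ii(1) kk \<pi>(1)] cp_comp[OF ii(1) i2\<xi> \<pi>(1)] \<pi> reassoc[OF \<pi>(3)] z_l'[OF a(3) ob(1)]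
    by (auto simp: d_def c_def)
  obtain p where p: "p \<in> hom Q B" "p ** q = \<pi>" using factor[OF \<pi>(1)] \<pi>d by auto
  \<comment> \<open>The kernel \<open>L\<close> of \<open>p\<close> is covered by B \<flat> X
    through \<open>q0\<close>. It gets identified with \<open>X\<close> by showing that \<xi>
    factors through \<open>q0\<close>.\<close>
  obtain L l where l: "kernel p Q B L l" using kernels[OF p(1)] by blast
  note lin = kernel_in[OF l]
  have qk: "q ** ka B X \<in> hom ?Y Q" "p ** q ** ka B X = z ?Y B" using qh kk reassoc[OF p(2)] \<pi>(4) by auto
  obtain q0 where q0: "q0 \<in> hom ?Y L" "l ** q0 = q ** ka B X" by (rule kernelE[OF l qk])
  have kap: "kernel (p ** q) ?S B ?Y (ka B X)" using ka[OF ob] p(2) \<pi>_def by simp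
  have cq0: "cover q0 ?Y L" by (rule cover_of_kernels[OF q kap l q0])
  \<comment> \<open>Elements x, y of B \<flat> X with the same class are, locally, the two images of
    an element of B + (B \<flat> X). That element lies over 0 in \<open>B\<close>, so it comes from
    some \<open>u\<close> in B \<flat> (B \<flat> X) with \<mu> u = x and (1 \<flat> \<xi>) u = y,
    and the associativity law of the action gives \<xi> x = \<xi> y.\<close>
  have resp: "\<xi> ** x = \<xi> ** y" if x: "x \<in> hom T ?Y" and y: "y \<in> hom T ?Y" and xy: "q0 ** x = q0 ** y" for T x y
  proof -
    have kx: "ka B X ** x \<in> hom T ?S" "ka B X ** y \<in> hom T ?S" using x y kk by auto
    have "q ** ka B X ** x = q ** ka B X ** y" using xy q0(2) by (metis assoc)
    then obtain t where t: "t \<in> hom T R" "r ** t = ka B X ** x" "s ** t = ka B X ** y" using qq kx by blast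
    obtain T' t' t2 where t': "cover t' T' T" "t2 \<in> hom T' ?S2" "e ** t2 = t ** t'" by (rule cover_lift[OF e t(1)])
    note t'h = cover_in[OF t'(1)]
    have dt: "d ** t2 = ka B X ** x ** t'" "c ** t2 = ka B X ** y ** t'" using t(2,3) t'(3) re by (metis assoc)+
    have "cp (idn B) (z ?Y B) ** t2 = z T' B"
      using \<pi>d(1) dt(1) reassoc[OF \<pi>(4)] z_l'[OF comp_in[OF t'h x] ob(1)] by (metis assoc)
    then obtain u where u: "u \<in> hom T' (fo B ?Y)" "ka B ?Y ** u = t2" using kernelE[OF ka[OF ob(1) Y] t'(2)] by blast
    have "ka B X ** mu B X ** u = ka B X ** x ** t'" using reassoc[OF ka_mu[OF ob]] u(2) dt(1) by (simp add: d_def)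
    then have 1: "mu B X ** u = x ** t'" by (rule ka_eqI) (use u mu_in[OF ob] x t'h ob in blast)+
    have "ka B X ** fl (idn B) \<xi> = c ** ka B ?Y" using ka_fl[OF iB a(3)] id_r[OF ii(1)] by (simp add: c_def)
    from reassoc[OF this, of u] have "ka B X ** fl (idn B) \<xi> ** u = ka B X ** y ** t'" using u(2) dt(2) by simp
    then have 2: "fl (idn B) \<xi> ** u = y ** t'" by (rule ka_eqI) (use u iB a y t'h ob in blast)+
    have "(\<xi> ** x) ** t' = (\<xi> ** y) ** t'" using 1 2 a(5) by (metis assoc)
    then show ?thesis by (rule coverD[OF t'(1)]) (use x y a in blast)+
  qed
  obtain x0 where x0: "x0 \<in> hom L X" "x0 ** q0 = \<xi>" by (rule cover_factor[OF cq0 a(3) resp])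
  define k where "k = q ** i2 B X"
  have k: "k \<in> hom X Q" using qh ii k_def by auto
  have k\<xi>: "k ** \<xi> = q ** ka B X" using d1(2,4) qdc unfolding k_def by (metis assoc)
  have "(k ** x0) ** q0 = l ** q0" using x0 k\<xi> q0 by simp
  then have kx0: "k ** x0 = l" by (rule coverD[OF cq0]) (use k x0 lin in blast)+
  have lq0: "l ** q0 ** eta B X = k" using reassoc[OF q0(2)] ka_eta[OF ob] by (simp add: k_def)
  have kern: "kernel p Q B X k" unfolding kernel_def
  proof (intro conjI allI impI)
    show "monic k X Q" unfolding monic_def
    proof (intro conjI allI impI)
      fix T x y assume *: "x \<in> hom T X" "y \<in> hom T X" "k ** x = k ** y"
      have "l ** q0 ** eta B X ** x = l ** q0 ** eta B X ** y" using *(3) lq0 by (metis assoc)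
      then have "q0 ** eta B X ** x = q0 ** eta B X ** y" by (rule monicD[OF lin(3)]) (use * q0 eta_in[OF ob] in blast)+
      then have "\<xi> ** eta B X ** x = \<xi> ** eta B X ** y" using x0(2) by (metis assoc)
      then show "x = y" using reassoc[OF a(4)] id_l[OF *(1)] id_l[OF *(2)] by simp
    qed (fact k)
    show "p ** k = z X B" using reassoc[OF p(2)] \<pi>(3) by (simp add: k_def)
    fix T t assume "t \<in> hom T Q" "p ** t = z T B"
    then obtain h where "h \<in> hom T L" "l ** h = t" using kernelE[OF l] by blast
    then show "\<exists>h\<in>hom T X. k ** h = t" using x0(1) reassoc[OF kx0] by (intro bexI[of _ "x0 ** h"]) auto
  qed (fact p)
  define s0 where "s0 = q ** i1 B X"
  have s0: "s0 \<in> hom B Q" "p ** s0 = idn B" using qh ii reassoc[OF p(2)] \<pi>(2) by (auto simp: s0_def)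
  have "split_ext X k Q p s0 B" using kern s0 p by (simp add: split_ext_def)
  moreover have "cp s0 k = q" using cp_comp[OF ii qh] cp_in1_in2[OF ob] id_r[OF qh] by (simp add: s0_def k_def)
  moreover have "\<exists>w\<in>hom Q T. w ** s0 = u \<and> w ** k = v"
    if uv: "u \<in> hom B T" "v \<in> hom X T" "cp u v ** ka B X = v ** \<xi>" for T u v
  proof -
    note cuv = cp_in[OF uv(1,2)]
    have "cp u v ** d = cp u v ** c" using cp_comp[OF ii(1) kk cuv] cp_comp[OF ii(1) i2\<xi> cuv] reassoc[OF cp_i2[OF uv(1,2)]] uv(3) by (simp add: d_def c_def)
    then obtain w where w: "w \<in> hom Q T" "w ** q = cp u v" using factor[OF cuv] by blast
    then have "w ** s0 = u" "w ** k = v" unfolding s0_def k_def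
      using reassoc[OF w(2)] cp_i1[OF uv(1,2)] cp_i2[OF uv(1,2)] by auto
    then show ?thesis using w by blast
  qed
  ultimately show ?thesis using that k\<xi> by auto
qed

lemma kernel_comp_isom:
  assumes k: "kernel f A B K k" and i: "isom i K' K"
  shows "kernel f A B K' (k ** i)"
proof -
  note kin = kernel_in[OF k] and ih = isom_in[OF i]
  obtain j where j: "j \<in> hom K K'" "i ** j = idn K" using i by (auto simp: isom_def)
  show ?thesis unfolding kernel_def
  proof (intro conjI allI impI)
    show "monic (k ** i) K' A" unfolding monic_def
    proof (intro conjI allI impI)
      fix T x y assume *: "x \<in> hom T K'" "y \<in> hom T K'" "(k ** i) ** x = (k ** i) ** y"
      then have "k ** i ** x = k ** i ** y" by simp
      then have "i ** x = i ** y" by (rule monicD[OF kin(3)]) (use * ih in blast)+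
      then show "x = y" by (rule monicD[OF isom_monic[OF i]]) (use * in blast)+
    qed (use kin ih in blast)
    show "f ** k ** i = z K' B" using reassoc[OF kin(4)] z_l'[OF ih] hom_ob[OF kin(1)] by simp
    fix T t assume "t \<in> hom T A" "f ** t = z T B"
    then obtain h where h: "h \<in> hom T K" "k ** h = t" using kernelE[OF k] by blast
    then have "(k ** i) ** j ** h = t" using reassoc[OF j(2)] id_l[OF h(1)] by simp
    then show "\<exists>h\<in>hom T K'. (k ** i) ** h = t" using j h by blast
  qed (fact kin)
qed

lemma cokernel_unique:
  assumes q: "cover q A Q" and kq: "kernel q A Q N a" and w: "cover w A L" and kw: "kernel w A L N a"
  obtains \<theta> where "isom \<theta> Q L" "\<theta> ** q = w"
proof -
  note qh = cover_in[OF q] and wh = cover_in[OF w]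
  have f: "\<exists>h. h \<in> hom B T \<and> h ** q' = t"
    if c: "cover q' A B" and k: "kernel q' A B N a" and k': "kernel t A T N a" for q' B t T
  proof -
    note k'in = kernel_in[OF k']
    have "t ** x = z S T" if x: "x \<in> hom S A" "q' ** x = z S B" for S x
    proof -
      obtain y where y: "y \<in> hom S N" "a ** y = x" by (rule kernelE[OF k x])
      then show ?thesis using reassoc[OF k'in(4)] z_l'[OF y(1)] hom_ob[OF k'in(1)] by auto
    qed
    then obtain h where "h \<in> hom B T" "h ** q' = t" by (rule cover_cokernel[OF c k'in(1)])
    then show ?thesis by blast
  qed
  obtain \<theta> where \<theta>: "\<theta> \<in> hom Q L" "\<theta> ** q = w" using f[OF q kq kw] by blast
  obtain \<theta>' where \<theta>': "\<theta>' \<in> hom L Q" "\<theta>' ** w = q" using f[OF w kw kq] by blast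
  have ob: "Q \<in> ob" "L \<in> ob" using hom_ob \<theta> by auto
  have "(\<theta>' ** \<theta>) ** q = idn Q ** q" "(\<theta> ** \<theta>') ** w = idn L ** w"
    using \<theta> \<theta>' id_l[OF qh] id_l[OF wh] by auto
  then have "\<theta>' ** \<theta> = idn Q" "\<theta> ** \<theta>' = idn L"
    using coverD[OF q, of "\<theta>' ** \<theta>" "idn Q" Q] coverD[OF w, of "\<theta> ** \<theta>'" "idn L" L] \<theta>(1) \<theta>'(1) ob by blast+
  then show ?thesis using that \<theta> \<theta>' by (auto simp: isom_def)
qed

text \<open>Here strong protomodularity enters: it makes \<open>N\<close> normal in the semidirect product of \<open>Y\<close>
  and \<open>B\<close>, whose quotient by \<open>N\<close> is a split extension with kernel \<open>Q\<close>.\<close>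

lemma quotient_action:
  assumes \<nu>: "act B N \<nu>" and \<xi>: "act B Y \<xi>" and a: "am B N \<nu> (idn B) a B Y \<xi>"
    and q: "cover q Y Q" and kq: "kernel q Y Q N a"
  obtains \<zeta> where "act B Q \<zeta>" "am B Y \<xi> (idn B) q B Q \<zeta>"
proof -
  note N = actD[OF \<nu>] and Y = actD[OF \<xi>] and qh = cover_in[OF q] and kqi = kernel_in[OF kq]
  have eq: "a ** \<nu> = \<xi> ** fl (idn B) a" and ah: "a \<in> hom N Y" using a by (auto simp: am_def)
  have iB: "idn B \<in> hom B B" using Y by blast
  obtain A p s k where A: "split_ext Y k A p s B" "k ** \<xi> = cp s k ** ka B Y" using semidirect_product[OF \<xi>] by metis
  obtain M p' s' k' where M: "split_ext N k' M p' s' B" "k' ** \<nu> = cp s' k' ** ka B N"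
    and univ: "\<forall>T u v. u \<in> hom B T --> v \<in> hom N T --> cp u v ** ka B N = v ** \<nu> -->
       (\<exists>w\<in>hom M T. w ** s' = u \<and> w ** k' = v)" by (rule semidirect_product[OF \<nu>])
  note Ai = split_ext_in[OF A(1)] and Mi = split_ext_in[OF M(1)]
  have ka': "k ** a \<in> hom N A" using Ai ah by blast
  \<comment> \<open>Equivariance of \<open>a\<close> is the condition under which the universal
    property of the semidirect product \<open>M\<close> yields a map \<phi> of split extensions over
    \<open>B\<close> that restricts to the normal monomorphism \<open>a\<close> on kernels.\<close>
  have "cp s (k ** a) ** ka B N = (k ** a) ** \<nu>"
    using eq reassoc[OF A(2)] cp_ka_fl[OF Ai(2,5) iB ah] id_r[OF Ai(2)] by simp
  then obtain \<phi> where \<phi>: "\<phi> \<in> hom M A" "\<phi> ** s' = s" "\<phi> ** k' = k ** a" using univ Ai(2) ka' by blast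
  have "p ** \<phi> = p'"
  proof (rule split_jointly_epic[OF Mi(1-3) _ Mi(1)])
    show "p ** \<phi> \<in> hom M B" using \<phi> Ai by blast
    show "(p ** \<phi>) ** s' = p' ** s'" using \<phi> Ai Mi by simp
    fix S x assume x: "x \<in> hom S M" "p' ** x = z S B"
    obtain y where y: "y \<in> hom S N" "k' ** y = x" by (rule kernelE[OF Mi(4) x])
    have "p ** \<phi> ** x = p ** k ** a ** y" using y(2) \<phi>(3) by (metis assoc)
    also have "\<dots> = z S B" using reassoc[OF Ai(7)] z_l'[OF comp_in[OF y(1) ah] Ai(10)] by simp
    finally show "(p ** \<phi>) ** x = p' ** x" using x by simp
  qed
  then have "normal (\<phi> ** k') N A"
    using strongly_protomodular[OF M(1) A(1) \<phi>(1) ah \<phi>(3) _ \<phi>(2)] kq by (auto simp: normal_def)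
  then have "normal (k ** a) N A" using \<phi>(3) by simp
  then obtain W w where w: "cover w A W" "kernel w A W N (k ** a)" using normal_cokernel by blast
  note wh = cover_in[OF w(1)] and wi = kernel_in[OF w(2)]
  have W: "W \<in> ob" using hom_ob[OF wh] by blast
  \<comment> \<open>As \<open>N\<close> vanishes in \<open>B\<close>, the projection
    \<open>p\<close> factors through the quotient \<open>W\<close> of the semidirect product by
    \<open>N\<close>. Then \<open>W\<close> is split over \<open>B\<close> again, and the kernel
    \<open>L\<close> of its projection is a quotient of \<open>Y\<close> by \<open>N\<close>, so it
    is isomorphic to \<open>Q\<close>; the action on \<open>Q\<close> is read off from this split
    extension.\<close>
  have "p ** x = z S B" if x: "x \<in> hom S A" "w ** x = z S W" for S x
  proof -
    obtain y where y: "y \<in> hom S N" "(k ** a) ** y = x" by (rule kernelE[OF w(2) x])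
    then have "p ** x = p ** k ** a ** y" by auto
    then show ?thesis using reassoc[OF Ai(7)] z_l'[OF comp_in[OF y(1) ah] Ai(10)] by simp
  qed
  then obtain pw where pw: "pw \<in> hom W B" "pw ** w = p" using cover_cokernel[OF w(1) Ai(1)] by blast
  obtain L l where l: "kernel pw W B L l" using kernels[OF pw(1)] by blast
  note li = kernel_in[OF l]
  have wk: "w ** k \<in> hom Y W" "pw ** w ** k = z Y B" using wh Ai reassoc[OF pw(2)] by auto
  obtain w0 where w0: "w0 \<in> hom Y L" "l ** w0 = w ** k" by (rule kernelE[OF l wk])
  have "kernel (pw ** w) A B Y k" using Ai(4) pw(2) by simp
  then have cw0: "cover w0 Y L" by (rule cover_of_kernels[OF w(1) _ l w0])
  have L: "L \<in> ob" using hom_ob w0 by blast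
  have kw0: "kernel w0 Y L N a" unfolding kernel_def
  proof (intro conjI allI impI)
    have "l ** w0 ** a = l ** z N L" using reassoc[OF w0(2)] wi(4) z_r'[OF li(2) N(2)] by simp
    then show "w0 ** a = z N L" by (rule monicD[OF li(3)]) (use w0 ah N L in blast)+
    fix T t assume t: "t \<in> hom T Y" "w0 ** t = z T L"
    have T: "T \<in> ob" using hom_ob[OF t(1)] by blast
    have "w ** k ** t = z T W" using t(2) w0(2) z_r'[OF li(2) T] by (metis assoc)
    then obtain y where y: "y \<in> hom T N" "(k ** a) ** y = k ** t" using kernelE[OF w(2) comp_in[OF t(1) Ai(5)]] by blast
    then have "k ** a ** y = k ** t" by simp
    then have "a ** y = t" by (rule monicD[OF Ai(6)]) (use y ah t in blast)+
    then show "\<exists>h\<in>hom T N. a ** h = t" using y by blast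
  qed (use w0 kqi in auto)
  obtain \<theta> where \<theta>: "isom \<theta> Q L" "\<theta> ** q = w0" by (rule cokernel_unique[OF q kq cw0 kw0])
  have kQ: "kernel pw W B Q (l ** \<theta>)" by (rule kernel_comp_isom[OF l \<theta>(1)])
  have ws: "w ** s \<in> hom B W" "pw ** w ** s = idn B" using wh Ai reassoc[OF pw(2)] by auto
  have E: "split_ext Q (l ** \<theta>) W pw (w ** s) B" using kQ ws pw by (simp add: split_ext_def)
  obtain \<zeta> where \<zeta>: "act B Q \<zeta>" "(l ** \<theta>) ** \<zeta> = cp (w ** s) (l ** \<theta>) ** ka B Q" by (rule act_of_split_ext[OF E])
  have "am B Y \<xi> (idn B) q B Q \<zeta>"
    by (rule am_of_split_ext_map[OF A(1) E Y(3) A(2) actD(3)[OF \<zeta>(1)] \<zeta>(2) wh iB qh])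
      (use \<theta>(2) w0(2) id_r[OF ws(1)] in auto)
  then show ?thesis using that \<zeta> by blast
qed

section \<open>Covers are preserved by sums and by f \<flat> g\<close>

text \<open>An arrow out of B + X is a pair of arrows, and compatibility with the kernel pair of f +
  g restricts to compatibility with the kernel pairs of \<open>f\<close> and of
  \<open>g\<close>.\<close>

lemma cover_sum:
  assumes f: "cover f B B'" and g: "cover g X X'"
  shows "cover (cp (i1 B' X' ** f) (i2 B' X' ** g)) (sm B X) (sm B' X')"
proof -
  note fh = cover_in[OF f] and gh = cover_in[OF g]
  have ob: "B \<in> ob" "X \<in> ob" "B' \<in> ob" "X' \<in> ob" using hom_ob fh gh by auto
  have i: "i1 B' X' ** f \<in> hom B (sm B' X')" "i2 B' X' ** g \<in> hom X (sm B' X')" using ob fh gh by auto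
  note ii = i1_in[OF ob(1,2)] i2_in[OF ob(1,2)] and ii' = i1_in[OF ob(3,4)] i2_in[OF ob(3,4)]
  note c1 = cp_i1[OF i] and c2 = cp_i2[OF i]
  show ?thesis unfolding cover_def
  proof (intro conjI allI impI)
    show "cp (i1 B' X' ** f) (i2 B' X' ** g) \<in> hom (sm B X) (sm B' X')" using i by blast
    fix T x y assume x: "x \<in> hom (sm B' X') T" and y: "y \<in> hom (sm B' X') T"
      and eq: "x ** cp (i1 B' X' ** f) (i2 B' X' ** g) = y ** cp (i1 B' X' ** f) (i2 B' X' ** g)"
    have "(x ** i1 B' X') ** f = (y ** i1 B' X') ** f" "(x ** i2 B' X') ** g = (y ** i2 B' X') ** g"
      using eq c1 c2 by (metis assoc)+
    then have "x ** i1 B' X' = y ** i1 B' X'" "x ** i2 B' X' = y ** i2 B' X'"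
      using coverD[OF f] coverD[OF g] x y ii' by blast+
    then show "x = y" using sm_eqI[OF x y ob(3,4)] by blast
  next
    fix T t assume t: "t \<in> hom (sm B X) T" and r: "\<forall>S x y. x \<in> hom S (sm B X) --> y \<in> hom S (sm B X) -->
      cp (i1 B' X' ** f) (i2 B' X' ** g) ** x = cp (i1 B' X' ** f) (i2 B' X' ** g) ** y --> t ** x = t ** y"
    have t1: "t ** i1 B X \<in> hom B T" and t2: "t ** i2 B X \<in> hom X T" using t ii by auto
    have "(t ** i1 B X) ** x = (t ** i1 B X) ** y" if xy: "x \<in> hom S B" "y \<in> hom S B" "f ** x = f ** y" for S x y
    proof -
      have "cp (i1 B' X' ** f) (i2 B' X' ** g) ** i1 B X ** x = cp (i1 B' X' ** f) (i2 B' X' ** g) ** i1 B X ** y"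
        using xy(3) reassoc[OF c1] by simp
      then have "t ** i1 B X ** x = t ** i1 B X ** y" using r comp_in[OF xy(1) ii(1)] comp_in[OF xy(2) ii(1)] by blast
      then show ?thesis by simp
    qed
    then obtain u where u: "u \<in> hom B' T" "u ** f = t ** i1 B X" using cover_factor[OF f t1] by blast
    have "(t ** i2 B X) ** x = (t ** i2 B X) ** y" if xy: "x \<in> hom S X" "y \<in> hom S X" "g ** x = g ** y" for S x y
    proof -
      have "cp (i1 B' X' ** f) (i2 B' X' ** g) ** i2 B X ** x = cp (i1 B' X' ** f) (i2 B' X' ** g) ** i2 B X ** y"
        using xy(3) reassoc[OF c2] by simp
      then have "t ** i2 B X ** x = t ** i2 B X ** y" using r comp_in[OF xy(1) ii(2)] comp_in[OF xy(2) ii(2)] by blast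
      then show ?thesis by simp
    qed
    then obtain v where v: "v \<in> hom X' T" "v ** g = t ** i2 B X" using cover_factor[OF g t2] by blast
    have "cp u v ** cp (i1 B' X' ** f) (i2 B' X' ** g) = cp (t ** i1 B X) (t ** i2 B X)"
      using cp_sum[OF u(1) v(1) fh gh] u(2) v(2) by simp
    also have "\<dots> = t" using cp_comp[OF ii t] cp_in1_in2[OF ob(1,2)] id_r[OF t] by simp
    finally show "\<exists>h\<in>hom (sm B' X') T. h ** cp (i1 B' X' ** f) (i2 B' X' ** g) = t" using u v by blast
  qed
qed

text \<open>B \<flat> X and B \<flat> X' are kernels of arrows to the same object \<open>B\<close>,
  so the cover 1 + g restricts to a cover between them.\<close>

lemma cover_fl_right:
  assumes g: "cover g X X'" and B: "B \<in> ob"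
  shows "cover (fl (idn B) g) (fo B X) (fo B X')"
proof -
  note gh = cover_in[OF g]
  have ob: "X \<in> ob" "X' \<in> ob" using hom_ob gh by auto
  have iB: "idn B \<in> hom B B" and zz: "z X' B \<in> hom X' B" using B ob by auto
  note c = cover_sum[OF isom_cover[OF isom_id[OF B]] g]
  have "cp (idn B) (z X' B) ** cp (i1 B X' ** idn B) (i2 B X' ** g) = cp (idn B) (z X B)"
    using cp_sum[OF iB zz iB gh] id_l[OF iB] z_l'[OF gh B] by simp
  then have k: "kernel (cp (idn B) (z X' B) ** cp (i1 B X' ** idn B) (i2 B X' ** g)) (sm B X) B (fo B X) (ka B X)"
    using ka[OF B ob(1)] by simp
  show ?thesis by (rule cover_of_kernels[OF c k ka[OF B ob(2)] fl_in[OF iB gh]]) (rule ka_fl[OF iB gh])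
qed

text \<open>Here the kernels lie over different bases. But B' \<flat> X is also the kernel of the
  projection to \<open>B\<close> of the pullback \<open>P\<close> of B' + X \<rightarrow> B' along
  \<open>q\<close>. The comparison \<open>c\<close> from B + X to \<open>P\<close> is shown to be a
  cover, and passing to kernels over \<open>B\<close> gives the claim.\<close>

lemma cover_fl_left:
  assumes q: "cover q B B'" and X: "X \<in> ob"
  shows "cover (fl q (idn X)) (fo B X) (fo B' X)"
proof -
  note qh = cover_in[OF q]
  have ob: "B \<in> ob" "B' \<in> ob" using hom_ob qh by auto
  have iX: "idn X \<in> hom X X" and iB: "idn B \<in> hom B B" and iB': "idn B' \<in> hom B' B'" using X ob by auto
  have zz: "z X B \<in> hom X B" "z X B' \<in> hom X B'" using X ob by auto
  define \<pi> where "\<pi> = cp (idn B) (z X B)"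
  define \<pi>' where "\<pi>' = cp (idn B') (z X B')"
  define qs where "qs = cp (i1 B' X ** q) (i2 B' X ** idn X)"
  have qs: "cover qs (sm B X) (sm B' X)" unfolding qs_def by (rule cover_sum[OF q isom_cover[OF isom_id[OF X]]])
  note qsh = cover_in[OF qs]
  have ii: "i1 B' X ** q \<in> hom B (sm B' X)" "i2 B' X ** idn X \<in> hom X (sm B' X)" using ob X qh by auto
  have qi1: "qs ** i1 B X = i1 B' X ** q" unfolding qs_def by (rule cp_i1[OF ii])
  have \<pi>: "\<pi> \<in> hom (sm B X) B" "\<pi> ** i1 B X = idn B" unfolding \<pi>_def using cp_in[OF iB zz(1)] cp_i1[OF iB zz(1)] by auto
  have \<pi>': "\<pi>' \<in> hom (sm B' X) B'" "\<pi>' ** i1 B' X = idn B'" unfolding \<pi>'_def using cp_in[OF iB' zz(2)] cp_i1[OF iB' zz(2)] by auto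
  have "\<pi>' ** qs = cp q (z X B')"
    unfolding \<pi>'_def qs_def using cp_sum[OF iB' zz(2) qh iX] id_l[OF qh] id_r[OF zz(2)] by simp
  moreover have "q ** \<pi> = cp q (z X B')"
    unfolding \<pi>_def using cp_comp[OF iB zz(1) qh] id_r[OF qh] z_r'[OF qh X] by simp
  ultimately have sq: "q ** \<pi> = \<pi>' ** qs" by simp
  obtain P a b where P: "pullback q \<pi>' B (sm B' X) B' P a b" using pullbacks[OF qh \<pi>'(1)] by blast
  note Pin = pullback_in[OF P]
  obtain c where c: "c \<in> hom (sm B X) P" "a ** c = \<pi>" "b ** c = qs" by (rule pullbackE[OF P \<pi>(1) qsh sq])
  obtain I e m where e: "cover e (sm B X) I" and m: "monic m I P" and me: "m ** e = c" using image[OF c(1)] .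
  note eh = cover_in[OF e] and mh = monic_in[OF m]
  \<comment> \<open>The image of \<open>c\<close> maps onto B' + X, so it is enough that it contains
    the kernel of \<open>b\<close>. An element of that kernel is a pair (y, 0) with q y = 0, and it
    is the image under \<open>c\<close> of y in the first summand.\<close>
  have "isom m I P"
  proof (rule subobject_isom[OF m Pin(4)])
    have "cover ((b ** m) ** e) (sm B X) (sm B' X)" using c(3) me qs by simp
    then show "cover (b ** m) I (sm B' X)" by (rule cover_cancel) (use eh mh Pin in blast)+
    fix T x assume x: "x \<in> hom T P" "b ** x = z T (sm B' X)"
    have T: "T \<in> ob" using hom_ob x by blast
    let ?y = "i1 B X ** a ** x"
    have y: "?y \<in> hom T (sm B X)" using x Pin i1_in[OF ob(1) X] by blast
    have "q ** a ** x = \<pi>' ** b ** x" using Pin(5) by (metis assoc)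
    also have "\<dots> = z T B'" using x(2) z_r'[OF \<pi>'(1) T] by simp
    finally have 1: "q ** a ** x = z T B'" .
    have "c ** ?y = x"
    proof (rule pullback_eqI[OF P])
      have ax: "a ** x \<in> hom T B" using x Pin by blast
      show "a ** c ** ?y = a ** x" using reassoc[OF c(2)] reassoc[OF \<pi>(2)] id_l[OF ax] by simp
      have "b ** c ** ?y = i1 B' X ** q ** a ** x" using reassoc[OF c(3)] reassoc[OF qi1] by simp
      then show "b ** c ** ?y = b ** x" using 1 x(2) z_r'[OF i1_in[OF ob(2) X] T] by simp
    qed (use x c y in blast)+
    then have "m ** e ** ?y = x" using reassoc[OF me] by simp
    then show "\<exists>y\<in>hom T I. m ** y = x" using y eh by blast
  qed
  from cover_comp_isom[OF e this] have cc: "cover c (sm B X) P" using me by simp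
  have k1: "kernel (a ** c) (sm B X) B (fo B X) (ka B X)" using ka[OF ob(1) X] c(2) \<pi>_def by simp
  note k2 = ka[OF ob(2) X, folded \<pi>'_def]
  note k2i = kernel_in[OF k2]
  have fo': "fo B' X \<in> ob" "z (fo B' X) B \<in> hom (fo B' X) B" using ob X by blast+
  have "q ** z (fo B' X) B = \<pi>' ** ka B' X" using z_r'[OF qh fo'(1)] k2i(4) by simp
  then obtain l where l: "l \<in> hom (fo B' X) P" "a ** l = z (fo B' X) B" "b ** l = ka B' X"
    using pullbackE[OF P fo'(2) k2i(2)] by blast
  have k3: "kernel a P B (fo B' X) l" unfolding kernel_def
  proof (intro conjI allI impI)
    show "monic l (fo B' X) P" using l k2i(3) unfolding monic_def by (metis assoc)
    fix T t assume t: "t \<in> hom T P" "a ** t = z T B"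
    have T: "T \<in> ob" using hom_ob t by blast
    have "\<pi>' ** b ** t = q ** a ** t" using Pin(5) by (metis assoc)
    then have "\<pi>' ** b ** t = z T B'" using t(2) z_r'[OF qh T] by simp
    then obtain h where h: "h \<in> hom T (fo B' X)" "ka B' X ** h = b ** t" using kernelE[OF k2 comp_in[OF t(1) Pin(4)]] by blast
    have "l ** h = t" by (rule pullback_eqI[OF P])
        (use reassoc[OF l(2)] reassoc[OF l(3)] h t l z_l'[OF h(1) ob(1)] in auto)
    then show "\<exists>h\<in>hom T (fo B' X). l ** h = t" using h by blast
  qed (use Pin l in auto)
  show ?thesis
  proof (rule cover_of_kernels[OF cc k1 k3 fl_in[OF qh iX]])
    show "l ** fl q (idn X) = c ** ka B X"
    proof (rule pullback_eqI[OF P])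
      have f: "fl q (idn X) \<in> hom (fo B X) (fo B' X)" using qh iX by blast
      show "a ** l ** fl q (idn X) = a ** c ** ka B X"
        using reassoc[OF l(2)] reassoc[OF c(2)] z_l'[OF f ob(1)] ka_zero[OF ob(1) X] by (simp add: \<pi>_def)
      show "b ** l ** fl q (idn X) = b ** c ** ka B X"
        using reassoc[OF l(3)] reassoc[OF c(3)] ka_fl[OF qh iX] by (simp add: qs_def)
      show "l ** fl q (idn X) \<in> hom (fo B X) P" "c ** ka B X \<in> hom (fo B X) P"
        using l f c ka_in[OF ob(1) X] by blast+
    qed
  qed
qed

lemma cover_fl:
  assumes f: "cover f B B'" and g: "cover g X X'"
  shows "cover (fl f g) (fo B X) (fo B' X')"
proof -
  note fh = cover_in[OF f] and gh = cover_in[OF g]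
  have ob: "B \<in> ob" "X' \<in> ob" using hom_ob fh gh by auto
  show ?thesis
    using cover_comp[OF cover_fl_right[OF g ob(1)] cover_fl_left[OF f ob(2)]] fl_split(1)[OF fh gh] by simp
qed

text \<open>The image of the copairing contains both the section and the kernel.\<close>

lemma cover_split_ext:
  assumes "split_ext X k A p s B"
  shows "cover (cp s k) (sm B X) A"
proof -
  note E = split_ext_in[OF assms]
  obtain I e m where e: "cover e (sm B X) I" and m: "monic m I A" and me: "m ** e = cp s k"
    using image[OF cp_in[OF E(2,5)]] .
  note eh = cover_in[OF e]
  note ii = i1_in[OF E(10,8)] i2_in[OF E(10,8)]
  have ei: "e ** i1 B X \<in> hom B I" using eh ii by blast
  have "isom m I A"
  proof (rule split_cover[OF m E(1) ei])
    show "p ** m ** e ** i1 B X = idn B" using reassoc[OF me] cp_i1[OF E(2,5)] E(3) by simp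
    fix T x assume x: "x \<in> hom T A" "p ** x = z T B"
    obtain y where y: "y \<in> hom T X" "k ** y = x" by (rule kernelE[OF E(4) x])
    have "m ** e ** i2 B X ** y = x" using reassoc[OF me] reassoc[OF cp_i2[OF E(2,5)]] y by simp
    then show "\<exists>y\<in>hom T I. m ** y = x" using eh ii y by blast
  qed
  from cover_comp_isom[OF e this] me show ?thesis by simp
qed

end

section \<open>Central morphisms\<close>

context exact_protomodular
begin

text \<open>\<open>cooperates X B j c\<close>: the morphism \<open>c : X \<times> B \<rightarrow> X\<close> witnesses that \<open>j : B \<rightarrow> X\<close> is central.
  On generalized elements it is an action of \<open>B\<close> on \<open>X\<close> by \<open>x + j b\<close>.\<close>

definition cooperates :: "'o => 'o => 'a => 'a => bool" where
  "cooperates X B j c \<longleftrightarrow> j \<in> hom B X \<and> c \<in> hom (pd X B) X \<and>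
     c ** pair X B (idn X) (z X B) = idn X \<and> c ** pair X B (z B X) (idn B) = j"

text \<open>Two unit laws and one inverse law suffice as a description: commutativity and
  associativity of \<open>m\<close> follow by comparison on the axes of products, as shown
  below.\<close>

definition abelian_group :: "'o => 'a => 'a => bool" where
  "abelian_group B m i \<longleftrightarrow> cooperates B B (idn B) m \<and> i \<in> hom B B \<and> m ** pair B B (idn B) i = z B B"

lemma cooperatesD:
  assumes "cooperates X B j c"
  shows "j \<in> hom B X" "c \<in> hom (pd X B) X" "X \<in> ob" "B \<in> ob"
    "x \<in> hom T X ==> c ** pair X B x (z T B) = x"
    "b \<in> hom T B ==> c ** pair X B (z T X) b = j ** b"
proof -
  note c = assms[unfolded cooperates_def]
  show "j \<in> hom B X" "c \<in> hom (pd X B) X" and ob: "X \<in> ob" "B \<in> ob" using c hom_ob by auto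
  have i: "idn X \<in> hom X X" "idn B \<in> hom B B" "z X B \<in> hom X B" "z B X \<in> hom B X" using ob by auto
  show "c ** pair X B x (z T B) = x" if x: "x \<in> hom T X"
  proof -
    have "pair X B (idn X) (z X B) ** x = pair X B x (z T B)"
      using pair_comp[OF i(1,3) x] id_l[OF x] z_l'[OF x ob(2)] by simp
    then show ?thesis using c id_l[OF x] by (metis assoc)
  qed
  show "c ** pair X B (z T X) b = j ** b" if b: "b \<in> hom T B"
  proof -
    have "pair X B (z B X) (idn B) ** b = pair X B (z T X) b"
      using pair_comp[OF i(4,2) b] id_l[OF b] z_l'[OF b ob(1)] by simp
    then show ?thesis using c by (metis assoc)
  qed
qed

lemma cooperates_comp:
  assumes "cooperates X B j c" "x \<in> hom T X" "b \<in> hom T B" "t \<in> hom S T"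
  shows "(c ** pair X B x b) ** t = c ** pair X B (x ** t) (b ** t)"
  using pair_comp[OF assms(2-4)] by simp

lemma cooperates_in:
  "cooperates X B j c ==> x \<in> hom T X ==> b \<in> hom T B ==> c ** pair X B x b \<in> hom T X"
  using pair(1) cooperatesD(2) comp_in by metis

lemma pair_id: "X \<in> ob ==> Y \<in> ob ==> pair X Y (p1 X Y) (p2 X Y) = idn (pd X Y)"
  by (rule pair_eqI[symmetric, of _ "pd X Y"]) (auto intro: id_r p_in)

text \<open>Both sides are arrows out of B \<times> B that agree on the two axes. In additive
  notation this is j b + b' = j (b + b').\<close>

lemma cooperates_abelian:
  assumes c: "cooperates X B j c" and m: "cooperates B B (idn B) m"
    and b: "b \<in> hom T B" and b': "b' \<in> hom T B"
  shows "c ** pair X B (j ** b) b' = j ** m ** pair B B b b'"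
proof -
  note C = cooperatesD[OF c] and M = cooperatesD[OF m]
  note pp = p_in[OF C(4) C(4)]
  have i: "idn B \<in> hom B B" "z B B \<in> hom B B" using C by auto
  note pr1 = pair[OF i] and pr2 = pair[OF i(2,1)]
  have jp: "j ** p1 B B \<in> hom (pd B B) X" using C by blast
  have "c ** pair X B (j ** p1 B B) (p2 B B) = j ** m"
  proof (rule product_jointly_epic[OF _ _ C(4) C(4)])
    show "c ** pair X B (j ** p1 B B) (p2 B B) \<in> hom (pd B B) X" by (rule cooperates_in[OF c jp pp(2)])
    show "j ** m \<in> hom (pd B B) X" using C M by blast
    show "(c ** pair X B (j ** p1 B B) (p2 B B)) ** pair B B (idn B) (z B B) = (j ** m) ** pair B B (idn B) (z B B)"
      using cooperates_comp[OF c jp pp(2) pr1(1)] pr1 C(5)[OF C(1)] M(5)[OF i(1)] id_r[OF C(1)] by simp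
    show "(c ** pair X B (j ** p1 B B) (p2 B B)) ** pair B B (z B B) (idn B) = (j ** m) ** pair B B (z B B) (idn B)"
      using cooperates_comp[OF c jp pp(2) pr2(1)] pr2 z_r'[OF C(1) C(4)] C(6)[OF i(1)] M(6)[OF i(1)] id_l[OF i(1)] by simp
  qed
  from arg_cong[OF this, of "\<lambda>u. u ** pair B B b b'"]
  show ?thesis using cooperates_comp[OF c jp pp(2) pair(1)[OF b b']] pair[OF b b'] by simp
qed

text \<open>Both sides are compared on the axes of X \<times> (B \<times> B): on \<open>X\<close>
  they are the identity, and on B \<times> B the claim is \<open>cooperates_abelian\<close>.\<close>

lemma cooperates_assoc:
  assumes c: "cooperates X B j c" and m: "cooperates B B (idn B) m"
    and x: "x \<in> hom T X" and b: "b \<in> hom T B" and b': "b' \<in> hom T B"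
  shows "c ** pair X B (c ** pair X B x b) b' = c ** pair X B x (m ** pair B B b b')"
proof -
  note C = cooperatesD[OF c] and M = cooperatesD[OF m]
  note pp = p_in[OF C(4) C(4)]
  let ?D = "pd B B"
  note qq = p_in[OF C(3) pp(3)]
  have xb: "p1 X ?D \<in> hom (pd X ?D) X" "p1 B B ** p2 X ?D \<in> hom (pd X ?D) B" "p2 B B ** p2 X ?D \<in> hom (pd X ?D) B"
    "m ** p2 X ?D \<in> hom (pd X ?D) B" using qq M by blast+
  note c1 = cooperates_in[OF c xb(1,2)]
  have i: "idn X \<in> hom X X" "z X ?D \<in> hom X ?D" "idn ?D \<in> hom ?D ?D" "z ?D X \<in> hom ?D X" using C by auto
  note pr1 = pair[OF i(1,2)] and pr2 = pair[OF i(4,3)]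
  define u where "u = c ** pair X B (c ** pair X B (p1 X ?D) (p1 B B ** p2 X ?D)) (p2 B B ** p2 X ?D)"
  define v where "v = c ** pair X B (p1 X ?D) (m ** p2 X ?D)"
  have uc: "u ** t = c ** pair X B (c ** pair X B (p1 X ?D ** t) (p1 B B ** p2 X ?D ** t)) (p2 B B ** p2 X ?D ** t)"
    and vc: "v ** t = c ** pair X B (p1 X ?D ** t) (m ** p2 X ?D ** t)" if "t \<in> hom S (pd X ?D)" for t S
    using cooperates_comp[OF c c1 xb(3) that] cooperates_comp[OF c xb(1,2) that]
      cooperates_comp[OF c xb(1,4) that] unfolding u_def v_def by auto
  have "u = v"
  proof (rule product_jointly_epic[OF _ _ C(3) pp(3)])
    show "u \<in> hom (pd X ?D) X" "v \<in> hom (pd X ?D) X"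
      unfolding u_def v_def using cooperates_in[OF c c1 xb(3)] cooperates_in[OF c xb(1,4)] by auto
    show "u ** pair X ?D (idn X) (z X ?D) = v ** pair X ?D (idn X) (z X ?D)"
      using uc[OF pr1(1)] vc[OF pr1(1)] pr1 C(5)[OF i(1)] z_r'[OF pp(1) C(3)] z_r'[OF pp(2) C(3)] z_r'[OF M(2) C(3)] by simp
    show "u ** pair X ?D (z ?D X) (idn ?D) = v ** pair X ?D (z ?D X) (idn ?D)"
      using uc[OF pr2(1)] vc[OF pr2(1)] pr2 C(6)[OF pp(1)] C(6)[OF M(2)] cooperates_abelian[OF c m pp(1,2)]
        id_r[OF pp(1)] id_r[OF pp(2)] id_r[OF M(2)] pair_id[OF C(4) C(4)] by simp
  qed
  moreover note pb = pair[OF b b']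
  note px = pair[OF x pb(1)]
  ultimately show ?thesis using uc[OF px(1)] vc[OF px(1)] pb by simp
qed

lemma kernel_p1:
  assumes "X \<in> ob" "Y \<in> ob"
  shows "kernel (p1 X Y) (pd X Y) X Y (pair X Y (z Y X) (idn Y))"
proof -
  have i: "z Y X \<in> hom Y X" "idn Y \<in> hom Y Y" using assms by auto
  note pr = pair[OF i]
  show ?thesis unfolding kernel_def
  proof (intro conjI allI impI)
    show "monic (pair X Y (z Y X) (idn Y)) Y (pd X Y)" unfolding monic_def
    proof (intro conjI allI impI)
      fix T x y assume *: "x \<in> hom T Y" "y \<in> hom T Y" "pair X Y (z Y X) (idn Y) ** x = pair X Y (z Y X) (idn Y) ** y"
      then have "p2 X Y ** pair X Y (z Y X) (idn Y) ** x = p2 X Y ** pair X Y (z Y X) (idn Y) ** y" by simp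
      then show "x = y" using reassoc[OF pr(3)] id_l[OF *(1)] id_l[OF *(2)] by simp
    qed (fact pr)
    fix T t assume t: "t \<in> hom T (pd X Y)" "p1 X Y ** t = z T X"
    have y: "p2 X Y ** t \<in> hom T Y" using t p_in[OF assms] by blast
    have "pair X Y (z Y X) (idn Y) ** p2 X Y ** t = t" by (rule pd_eqI[OF _ t(1) assms])
        (use y pr t in \<open>auto simp: reassoc[OF pr(2)] reassoc[OF pr(3)] z_l'[OF y assms(1)] id_l[OF y]\<close>)
    then show "\<exists>h\<in>hom T Y. pair X Y (z Y X) (idn Y) ** h = t" using y by blast
  qed (use pr p_in[OF assms] in auto)
qed

lemma cooperates_commute:
  assumes m: "cooperates B B (idn B) m" and b: "b \<in> hom T B" and b': "b' \<in> hom T B"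
  shows "m ** pair B B b b' = m ** pair B B b' b"
proof -
  note M = cooperatesD[OF m]
  note pp = p_in[OF M(3) M(3)]
  have i: "idn B \<in> hom B B" "z B B \<in> hom B B" using M by auto
  note pr1 = pair[OF i] and pr2 = pair[OF i(2,1)]
  have "m = m ** pair B B (p2 B B) (p1 B B)"
  proof (rule product_jointly_epic[OF M(2) cooperates_in[OF m pp(2,1)] M(3) M(3)])
    show "m ** pair B B (idn B) (z B B) = (m ** pair B B (p2 B B) (p1 B B)) ** pair B B (idn B) (z B B)"
      using cooperates_comp[OF m pp(2,1) pr1(1)] pr1 M(5)[OF i(1)] M(6)[OF i(1)] id_l[OF i(1)] by simp
    show "m ** pair B B (z B B) (idn B) = (m ** pair B B (p2 B B) (p1 B B)) ** pair B B (z B B) (idn B)"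
      using cooperates_comp[OF m pp(2,1) pr2(1)] pr2 M(5)[OF i(1)] M(6)[OF i(1)] id_l[OF i(1)] by simp
  qed
  from arg_cong[OF this, of "\<lambda>u. u ** pair B B b b'"]
  show ?thesis using cooperates_comp[OF m pp(2,1) pair(1)[OF b b']] pair[OF b b'] by simp
qed

text \<open>The shear map (x, y) \<mapsto> (x, x + y) is the identity on the kernel of the first
  projection and carries the section (1, 0) to the diagonal, so protomodularity makes it invertible.
  The negative of x is the second entry of the preimage of (x, 0).\<close>

lemma abelian_groupI:
  assumes m: "cooperates B B (idn B) m"
  obtains i where "abelian_group B m i"
proof -
  note M = cooperatesD[OF m]
  note pp = p_in[OF M(3) M(3)]
  have i: "idn B \<in> hom B B" "z B B \<in> hom B B" using M by auto
  note pr1 = pair[OF i] and pr2 = pair[OF i(2,1)] and pr3 = pair[OF i(1,1)] and \<phi> = pair[OF pp(1) M(2)]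
  have k: "kernel (p1 B B) (pd B B) B B (pair B B (z B B) (idn B))" by (rule kernel_p1[OF M(3) M(3)])
  have "isom (pair B B (p1 B B) m) (pd B B) (pd B B)"
  proof (rule protomodular[OF _ _ \<phi>(1) i(1)])
    show "split_ext B (pair B B (z B B) (idn B)) (pd B B) (p1 B B) (pair B B (idn B) (z B B)) B"
      using k pr1 pp by (simp add: split_ext_def)
    show "split_ext B (pair B B (z B B) (idn B)) (pd B B) (p1 B B) (pair B B (idn B) (idn B)) B"
      using k pr3 pp by (simp add: split_ext_def)
    show "pair B B (p1 B B) m ** pair B B (z B B) (idn B) = pair B B (z B B) (idn B) ** idn B"
      using pair_comp[OF pp(1) M(2) pr2(1)] pr2 M(6)[OF i(1)] id_l[OF i(1)] id_r[OF pr2(1)] by simp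
    show "pair B B (p1 B B) m ** pair B B (idn B) (z B B) = pair B B (idn B) (idn B)"
      using pair_comp[OF pp(1) M(2) pr1(1)] pr1 M(5)[OF i(1)] by simp
  qed (use \<phi> isom_id[OF M(3)] in auto)
  then obtain \<psi> where \<psi>: "\<psi> \<in> hom (pd B B) (pd B B)" "pair B B (p1 B B) m ** \<psi> = idn (pd B B)"
    by (auto simp: isom_def)
  let ?w = "\<psi> ** pair B B (idn B) (z B B)"
  have w: "?w \<in> hom B (pd B B)" using \<psi> pr1 by blast
  have "p1 B B ** ?w = p1 B B ** pair B B (p1 B B) m ** ?w" using reassoc[OF \<phi>(2)] by simp
  also have "\<dots> = idn B" using reassoc[OF \<psi>(2)] id_l[OF pr1(1)] pr1(2) by simp
  finally have 1: "p1 B B ** ?w = idn B" .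
  have "m ** ?w = p2 B B ** pair B B (p1 B B) m ** ?w" using reassoc[OF \<phi>(3)] by simp
  also have "\<dots> = z B B" using reassoc[OF \<psi>(2)] id_l[OF pr1(1)] pr1(3) by simp
  finally have 2: "m ** ?w = z B B" .
  have "?w = pair B B (idn B) (p2 B B ** ?w)" by (rule pair_eqI[OF w M(3) M(3) 1]) simp
  then have "abelian_group B m (p2 B B ** ?w)" unfolding abelian_group_def using m 2 w pp by auto
  then show ?thesis by (rule that)
qed

lemma abelian_groupD:
  assumes "abelian_group B m i"
  shows "cooperates B B (idn B) m" "i \<in> hom B B" "B \<in> ob" "m \<in> hom (pd B B) B"
    "b \<in> hom T B ==> m ** pair B B b (i ** b) = z T B"
    "b \<in> hom T B ==> m ** pair B B (i ** b) b = z T B"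
    "b \<in> hom T B ==> i ** i ** b = b"
proof -
  show m: "cooperates B B (idn B) m" and i: "i \<in> hom B B" using assms by (auto simp: abelian_group_def)
  note M = cooperatesD[OF m]
  show "B \<in> ob" "m \<in> hom (pd B B) B" by (fact M)+
  have iB: "idn B \<in> hom B B" using M by blast
  have mi: "m ** pair B B (idn B) i = z B B" using assms by (simp add: abelian_group_def)
  have 1: "m ** pair B B b (i ** b) = z T B" if b: "b \<in> hom T B" for b T
    using cooperates_comp[OF m iB i b] id_l[OF b] reassoc[OF mi] z_l'[OF b M(3)] by simp
  show 2: "m ** pair B B (i ** b) b = z T B" if b: "b \<in> hom T B" for b T
    using 1[OF b] cooperates_commute[OF m b comp_in[OF b i]] by simp
  show "m ** pair B B b (i ** b) = z T B" if b: "b \<in> hom T B" using 1[OF b] .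
  show "i ** i ** b = b" if b: "b \<in> hom T B"
  proof -
    have ib: "i ** b \<in> hom T B" "i ** i ** b \<in> hom T B" using b i by blast+
    have "m ** pair B B (m ** pair B B b (i ** b)) (i ** i ** b) = m ** pair B B b (m ** pair B B (i ** b) (i ** i ** b))"
      by (rule cooperates_assoc[OF m m b ib])
    then show ?thesis using 1[OF b] 1[OF ib(1)] M(5)[OF b] M(6)[OF ib(2)] id_l[OF ib(2)] by simp
  qed
qed

text \<open>The two sides agree on the axes of B \<times> B, so additivity is automatic for arrows
  between abelian objects.\<close>

lemma abelian_hom_add:
  assumes m: "cooperates B B (idn B) m" and m': "cooperates B' B' (idn B') m'" and h: "h \<in> hom B B'"
    and b: "b \<in> hom T B" and b': "b' \<in> hom T B"
  shows "h ** m ** pair B B b b' = m' ** pair B' B' (h ** b) (h ** b')"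
proof -
  note M = cooperatesD[OF m] and M' = cooperatesD[OF m']
  note pp = p_in[OF M(3) M(3)]
  have i: "idn B \<in> hom B B" "z B B \<in> hom B B" using M by auto
  note pr1 = pair[OF i] and pr2 = pair[OF i(2,1)]
  have hp: "h ** p1 B B \<in> hom (pd B B) B'" "h ** p2 B B \<in> hom (pd B B) B'" using h pp by blast+
  have "h ** m = m' ** pair B' B' (h ** p1 B B) (h ** p2 B B)"
  proof (rule product_jointly_epic[OF _ cooperates_in[OF m' hp] M(3) M(3)])
    show "h ** m \<in> hom (pd B B) B'" using h M by blast
    show "(h ** m) ** pair B B (idn B) (z B B) = (m' ** pair B' B' (h ** p1 B B) (h ** p2 B B)) ** pair B B (idn B) (z B B)"
      using cooperates_comp[OF m' hp pr1(1)] pr1 M(5)[OF i(1)] M'(5)[OF h] id_r[OF h] z_r'[OF h M(3)] by simp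
    show "(h ** m) ** pair B B (z B B) (idn B) = (m' ** pair B' B' (h ** p1 B B) (h ** p2 B B)) ** pair B B (z B B) (idn B)"
      using cooperates_comp[OF m' hp pr2(1)] pr2 M(6)[OF i(1)] M'(6)[OF h] id_r[OF h] id_l[OF i(1)] id_l[OF h]
        z_r'[OF h M(3)] by simp
  qed
  from arg_cong[OF this, of "\<lambda>u. u ** pair B B b b'"]
  show ?thesis using cooperates_comp[OF m' hp pair(1)[OF b b']] pair[OF b b'] by simp
qed

lemma abelian_hom_minus:
  assumes B: "abelian_group B m i" and B': "abelian_group B' m' i'" and h: "h \<in> hom B B'" and b: "b \<in> hom T B"
  shows "h ** i ** b = i' ** h ** b"
proof -
  note G = abelian_groupD[OF B] and G' = abelian_groupD[OF B']
  note M' = cooperatesD[OF G'(1)]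
  have T: "T \<in> ob" using hom_ob b by blast
  have hb: "h ** b \<in> hom T B'" "i' ** h ** b \<in> hom T B'" "h ** i ** b \<in> hom T B'" "i ** b \<in> hom T B" using h b G G' by blast+
  have "m' ** pair B' B' (m' ** pair B' B' (i' ** h ** b) (h ** b)) (h ** i ** b) =
      m' ** pair B' B' (i' ** h ** b) (m' ** pair B' B' (h ** b) (h ** i ** b))"
    by (rule cooperates_assoc[OF G'(1) G'(1) hb(2,1,3)])
  moreover have "m' ** pair B' B' (h ** b) (h ** i ** b) = z T B'"
    using abelian_hom_add[OF G(1) G'(1) h b hb(4)] G(5)[OF b] z_r'[OF h T] by simp
  ultimately show ?thesis using G'(6)[OF hb(1)] M'(5)[OF hb(2)] M'(6)[OF hb(3)] id_l[OF hb(3)] by simp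
qed

text \<open>On elements the pair (p1, c) is the relation x ~ x + a n. It is jointly monic because
  \<open>a\<close> is monic and reflexive by n = 0, hence effective, and the class of 0 is
  \<open>N\<close>. In particular central subobjects are normal.\<close>

lemma central_quotient:
  assumes c: "cooperates X N a c" and a: "monic a N X"
  obtains Q q where "cover q X Q" "kernel q X Q N a" "q ** c = q ** p1 X N"
proof -
  note C = cooperatesD[OF c]
  note pp = p_in[OF C(3,4)]
  have i: "idn X \<in> hom X X" "z X N \<in> hom X N" "idn N \<in> hom N N" "z N X \<in> hom N X" using C by auto
  note pr1 = pair[OF i(1,2)] and pr2 = pair[OF i(4,3)]
  have w: "pair X X (p1 X N) c \<in> hom (pd X N) (pd X X)" by (rule pair(1)[OF pp(1) C(2)])
  note wp = pair[OF pp(1) C(2)]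
  have wmonic: "monic (pair X X (p1 X N) c) (pd X N) (pd X X)"
  proof (rule monic_if_kernel_zero[OF w])
    fix T x assume x: "x \<in> hom T (pd X N)" "pair X X (p1 X N) c ** x = z T (pd X X)"
    have T: "T \<in> ob" using hom_ob x by blast
    note XX = p_in[OF C(3) C(3)]
    have "p1 X X ** pair X X (p1 X N) c ** x = z T X" "p2 X X ** pair X X (p1 X N) c ** x = z T X"
      using x(2) z_r'[OF XX(1) T] z_r'[OF XX(2) T] by auto
    then have 1: "p1 X N ** x = z T X" "c ** x = z T X" using reassoc[OF wp(2)] reassoc[OF wp(3)] by auto
    have n: "p2 X N ** x \<in> hom T N" using x pp by blast
    have xe: "x = pair X N (z T X) (p2 X N ** x)" by (rule pair_eqI[OF x(1) C(3,4) 1(1)]) simp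
    have "c ** x = a ** p2 X N ** x" using C(6)[OF n] xe by simp
    then have "a ** p2 X N ** x = a ** z T N" using 1(2) z_r'[OF C(1) T] by simp
    then have "p2 X N ** x = z T N" by (rule monicD[OF a]) (use n T C in blast)+
    then show "x = z T (pd X N)" by (intro pd_eqI[OF x(1) _ C(3,4)]) (use 1 T pp z_r'[OF pp(1) T] z_r'[OF pp(2) T] in auto)
  qed
  have jm: "\<forall>T x y. x \<in> hom T (pd X N) --> y \<in> hom T (pd X N) -->
      p1 X N ** x = p1 X N ** y --> c ** x = c ** y --> x = y"
  proof (intro allI impI)
    fix T x y assume *: "x \<in> hom T (pd X N)" "y \<in> hom T (pd X N)" "p1 X N ** x = p1 X N ** y" "c ** x = c ** y"
    have "pair X X (p1 X N) c ** x = pair X X (p1 X N) c ** y"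
      using pair_comp[OF pp(1) C(2) *(1)] pair_comp[OF pp(1) C(2) *(2)] * by simp
    then show "x = y" by (rule monicD[OF wmonic]) (use * in blast)+
  qed
  obtain Q q where q: "cover q X Q" and qq: "\<forall>T x y. x \<in> hom T X --> y \<in> hom T X -->
      (q ** x = q ** y \<longleftrightarrow> (\<exists>t\<in>hom T (pd X N). p1 X N ** t = x \<and> c ** t = y))"
    by (rule reflexive_effective[OF pp(1) C(2) jm pr1(1,2)]) (use c in \<open>simp add: cooperates_def\<close>)
  note qh = cover_in[OF q]
  have Q: "Q \<in> ob" using hom_ob qh by blast
  have iP: "idn (pd X N) \<in> hom (pd X N) (pd X N)" using pp by blast
  have qc: "q ** c = q ** p1 X N" using qq C(2) pp(1) iP id_r[OF C(2)] id_r[OF pp(1)] by metis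
  have "kernel q X Q N a" unfolding kernel_def
  proof (intro conjI allI impI)
    have "q ** c ** pair X N (z N X) (idn N) = q ** p1 X N ** pair X N (z N X) (idn N)" using qc by (metis assoc)
    then show "q ** a = z N Q" using C(6)[OF i(3)] id_r[OF C(1)] pr2 z_r'[OF qh C(4)] by simp
    fix T t assume t: "t \<in> hom T X" "q ** t = z T Q"
    have T: "T \<in> ob" using hom_ob t by blast
    have "q ** z T X = q ** t" using t z_r'[OF qh T] by simp
    then obtain u where u: "u \<in> hom T (pd X N)" "p1 X N ** u = z T X" "c ** u = t" using qq t(1) z_in[OF T C(3)] by blast
    have n: "p2 X N ** u \<in> hom T N" using u pp by blast
    have "u = pair X N (z T X) (p2 X N ** u)" by (rule pair_eqI[OF u(1) C(3,4) u(2)]) simp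
    then have "a ** p2 X N ** u = t" using C(6)[OF n] u(3) by simp
    then show "\<exists>h\<in>hom T N. a ** h = t" using n by blast
  qed (use qh a in auto)
  then show ?thesis using that q qc by blast
qed

end

context semi_abelian
begin

section \<open>Equivariance of differences, negatives and sums\<close>

definition pact :: "'o => 'o => 'a => 'o => 'a => 'a" where
  "pact B X \<xi> Y \<upsilon> = pair X Y (\<xi> ** fl (idn B) (p1 X Y)) (\<upsilon> ** fl (idn B) (p2 X Y))"

lemma act_product:
  assumes "act B X \<xi>" "act B Y \<upsilon>"
  shows "act B (pd X Y) (pact B X \<xi> Y \<upsilon>)"
    and "am B (pd X Y) (pact B X \<xi> Y \<upsilon>) (idn B) (p1 X Y) B X \<xi>"
    and "am B (pd X Y) (pact B X \<xi> Y \<upsilon>) (idn B) (p2 X Y) B Y \<upsilon>"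
proof -
  note a = actD[OF assms(1)] and b = actD[OF assms(2)]
  note pp = p_in[OF a(2) b(2)]
  have iB: "idn B \<in> hom B B" using a by blast
  let ?f1 = "fl (idn B) (p1 X Y)" and ?f2 = "fl (idn B) (p2 X Y)" and ?P = "pd X Y"
  let ?\<pi> = "pact B X \<xi> Y \<upsilon>"
  note f = fl_in[OF iB pp(1)] fl_in[OF iB pp(2)]
  have g: "\<xi> ** ?f1 \<in> hom (fo B ?P) X" "\<upsilon> ** ?f2 \<in> hom (fo B ?P) Y" using a b by blast+
  note pr = pair[OF g, folded pact_def]
  note e = eta_in[OF a(1) pp(3)] and mm = mu_in[OF a(1) pp(3)]
  have "?\<pi> ** eta B ?P = idn ?P"
  proof (rule pd_eqI[OF _ _ a(2) b(2)])
    show "p1 X Y ** ?\<pi> ** eta B ?P = p1 X Y ** idn ?P"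
      using reassoc[OF pr(2)] eta_natural[OF iB pp(1)] reassoc[OF a(4)] id_l[OF pp(1)] id_r[OF pp(1)] by simp
    show "p2 X Y ** ?\<pi> ** eta B ?P = p2 X Y ** idn ?P"
      using reassoc[OF pr(3)] eta_natural[OF iB pp(2)] reassoc[OF b(4)] id_l[OF pp(2)] id_r[OF pp(2)] by simp
  qed (use pr e pp in blast)+
  moreover have "?\<pi> ** mu B ?P = ?\<pi> ** fl (idn B) ?\<pi>"
  proof (rule pd_eqI[OF _ _ a(2) b(2)])
    show "p1 X Y ** ?\<pi> ** mu B ?P = p1 X Y ** ?\<pi> ** fl (idn B) ?\<pi>"
      using reassoc[OF pr(2)] mu_natural[OF iB pp(1)] reassoc[OF a(5)] fl_comp[OF iB f(1) iB a(3)] fl_comp[OF iB pr(1) iB pp(1)] pr(2) by simp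
    show "p2 X Y ** ?\<pi> ** mu B ?P = p2 X Y ** ?\<pi> ** fl (idn B) ?\<pi>"
      using reassoc[OF pr(3)] mu_natural[OF iB pp(2)] reassoc[OF b(5)] fl_comp[OF iB f(2) iB b(3)] fl_comp[OF iB pr(1) iB pp(2)] pr(3) by simp
  qed (use pr mm iB in blast)+
  ultimately show "act B ?P ?\<pi>" using a pp pr by (auto simp: act_def)
  show "am B ?P ?\<pi> (idn B) (p1 X Y) B X \<xi>" "am B ?P ?\<pi> (idn B) (p2 X Y) B Y \<upsilon>"
    using iB pp pr by (auto simp: am_def)
qed

lemma am_pair:
  assumes \<xi>: "act B X \<xi>" and \<upsilon>: "act B Y \<upsilon>" and \<omega>: "\<omega> \<in> hom (fo A W) W"
    and x: "am A W \<omega> f x B X \<xi>" and y: "am A W \<omega> f y B Y \<upsilon>"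
  shows "am A W \<omega> f (pair X Y x y) B (pd X Y) (pact B X \<xi> Y \<upsilon>)"
proof -
  have f: "f \<in> hom A B" and xh: "x \<in> hom W X" and yh: "y \<in> hom W Y"
    and xe: "x ** \<omega> = \<xi> ** fl f x" and ye: "y ** \<omega> = \<upsilon> ** fl f y" using x y by (auto simp: am_def)
  note a = actD[OF \<xi>] and b = actD[OF \<upsilon>]
  note pp = p_in[OF a(2) b(2)]
  note P = act_product[OF \<xi> \<upsilon>]
  note pr = pair[OF xh yh]
  have ff: "fl f (pair X Y x y) \<in> hom (fo A W) (fo B (pd X Y))" using f pr by blast
  have iB: "idn B \<in> hom B B" using a by blast
  have "pair X Y x y ** \<omega> = pact B X \<xi> Y \<upsilon> ** fl f (pair X Y x y)"
  proof (rule pd_eqI[OF _ _ a(2) b(2)])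
    have 1: "p1 X Y ** pact B X \<xi> Y \<upsilon> = \<xi> ** fl (idn B) (p1 X Y)"
      "p2 X Y ** pact B X \<xi> Y \<upsilon> = \<upsilon> ** fl (idn B) (p2 X Y)" using P(2,3) by (auto simp: am_def)
    show "p1 X Y ** pair X Y x y ** \<omega> = p1 X Y ** pact B X \<xi> Y \<upsilon> ** fl f (pair X Y x y)"
      using reassoc[OF pr(2)] reassoc[OF 1(1)] xe fl_comp[OF f pr(1) iB pp(1)] pr(2) id_l[OF f] by simp
    show "p2 X Y ** pair X Y x y ** \<omega> = p2 X Y ** pact B X \<xi> Y \<upsilon> ** fl f (pair X Y x y)"
      using reassoc[OF pr(3)] reassoc[OF 1(2)] ye fl_comp[OF f pr(1) iB pp(2)] pr(3) id_l[OF f] by simp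
  qed (use \<omega> pr ff actD(3)[OF P(1)] in blast)+
  then show ?thesis using f pr by (simp add: am_def)
qed

text \<open>The copairing of \<open>f\<close> and 0 factors through [1, 0], and B \<flat> X is the
  kernel of the latter.\<close>

lemma fl_zero:
  assumes f: "f \<in> hom B B'" and ob: "X \<in> ob" "X' \<in> ob"
  shows "fl f (z X X') = z (fo B X) (fo B' X')"
proof -
  have B: "B \<in> ob" "B' \<in> ob" using hom_ob f by auto
  have i: "i1 B' X' ** f \<in> hom B (sm B' X')" using f B ob by blast
  have zz: "z X X' \<in> hom X X'" "idn B \<in> hom B B" "z X B \<in> hom X B" using B ob by auto
  note fo = fo_ob[OF B(1) ob(1)] fo_ob[OF B(2) ob(2)]
  have "ka B' X' ** fl f (z X X') = cp (i1 B' X' ** f) (z X (sm B' X')) ** ka B X"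
    using ka_fl[OF f zz(1)] z_r'[OF i2_in[OF B(2) ob(2)] ob(1)] by simp
  also have "\<dots> = (i1 B' X' ** f) ** cp (idn B) (z X B) ** ka B X"
    using reassoc[OF cp_comp[OF zz(2,3) i]] id_r[OF i] z_r'[OF i ob(1)] by simp
  also have "\<dots> = ka B' X' ** z (fo B X) (fo B' X')"
    using ka_zero[OF B(1) ob(1)] z_r'[OF i fo(1)] z_r'[OF ka_in[OF B(2) ob(2)] fo(1)] by simp
  finally show ?thesis by (rule ka_eqI) (use f zz fo B ob in blast)+
qed

lemma am_zero:
  assumes "act B X \<xi>" "act B' X' \<xi>'" "f \<in> hom B B'"
  shows "am B X \<xi> f (z X X') B' X' \<xi>'"
proof -
  note a = actD[OF assms(1)] and b = actD[OF assms(2)]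
  show ?thesis unfolding am_def
    using assms(3) a b z_l'[OF a(3) b(2)] fl_zero[OF assms(3) a(2) b(2)] z_r'[OF b(3) fo_ob[OF a(1,2)]] by auto
qed

text \<open>The difference map \<open>d : X \<times> N \<rightarrow> X\<close> is a cokernel of the equivariant map \<open>(j, 1)\<close>, so some action
  on \<open>X\<close> makes it equivariant. Restricting along the equivariant section \<open>(1, 0)\<close> of \<open>d\<close> shows that
  this is the given action.\<close>

lemma difference_equivariant:
  assumes \<xi>: "act B X \<xi>" and \<nu>: "act B N \<nu>" and j: "am B N \<nu> (idn B) j B X \<xi>"
    and c: "cooperates X N j c" and N: "abelian_group N m i"
  shows "am B (pd X N) (pact B X \<xi> N \<nu>) (idn B) (c ** pair X N (p1 X N) (i ** p2 X N)) B X \<xi>"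
proof -
  note C = cooperatesD[OF c] and G = abelian_groupD[OF N] and a = actD[OF \<xi>]
  note pp = p_in[OF C(3,4)]
  have iN: "idn N \<in> hom N N" "z X N \<in> hom X N" "idn X \<in> hom X X" "z N X \<in> hom N X" and iB: "idn B \<in> hom B B" using C a by auto
  have ip: "i ** p2 X N \<in> hom (pd X N) N" using G pp by blast
  note P = act_product[OF \<xi> \<nu>]
  let ?d = "c ** pair X N (p1 X N) (i ** p2 X N)" and ?a = "pair X N j (idn N)" and ?s = "pair X N (idn X) (z X N)"
  note d = cooperates_in[OF c pp(1) ip]
  note pa = pair[OF C(1) iN(1)] and ps = pair[OF iN(3,2)]
  have dt: "?d ** t = c ** pair X N (p1 X N ** t) (i ** p2 X N ** t)" if "t \<in> hom S (pd X N)" for S t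
    using cooperates_comp[OF c pp(1) ip that] by simp
  have ds: "?d ** ?s = idn X" using dt[OF ps(1)] ps z_r'[OF G(2) C(3)] C(5)[OF iN(3)] by simp
  have cov: "cover ?d (pd X N) X" by (rule split_epi_cover[OF d ps(1) ds])
  \<comment> \<open>On elements the map is (x, n) \<mapsto> x - j n, so its kernel consists of the
    pairs (j n, n).\<close>
  have "kernel ?d (pd X N) X N ?a" unfolding kernel_def
  proof (intro conjI allI impI)
    show "monic ?a N (pd X N)" unfolding monic_def
    proof (intro conjI allI impI)
      fix T x y assume *: "x \<in> hom T N" "y \<in> hom T N" "?a ** x = ?a ** y"
      then have "p2 X N ** ?a ** x = p2 X N ** ?a ** y" by simp
      then show "x = y" using reassoc[OF pa(3)] id_l[OF *(1)] id_l[OF *(2)] by simp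
    qed (fact pa)
    show "?d ** ?a = z N X"
      using dt[OF pa(1)] pa cooperates_abelian[OF c G(1) iN(1) comp_in[OF iN(1) G(2)]] G(5)[OF iN(1)]
        id_r[OF C(1)] z_r'[OF C(1) C(4)] by simp
    fix T t assume t: "t \<in> hom T (pd X N)" "?d ** t = z T X"
    have xn: "p1 X N ** t \<in> hom T X" "p2 X N ** t \<in> hom T N" "i ** p2 X N ** t \<in> hom T N" using t pp G by blast+
    have "c ** pair X N (c ** pair X N (p1 X N ** t) (i ** p2 X N ** t)) (p2 X N ** t) = p1 X N ** t"
      using cooperates_assoc[OF c G(1) xn(1,3,2)] G(6)[OF xn(2)] C(5)[OF xn(1)] by simp
    then have "p1 X N ** t = j ** p2 X N ** t" using dt[OF t(1)] t(2) C(6)[OF xn(2)] by simp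
    then have "?a ** p2 X N ** t = t" by (intro pd_eqI[OF _ t(1) C(3,4)])
        (use pa xn reassoc[OF pa(2)] reassoc[OF pa(3)] id_l[OF xn(2)] in auto)
    then show "\<exists>h\<in>hom T N. ?a ** h = t" using xn by blast
  qed (fact d)
  moreover have "am B N \<nu> (idn B) ?a B (pd X N) (pact B X \<xi> N \<nu>)"
    by (rule am_pair[OF \<xi> \<nu> actD(3)[OF \<nu>] j am_id[OF \<nu>]])
  ultimately obtain \<zeta> where \<zeta>: "act B X \<zeta>" "am B (pd X N) (pact B X \<xi> N \<nu>) (idn B) ?d B X \<zeta>"
    using quotient_action[OF \<nu> P(1) _ cov] by metis
  have "am B X \<xi> (idn B) ?s B (pd X N) (pact B X \<xi> N \<nu>)"
    by (rule am_pair[OF \<xi> \<nu> a(3) am_id[OF \<xi>] am_zero[OF \<xi> \<nu> iB]])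
  from am_comp[OF this \<zeta>(2)] have "am B X \<xi> (idn B) (idn X) B X \<zeta>" using ds id_l[OF iB] by simp
  then have "\<xi> = \<zeta>" using fl_id[OF a(1,2)] id_l[OF a(3)] id_r[OF actD(3)[OF \<zeta>(1)]] by (simp add: am_def)
  then show ?thesis using \<zeta> by simp
qed

text \<open>The negative of n is the difference map of \<open>N\<close> with itself evaluated at (0,
  n).\<close>

lemma minus_equivariant:
  assumes \<nu>: "act B N \<nu>" and N: "abelian_group N m i"
  shows "am B N \<nu> (idn B) i B N \<nu>"
proof -
  note G = abelian_groupD[OF N] and a = actD[OF \<nu>]
  note M = cooperatesD[OF G(1)]
  note pp = p_in[OF a(2) a(2)]
  have i: "idn N \<in> hom N N" "z N N \<in> hom N N" "idn B \<in> hom B B" using a by auto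
  note pr = pair[OF i(2,1)]
  have ip: "i ** p2 N N \<in> hom (pd N N) N" using G by blast
  note d = difference_equivariant[OF \<nu> \<nu> am_id[OF \<nu>] G(1) N]
  have "am B N \<nu> (idn B) (pair N N (z N N) (idn N)) B (pd N N) (pact B N \<nu> N \<nu>)"
    by (rule am_pair[OF \<nu> \<nu> a(3) am_zero[OF \<nu> \<nu> i(3)] am_id[OF \<nu>]])
  from am_comp[OF this d] show ?thesis
    using cooperates_comp[OF G(1) pp(1) ip pr(1)] pr id_l[OF i(3)] id_r[OF G(2)] M(6)[OF G(2)] id_l[OF G(2)] by simp
qed

text \<open>The sum x + j n is computed as x - j (- n), a composite of equivariant maps.\<close>

lemma cooperator_equivariant:
  assumes \<xi>: "act B X \<xi>" and \<nu>: "act B N \<nu>" and j: "am B N \<nu> (idn B) j B X \<xi>"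
    and c: "cooperates X N j c" and N: "abelian_group N m i"
  shows "am B (pd X N) (pact B X \<xi> N \<nu>) (idn B) c B X \<xi>"
proof -
  note C = cooperatesD[OF c] and G = abelian_groupD[OF N] and a = actD[OF \<xi>]
  note pp = p_in[OF C(3,4)]
  note P = act_product[OF \<xi> \<nu>]
  have iB: "idn B \<in> hom B B" using a by blast
  have ip: "i ** p2 X N \<in> hom (pd X N) N" using G pp by blast
  note pr = pair[OF pp(1) ip]
  note Pa = actD(3)[OF P(1)]
  note ip' = am_comp[OF P(3) minus_equivariant[OF \<nu> N], unfolded id_l[OF iB]]
  have "am B (pd X N) (pact B X \<xi> N \<nu>) (idn B) (pair X N (p1 X N) (i ** p2 X N)) B (pd X N) (pact B X \<xi> N \<nu>)"
    by (rule am_pair[OF \<xi> \<nu> Pa P(2) ip'])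
  from am_comp[OF this difference_equivariant[OF \<xi> \<nu> j c N]]
  have "am B (pd X N) (pact B X \<xi> N \<nu>) (idn B ** idn B)
      ((c ** pair X N (p1 X N) (i ** p2 X N)) ** pair X N (p1 X N) (i ** p2 X N)) B X \<xi>" .
  moreover have "(c ** pair X N (p1 X N) (i ** p2 X N)) ** pair X N (p1 X N) (i ** p2 X N) = c"
    using cooperates_comp[OF c pp(1) ip pr(1)] pr G(7)[OF pp(2)] pair_id[OF C(3,4)] id_r[OF C(2)] by simp
  ultimately show ?thesis using id_l[OF iB] by simp
qed

end

section \<open>Pushforwards and crossed modules\<close>

context exact_protomodular
begin

text \<open>The antidiagonal (j, - f) is central in X \<times> B': the cooperator \<open>c2\<close>
  lets b translate (x, b') to (x + j b, b' - f b). Dividing by this translation yields (x + j b, b')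
  ~ (x, b' + f b), which is the last conclusion.\<close>

lemma pushforward_quotient:
  assumes c: "cooperates X B j c" and j: "monic j B X" and B: "abelian_group B m i"
    and B': "abelian_group B' m' i'" and f: "f \<in> hom B B'"
  obtains X' q where "cover q (pd X B') X'" "kernel q (pd X B') X' B (pair X B' j (i' ** f))"
    "\<forall>T x b b'. x \<in> hom T X --> b \<in> hom T B --> b' \<in> hom T B' -->
       q ** pair X B' (c ** pair X B x b) b' = q ** pair X B' x (m' ** pair B' B' b' (f ** b))"
proof -
  note C = cooperatesD[OF c] and G' = abelian_groupD[OF B']
  note M' = cooperatesD[OF G'(1)]
  note pp = p_in[OF C(3) M'(3)]
  let ?P = "pd X B'"
  note qq = p_in[OF pp(3) C(4)]
  have if': "i' ** f \<in> hom B B'" using f G' by blast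
  note pa = pair[OF C(1) if']
  have e: "p1 X B' ** p1 ?P B \<in> hom (pd ?P B) X" "p2 X B' ** p1 ?P B \<in> hom (pd ?P B) B'"
    "i' ** f ** p2 ?P B \<in> hom (pd ?P B) B'" using pp qq f G' by blast+
  define c2 where "c2 = pair X B' (c ** pair X B (p1 X B' ** p1 ?P B) (p2 ?P B))
     (m' ** pair B' B' (p2 X B' ** p1 ?P B) (i' ** f ** p2 ?P B))"
  note e1 = cooperates_in[OF c e(1) qq(2)] and e2 = cooperates_in[OF G'(1) e(2,3)]
  have c2: "c2 \<in> hom (pd ?P B) ?P" unfolding c2_def by (rule pair(1)[OF e1 e2])
  have c2t: "c2 ** t = pair X B' (c ** pair X B (p1 X B' ** p1 ?P B ** t) (p2 ?P B ** t))
     (m' ** pair B' B' (p2 X B' ** p1 ?P B ** t) (i' ** f ** p2 ?P B ** t))" if t: "t \<in> hom T (pd ?P B)" for t T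
    using pair_comp[OF e1 e2 t] cooperates_comp[OF c e(1) qq(2) t] cooperates_comp[OF G'(1) e(2,3) t]
    unfolding c2_def by simp
  have c2p: "c2 ** pair ?P B (pair X B' x b') b =
      pair X B' (c ** pair X B x b) (m' ** pair B' B' b' (i' ** f ** b))"
    if x: "x \<in> hom T X" and b: "b \<in> hom T B" and b': "b' \<in> hom T B'" for T x b b'
    using c2t[OF pair(1)[OF pair(1)[OF x b'] b]] pair[OF x b'] pair[OF pair(1)[OF x b'] b] by simp
  have id': "idn ?P \<in> hom ?P ?P" "z ?P B \<in> hom ?P B" "z B ?P \<in> hom B ?P" "idn B \<in> hom B B" "z B X \<in> hom B X" "z B B' \<in> hom B B'"
    using C M' by auto
  have coop: "cooperates ?P B (pair X B' j (i' ** f)) c2" unfolding cooperates_def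
  proof (intro conjI)
    have "c2 ** pair ?P B (pair X B' (p1 X B') (p2 X B')) (z ?P B) = pair X B' (p1 X B') (p2 X B')"
      using c2p[OF pp(1) id'(2) pp(2)] C(5)[OF pp(1)] M'(5)[OF pp(2)] z_r'[OF f pp(3)] z_r'[OF G'(2) pp(3)] by simp
    then show "c2 ** pair ?P B (idn ?P) (z ?P B) = idn ?P" using pair_id[OF C(3) M'(3)] by simp
    have "pair X B' (z B X) (z B B') = z B ?P"
      by (rule pair_eqI[symmetric, OF id'(3) C(3) M'(3)]) (use z_r'[OF pp(1) C(4)] z_r'[OF pp(2) C(4)] in auto)
    then show "c2 ** pair ?P B (z B ?P) (idn B) = pair X B' j (i' ** f)"
      using c2p[OF id'(5,4,6)] C(6)[OF id'(4)] M'(6)[OF if'] id_l[OF if'] id_r[OF f] id_r[OF C(1)] by simp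
  qed (fact pa c2)+
  have "monic (pair X B' j (i' ** f)) B ?P" unfolding monic_def
  proof (intro conjI allI impI)
    fix T x y assume *: "x \<in> hom T B" "y \<in> hom T B" "pair X B' j (i' ** f) ** x = pair X B' j (i' ** f) ** y"
    then have "p1 X B' ** pair X B' j (i' ** f) ** x = p1 X B' ** pair X B' j (i' ** f) ** y" by simp
    then have "j ** x = j ** y" using reassoc[OF pa(2)] by simp
    then show "x = y" by (rule monicD[OF j]) (use * in blast)+
  qed (fact pa)
  from central_quotient[OF coop this] obtain X' q where q: "cover q ?P X'"
    "kernel q ?P X' B (pair X B' j (i' ** f))" "q ** c2 = q ** p1 ?P B" by metis
  have "q ** pair X B' (c ** pair X B x b) b' = q ** pair X B' x (m' ** pair B' B' b' (f ** b))"
    if x: "x \<in> hom T X" and b: "b \<in> hom T B" and b': "b' \<in> hom T B'" for T x b b'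
  proof -
    have fb: "f ** b \<in> hom T B'" "i' ** f ** b \<in> hom T B'" using f b G' by blast+
    note bb = cooperates_in[OF G'(1) b' fb(1)]
    have "m' ** pair B' B' (m' ** pair B' B' b' (f ** b)) (i' ** f ** b) = b'"
      using cooperates_assoc[OF G'(1) G'(1) b' fb] G'(5)[OF fb(1)] M'(5)[OF b'] by simp
    then have "c2 ** pair ?P B (pair X B' x (m' ** pair B' B' b' (f ** b))) b = pair X B' (c ** pair X B x b) b'"
      using c2p[OF x b bb] by simp
    moreover note reassoc[OF q(3), of "pair ?P B (pair X B' x (m' ** pair B' B' b' (f ** b))) b"]
    ultimately show ?thesis using pair[OF pair(1)[OF x bb] b] by simp
  qed
  then show ?thesis using that[OF q(1,2)] by blast
qed

end

context semi_abelian
begin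

text \<open>The pushforward \<open>X'\<close> of \<open>j : B \<rightarrow> X\<close> along \<open>f : B \<rightarrow> B'\<close> is the quotient of \<open>X \<times> B'\<close> by the
  antidiagonal \<open>(j, - f)\<close>.\<close>

definition pushforward :: "'o => 'o => 'a => 'o => 'a => 'o => 'a => 'a => 'o => 'a => 'a => bool" where
  "pushforward D X \<xi> B j B' \<beta>' f X' \<zeta> q \<longleftrightarrow>
     cover q (pd X B') X' \<and> act D X' \<zeta> \<and> am D (pd X B') (pact D X \<xi> B' \<beta>') (idn D) q D X' \<zeta> \<and>
     (\<exists>m' i'. abelian_group B' m' i' \<and> kernel q (pd X B') X' B (pair X B' j (i' ** f)))"

definition inl :: "'o => 'o => 'a" where "inl X Y = pair X Y (idn X) (z X Y)"
definition inr :: "'o => 'o => 'a" where "inr X Y = pair X Y (z Y X) (idn Y)"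

lemma inl:
  assumes "X \<in> ob" "Y \<in> ob"
  shows "inl X Y \<in> hom X (pd X Y)" "p1 X Y ** inl X Y = idn X" "p2 X Y ** inl X Y = z X Y"
    "x \<in> hom T X ==> inl X Y ** x = pair X Y x (z T Y)"
proof -
  have i: "idn X \<in> hom X X" "z X Y \<in> hom X Y" using assms by auto
  show "inl X Y \<in> hom X (pd X Y)" "p1 X Y ** inl X Y = idn X" "p2 X Y ** inl X Y = z X Y"
    unfolding inl_def using pair[OF i] by auto
  show "inl X Y ** x = pair X Y x (z T Y)" if "x \<in> hom T X"
    unfolding inl_def using pair_comp[OF i that] id_l[OF that] z_l'[OF that assms(2)] by simp
qed

lemma inr:
  assumes "X \<in> ob" "Y \<in> ob"
  shows "inr X Y \<in> hom Y (pd X Y)" "p1 X Y ** inr X Y = z Y X" "p2 X Y ** inr X Y = idn Y"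
    "y \<in> hom T Y ==> inr X Y ** y = pair X Y (z T X) y"
proof -
  have i: "z Y X \<in> hom Y X" "idn Y \<in> hom Y Y" using assms by auto
  show "inr X Y \<in> hom Y (pd X Y)" "p1 X Y ** inr X Y = z Y X" "p2 X Y ** inr X Y = idn Y"
    unfolding inr_def using pair[OF i] by auto
  show "inr X Y ** y = pair X Y (z T X) y" if "y \<in> hom T Y"
    unfolding inr_def using pair_comp[OF i that] id_l[OF that] z_l'[OF that assms(1)] by simp
qed

lemma am_inl:
  assumes "act D X \<xi>" "act D Y \<upsilon>"
  shows "am D X \<xi> (idn D) (inl X Y) D (pd X Y) (pact D X \<xi> Y \<upsilon>)"
  unfolding inl_def using actD[OF assms(1)] am_pair[OF assms _ am_id am_zero] assms by blast

lemma am_inr: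
  assumes "act D X \<xi>" "act D Y \<upsilon>"
  shows "am D Y \<upsilon> (idn D) (inr X Y) D (pd X Y) (pact D X \<xi> Y \<upsilon>)"
  unfolding inr_def using actD[OF assms(2)] am_pair[OF assms _ am_zero am_id] assms by blast

text \<open>Equivariance of \<open>h\<close> is tested after 1 \<flat> q, which is a cover and hence
  epimorphic.\<close>

lemma am_factor:
  assumes \<zeta>: "act D Q \<zeta>" and q: "cover q P Q" and qa: "am D P \<pi> (idn D) q D Q \<zeta>"
    and \<phi>: "am D P \<pi> e \<phi> E F \<upsilon>" and h: "h \<in> hom Q F" "h ** q = \<phi>" and \<upsilon>: "\<upsilon> \<in> hom (fo E F) F"
  shows "am D Q \<zeta> e h E F \<upsilon>"
proof -
  note qh = cover_in[OF q] and a = actD[OF \<zeta>]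
  have qe: "q ** \<pi> = \<zeta> ** fl (idn D) q" using qa by (simp add: am_def)
  have e: "e \<in> hom D E" and \<phi>e: "\<phi> ** \<pi> = \<upsilon> ** fl e \<phi>" using \<phi> by (auto simp: am_def)
  have iD: "idn D \<in> hom D D" using a by blast
  have "(h ** \<zeta>) ** fl (idn D) q = (\<upsilon> ** fl e h) ** fl (idn D) q"
    using qe \<phi>e reassoc[OF h(2), of \<pi>] fl_comp[OF iD qh e h(1)] h(2) id_r[OF e] by simp
  then have "h ** \<zeta> = \<upsilon> ** fl e h"
    by (rule coverD[OF cover_fl_right[OF q a(1)]]) (use h a e \<upsilon> in blast)+
  then show ?thesis using e h by (simp add: am_def)
qed

lemma pushforward_exists:
  assumes \<xi>: "act D X \<xi>" and \<beta>: "act D B \<beta>" and \<beta>': "act D B' \<beta>'"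
    and ja: "am D B \<beta> (idn D) j D X \<xi>" and fa: "am D B \<beta> (idn D) f D B' \<beta>'"
    and c: "cooperates X B j c" and B: "abelian_group B m i" and B': "abelian_group B' m' i'"
    and d: "kernel d X Y B j"
  obtains X' \<zeta> q d' where "pushforward D X \<xi> B j B' \<beta>' f X' \<zeta> q"
    "q ** inl X B' ** j = q ** inr X B' ** f"
    "d' \<in> hom X' Y" "d' ** q = d ** p1 X B'" "kernel d' X' Y B' (q ** inr X B')"
proof -
  note C = cooperatesD[OF c] and G' = abelian_groupD[OF B'] and di = kernel_in[OF d]
  note M' = cooperatesD[OF G'(1)]
  note pp = p_in[OF C(3) M'(3)]
  have f: "f \<in> hom B B'" using fa by (simp add: am_def)
  obtain X' q where q: "cover q (pd X B') X'" and kq: "kernel q (pd X B') X' B (pair X B' j (i' ** f))"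
    and rel: "\<forall>T x b b'. x \<in> hom T X --> b \<in> hom T B --> b' \<in> hom T B' -->
       q ** pair X B' (c ** pair X B x b) b' = q ** pair X B' x (m' ** pair B' B' b' (f ** b))"
    by (rule pushforward_quotient[OF c di(3) B B' f])
  note qh = cover_in[OF q]
  note L = inl[OF C(3) M'(3)] and R = inr[OF C(3) M'(3)]
  have iD: "idn D \<in> hom D D" and ii: "idn B \<in> hom B B" "idn X \<in> hom X X" "idn B' \<in> hom B' B'" "z B X \<in> hom B X" "z B B' \<in> hom B B'"
    using actD[OF \<xi>] C M' by auto
  note P = act_product[OF \<xi> \<beta>']
  have if': "i' ** f \<in> hom B B'" using f G' by blast
  note pa = pair[OF C(1) if']
  have "am D B \<beta> (idn D) (i' ** f) D B' \<beta>'"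
    using am_comp[OF fa minus_equivariant[OF \<beta>' B']] id_l[OF iD] by simp
  then have "am D B \<beta> (idn D) (pair X B' j (i' ** f)) D (pd X B') (pact D X \<xi> B' \<beta>')"
    by (rule am_pair[OF \<xi> \<beta>' actD(3)[OF \<beta>] ja])
  then obtain \<zeta> where \<zeta>: "act D X' \<zeta>" "am D (pd X B') (pact D X \<xi> B' \<beta>') (idn D) q D X' \<zeta>"
    by (rule quotient_action[OF \<beta> P(1) _ q kq])
  have 1: "pushforward D X \<xi> B j B' \<beta>' f X' \<zeta> q" unfolding pushforward_def using q \<zeta> B' kq by blast
  have "q ** pair X B' (c ** pair X B (z B X) (idn B)) (z B B') = q ** pair X B' (z B X) (m' ** pair B' B' (z B B') (f ** idn B))"
    using rel ii by blast
  then have 2: "q ** inl X B' ** j = q ** inr X B' ** f"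
    using C(6)[OF ii(1)] M'(6)[OF f] id_r[OF f] id_r[OF C(1)] id_l[OF f] L(4)[OF C(1)] R(4)[OF f] by simp
  have dp: "d ** p1 X B' \<in> hom (pd X B') Y" using di pp by blast
  have "(d ** p1 X B') ** x = z S Y" if x: "x \<in> hom S (pd X B')" "q ** x = z S X'" for S x
  proof -
    obtain y where y: "y \<in> hom S B" "pair X B' j (i' ** f) ** y = x" by (rule kernelE[OF kq x])
    then have "p1 X B' ** x = j ** y" using reassoc[OF pa(2)] by auto
    then show ?thesis using reassoc[OF di(4)] z_l'[OF y(1)] hom_ob[OF di(1)] by simp
  qed
  then obtain d' where d': "d' \<in> hom X' Y" "d' ** q = d ** p1 X B'" by (rule cover_cokernel[OF q dp])
  have j': "q ** inr X B' \<in> hom B' X'" using qh R by blast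
  \<comment> \<open>If (0, x) dies in the quotient, it equals (j y, - f y) for some y; then j y = 0
    forces y = 0 and x = 0.\<close>
  have mj: "monic (q ** inr X B') B' X'"
  proof (rule monic_if_kernel_zero[OF j'])
    fix T x assume x: "x \<in> hom T B'" "(q ** inr X B') ** x = z T X'"
    have T: "T \<in> ob" using hom_ob x by blast
    have rx: "inr X B' ** x \<in> hom T (pd X B')" "q ** inr X B' ** x = z T X'" using R(1) x by auto
    obtain y where y: "y \<in> hom T B" "pair X B' j (i' ** f) ** y = inr X B' ** x" by (rule kernelE[OF kq rx])
    have "p1 X B' ** pair X B' j (i' ** f) ** y = p1 X B' ** inr X B' ** x" "p2 X B' ** pair X B' j (i' ** f) ** y = p2 X B' ** inr X B' ** x"
      using y by auto
    then have 1: "j ** y = z T X" "i' ** f ** y = x"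
      using reassoc[OF pa(2)] reassoc[OF pa(3)] reassoc[OF R(2)] reassoc[OF R(3)] z_l'[OF x(1) C(3)] id_l[OF x(1)] by auto
    then have "j ** y = j ** z T B" using z_r'[OF C(1) T] by simp
    then have "y = z T B" by (rule monicD[OF di(3)]) (use y T C in blast)+
    then show "x = z T B'" using 1(2) z_r'[OF f T] z_r'[OF G'(2) T] by simp
  qed
  have "kernel d' X' Y B' (q ** inr X B')" unfolding kernel_def
  proof (intro conjI allI impI)
    show "d' ** q ** inr X B' = z B' Y" using reassoc[OF d'(2)] R(2) z_r'[OF di(1) M'(3)] by simp
    fix T t assume t: "t \<in> hom T X'" "d' ** t = z T Y"
    \<comment> \<open>Locally an element of the kernel of \<open>d'\<close> is the class of some (x,
      b') with d x = 0. Then x = j b by exactness, and (j b, b') ~ (0, b' + f b), so locally the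
      element comes from \<open>B'\<close>; by descent along the cover it does so already over
      \<open>T\<close>.\<close>
    obtain T' e w where w: "cover e T' T" "w \<in> hom T' (pd X B')" "q ** w = t ** e" by (rule cover_lift[OF q t(1)])
    note eh = cover_in[OF w(1)]
    have Y: "Y \<in> ob" using hom_ob d' by blast
    have T': "T' \<in> ob" using hom_ob w by blast
    have pw: "p1 X B' ** w \<in> hom T' X" "p2 X B' ** w \<in> hom T' B'" using pp w by blast+
    have "d ** p1 X B' ** w = d' ** q ** w" using reassoc[OF d'(2)] by simp
    also have "\<dots> = z T' Y" using w(3) reassoc[OF t(2)] z_l'[OF eh Y] by simp
    finally obtain b where b: "b \<in> hom T' B" "j ** b = p1 X B' ** w" using kernelE[OF d pw(1)] by blast
    have fb: "f ** b \<in> hom T' B'" using f b by blast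
    let ?v = "m' ** pair B' B' (p2 X B' ** w) (f ** b)"
    have v: "?v \<in> hom T' B'" by (rule cooperates_in[OF G'(1) pw(2) fb])
    have zT: "z T' X \<in> hom T' X" using T' C by blast
    have "w = pair X B' (j ** b) (p2 X B' ** w)" by (rule pair_eqI[OF w(2) C(3) M'(3)]) (use b in auto)
    then have "q ** w = q ** pair X B' (c ** pair X B (z T' X) b) (p2 X B' ** w)" using C(6)[OF b(1)] by simp
    also have "\<dots> = q ** inr X B' ** ?v" using rel zT b(1) pw(2) R(4)[OF v] by simp
    finally have "(q ** inr X B') ** ?v = t ** e" using w(3) by simp
    then obtain u where "u \<in> hom T B'" "(q ** inr X B') ** u = t" by (rule monic_from_cover[OF mj w(1) t(1) v])
    then show "\<exists>h\<in>hom T B'. (q ** inr X B') ** h = t" by blast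
  qed (fact d' mj)+
  then show ?thesis using that 1 2 d' by blast
qed

lemma pushforward_in:
  assumes "pushforward D X \<xi> B j B' \<beta>' f X' \<zeta> q"
  shows "cover q (pd X B') X'" "q \<in> hom (pd X B') X'" "act D X' \<zeta>"
    "am D (pd X B') (pact D X \<xi> B' \<beta>') (idn D) q D X' \<zeta>" using assms by (auto simp: pushforward_def cover_in)

lemma pushforward_jointly_epic:
  assumes pf: "pushforward D X \<xi> B j B' \<beta>' f X' \<zeta> q" and ob: "X \<in> ob" "B' \<in> ob"
    and u: "u \<in> hom X' T" and v: "v \<in> hom X' T"
    and 1: "u ** q ** inl X B' = v ** q ** inl X B'" and 2: "u ** q ** inr X B' = v ** q ** inr X B'"
  shows "u = v"
proof -
  note Q = pushforward_in[OF pf]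
  have "u ** q = v ** q" by (rule product_jointly_epic[of _ X B' T])
      (use ob u v Q(2) 1[unfolded inl_def] 2[unfolded inr_def] in auto)
  then show ?thesis by (rule coverD[OF Q(1) _ u v])
qed

text \<open>Centrality of \<open>l\<close> makes (x, b') \<mapsto> g x + l (k b') an arrow on X
  \<times> B'. It is equivariant as a composite of equivariant maps, and it kills the antidiagonal
  (j, - f) because g j = l k f.\<close>

lemma pushforward_universal:
  assumes pf: "pushforward D X \<xi> B j B' \<beta>' f X' \<zeta> q"
    and \<xi>: "act D X \<xi>" and \<beta>': "act D B' \<beta>'" and f: "f \<in> hom B B'" and j: "j \<in> hom B X"
    and \<upsilon>: "act E F \<upsilon>" and \<kappa>: "act E K \<kappa>" and l: "am E K \<kappa> (idn E) l E F \<upsilon>"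
    and c: "cooperates F K l c" and K: "abelian_group K m i"
    and g: "am D X \<xi> e g E F \<upsilon>" and k: "am D B' \<beta>' e k E K \<kappa>" and eq: "g ** j = l ** k ** f"
  obtains h where "am D X' \<zeta> e h E F \<upsilon>" "h ** q ** inl X B' = g" "h ** q ** inr X B' = l ** k"
proof -
  note Q = pushforward_in[OF pf]
  obtain m' i' where B': "abelian_group B' m' i'" and kq: "kernel q (pd X B') X' B (pair X B' j (i' ** f))"
    using pf by (auto simp: pushforward_def)
  note G' = abelian_groupD[OF B'] and G = abelian_groupD[OF K] and C = cooperatesD[OF c]
  note X = actD[OF \<xi>]
  note pp = p_in[OF X(2) G'(3)]
  have gh: "g \<in> hom X F" "k \<in> hom B' K" "e \<in> hom D E" using g k by (auto simp: am_def)
  have gp: "g ** p1 X B' \<in> hom (pd X B') F" "k ** p2 X B' \<in> hom (pd X B') K" using gh pp by blast+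
  let ?\<phi> = "c ** pair F K (g ** p1 X B') (k ** p2 X B')"
  have \<phi>: "?\<phi> \<in> hom (pd X B') F" by (rule cooperates_in[OF c gp])
  have \<phi>t: "?\<phi> ** t = c ** pair F K (g ** p1 X B' ** t) (k ** p2 X B' ** t)" if "t \<in> hom S (pd X B')" for S t
    using cooperates_comp[OF c gp that] by simp
  note P = act_product[OF \<xi> \<beta>']
  have \<phi>a: "am D (pd X B') (pact D X \<xi> B' \<beta>') e ?\<phi> E F \<upsilon>"
  proof -
    have 1: "am D (pd X B') (pact D X \<xi> B' \<beta>') e (g ** p1 X B') E F \<upsilon>" using am_comp[OF P(2) g] id_r[OF gh(3)] by simp
    have 2: "am D (pd X B') (pact D X \<xi> B' \<beta>') e (k ** p2 X B') E K \<kappa>" using am_comp[OF P(3) k] id_r[OF gh(3)] by simp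
    from am_comp[OF am_pair[OF \<upsilon> \<kappa> actD(3)[OF P(1)] 1 2] cooperator_equivariant[OF \<upsilon> \<kappa> l c K]]
    show ?thesis using id_l[OF gh(3)] by simp
  qed
  have if': "i' ** f \<in> hom B B'" using f G' by blast
  note pa = pair[OF j if']
  have kf: "k ** f \<in> hom B K" using gh f by blast
  have \<phi>0: "?\<phi> ** pair X B' j (i' ** f) = z B F"
    using \<phi>t[OF pa(1)] pa eq abelian_hom_minus[OF B' K gh(2) f] cooperates_abelian[OF c G(1) kf comp_in[OF kf G(2)]]
      G(5)[OF kf] z_r'[OF C(1)] hom_ob[OF kf] by simp
  have "?\<phi> ** x = z S F" if x: "x \<in> hom S (pd X B')" "q ** x = z S X'" for S x
  proof -
    obtain y where y: "y \<in> hom S B" "pair X B' j (i' ** f) ** y = x" by (rule kernelE[OF kq x])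
    then show ?thesis using reassoc[OF \<phi>0, of y] z_l'[OF y(1) C(3)] by simp
  qed
  then obtain h where h: "h \<in> hom X' F" "h ** q = ?\<phi>" by (rule cover_cokernel[OF Q(1) \<phi>])
  have 1: "am D X' \<zeta> e h E F \<upsilon>" by (rule am_factor[OF Q(3,1,4) \<phi>a h actD(3)[OF \<upsilon>]])
  note L = inl[OF X(2) G'(3)] and R = inr[OF X(2) G'(3)]
  have 2: "h ** q ** inl X B' = g"
    using reassoc[OF h(2), of "inl X B'"] \<phi>t[OF L(1)] L(2,3) id_r[OF gh(1)] z_r'[OF gh(2) X(2)] C(5)[OF gh(1)] by simp
  have 3: "h ** q ** inr X B' = l ** k"
    using reassoc[OF h(2), of "inr X B'"] \<phi>t[OF R(1)] R(2,3) id_r[OF gh(2)] z_r'[OF gh(1) G'(3)] C(6)[OF gh(2)] by simp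
  show ?thesis using that 1 2 3 by blast
qed

section \<open>Centrality as an equation, conjugation and crossed modules\<close>

text \<open>The canonical arrow \<open>w\<close> from B + X to X \<times> B is a cover whose kernel
  lies in B \<flat> X, and a cooperator for \<open>j\<close> is a factorization of [j, 1] through
  \<open>w\<close>. On the kernel of \<open>w\<close> the arrow [0, 1] vanishes, so the equation is
  what such a factorization requires. In equational form, centrality is easily transported to
  quotients and products.\<close>

lemma central_iff:
  assumes j: "j \<in> hom B X"
  shows "(\<exists>c. cooperates X B j c) \<longleftrightarrow> cp j (idn X) ** ka B X = cp (z B X) (idn X) ** ka B X"
proof -
  have ob: "B \<in> ob" "X \<in> ob" using hom_ob j by auto
  have ii: "idn X \<in> hom X X" "idn B \<in> hom B B" "z X B \<in> hom X B" "z B X \<in> hom B X" using ob by auto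
  note L = inl[OF ob(2,1)] and R = inr[OF ob(2,1)]
  note pp = p_in[OF ob(2,1)]
  define w where "w = cp (inr X B) (inl X B)"
  have w: "w \<in> hom (sm B X) (pd X B)" unfolding w_def using L R by blast
  have wi: "w ** i1 B X = inr X B" "w ** i2 B X = inl X B" unfolding w_def using cp_i1[OF R(1) L(1)] cp_i2[OF R(1) L(1)] by auto
  have pw: "p1 X B ** w = cp (z B X) (idn X)" "p2 X B ** w = cp (idn B) (z X B)"
    unfolding w_def using cp_comp[OF R(1) L(1) pp(1)] cp_comp[OF R(1) L(1) pp(2)] L R by auto
  note kk = ka_in[OF ob] and k0 = ka_zero[OF ob]
  have jX: "cp j (idn X) \<in> hom (sm B X) X" using j ii by blast
  show ?thesis
  proof
    assume "\<exists>c. cooperates X B j c"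
    then obtain c where c: "cooperates X B j c" by blast
    note C = cooperatesD[OF c]
    have "c ** w = cp j (idn X)"
      unfolding w_def using cp_comp[OF R(1) L(1) C(2)] c by (simp add: cooperates_def inl_def inr_def)
    moreover have wk: "w ** ka B X = pair X B (cp (z B X) (idn X) ** ka B X) (z (fo B X) B)"
      by (rule pair_eqI[OF comp_in[OF kk w] ob(2,1)]) (use reassoc[OF pw(1)] reassoc[OF pw(2)] k0 in auto)
    moreover have "cp (z B X) (idn X) ** ka B X \<in> hom (fo B X) X" using ii kk by blast
    ultimately show "cp j (idn X) ** ka B X = cp (z B X) (idn X) ** ka B X" using C(5) by (metis assoc)
  next
    assume eq: "cp j (idn X) ** ka B X = cp (z B X) (idn X) ** ka B X"
    have "split_ext B (inr X B) (pd X B) (p1 X B) (inl X B) X"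
      unfolding split_ext_def using kernel_p1[OF ob(2,1)] pp L by (simp add: inr_def)
    from cover_split_ext[OF this] have cov': "cover (cp (inl X B) (inr X B)) (sm X B) (pd X B)" .
    \<comment> \<open>\<open>cover_split_ext\<close> concerns X + B with the summands in the other
      order; switching them by \<sigma> and cancelling shows that \<open>w\<close> is a
      cover.\<close>
    define \<sigma> where "\<sigma> = cp (i2 B X) (i1 B X)"
    have ib: "i2 B X \<in> hom X (sm B X)" "i1 B X \<in> hom B (sm B X)" using ob by auto
    have \<sigma>: "\<sigma> \<in> hom (sm X B) (sm B X)" unfolding \<sigma>_def using ib by blast
    have "w ** \<sigma> = cp (inl X B) (inr X B)" unfolding \<sigma>_def using cp_comp[OF ib w] wi by simp
    then have cov: "cover w (sm B X) (pd X B)" using cover_cancel[OF _ \<sigma> w] cov' by simp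
    have "cp j (idn X) ** x = z S X" if x: "x \<in> hom S (sm B X)" "w ** x = z S (pd X B)" for S x
    proof -
      have S: "S \<in> ob" using hom_ob x by blast
      have "p1 X B ** w ** x = z S X" "p2 X B ** w ** x = z S B" using x(2) z_r'[OF pp(1) S] z_r'[OF pp(2) S] by auto
      then have 1: "cp (z B X) (idn X) ** x = z S X" "cp (idn B) (z X B) ** x = z S B"
        using reassoc[OF pw(1)] reassoc[OF pw(2)] by auto
      obtain y where y: "y \<in> hom S (fo B X)" "ka B X ** y = x" by (rule kernelE[OF ka[OF ob] x(1) 1(2)])
      then show ?thesis using 1(1) eq by (metis assoc)
    qed
    then obtain c where c: "c \<in> hom (pd X B) X" "c ** w = cp j (idn X)" by (rule cover_cokernel[OF cov jX])
    have "c ** inl X B = idn X" "c ** inr X B = j"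
      using wi[symmetric] reassoc[OF c(2)] cp_i1[OF j ii(1)] cp_i2[OF j ii(1)] by auto
    then show "\<exists>c. cooperates X B j c" using j c unfolding cooperates_def inl_def inr_def by blast
  qed
qed

definition conj :: "'o => 'a" where
  "conj X = cp (idn X) (idn X) ** ka X X"

definition abelian :: "'o => bool" where
  "abelian X \<longleftrightarrow> (\<exists>m. cooperates X X (idn X) m)"

definition crossed_module :: "'o => 'o => 'a => 'a => bool" where
  "crossed_module X D d \<xi> \<longleftrightarrow> d \<in> hom X D \<and> act D X \<xi> \<and>
     d ** \<xi> = conj D ** fl (idn D) d \<and> \<xi> ** fl d (idn X) = conj X"

lemma abelian_group_exists:
  assumes "abelian B"
  obtains m i where "abelian_group B m i" using assms abelian_groupI unfolding abelian_def by blast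

lemma abelian_ob: "abelian X ==> X \<in> ob"
  unfolding abelian_def using cooperatesD(3) by blast

lemma abelian_iff: "X \<in> ob ==> abelian X \<longleftrightarrow> conj X = cp (z X X) (idn X) ** ka X X"
  unfolding abelian_def conj_def using central_iff[of "idn X" X X] by blast

lemma conj_in: "X \<in> ob ==> conj X \<in> hom (fo X X) X"
  unfolding conj_def by blast

lemma conj_natural:
  assumes "f \<in> hom X Y"
  shows "conj Y ** fl f f = f ** conj X"
proof -
  have i: "idn X \<in> hom X X" "idn Y \<in> hom Y Y" using hom_ob assms by blast+
  show ?thesis unfolding conj_def
    using cp_ka_fl[OF i(2,2) assms assms] reassoc[OF cp_comp[OF i(1,1) assms]] id_l[OF assms] id_r[OF assms] by simp
qed

lemma trivial_natural:
  assumes "f \<in> hom X Y" "g \<in> hom B B'"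
  shows "(cp (z B' Y) (idn Y) ** ka B' Y) ** fl g f = f ** cp (z B X) (idn X) ** ka B X"
proof -
  have i: "idn X \<in> hom X X" "idn Y \<in> hom Y Y" "z B' Y \<in> hom B' Y" "z B X \<in> hom B X" and ob: "B \<in> ob" "Y \<in> ob"
    using hom_ob[OF assms(1)] hom_ob[OF assms(2)] by auto
  show ?thesis
    using cp_ka_fl[OF i(3,2) assms(2,1)] reassoc[OF cp_comp[OF i(4,1) assms(1)]] id_l[OF assms(1)] id_r[OF assms(1)]
      z_l'[OF assms(2) ob(2)] z_r'[OF assms(1) ob(1)] by simp
qed

text \<open>Triviality of conjugation on \<open>Q\<close> is tested after the cover q \<flat> q,
  where naturality reduces it to triviality of conjugation on \<open>Y\<close>.\<close>

lemma abelian_quotient: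
  assumes Y: "abelian Y" and q: "cover q Y Q"
  shows "abelian Q"
proof -
  note qh = cover_in[OF q]
  have ob: "Y \<in> ob" "Q \<in> ob" using hom_ob qh by auto
  have iQ: "idn Q \<in> hom Q Q" "z Q Q \<in> hom Q Q" using ob by auto
  have "conj Q ** fl q q = (cp (z Q Q) (idn Q) ** ka Q Q) ** fl q q"
    using conj_natural[OF qh] trivial_natural[OF qh qh] Y abelian_iff[OF ob(1)] by simp
  then have "conj Q = cp (z Q Q) (idn Q) ** ka Q Q" by (rule coverD[OF cover_fl[OF q q]]) (use conj_in ob iQ in blast)+
  then show ?thesis using abelian_iff[OF ob(2)] by simp
qed

lemma abelian_product:
  assumes "abelian X" "abelian Y"
  shows "abelian (pd X Y)"
proof -
  note ob = abelian_ob[OF assms(1)] abelian_ob[OF assms(2)]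
  note pp = p_in[OF ob]
  have i: "idn (pd X Y) \<in> hom (pd X Y) (pd X Y)" "z (pd X Y) (pd X Y) \<in> hom (pd X Y) (pd X Y)" using pp by auto
  have "conj (pd X Y) = cp (z (pd X Y) (pd X Y)) (idn (pd X Y)) ** ka (pd X Y) (pd X Y)"
  proof (rule pd_eqI[OF conj_in[OF pp(3)] _ ob])
    show "p1 X Y ** conj (pd X Y) = p1 X Y ** cp (z (pd X Y) (pd X Y)) (idn (pd X Y)) ** ka (pd X Y) (pd X Y)"
      using conj_natural[OF pp(1)] trivial_natural[OF pp(1,1)] assms(1) abelian_iff[OF ob(1)] by simp
    show "p2 X Y ** conj (pd X Y) = p2 X Y ** cp (z (pd X Y) (pd X Y)) (idn (pd X Y)) ** ka (pd X Y) (pd X Y)"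
      using conj_natural[OF pp(2)] trivial_natural[OF pp(2,2)] assms(2) abelian_iff[OF ob(2)] by simp
  qed (use i pp in blast)
  then show ?thesis using abelian_iff[OF pp(3)] by simp
qed

text \<open>By the Peiffer identity, [u, 1] on B \<flat> X equals \<xi> (d u \<flat> 1), which
  depends on \<open>u\<close> only through d u. Since d j = 0 = d 0, the equation of
  \<open>central_iff\<close> holds for \<open>j\<close>.\<close>

lemma crossed_module_kernel_central:
  assumes cm: "crossed_module X D d \<xi>" and j: "j \<in> hom B X" and dj: "d ** j = z B D"
  obtains c where "cooperates X B j c"
proof -
  have d: "d \<in> hom X D" and peiffer: "\<xi> ** fl d (idn X) = conj X" and \<xi>: "act D X \<xi>"
    using cm by (auto simp: crossed_module_def)
  have ob: "B \<in> ob" "X \<in> ob" using hom_ob j by auto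
  have i: "idn X \<in> hom X X" "z B X \<in> hom B X" using ob by auto
  have "cp u (idn X) ** ka B X = \<xi> ** fl (d ** u) (idn X)" if u: "u \<in> hom B X" for u
    using cp_ka_fl[OF i(1,1) u i(1)] reassoc[OF peiffer, of "fl u (idn X)"] fl_comp[OF u i(1) d i(1)] id_l[OF u]
      id_l[OF i(1)] by (simp add: conj_def)
  then have "cp j (idn X) ** ka B X = cp (z B X) (idn X) ** ka B X" using dj j i z_r'[OF d ob(1)] by simp
  then show ?thesis using central_iff[OF j] that by blast
qed

text \<open>0 \<flat> h factors through the unit \<eta> of the monad, and an action composed with
  the unit is the identity.\<close>

lemma act_trivial:
  assumes \<phi>: "act C K \<phi>" and h: "h \<in> hom V K" and W: "W \<in> ob"
  shows "\<phi> ** fl (z W C) h = cp (z W K) h ** ka W V"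
proof -
  note a = actD[OF \<phi>]
  have V: "V \<in> ob" using hom_ob h by blast
  have zz: "z W C \<in> hom W C" "z W K \<in> hom W K" using W a by auto
  note i2 = i2_in[OF a(1,2)]
  have e: "cp (z W K) h ** ka W V \<in> hom (fo W V) K" using zz h W V by blast
  have "ka C K ** fl (z W C) h = ka C K ** eta C K ** cp (z W K) h ** ka W V"
    using ka_fl[OF zz(1) h] reassoc[OF ka_eta[OF a(1,2)]] reassoc[OF cp_comp[OF zz(2) h i2]]
      z_r'[OF i1_in[OF a(1,2)] W] z_r'[OF i2 W] by simp
  then have "fl (z W C) h = eta C K ** cp (z W K) h ** ka W V" by (rule ka_eqI) (use zz h a e eta_in[OF a(1,2)] in blast)+
  then show ?thesis using reassoc[OF a(4)] id_l[OF e] by simp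
qed

text \<open>Both identities are tested on the cover X \<times> B'. There the Peiffer identity splits
  into components: on \<open>X\<close> it is the given one; on \<open>B'\<close> the acting element
  d x becomes 0 in \<open>C\<close> and so acts trivially, and conjugation in the abelian object
  \<open>B'\<close> is trivial too.\<close>

lemma pushforward_crossed_module:
  assumes pf: "pushforward D X \<xi> B j B' (\<phi> ** fl p (idn B')) f X' \<zeta> q"
    and cm: "crossed_module X D d \<xi>" and \<phi>: "act C B' \<phi>" and p: "p \<in> hom D C" and pd': "p ** d = z X C"
    and B': "abelian B'" and d': "d' \<in> hom X' D" "d' ** q = d ** p1 X B'"
  shows "crossed_module X' D d' \<zeta>"
proof -
  note Q = pushforward_in[OF pf]
  have d: "d \<in> hom X D" and dx: "d ** \<xi> = conj D ** fl (idn D) d" and peiffer: "\<xi> ** fl d (idn X) = conj X"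
    and \<xi>: "act D X \<xi>" using cm by (auto simp: crossed_module_def)
  note a = actD[OF \<xi>] and b = actD[OF \<phi>] and \<zeta> = actD[OF Q(3)]
  note ob = a(2) b(2)
  note pp = p_in[OF ob]
  let ?P = "pd X B'" and ?\<pi> = "pact D X \<xi> B' (\<phi> ** fl p (idn B'))"
  have \<beta>: "act D B' (\<phi> ** fl p (idn B'))" by (rule act_restrict(1)[OF \<phi> p])
  note P = act_product[OF \<xi> \<beta>]
  have p1e: "p1 X B' ** ?\<pi> = \<xi> ** fl (idn D) (p1 X B')"
    and p2e: "p2 X B' ** ?\<pi> = \<phi> ** fl p (idn B') ** fl (idn D) (p2 X B')" using P(2,3) by (auto simp: am_def)
  have qe: "q ** ?\<pi> = \<zeta> ** fl (idn D) q" using Q(4) by (simp add: am_def)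
  have iD: "idn D \<in> hom D D" "conj D \<in> hom (fo D D) D" using a conj_in by auto
  have ii: "idn X \<in> hom X X" "idn B' \<in> hom B' B'" "idn ?P \<in> hom ?P ?P" "idn X' \<in> hom X' X'" using ob \<zeta> by auto
  have "(d' ** \<zeta>) ** fl (idn D) q = d ** p1 X B' ** ?\<pi>" using qe reassoc[OF d'(2), of ?\<pi>] by simp
  also have "\<dots> = conj D ** fl (idn D) (d' ** q)"
    using p1e reassoc[OF dx] fl_comp[OF iD(1) pp(1) iD(1) d] d'(2) id_l[OF iD(1)] by simp
  also have "\<dots> = (conj D ** fl (idn D) d') ** fl (idn D) q"
    using fl_comp[OF iD(1) Q(2) iD(1) d'(1)] id_l[OF iD(1)] by simp
  finally have 1: "d' ** \<zeta> = conj D ** fl (idn D) d'"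
    by (rule coverD[OF cover_fl_right[OF Q(1) a(1)]]) (use d' \<zeta> iD in blast)+
  have dp: "d ** p1 X B' \<in> hom ?P D" using d pp by blast
  note fdp = fl_in[OF dp ii(3)]
  have "?\<pi> ** fl (d ** p1 X B') (idn ?P) = conj ?P"
  proof (rule pd_eqI[OF _ conj_in[OF pp(3)] ob])
    have "p1 X B' ** ?\<pi> ** fl (d ** p1 X B') (idn ?P) = \<xi> ** fl (d ** p1 X B') (p1 X B')"
      using reassoc[OF p1e] fl_split(2)[OF dp pp(1)] by simp
    also have "\<dots> = conj X ** fl (p1 X B') (p1 X B')"
      using reassoc[OF peiffer, of "fl (p1 X B') (p1 X B')"] fl_comp[OF pp(1,1) d ii(1)] id_l[OF pp(1)] by simp
    finally show "p1 X B' ** ?\<pi> ** fl (d ** p1 X B') (idn ?P) = p1 X B' ** conj ?P" using conj_natural[OF pp(1)] by simp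
    have pdp: "p ** d ** p1 X B' = z ?P C" using reassoc[OF pd'] z_l'[OF pp(1) b(1)] by simp
    have "p2 X B' ** ?\<pi> ** fl (d ** p1 X B') (idn ?P) = \<phi> ** fl p (idn B') ** fl (d ** p1 X B') (p2 X B')"
      using reassoc[OF p2e] fl_split(2)[OF dp pp(2)] by simp
    also have "\<dots> = \<phi> ** fl (z ?P C) (p2 X B')" using fl_comp[OF dp pp(2) p ii(2)] pdp id_l[OF pp(2)] by simp
    also have "\<dots> = \<phi> ** fl (z B' C) (idn B') ** fl (p2 X B') (p2 X B')"
      using fl_comp[OF pp(2,2) z_in[OF b(2,1)] ii(2)] id_l[OF pp(2)] z_l'[OF pp(2) b(1)] by simp
    also have "\<dots> = conj B' ** fl (p2 X B') (p2 X B')"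
      using reassoc[OF act_trivial[OF \<phi> ii(2) b(2)], of "fl (p2 X B') (p2 X B')"] B' abelian_iff[OF b(2)] by simp
    finally show "p2 X B' ** ?\<pi> ** fl (d ** p1 X B') (idn ?P) = p2 X B' ** conj ?P" using conj_natural[OF pp(2)] by simp
  qed (use actD(3)[OF P(1)] fdp in blast)
  then have "q ** ?\<pi> ** fl (d ** p1 X B') (idn ?P) = q ** conj ?P" by simp
  moreover have "q ** ?\<pi> ** fl (d ** p1 X B') (idn ?P) = \<zeta> ** fl (d' ** q) q"
    using reassoc[OF qe] fl_split(2)[OF dp Q(2)] d'(2) by simp
  moreover have "\<dots> = (\<zeta> ** fl d' (idn X')) ** fl q q" using fl_comp[OF Q(2,2) d'(1) ii(4)] id_l[OF Q(2)] by simp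
  ultimately have "(\<zeta> ** fl d' (idn X')) ** fl q q = conj X' ** fl q q" using conj_natural[OF Q(2)] by simp
  then have 2: "\<zeta> ** fl d' (idn X') = conj X'"
    by (rule coverD[OF cover_fl[OF Q(1,1)]]) (use \<zeta> d' ii conj_in in blast)+
  show ?thesis unfolding crossed_module_def using 1 2 d' Q by blast
qed

section \<open>Crossed extensions\<close>

text \<open>The cooperator is (x, b) \<mapsto> x + j b for the addition of \<open>X\<close>.\<close>

lemma abelian_cooperates:
  assumes X: "abelian X" and j: "j \<in> hom B X"
  obtains c where "cooperates X B j c"
proof -
  obtain m where m: "cooperates X X (idn X) m" using X by (auto simp: abelian_def)
  note M = cooperatesD[OF m]
  have B: "B \<in> ob" using hom_ob j by blast
  note pp = p_in[OF M(3) B] and L = inl[OF M(3) B] and R = inr[OF M(3) B]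
  have jp: "j ** p2 X B \<in> hom (pd X B) X" using j pp by blast
  have iX: "idn X \<in> hom X X" using M by blast
  let ?c = "m ** pair X X (p1 X B) (j ** p2 X B)"
  have "?c ** inl X B = idn X" using cooperates_comp[OF m pp(1) jp L(1)] L(2,3) z_r'[OF j M(3)] M(5)[OF iX] by simp
  moreover have "?c ** inr X B = j" using cooperates_comp[OF m pp(1) jp R(1)] R(2,3) id_r[OF j] M(6)[OF j] id_l[OF j] by simp
  ultimately have "cooperates X B j ?c" using j cooperates_in[OF m pp(1) jp] by (simp add: cooperates_def inl_def inr_def)
  then show ?thesis by (rule that)
qed

definition exact :: "'a => 'a => 'o => 'o => 'o => bool" where
  "exact f g A B D \<longleftrightarrow> f \<in> hom A B \<and> g \<in> hom B D \<and>
     (\<exists>K k e. kernel g B D K k \<and> cover e A K \<and> f = k ** e)"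

definition act_module :: "'o => 'o => 'a => bool" where
  "act_module C B \<xi> \<longleftrightarrow> abelian B \<and> act C B \<xi>"

definition kernel_equivariant ::
    "'o => 'o => 'o => 'a => 'a => 'a => 'o => 'a => 'a => bool" where
  "kernel_equivariant C G1 G2 p d \<xi> B \<beta> c \<longleftrightarrow>
     (\<exists>K k \<phi> e. kernel d G2 G1 K k \<and> act_module C K \<phi> \<and>
        k ** \<phi> ** fl p (idn K) = \<xi> ** fl (idn G1) k \<and> k ** e = c \<and> am C B \<beta> (idn C) e C K \<phi>)"

text \<open>The clauses of \<open>is_xext\<close> other than those on values outside the index
  range, so that constructions may leave such values arbitrary; they are trimmed on the way back to
  \<open>C\<close>.\<close>

definition ext :: "nat => ('o, 'a) xext => bool" where
  "ext n E \<longleftrightarrow>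
     (\<forall>i\<in>{0..n+1}. xob E i \<in> ob) \<and>
     (\<forall>i\<in>{0..n}. xd E i \<in> hom (xob E (i+1)) (xob E i)) \<and>
     exact (z Z (xob E (n+1))) (xd E n) Z (xob E (n+1)) (xob E n) \<and>
     (\<forall>i\<in>{1..n}. exact (xd E i) (xd E (i-1)) (xob E (i+1)) (xob E i) (xob E (i-1))) \<and>
     exact (xd E 0) (z (xob E 0) Z) (xob E 1) (xob E 0) Z \<and>
     crossed_module (xob E 2) (xob E 1) (xd E 1) (xact E 2) \<and>
     (\<forall>i\<in>{3..n+1}. act_module (xob E 0) (xob E i) (xact E i)) \<and>
     kernel_equivariant (xob E 0) (xob E 1) (xob E 2) (xd E 0) (xd E 1) (xact E 2) (xob E 3) (xact E 3) (xd E 2) \<and>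
     (\<forall>i\<in>{3..n}. am (xob E 0) (xob E (i+1)) (xact E (i+1)) (idn (xob E 0)) (xd E i) (xob E 0) (xob E i) (xact E i))"

definition ext_mor :: "nat => ('o, 'a) xext => (nat => 'a) => ('o, 'a) xext => bool" where
  "ext_mor n E f E' \<longleftrightarrow>
     (\<forall>i\<in>{0..n+1}. f i \<in> hom (xob E i) (xob E' i)) \<and>
     (\<forall>i\<in>{0..n}. f i ** xd E i = xd E' i ** f (i+1)) \<and>
     am (xob E 1) (xob E 2) (xact E 2) (f 1) (f 2) (xob E' 1) (xob E' 2) (xact E' 2) \<and>
     (\<forall>i\<in>{3..n+1}. am (xob E 0) (xob E i) (xact E i) (f 0) (f i) (xob E' 0) (xob E' i) (xact E' i))"

lemma exact_comp_zero:
  assumes "exact f g A B D"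
  shows "g ** f = z A D"
proof -
  obtain K k e where e: "kernel g B D K k" "cover e A K" "f = k ** e" using assms by (auto simp: exact_def)
  note ki = kernel_in[OF e(1)]
  show ?thesis using e(3) reassoc[OF ki(4)] z_l'[OF cover_in[OF e(2)]] hom_ob[OF ki(1)] by simp
qed

lemma exact_zero_monic:
  assumes "exact (z Z A) g Z A D"
  shows "monic g A D"
proof -
  obtain K k e where e: "kernel g A D K k" "cover e Z K" "z Z A = k ** e" and g: "g \<in> hom A D"
    using assms by (auto simp: exact_def)
  note ki = kernel_in[OF e(1)] and eh = cover_in[OF e(2)]
  have ob: "K \<in> ob" "A \<in> ob" using hom_ob ki by auto
  have "k ** e = z K A ** e" using e(3) z_l'[OF eh ob(2)] by simp
  then have k: "k = z K A" by (rule coverD[OF e(2)]) (use ki ob in blast)+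
  show ?thesis
  proof (rule monic_if_kernel_zero[OF g])
    fix T x assume x: "x \<in> hom T A" "g ** x = z T D"
    obtain y where "y \<in> hom T K" "k ** y = x" by (rule kernelE[OF e(1) x])
    then show "x = z T A" using k z_l' ob by auto
  qed
qed

lemma monic_exact_zero:
  assumes g: "monic g A D"
  shows "exact (z Z A) g Z A D"
proof -
  note gh = monic_in[OF g]
  have ob: "A \<in> ob" "D \<in> ob" using hom_ob gh by auto
  have zz: "z Z A \<in> hom Z A" using ob by blast
  have "kernel g A D Z (z Z A)" unfolding kernel_def
  proof (intro conjI allI impI)
    show "monic (z Z A) Z A" unfolding monic_def using zz Z_terminal by metis
    show "g ** z Z A = z Z D" using z_r'[OF gh Z_ob] .
    fix T t assume t: "t \<in> hom T A" "g ** t = z T D"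
    have T: "T \<in> ob" using hom_ob t by blast
    have tz: "z T Z \<in> hom T Z" using T by blast
    have "g ** t = g ** z T A" using t z_r'[OF gh T] by simp
    then have "t = z T A" by (rule monicD[OF g]) (use t T ob in blast)+
    then show "\<exists>h\<in>hom T Z. z Z A ** h = t" using z_l'[OF tz ob(1)] tz by blast
  qed (fact gh)
  moreover have "z Z A = z Z A ** idn Z" using id_r[OF zz] by simp
  ultimately show ?thesis unfolding exact_def using zz gh isom_cover[OF isom_id[OF Z_ob]] by blast
qed

lemma exact_kernel:
  assumes "exact f g A B D" "monic f A B"
  shows "kernel g B D A f"
proof -
  obtain K k e where e: "kernel g B D K k" "cover e A K" "f = k ** e" using assms by (auto simp: exact_def)
  note eh = cover_in[OF e(2)]
  have "monic e A K" unfolding monic_def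
  proof (intro conjI allI impI)
    fix T x y assume *: "x \<in> hom T A" "y \<in> hom T A" "e ** x = e ** y"
    then have "f ** x = f ** y" using e(3) by simp
    then show "x = y" by (rule monicD[OF assms(2)]) (use * in blast)+
  qed (fact eh)
  moreover have "cover (e ** idn A) A K" using id_r[OF eh] e by simp
  ultimately have "isom e A K" using monic_cover_isom[of e A K "idn A" A] hom_ob[OF eh] by blast
  from kernel_comp_isom[OF e(1) this] e(3) show ?thesis by simp
qed

lemma kernel_exact:
  assumes "kernel g B D A f"
  shows "exact f g A B D"
proof -
  note ki = kernel_in[OF assms]
  have "cover (idn A) A A" using isom_cover[OF isom_id] hom_ob[OF ki(2)] by blast
  moreover have "f = f ** idn A" using id_r[OF ki(2)] by simp
  ultimately show ?thesis unfolding exact_def using assms ki by blast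
qed

lemma exact_cover_iff:
  assumes A: "A \<in> ob" and f: "f \<in> hom B A"
  shows "exact f (z A Z) B A Z \<longleftrightarrow> cover f B A"
proof -
  have iA: "idn A \<in> hom A A" and zA: "z A Z \<in> hom A Z" using A by auto
  show ?thesis
  proof
    assume "exact f (z A Z) B A Z"
    then obtain K k e where e: "kernel (z A Z) A Z K k" "cover e B K" "f = k ** e" by (auto simp: exact_def)
    note ki = kernel_in[OF e(1)]
    obtain s where "s \<in> hom A K" "k ** s = idn A" by (rule kernelE[OF e(1) iA]) (use id_r[OF zA] in blast)+
    from cover_comp_isom[OF e(2) monic_split_isom[OF ki(3) this]] e(3) show "cover f B A" by simp
  next
    assume f: "cover f B A"
    have "kernel (z A Z) A Z A (idn A)" unfolding kernel_def
    proof (intro conjI allI impI)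
      show "monic (idn A) A A" using isom_monic[OF isom_id[OF A]] .
      fix T t assume "t \<in> hom T A"
      then show "\<exists>h\<in>hom T A. idn A ** h = t" using id_l by blast
    qed (use zA id_r in auto)
    moreover have "f = idn A ** f" using id_l[OF cover_in[OF f]] by simp
    ultimately show "exact f (z A Z) B A Z" unfolding exact_def using f cover_in[OF f] zA by blast
  qed
qed

text \<open>Along \<open>p\<close> an action of \<open>C\<close> becomes one of \<open>G1\<close>,
  and composing with the kernel inclusion turns equivariance of the corestriction over
  \<open>C\<close> into equivariance over \<open>G1\<close> of the map into \<open>G2\<close>
  itself. In this form n = 2 resembles the higher cases.\<close>

lemma kernel_equivariant_am:
  assumes "kernel_equivariant C G1 G2 p d \<xi> B \<beta> c" and \<beta>: "act C B \<beta>" and p: "p \<in> hom G1 C" and \<xi>: "act G1 G2 \<xi>"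
  shows "am G1 B (\<beta> ** fl p (idn B)) (idn G1) c G1 G2 \<xi>"
proof -
  obtain K k \<phi> e where k: "kernel d G2 G1 K k" and m: "act_module C K \<phi>"
    and eq: "k ** \<phi> ** fl p (idn K) = \<xi> ** fl (idn G1) k" "k ** e = c" and e: "am C B \<beta> (idn C) e C K \<phi>"
    using assms(1) by (auto simp: kernel_equivariant_def)
  note ki = kernel_in[OF k] and x = actD[OF \<xi>]
  have \<phi>: "act C K \<phi>" using m by (simp add: act_module_def)
  have eh: "e \<in> hom B K" "e ** \<beta> = \<phi> ** fl (idn C) e" using e by (auto simp: am_def)
  have iG: "idn G1 \<in> hom G1 G1" using x by blast
  have "c ** \<beta> ** fl p (idn B) = k ** \<phi> ** fl p (idn K) ** fl (idn G1) e"
    using eq(2)[symmetric] reassoc[OF eh(2)] fl_split[OF p eh(1)] by simp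
  also have "\<dots> = \<xi> ** fl (idn G1) k ** fl (idn G1) e" using eq(1) by (metis assoc)
  also have "\<dots> = \<xi> ** fl (idn G1) c" using fl_comp[OF iG eh(1) iG ki(2)] eq(2) id_l[OF iG] by simp
  finally show ?thesis unfolding am_def using iG eh ki eq(2) by auto
qed

lemma extD:
  assumes "ext n E" "n \<ge> 2"
  shows "i \<le> n + 1 ==> xob E i \<in> ob"
    "i \<le> n ==> xd E i \<in> hom (xob E (Suc i)) (xob E i)"
    "i < n ==> exact (xd E (Suc i)) (xd E i) (xob E (Suc (Suc i))) (xob E (Suc i)) (xob E i)"
    "monic (xd E n) (xob E (Suc n)) (xob E n)"
    "cover (xd E 0) (xob E 1) (xob E 0)"
    "crossed_module (xob E 2) (xob E 1) (xd E 1) (xact E 2)"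
    "3 \<le> i ==> i \<le> n + 1 ==> act_module (xob E 0) (xob E i) (xact E i)"
    "kernel_equivariant (xob E 0) (xob E 1) (xob E 2) (xd E 0) (xd E 1) (xact E 2) (xob E 3) (xact E 3) (xd E 2)"
    "3 \<le> i ==> i \<le> n ==>
       am (xob E 0) (xob E (Suc i)) (xact E (Suc i)) (idn (xob E 0)) (xd E i) (xob E 0) (xob E i) (xact E i)"
    "i < n ==> xd E i ** xd E (Suc i) = z (xob E (Suc (Suc i))) (xob E i)"
proof -
  note e = assms(1)[unfolded ext_def]
  show o: "i \<le> n + 1 ==> xob E i \<in> ob" for i using e by simp
  show d: "i \<le> n ==> xd E i \<in> hom (xob E (Suc i)) (xob E i)" for i using e by simp
  show x: "i < n ==> exact (xd E (Suc i)) (xd E i) (xob E (Suc (Suc i))) (xob E (Suc i)) (xob E i)" for i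
  proof -
    assume "i < n"
    then have i: "Suc i \<in> {1..n}" by simp
    have "\<forall>i\<in>{1..n}. exact (xd E i) (xd E (i-1)) (xob E (i+1)) (xob E i) (xob E (i-1))" using e by blast
    from bspec[OF this i] show ?thesis by simp
  qed
  show "i < n ==> xd E i ** xd E (Suc i) = z (xob E (Suc (Suc i))) (xob E i)" by (rule exact_comp_zero[OF x])
  show "monic (xd E n) (xob E (Suc n)) (xob E n)" using e exact_zero_monic by simp
  show "cover (xd E 0) (xob E 1) (xob E 0)" using e exact_cover_iff[OF o[of 0] d[of 0]] by simp
qed (use assms in \<open>auto simp: ext_def\<close>)

lemma ext_morD:
  assumes "ext_mor n E f E'" "n \<ge> 2"
  shows "i \<le> n + 1 ==> f i \<in> hom (xob E i) (xob E' i)"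
    "i \<le> n ==> f i ** xd E i = xd E' i ** f (Suc i)"
    "am (xob E 1) (xob E 2) (xact E 2) (f 1) (f 2) (xob E' 1) (xob E' 2) (xact E' 2)"
    "3 \<le> i ==> i \<le> n + 1 ==> am (xob E 0) (xob E i) (xact E i) (f 0) (f i) (xob E' 0) (xob E' i) (xact E' i)"
  using assms by (auto simp: ext_mor_def)

lemma ext_morI:
  assumes "\<And>i. i \<le> n + 1 ==> f i \<in> hom (xob E i) (xob E' i)"
    "\<And>i. i \<le> n ==> f i ** xd E i = xd E' i ** f (Suc i)"
    "am (xob E 1) (xob E 2) (xact E 2) (f 1) (f 2) (xob E' 1) (xob E' 2) (xact E' 2)"
    "\<And>i. 3 \<le> i ==> i \<le> n + 1 ==> am (xob E 0) (xob E i) (xact E i) (f 0) (f i) (xob E' 0) (xob E' i) (xact E' i)"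
  shows "ext_mor n E f E'"
  using assms by (auto simp: ext_mor_def)

lemma ext_act2: "ext n E ==> n \<ge> 2 ==> act (xob E 1) (xob E 2) (xact E 2)"
  using extD(6) by (simp add: crossed_module_def)

lemma ext_act: "ext n E ==> n \<ge> 2 ==> 3 \<le> i ==> i \<le> n + 1 ==> act (xob E 0) (xob E i) (xact E i)"
  using extD(7) by (simp add: act_module_def)

lemma ext_mor_id:
  assumes "ext n E" "n \<ge> 2"
  shows "ext_mor n E (\<lambda>i. idn (xob E i)) E"
proof (rule ext_morI)
  show "idn (xob E i) \<in> hom (xob E i) (xob E i)" if "i \<le> n + 1" for i using extD(1)[OF assms that] by blast
  show "idn (xob E i) ** xd E i = xd E i ** idn (xob E (Suc i))" if "i \<le> n" for i
    using id_l[OF extD(2)[OF assms that]] id_r[OF extD(2)[OF assms that]] by simp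
qed (use am_id ext_act2 ext_act assms in blast)+

lemma ext_mor_comp:
  assumes f: "ext_mor n E f E'" and g: "ext_mor n E' g E''" and n: "n \<ge> 2"
  shows "ext_mor n E (\<lambda>i. g i ** f i) E''"
proof (rule ext_morI)
  show "g i ** f i \<in> hom (xob E i) (xob E'' i)" if "i \<le> n + 1" for i
    using ext_morD(1)[OF f n that] ext_morD(1)[OF g n that] by blast
  show "(g i ** f i) ** xd E i = xd E'' i ** g (Suc i) ** f (Suc i)" if "i \<le> n" for i
    using ext_morD(2)[OF f n that] reassoc[OF ext_morD(2)[OF g n that]] by simp
qed (use am_comp ext_morD(3,4)[OF f n] ext_morD(3,4)[OF g n] in blast)+

lemma ext_mor_inverse:
  assumes E: "ext n E" and E': "ext n E'" and t: "ext_mor n E t E'" and n: "n \<ge> 2"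
    and iso: "\<And>i. i \<le> n + 1 ==> isom (t i) (xob E i) (xob E' i)"
  obtains s where "ext_mor n E' s E" "\<And>i. i \<le> n + 1 ==> s i \<in> hom (xob E' i) (xob E i)"
    "\<And>i. i \<le> n + 1 ==> s i ** t i = idn (xob E i)" "\<And>i. i \<le> n + 1 ==> t i ** s i = idn (xob E' i)"
proof -
  have "\<forall>i. \<exists>s. i \<le> n + 1 --> s \<in> hom (xob E' i) (xob E i) \<and> s ** t i = idn (xob E i) \<and> t i ** s = idn (xob E' i)"
    using iso unfolding isom_def by blast
  then obtain s where s: "\<And>i. i \<le> n + 1 ==> s i \<in> hom (xob E' i) (xob E i)"
    "\<And>i. i \<le> n + 1 ==> s i ** t i = idn (xob E i)" "\<And>i. i \<le> n + 1 ==> t i ** s i = idn (xob E' i)"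
    by metis
  have "ext_mor n E' s E"
  proof (rule ext_morI)
    show "s i ** xd E' i = xd E i ** s (Suc i)" if i: "i \<le> n" for i
    proof -
      note d = extD(2)[OF E n i] and d' = extD(2)[OF E' n i]
      have "xd E i ** s (Suc i) = s i ** t i ** xd E i ** s (Suc i)"
        using reassoc[OF s(2)[of i]] reassoc[OF id_l[OF d]] i by simp
      also have "\<dots> = s i ** xd E' i ** t (Suc i) ** s (Suc i)" using reassoc[OF ext_morD(2)[OF t n i]] by simp
      also have "\<dots> = s i ** xd E' i" using s(3)[of "Suc i"] i id_r[OF d'] by simp
      finally show ?thesis by simp
    qed
    show "am (xob E' 1) (xob E' 2) (xact E' 2) (s 1) (s 2) (xob E 1) (xob E 2) (xact E 2)"
      by (rule am_inverse[OF ext_morD(3)[OF t n]]) (use s n ext_act2[OF E n] ext_act2[OF E' n] actD in auto)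
    show "am (xob E' 0) (xob E' i) (xact E' i) (s 0) (s i) (xob E 0) (xob E i) (xact E i)"
      if "3 \<le> i" "i \<le> n + 1" for i by (rule am_inverse[OF ext_morD(4)[OF t n that]])
        (use s n that ext_act[OF E n that] ext_act[OF E' n that] actD in auto)
  qed (use s in blast)
  then show ?thesis using that s by blast
qed

section \<open>Reindexing of crossed extensions\<close>

definition ext_cartesian :: "nat => ('o, 'a) xext => (nat => 'a) => ('o, 'a) xext => bool" where
  "ext_cartesian n E' f E \<longleftrightarrow> ext n E' \<and> ext n E \<and> ext_mor n E' f E \<and>
     (\<forall>i. 2 \<le> i --> i \<le> n + 1 --> isom (f i) (xob E' i) (xob E i)) \<and>
     pullback (xd E 0) (f 0) (xob E 1) (xob E' 0) (xob E 0) (xob E' 1) (f 1) (xd E' 0)"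

text \<open>The factorization is \<open>u\<close> in degree 0, the arrow into the pullback in degree
  1, and the inverse of \<open>f\<close> composed with \<open>g\<close> in higher degrees. The
  required equations are obtained by cancelling \<open>f\<close>, which is monic from degree 2
  on.\<close>

lemma ext_cartesian_factor:
  assumes c: "ext_cartesian n E' f E" and n: "n \<ge> 2" and F: "ext n F" and g: "ext_mor n F g E"
    and u: "u \<in> hom (xob F 0) (xob E' 0)" and fu: "f 0 ** u = g 0"
  obtains h where "ext_mor n F h E'" "h 0 = u" "\<And>i. i \<le> n + 1 ==> f i ** h i = g i"
proof -
  have E': "ext n E'" and f: "ext_mor n E' f E"
    and iso: "\<And>i. 2 \<le> i ==> i \<le> n + 1 ==> isom (f i) (xob E' i) (xob E i)"
    and pb: "pullback (xd E 0) (f 0) (xob E 1) (xob E' 0) (xob E 0) (xob E' 1) (f 1) (xd E' 0)"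
    using c by (auto simp: ext_cartesian_def)
  have "\<forall>i. \<exists>s. 2 \<le> i \<and> i \<le> n + 1 --> s \<in> hom (xob E i) (xob E' i) \<and> f i ** s = idn (xob E i)"
    using iso unfolding isom_def by blast
  then obtain s where s: "\<And>i. 2 \<le> i ==> i \<le> n + 1 ==> s i \<in> hom (xob E i) (xob E' i)"
    "\<And>i. 2 \<le> i ==> i \<le> n + 1 ==> f i ** s i = idn (xob E i)" by metis
  note gh = ext_morD(1)[OF g n]
  have ud: "u ** xd F 0 \<in> hom (xob F 1) (xob E' 0)" using u extD(2)[OF F n, of 0] by auto
  have "xd E 0 ** g 1 = f 0 ** u ** xd F 0" using ext_morD(2)[OF g n, of 0] reassoc[OF fu] by simp
  then obtain h1 where h1: "h1 \<in> hom (xob F 1) (xob E' 1)" "f 1 ** h1 = g 1" "xd E' 0 ** h1 = u ** xd F 0"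
    using pullbackE[OF pb gh[of 1] ud] by auto
  define h where "h = (\<lambda>i. if i = 0 then u else if i = 1 then h1 else s i ** g i)"
  have hh: "h i \<in> hom (xob F i) (xob E' i)" if "i \<le> n + 1" for i
    using u h1 s(1)[of i] gh[of i] that by (auto simp: h_def)
  have fh': "f i ** h i = g i" if i: "i \<le> n + 1" for i
  proof -
    consider "i = 0" | "i = 1" | "2 \<le> i" by linarith
    then show ?thesis
    proof cases
      case 3 then show ?thesis using reassoc[OF s(2)[OF 3 i]] id_l[OF gh[OF i]] by (simp add: h_def)
    qed (use fu h1 in \<open>auto simp: h_def\<close>)
  qed
  have cancel: "x = y" if "2 \<le> i" "i \<le> n + 1" "f i ** x = f i ** y" "x \<in> hom T (xob E' i)" "y \<in> hom T (xob E' i)" for i x y T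
    using monicD[OF isom_monic[OF iso[OF that(1,2)]]] that by blast
  have am: "am A (xob F i) \<alpha> e (h i) B (xob E' i) \<beta>"
    if i: "2 \<le> i" "i \<le> n + 1" and fa: "am B (xob E' i) \<beta> e' (f i) D (xob E i) \<epsilon>"
      and ga: "am A (xob F i) \<alpha> (e' ** e) (g i) D (xob E i) \<epsilon>" and e: "e \<in> hom A B"
      and \<alpha>: "\<alpha> \<in> hom (fo A (xob F i)) (xob F i)" and \<beta>: "\<beta> \<in> hom (fo B (xob E' i)) (xob E' i)" for i A \<alpha> e B \<beta> e' D \<epsilon>
    by (rule am_cancel[OF isom_monic[OF iso[OF i]] fa _ e hh[OF i(2)] \<alpha> \<beta>]) (use ga fh'[OF i(2)] in simp)
  have "ext_mor n F h E'"
  proof (rule ext_morI[OF hh])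
    show "h i ** xd F i = xd E' i ** h (Suc i)" if i: "i \<le> n" for i
    proof -
      note dF = extD(2)[OF F n i] and dE' = extD(2)[OF E' n i]
      have hs: "h i \<in> hom (xob F i) (xob E' i)" "h (Suc i) \<in> hom (xob F (Suc i)) (xob E' (Suc i))" using hh i by auto
      have eq: "f i ** h i ** xd F i = f i ** xd E' i ** h (Suc i)"
        using reassoc[OF fh'[of i]] fh'[of "Suc i"] ext_morD(2)[OF g n i] reassoc[OF ext_morD(2)[OF f n i]] i by simp
      have ty: "h i ** xd F i \<in> hom (xob F (Suc i)) (xob E' i)" "xd E' i ** h (Suc i) \<in> hom (xob F (Suc i)) (xob E' i)"
        using hs dF dE' by blast+
      consider "i = 0" | "i = 1" | "2 \<le> i" by linarith
      then show ?thesis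
      proof cases
        case 1 then show ?thesis using h1 by (simp add: h_def)
      next
        case 2
        \<comment> \<open>In degree 1 the map \<open>f 1\<close> need not be monic, so the other
          pullback projection \<open>xd E' 0\<close> is used as well; after it both sides vanish
          because consecutive differentials compose to zero.\<close>
        have "xd E' 0 ** xd E' (Suc 0) = z (xob E' 2) (xob E' 0)" "xd F 0 ** xd F (Suc 0) = z (xob F 2) (xob F 0)"
          using extD(10)[OF E' n, of 0] extD(10)[OF F n, of 0] n by (auto simp: numeral_2_eq_2)
        note zz = this
        have h2: "h 2 \<in> hom (xob F 2) (xob E' 2)" "xob F 2 \<in> ob" "xob E' 0 \<in> ob" using hh[of 2] n hom_ob u by auto
        have "xd E' 0 ** h 1 ** xd F 1 = xd E' 0 ** xd E' 1 ** h 2"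
          using reassoc[OF h1(3)] zz reassoc[OF zz(1)] z_l'[OF h2(1,3)] z_r'[OF u h2(2)] by (simp add: h_def)
        moreover have "Suc 1 = 2" by simp
        ultimately show ?thesis using pullback_eqI[OF pb] eq ty unfolding 2 by metis
      next
        case 3
        show ?thesis by (rule cancel[OF 3 _ eq ty]) (use i in simp)
      qed
    qed
    show "am (xob F 1) (xob F 2) (xact F 2) (h 1) (h 2) (xob E' 1) (xob E' 2) (xact E' 2)"
      by (rule am[OF _ _ ext_morD(3)[OF f n]])
        (use n ext_morD(3)[OF g n] fh'[of 1] hh[of 1] actD(3)[OF ext_act2[OF F n]] actD(3)[OF ext_act2[OF E' n]] in auto)
    show "am (xob F 0) (xob F i) (xact F i) (h 0) (h i) (xob E' 0) (xob E' i) (xact E' i)"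
      if i: "3 \<le> i" "i \<le> n + 1" for i by (rule am[OF _ i(2) ext_morD(4)[OF f n i]])
        (use i n ext_morD(4)[OF g n i] fh'[of 0] hh[of 0] actD(3)[OF ext_act[OF F n i]] actD(3)[OF ext_act[OF E' n i]] in auto)
  qed
  moreover have "h 0 = u" by (simp add: h_def)
  ultimately show ?thesis using that fh' by blast
qed

lemma ext_cartesian_unique:
  assumes c: "ext_cartesian n E' f E" and n: "n \<ge> 2"
    and g: "ext_mor n F g E'" and h: "ext_mor n F h E'" and 0: "g 0 = h 0"
    and eq: "\<And>i. i \<le> n + 1 ==> f i ** g i = f i ** h i" and F: "ext n F" and i: "i \<le> n + 1"
  shows "g i = h i"
proof -
  have iso: "\<And>i. 2 \<le> i ==> i \<le> n + 1 ==> isom (f i) (xob E' i) (xob E i)"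
    and pb: "pullback (xd E 0) (f 0) (xob E 1) (xob E' 0) (xob E 0) (xob E' 1) (f 1) (xd E' 0)"
    using c by (auto simp: ext_cartesian_def)
  note gh = ext_morD(1)[OF g n] and hh = ext_morD(1)[OF h n]
  consider "i = 0" | "i = 1" | "2 \<le> i" by linarith
  then show ?thesis
  proof cases
    case 1 then show ?thesis using 0 by simp
  next
    case 2
    have "xd E' 0 ** g 1 = xd E' 0 ** h 1" using ext_morD(2)[OF g n, of 0] ext_morD(2)[OF h n, of 0] 0 by simp
    then have "g 1 = h 1" by (intro pullback_eqI[OF pb eq]) (use gh[of 1] hh[of 1] in auto)
    then show ?thesis using 2 by simp
  next
    case 3
    show ?thesis by (rule monicD[OF isom_monic[OF iso[OF 3 i]] eq[OF i] gh[OF i] hh[OF i]])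
  qed
qed

lemma extI:
  assumes n: "n \<ge> 2"
    and ob: "\<And>i. i \<le> n + 1 ==> xob E i \<in> ob"
    and d: "\<And>i. i \<le> n ==> xd E i \<in> hom (xob E (Suc i)) (xob E i)"
    and mono: "monic (xd E n) (xob E (Suc n)) (xob E n)"
    and ex: "\<And>i. i < n ==> exact (xd E (Suc i)) (xd E i) (xob E (Suc (Suc i))) (xob E (Suc i)) (xob E i)"
    and cov: "cover (xd E 0) (xob E 1) (xob E 0)"
    and "crossed_module (xob E 2) (xob E 1) (xd E 1) (xact E 2)"
    and "\<And>i. 3 \<le> i ==> i \<le> n + 1 ==> act_module (xob E 0) (xob E i) (xact E i)"
    and "kernel_equivariant (xob E 0) (xob E 1) (xob E 2) (xd E 0) (xd E 1) (xact E 2) (xob E 3) (xact E 3) (xd E 2)"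
    and "\<And>i. 3 \<le> i ==> i \<le> n ==>
       am (xob E 0) (xob E (Suc i)) (xact E (Suc i)) (idn (xob E 0)) (xd E i) (xob E 0) (xob E i) (xact E i)"
  shows "ext n E"
proof -
  have "exact (xd E i) (xd E (i-1)) (xob E (i+1)) (xob E i) (xob E (i-1))" if "i \<in> {1..n}" for i
    using ex[of "i - 1"] that by auto
  moreover have "exact (z Z (xob E (n+1))) (xd E n) Z (xob E (n+1)) (xob E n)" using monic_exact_zero[OF mono] by simp
  moreover have "exact (xd E 0) (z (xob E 0) Z) (xob E 1) (xob E 0) Z" using exact_cover_iff[OF ob[of 0] d[of 0]] cov by simp
  ultimately show ?thesis unfolding ext_def using assms by simp
qed

lemma am_restrict:
  assumes b: "am C M \<mu> \<gamma> b C' N \<kappa>" and p: "p \<in> hom D C" "p' \<in> hom D' C'" "\<delta> \<in> hom D D'" "p' ** \<delta> = \<gamma> ** p"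
  shows "am D M (\<mu> ** fl p (idn M)) \<delta> b D' N (\<kappa> ** fl p' (idn N))"
proof -
  have 1: "\<gamma> \<in> hom C C'" "b \<in> hom M N" "b ** \<mu> = \<kappa> ** fl \<gamma> b" using b by (auto simp: am_def)
  have i: "idn M \<in> hom M M" "idn N \<in> hom N N" using hom_ob 1 by blast+
  have "b ** \<mu> ** fl p (idn M) = \<kappa> ** fl p' (idn N) ** fl \<delta> b"
    using reassoc[OF 1(3)] fl_comp[OF p(1) i(1) 1(1,2)] fl_comp[OF p(3) 1(2) p(2) i(2)] p(4) id_l[OF 1(2)] id_r[OF 1(2)]
    by simp
  then show ?thesis using 1 p by (simp add: am_def)
qed

lemma am_restrict_id:
  assumes "am C M \<mu> (idn C) b C N \<kappa>" "\<gamma> \<in> hom D C"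
  shows "am D M (\<mu> ** fl \<gamma> (idn M)) (idn D) b D N (\<kappa> ** fl \<gamma> (idn N))"
  by (rule am_restrict[OF assms(1,2,2)]) (use assms(2) hom_ob id_l id_r in auto)

text \<open>The boundary identity is compared after both pullback projections: after
  \<open>q1\<close> it is the given one, and after \<open>q2\<close> both sides vanish. The Peiffer
  identity carries over because q1 \<delta> = d.\<close>

lemma crossed_module_pullback:
  assumes cm: "crossed_module G2 G1 d \<xi>" and pb: "pullback p \<gamma> G1 C' C P q1 q2"
    and \<delta>: "\<delta> \<in> hom G2 P" "q1 ** \<delta> = d" "q2 ** \<delta> = z G2 C'"
  shows "crossed_module G2 P \<delta> (\<xi> ** fl q1 (idn G2))"
proof -
  have d: "d \<in> hom G2 G1" and \<xi>: "act G1 G2 \<xi>" and de: "d ** \<xi> = conj G1 ** fl (idn G1) d"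
    and pe: "\<xi> ** fl d (idn G2) = conj G2" using cm by (auto simp: crossed_module_def)
  note a = actD[OF \<xi>] and Pin = pullback_in[OF pb]
  have i: "idn G2 \<in> hom G2 G2" "idn P \<in> hom P P" "idn G1 \<in> hom G1 G1" and C': "C' \<in> ob" using a Pin hom_ob by auto
  let ?\<xi> = "\<xi> ** fl q1 (idn G2)"
  note r = act_restrict(1)[OF \<xi> Pin(3)]
  note f1 = fl_in[OF i(2) \<delta>(1)]
  have "\<delta> ** ?\<xi> = conj P ** fl (idn P) \<delta>"
  proof (rule pullback_eqI[OF pb])
    have "q1 ** \<delta> ** ?\<xi> = conj G1 ** fl q1 d"
      using reassoc[OF \<delta>(2)] reassoc[OF de] fl_comp[OF Pin(3) i(1) i(3) d] id_l[OF Pin(3)] id_r[OF d] by simp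
    then show "q1 ** \<delta> ** ?\<xi> = q1 ** conj P ** fl (idn P) \<delta>"
      using reassoc[OF conj_natural[OF Pin(3)], of "fl (idn P) \<delta>"] fl_comp[OF i(2) \<delta>(1) Pin(3,3)] \<delta>(2) id_r[OF Pin(3)] by simp
    have "q2 ** conj P ** fl (idn P) \<delta> = conj C' ** z (fo P G2) (fo C' C')"
      using reassoc[OF conj_natural[OF Pin(4)], of "fl (idn P) \<delta>"] fl_comp[OF i(2) \<delta>(1) Pin(4,4)] \<delta>(3) id_r[OF Pin(4)]
        fl_zero[OF Pin(4) a(2) C'] by simp
    then show "q2 ** \<delta> ** ?\<xi> = q2 ** conj P ** fl (idn P) \<delta>"
      using reassoc[OF \<delta>(3)] z_l'[OF actD(3)[OF r] C'] z_r'[OF conj_in[OF C'] fo_ob[OF Pin(6) a(2)]] by simp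
  qed (use \<delta> actD(3)[OF r] conj_in[OF Pin(6)] f1 in blast)+
  moreover have "?\<xi> ** fl \<delta> (idn G2) = conj G2"
    using fl_comp[OF \<delta>(1) i(1) Pin(3) i(1)] \<delta>(2) id_l[OF i(1)] pe by simp
  ultimately show ?thesis using \<delta> r by (simp add: crossed_module_def)
qed

lemma ext_pullback:
  assumes E: "ext n E" and n: "n \<ge> 2" and \<gamma>: "\<gamma> \<in> hom C' (xob E 0)"
  obtains E' f where "ext_cartesian n E' f E" "f 0 = \<gamma>" "xob E' 0 = C'"
proof -
  let ?G = "xob E" and ?d = "xd E" and ?a = "xact E"
  have d0: "?d 0 \<in> hom (?G 1) (?G 0)" and d1: "?d 1 \<in> hom (?G 2) (?G 1)"
    using extD(2)[OF E n, of 0] extD(2)[OF E n, of 1] n by (auto simp: numeral_2_eq_2)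
  have G: "?G 2 \<in> ob" "?G 1 \<in> ob" "?G 0 \<in> ob" "C' \<in> ob" using d1 hom_ob \<gamma> by blast+
  have ex0: "exact (?d 1) (?d 0) (?G 2) (?G 1) (?G 0)" and ex1: "exact (?d 2) (?d 1) (?G 3) (?G 2) (?G 1)"
    using extD(3)[OF E n, of 0] extD(3)[OF E n, of 1] n by (auto simp: numeral_2_eq_2 numeral_3_eq_3)
  obtain P q1 q2 where pb: "pullback (?d 0) \<gamma> (?G 1) C' (?G 0) P q1 q2" using pullbacks[OF d0 \<gamma>] by blast
  note Pin = pullback_in[OF pb]
  have zz: "z (?G 2) C' \<in> hom (?G 2) C'" using G by blast
  \<comment> \<open>The new boundary is (d, 0) from the second term to \<open>P\<close>. It has the
    same kernel as the old one, so the terms above survive unchanged, with the action in degree 2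
    restricted along \<open>q1\<close> and all others along \<gamma>.\<close>
  have "?d 0 ** ?d 1 = \<gamma> ** z (?G 2) C'" using exact_comp_zero[OF ex0] z_r'[OF \<gamma> G(1)] by simp
  then obtain \<delta> where \<delta>: "\<delta> \<in> hom (?G 2) P" "q1 ** \<delta> = ?d 1" "q2 ** \<delta> = z (?G 2) C'" using pullbackE[OF pb d1 zz] by blast
  define E' where "E' = \<lparr>xob = (\<lambda>i. if i = 0 then C' else if i = 1 then P else ?G i),
     xd = (\<lambda>i. if i = 0 then q2 else if i = 1 then \<delta> else ?d i),
     xact = (\<lambda>i. if i = 2 then ?a 2 ** fl q1 (idn (?G 2)) else ?a i ** fl \<gamma> (idn (?G i)))\<rparr>"
  define f where "f = (\<lambda>i. if i = 0 then \<gamma> else if i = 1 then q1 else idn (?G i))"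
  have E'ob: "xob E' 0 = C'" "xob E' 1 = P" "xob E' (Suc 0) = P" "\<And>i. 2 \<le> i ==> xob E' i = ?G i" "\<And>i. xob E' (Suc (Suc i)) = ?G (Suc (Suc i))"
    and E'd: "xd E' 0 = q2" "xd E' 1 = \<delta>" "xd E' (Suc 0) = \<delta>" "\<And>i. 2 \<le> i ==> xd E' i = ?d i" "\<And>i. xd E' (Suc (Suc i)) = ?d (Suc (Suc i))"
    and E'a: "xact E' 2 = ?a 2 ** fl q1 (idn (?G 2))" "\<And>i. 3 \<le> i ==> xact E' i = ?a i ** fl \<gamma> (idn (?G i))"
    by (auto simp: E'_def)
  have kern: "kernel \<delta> (?G 2) P K k" if k: "kernel (?d 1) (?G 2) (?G 1) K k" for K k
  proof -
    note ki = kernel_in[OF k]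
    have K: "K \<in> ob" using hom_ob ki by blast
    have "\<delta> ** k = z K P" by (rule pullback_eqI[OF pb])
        (use reassoc[OF \<delta>(2)] reassoc[OF \<delta>(3)] ki K \<delta> Pin z_l'[OF ki(2) G(4)] z_r'[OF Pin(3) K] z_r'[OF Pin(4) K] in auto)
    moreover have "\<exists>h\<in>hom T K. k ** h = t" if t: "t \<in> hom T (?G 2)" "\<delta> ** t = z T P" for T t
    proof -
      have "?d 1 ** t = z T (?G 1)" using t reassoc[OF \<delta>(2), of t] z_r'[OF Pin(3)] hom_ob[OF t(1)] by simp
      then show ?thesis using kernelE[OF k t(1)] by metis
    qed
    ultimately show ?thesis using \<delta> ki by (simp add: kernel_def)
  qed
  have ext: "ext n E'"
  proof (rule extI[OF n])
    show "xob E' i \<in> ob" if "i \<le> n + 1" for i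
      using extD(1)[OF E n that] G Pin by (auto simp: E'_def)
    show "xd E' i \<in> hom (xob E' (Suc i)) (xob E' i)" if "i \<le> n" for i
      using extD(2)[OF E n that] Pin \<delta> by (auto simp: E'_def numeral_2_eq_2)
    show "monic (xd E' n) (xob E' (Suc n)) (xob E' n)" using extD(4)[OF E n] n E'ob E'd by simp
    show "exact (xd E' (Suc i)) (xd E' i) (xob E' (Suc (Suc i))) (xob E' (Suc i)) (xob E' i)" if i: "i < n" for i
    proof -
      consider "i = 0" | "i = 1" | "2 \<le> i" by linarith
      then show ?thesis
      proof cases
        case 1
        \<comment> \<open>The kernel of \<open>q2\<close> is the kernel of the old projection,
          embedded in \<open>P\<close> by (k, 0), and \<delta> factors through it by the same cover
          \<open>e\<close>.\<close>
        obtain K k e where k: "kernel (?d 0) (?G 1) (?G 0) K k" and e: "cover e (?G 2) K" "?d 1 = k ** e"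
          using ex0 by (auto simp: exact_def)
        note ki = kernel_in[OF k] and eh = cover_in[OF e(1)]
        have K: "K \<in> ob" using hom_ob ki by blast
        have zK: "z K C' \<in> hom K C'" using K G by blast
        have "?d 0 ** k = \<gamma> ** z K C'" using ki z_r'[OF \<gamma> K] by simp
        then obtain k' where k': "k' \<in> hom K P" "q1 ** k' = k" "q2 ** k' = z K C'" using pullbackE[OF pb ki(2) zK] by blast
        have "kernel q2 P C' K k'" unfolding kernel_def
        proof (intro conjI allI impI)
          show "monic k' K P" using k' ki(3) unfolding monic_def by (metis assoc)
          fix T t assume t: "t \<in> hom T P" "q2 ** t = z T C'"
          have T: "T \<in> ob" using hom_ob t by blast
          have "?d 0 ** q1 ** t = \<gamma> ** q2 ** t" using Pin(5) by (metis assoc)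
          then have "?d 0 ** q1 ** t = z T (?G 0)" using t z_r'[OF \<gamma> T] by simp
          then obtain h where h: "h \<in> hom T K" "k ** h = q1 ** t" using kernelE[OF k comp_in[OF t(1) Pin(3)]] by blast
          have "k' ** h = t" by (rule pullback_eqI[OF pb])
              (use reassoc[OF k'(2)] reassoc[OF k'(3)] h k' t z_l'[OF h(1) G(4)] in auto)
          then show "\<exists>h\<in>hom T K. k' ** h = t" using h by blast
        qed (use Pin k' in auto)
        moreover have "\<delta> = k' ** e" by (rule pullback_eqI[OF pb])
            (use reassoc[OF k'(2)] reassoc[OF k'(3)] \<delta> e k' eh z_l'[OF eh G(4)] in auto)
        ultimately have "exact \<delta> q2 (?G 2) P C'" unfolding exact_def using \<delta> Pin e by blast
        then show ?thesis using 1 by (simp add: E'_def numeral_2_eq_2)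
      next
        case 2
        obtain K k e where k: "kernel (?d 1) (?G 2) (?G 1) K k" "cover e (?G 3) K" "?d 2 = k ** e" and d2: "?d 2 \<in> hom (?G 3) (?G 2)"
          using ex1 by (auto simp: exact_def)
        then have "exact (?d 2) \<delta> (?G 3) (?G 2) P" unfolding exact_def using \<delta> kern by blast
        then show ?thesis using 2 by (simp add: E'_def numeral_2_eq_2 numeral_3_eq_3)
      next
        case 3
        then show ?thesis using extD(3)[OF E n i] E'ob E'd by simp
      qed
    qed
    show "cover (xd E' 0) (xob E' 1) (xob E' 0)"
      using cover_pullback[OF pb extD(5)[OF E n]] E'ob E'd by simp
    show "crossed_module (xob E' 2) (xob E' 1) (xd E' 1) (xact E' 2)"
      using crossed_module_pullback[OF extD(6)[OF E n] pb \<delta>] E'ob E'd E'a by simp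
    show "act_module (xob E' 0) (xob E' i) (xact E' i)" if "3 \<le> i" "i \<le> n + 1" for i
      using extD(7)[OF E n that] act_restrict(1)[OF ext_act[OF E n that] \<gamma>] that E'ob E'a by (simp add: act_module_def)
    obtain K k \<phi> e where k: "kernel (?d 1) (?G 2) (?G 1) K k" and m: "act_module (?G 0) K \<phi>"
      and eq: "k ** \<phi> ** fl (?d 0) (idn K) = ?a 2 ** fl (idn (?G 1)) k" "k ** e = ?d 2"
      and e: "am (?G 0) (?G 3) (?a 3) (idn (?G 0)) e (?G 0) K \<phi>"
      using extD(8)[OF E n] by (auto simp: kernel_equivariant_def)
    have \<phi>: "act (?G 0) K \<phi>" using m by (simp add: act_module_def)
    note ki = kernel_in[OF k]
    have iK: "idn K \<in> hom K K" using hom_ob ki by blast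
    \<comment> \<open>The induced action on the kernel is the old one restricted along \<gamma>; the
      pullback square identifies the two ways of letting \<open>P\<close> act.\<close>
    have "k ** \<phi> ** fl \<gamma> (idn K) ** fl q2 (idn K) = k ** \<phi> ** fl (?d 0) (idn K) ** fl q1 (idn K)"
      using fl_comp[OF Pin(4) iK \<gamma> iK] fl_comp[OF Pin(3) iK d0 iK] Pin(5) by simp
    also have "\<dots> = (k ** \<phi> ** fl (?d 0) (idn K)) ** fl q1 (idn K)" by simp
    also have "\<dots> = ?a 2 ** fl (idn (?G 1)) k ** fl q1 (idn K)" unfolding eq(1) by simp
    also have "\<dots> = ?a 2 ** fl q1 (idn (?G 2)) ** fl (idn P) k" using fl_split[OF Pin(3) ki(2)] by simp
    finally have 1: "k ** \<phi> ** fl \<gamma> (idn K) ** fl q2 (idn K) = ?a 2 ** fl q1 (idn (?G 2)) ** fl (idn P) k" .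
    have 2: "act_module C' K (\<phi> ** fl \<gamma> (idn K))" using m act_restrict(1)[OF \<phi> \<gamma>] by (simp add: act_module_def)
    show "kernel_equivariant (xob E' 0) (xob E' 1) (xob E' 2) (xd E' 0) (xd E' 1) (xact E' 2) (xob E' 3) (xact E' 3) (xd E' 2)"
      unfolding kernel_equivariant_def using kern[OF k] 1 2 eq(2) am_restrict_id[OF e \<gamma>] E'ob E'd E'a
      by (intro exI[of _ K] exI[of _ k] exI[of _ "\<phi> ** fl \<gamma> (idn K)"] exI[of _ e]) simp
    show "am (xob E' 0) (xob E' (Suc i)) (xact E' (Suc i)) (idn (xob E' 0)) (xd E' i) (xob E' 0) (xob E' i) (xact E' i)"
      if "3 \<le> i" "i \<le> n" for i using am_restrict_id[OF extD(9)[OF E n that] \<gamma>] that E'ob E'd E'a by simp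
  qed
  have mor: "ext_mor n E' f E"
  proof (rule ext_morI)
    show "f i \<in> hom (xob E' i) (?G i)" if "i \<le> n + 1" for i
      using extD(1)[OF E n that] Pin by (auto simp: E'_def f_def)
    show "f i ** xd E' i = ?d i ** f (Suc i)" if "i \<le> n" for i
      using extD(2)[OF E n that] Pin \<delta> id_l id_r by (auto simp: E'_def f_def numeral_2_eq_2)
    show "am (xob E' 1) (xob E' 2) (xact E' 2) (f 1) (f 2) (?G 1) (?G 2) (?a 2)"
      using act_restrict(2)[OF ext_act2[OF E n] Pin(3)] E'ob E'a by (simp add: f_def)
    show "am (xob E' 0) (xob E' i) (xact E' i) (f 0) (f i) (?G 0) (?G i) (?a i)" if "3 \<le> i" "i \<le> n + 1" for i
      using act_restrict(2)[OF ext_act[OF E n that] \<gamma>] E'ob E'a that by (simp add: f_def)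
  qed
  have "ext_cartesian n E' f E" unfolding ext_cartesian_def
    using ext E mor pb isom_id[OF extD(1)[OF E n]] by (auto simp: E'_def f_def)
  then show ?thesis using that by (simp add: f_def E'ob)
qed

text \<open>The action relevant at the top of an extension: \<open>G\<^sub>n\<close> is acted on by \<open>tb\<close>, which is \<open>G\<^sub>1\<close> if
  \<open>n = 2\<close> and \<open>C\<close> otherwise, and \<open>tp\<close> is the map from it to \<open>C\<close>.\<close>

definition tb :: "nat => ('o, 'a) xext => 'o" where "tb n E = (if n = 2 then xob E 1 else xob E 0)"
definition tp :: "nat => ('o, 'a) xext => 'a" where "tp n E = (if n = 2 then xd E 0 else idn (xob E 0))"
definition tm :: "nat => (nat => 'a) => 'a" where "tm n g = (if n = 2 then g 1 else g 0)"

definition tact :: "nat => ('o, 'a) xext => 'o => 'a => 'a" where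
  "tact n E M \<mu> = \<mu> ** fl (tp n E) (idn M)"

text \<open>This packages what the pushforward needs in degree \<open>n\<close>, with one acting
  object for all \<open>n\<close>. Centrality of the inclusion of the module has two sources: the
  Peiffer identity for n = 2, and abelianness of the top term for n > 2.\<close>

lemma ext_top:
  assumes E: "ext n E" and n: "n \<ge> 2"
  shows "tp n E \<in> hom (tb n E) (xob E 0)"
    and "act (tb n E) (xob E n) (xact E n)"
    and "am (xob E 0) M \<mu> (idn (xob E 0)) b (xob E 0) N \<kappa> ==>
      am (tb n E) M (tact n E M \<mu>) (idn (tb n E)) b (tb n E) N (tact n E N \<kappa>)"
    and "act (xob E 0) M \<mu> ==> act (tb n E) M (tact n E M \<mu>)"
    and "am (tb n E) (xob E (Suc n)) (tact n E (xob E (Suc n)) (xact E (Suc n))) (idn (tb n E)) (xd E n)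
      (tb n E) (xob E n) (xact E n)"
    and "\<exists>c. cooperates (xob E n) (xob E (Suc n)) (xd E n) c"
    and "abelian (xob E (Suc n))" and "act (xob E 0) (xob E (Suc n)) (xact E (Suc n))"
    and "kernel (xd E (n - 1)) (xob E n) (xob E (n - 1)) (xob E (Suc n)) (xd E n)"
proof -
  show tp: "tp n E \<in> hom (tb n E) (xob E 0)"
    unfolding tp_def tb_def using extD(2)[OF E n, of 0] extD(1)[OF E n, of 0] by auto
  show "act (tb n E) (xob E n) (xact E n)"
    unfolding tb_def using ext_act2[OF E n] ext_act[OF E n, of n] n by (cases "n = 2") auto
  show "am (xob E 0) M \<mu> (idn (xob E 0)) b (xob E 0) N \<kappa> ==>
      am (tb n E) M (tact n E M \<mu>) (idn (tb n E)) b (tb n E) N (tact n E N \<kappa>)"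
    unfolding tact_def by (rule am_restrict_id[OF _ tp])
  show "act (xob E 0) M \<mu> ==> act (tb n E) M (tact n E M \<mu>)"
    unfolding tact_def by (rule act_restrict(1)[OF _ tp])
  show a: "act (xob E 0) (xob E (Suc n)) (xact E (Suc n))" using ext_act[OF E n, of "Suc n"] n by simp
  show "abelian (xob E (Suc n))" using extD(7)[OF E n, of "Suc n"] n by (simp add: act_module_def)
  show k: "kernel (xd E (n - 1)) (xob E n) (xob E (n - 1)) (xob E (Suc n)) (xd E n)"
    using exact_kernel[OF extD(3)[OF E n, of "n - 1"]] extD(4)[OF E n] n by simp
  have dn: "xd E n \<in> hom (xob E (Suc n)) (xob E n)" using extD(2)[OF E n] by simp
  note a' = actD[OF a]
  show "am (tb n E) (xob E (Suc n)) (tact n E (xob E (Suc n)) (xact E (Suc n))) (idn (tb n E)) (xd E n)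
      (tb n E) (xob E n) (xact E n)"
  proof (cases "n = 2")
    case True
    have d0: "xd E 0 \<in> hom (xob E 1) (xob E 0)" using extD(2)[OF E n, of 0] by simp
    have a3: "act (xob E 0) (xob E 3) (xact E 3)" using ext_act[OF E n, of 3] n by simp
    have "Suc 2 = (3::nat)" by simp
    then show ?thesis
      using True kernel_equivariant_am[OF extD(8)[OF E n] a3 d0 ext_act2[OF E n]] by (simp add: tact_def tb_def tp_def)
  next
    case False
    have "tact n E (xob E (Suc n)) (xact E (Suc n)) = xact E (Suc n)"
      using False fl_id[OF a'(1,2)] id_r[OF a'(3)] by (simp add: tact_def tp_def)
    then show ?thesis using False n extD(9)[OF E n, of n] by (simp add: tb_def)
  qed
  show "\<exists>c. cooperates (xob E n) (xob E (Suc n)) (xd E n) c"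
  proof (cases "n = 2")
    case True
    have "crossed_module (xob E n) (xob E 1) (xd E 1) (xact E n)" "xd E 1 ** xd E n = z (xob E (Suc n)) (xob E 1)"
      using extD(6)[OF E n] kernel_in(4)[OF k] True by auto
    then show ?thesis using crossed_module_kernel_central dn by metis
  next
    case False
    then have "abelian (xob E n)" using extD(7)[OF E n, of n] n by (simp add: act_module_def)
    then show ?thesis using abelian_cooperates dn by metis
  qed
qed

lemma ext_mor_top:
  assumes E: "ext n E" and F: "ext n F" and n: "n \<ge> 2" and g: "ext_mor n E g F"
  shows "tm n g \<in> hom (tb n E) (tb n F)"
    and "am (tb n E) (xob E n) (xact E n) (tm n g) (g n) (tb n F) (xob F n) (xact F n)"
    and "am (xob E 0) M \<mu> (g 0) b (xob F 0) N \<kappa> ==>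
       am (tb n E) M (tact n E M \<mu>) (tm n g) b (tb n F) N (tact n F N \<kappa>)"
proof -
  show t: "tm n g \<in> hom (tb n E) (tb n F)"
    unfolding tm_def tb_def using ext_morD(1)[OF g n, of 0] ext_morD(1)[OF g n, of 1] by auto
  show "am (tb n E) (xob E n) (xact E n) (tm n g) (g n) (tb n F) (xob F n) (xact F n)"
    unfolding tm_def tb_def using ext_morD(3)[OF g n] ext_morD(4)[OF g n, of n] n by (cases "n = 2") auto
  have g0: "g 0 \<in> hom (xob E 0) (xob F 0)" using ext_morD(1)[OF g n] by simp
  have "tp n F ** tm n g = g 0 ** tp n E"
    unfolding tp_def tm_def using ext_morD(2)[OF g n, of 0] id_l[OF g0] id_r[OF g0] by simp
  then show "am (xob E 0) M \<mu> (g 0) b (xob F 0) N \<kappa> ==>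
       am (tb n E) M (tact n E M \<mu>) (tm n g) b (tb n F) N (tact n F N \<kappa>)"
    unfolding tact_def by (intro am_restrict[OF _ ext_top(1)[OF E n] ext_top(1)[OF F n] t])
qed

text \<open>The class is described by a property, without reference to the construction in degree
  \<open>n\<close>, so that stability under reindexing becomes a matter of cancelling isomorphisms.
  Degree 0 is fixed strictly, which makes these morphisms vertical.\<close>

definition ext_push :: "nat => ('o, 'a) xext => (nat => 'a) => ('o, 'a) xext => bool" where
  "ext_push n E w E' \<longleftrightarrow> ext n E \<and> ext n E' \<and> ext_mor n E w E' \<and> xob E' 0 = xob E 0 \<and>
     w 0 = idn (xob E 0) \<and> (\<forall>i<n. isom (w i) (xob E i) (xob E' i))"

text \<open>From degree 2 on the reindexing maps are invertible and cancel from the square. In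
  degree 1 the inverse of \<open>v\<close> is induced by the pullback defining \<open>F\<close>: its
  first component is \<open>f'\<close> followed by the inverse of \<open>w\<close>, which is
  legitimate because \<open>f\<close> and \<open>f'\<close> agree in degree 0.\<close>

lemma ext_push_base_change:
  assumes n: "n \<ge> 2" and w: "ext_push n E w E'" and f: "ext_cartesian n F f E" and f': "ext_cartesian n F' f' E'"
    and v: "ext_mor n F v F'" and v0: "v 0 = idn (xob F 0)" and F0: "xob F' 0 = xob F 0"
    and sq: "\<And>i. i \<le> n + 1 ==> f' i ** v i = w i ** f i"
  shows "ext_push n F v F'"
proof -
  have wm: "ext_mor n E w E'" and w0: "w 0 = idn (xob E 0)" and E0: "xob E' 0 = xob E 0"
    and wi: "\<And>i. i < n ==> isom (w i) (xob E i) (xob E' i)" using w by (auto simp: ext_push_def)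
  have F: "ext n F" and fi: "\<And>i. 2 \<le> i ==> i \<le> n + 1 ==> isom (f i) (xob F i) (xob E i)"
    and pf: "pullback (xd E 0) (f 0) (xob E 1) (xob F 0) (xob E 0) (xob F 1) (f 1) (xd F 0)"
    using f by (auto simp: ext_cartesian_def)
  have F': "ext n F'" and fi': "\<And>i. 2 \<le> i ==> i \<le> n + 1 ==> isom (f' i) (xob F' i) (xob E' i)"
    and pf': "pullback (xd E' 0) (f' 0) (xob E' 1) (xob F 0) (xob E 0) (xob F' 1) (f' 1) (xd F' 0)"
    using f' F0 E0 by (auto simp: ext_cartesian_def)
  note p = pullback_in[OF pf] and p' = pullback_in[OF pf']
  have vh: "v i \<in> hom (xob F i) (xob F' i)" if "i \<le> n + 1" for i using ext_morD(1)[OF v n that] .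
  have "isom (v i) (xob F i) (xob F' i)" if i: "i < n" for i
  proof -
    consider "i = 0" | "i = 1" | "2 \<le> i" by linarith
    then show ?thesis
    proof cases
      case 1
      then show ?thesis using v0 F0 isom_id extD(1)[OF F n, of 0] by simp
    next
      case 2
      have "isom (w 1) (xob E 1) (xob E' 1)" using wi i 2 by simp
      then obtain s where s: "w 1 \<in> hom (xob E 1) (xob E' 1)" "s \<in> hom (xob E' 1) (xob E 1)" "s ** w 1 = idn (xob E 1)" "w 1 ** s = idn (xob E' 1)"
        by (auto simp: isom_def)
      have dw: "xd E 0 = xd E' 0 ** w 1" using ext_morD(2)[OF wm n, of 0] w0 id_l[OF p(1)] by simp
      have f0: "f' 0 = f 0" using sq[of 0] v0 w0 id_r id_l p(2) p'(2) by (metis le0)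
      have sf: "s ** f' 1 \<in> hom (xob F' 1) (xob E 1)" using s p' by blast
      have "xd E 0 ** s ** f' 1 = f 0 ** xd F' 0" using dw reassoc[OF s(4)] id_l[OF p'(3)] p'(5) f0 by simp
      then obtain h where h: "h \<in> hom (xob F' 1) (xob F 1)" "f 1 ** h = s ** f' 1" "xd F 0 ** h = xd F' 0"
        using pullbackE[OF pf sf p'(4)] by blast
      have v1: "v 1 \<in> hom (xob F 1) (xob F' 1)" "f' 1 ** v 1 = w 1 ** f 1" using vh[of 1] sq[of 1] by auto
      have dv: "xd F' 0 ** v 1 = xd F 0" using ext_morD(2)[OF v n, of 0] v0 id_l[OF p(4)] by simp
      have "h ** v 1 = idn (xob F 1)" by (rule pullback_eqI[OF pf])
          (use reassoc[OF h(2)] reassoc[OF h(3)] v1 dv h reassoc[OF s(3)] id_l[OF p(3)] id_r[OF p(3)] id_r[OF p(4)] p(6) in auto)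
      moreover have "v 1 ** h = idn (xob F' 1)" by (rule pullback_eqI[OF pf'])
          (use reassoc[OF v1(2)] reassoc[OF dv] v1 h reassoc[OF s(4)] id_l[OF p'(3)] id_r[OF p'(3)] id_r[OF p'(4)] p'(6) in auto)
      ultimately show ?thesis using 2 v1 h by (auto simp: isom_def)
    next
      case 3
      have "isom (f' i ** v i) (xob F i) (xob E' i)" using sq[of i] i isom_comp[OF fi wi] 3 by simp
      then show ?thesis by (rule isom_cancel_left[OF _ fi']) (use 3 i vh in auto)
    qed
  qed
  then show ?thesis using F F' v v0 F0 by (simp add: ext_push_def)
qed

section \<open>Pushforward of crossed extensions\<close>

text \<open>\<open>d\<close> and \<open>d'\<close> have the same regular image, since they agree on
  a common cover \<open>P\<close> of their domains.\<close>

lemma exact_factor_left: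
  assumes ex: "exact d g X Y W" and c: "cover q P X'" and pr: "cover r P X"
    and d': "d' \<in> hom X' Y" "d' ** q = d ** r"
  shows "exact d' g X' Y W"
proof -
  obtain K k e where k: "kernel g Y W K k" and e: "cover e X K" "d = k ** e" and dg: "d \<in> hom X Y" "g \<in> hom Y W"
    using ex by (auto simp: exact_def)
  note ki = kernel_in[OF k] and eh = cover_in[OF e(1)] and qh = cover_in[OF c] and rh = cover_in[OF pr]
  have ob: "W \<in> ob" "X' \<in> ob" using hom_ob dg d' by blast+
  have zz: "z X' W \<in> hom X' W" using ob by blast
  have gd: "g ** d = z X W" using exact_comp_zero[OF ex] .
  have "(g ** d') ** q = z X' W ** q" using d'(2) reassoc[OF gd] z_l'[OF rh ob(1)] z_l'[OF qh ob(1)] by simp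
  then have "g ** d' = z X' W" by (rule coverD[OF c]) (use dg d' zz in blast)+
  then obtain e' where e': "e' \<in> hom X' K" "k ** e' = d'" using kernelE[OF k d'(1)] by blast
  have "k ** e' ** q = k ** e ** r" using reassoc[OF e'(2)] d'(2) e(2) by simp
  then have "e' ** q = e ** r" by (rule monicD[OF ki(3)]) (use e' qh eh rh in blast)+
  then have "cover (e' ** q) P K" using cover_comp[OF pr e(1)] by simp
  then have "cover e' X' K" by (rule cover_cancel[OF _ qh e'(1)])
  then show ?thesis unfolding exact_def using d' dg k e'(2) by blast
qed

text \<open>Only the top term and the module change, so the case distinctions follow the place of
  the new term: it is the crossed module itself for n = 2, the source of the map into
  \<open>G2\<close> for n = 3, and a module mapping to a module for n > 3. The last two conclusions,
  joint epimorphy and existence of factorizations, are stated for the constructed extension and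
  transported to other ones later.\<close>

lemma ext_pushforward:
  assumes E: "ext n E" and n: "n \<ge> 2" and M: "act_module (xob E 0) M \<mu>"
    and f: "am (xob E 0) (xob E (Suc n)) (xact E (Suc n)) (idn (xob E 0)) f (xob E 0) M \<mu>"
  obtains E' w where "ext_push n E w E'" "xob E' (Suc n) = M" "xact E' (Suc n) = \<mu>" "w (Suc n) = f"
    "\<forall>T u v. u \<in> hom (xob E' n) T --> v \<in> hom (xob E' n) T --> u ** w n = v ** w n -->
       u ** xd E' n = v ** xd E' n --> u = v"
    "\<forall>F g b. ext n F --> ext_mor n E g F -->
       am (xob E 0) M \<mu> (g 0) b (xob F 0) (xob F (Suc n)) (xact F (Suc n)) --> b ** f = g (Suc n) -->
       (\<exists>h. ext_mor n E' h F \<and> (\<forall>i\<le>Suc n. h i ** w i = g i) \<and> h (Suc n) = b)"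
proof -
  let ?G = "xob E" and ?d = "xd E" and ?a = "xact E" and ?D = "tb n E"
  let ?X = "?G n" and ?B = "?G (Suc n)" and ?Y = "?G (n - 1)" and ?j = "?d n"
  note top = ext_top[OF E n]
  have \<mu>: "act (?G 0) M \<mu>" "abelian M" using M by (auto simp: act_module_def)
  obtain c where c: "cooperates ?X ?B ?j c" using top(6) by blast
  obtain m i where B: "abelian_group ?B m i" using abelian_group_exists[OF top(7)] .
  obtain m' i' where Mg: "abelian_group M m' i'" using abelian_group_exists[OF \<mu>(2)] .
  have \<beta>': "act ?D M (tact n E M \<mu>)" by (rule top(4)[OF \<mu>(1)])
  have fh: "f \<in> hom ?B M" using f by (simp add: am_def)
  obtain X' \<zeta> q d' where pf: "pushforward ?D ?X (?a n) ?B ?j M (tact n E M \<mu>) f X' \<zeta> q"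
    and sq: "q ** inl ?X M ** ?j = q ** inr ?X M ** f"
    and d': "d' \<in> hom X' ?Y" "d' ** q = ?d (n - 1) ** p1 ?X M" and kd': "kernel d' X' ?Y M (q ** inr ?X M)"
    by (rule pushforward_exists[OF top(2) top(4)[OF top(8)] \<beta>' top(5) top(3)[OF f] c B Mg top(9)])
  note Q = pushforward_in[OF pf]
  have ob: "?X \<in> ob" "M \<in> ob" "X' \<in> ob" using extD(1)[OF E n, of n] actD[OF \<mu>(1)] actD[OF Q(3)] by auto
  note L = inl[OF ob(1,2)] and R = inr[OF ob(1,2)] and pp = p_in[OF ob(1,2)]
  have cp1: "cover (p1 ?X M) (pd ?X M) ?X" by (rule split_epi_cover[OF pp(1) L(1,2)])
  have \<nu>: "q ** inl ?X M \<in> hom ?X X'" and j': "q ** inr ?X M \<in> hom M X'" using Q L R by blast+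
  have iD: "idn ?D \<in> hom ?D ?D" using actD[OF top(2)] by blast
  have \<nu>a: "am ?D ?X (?a n) (idn ?D) (q ** inl ?X M) ?D X' \<zeta>"
    using am_comp[OF am_inl[OF top(2) \<beta>'] Q(4)] id_l[OF iD] by simp
  have j'a: "am ?D M (tact n E M \<mu>) (idn ?D) (q ** inr ?X M) ?D X' \<zeta>"
    using am_comp[OF am_inr[OF top(2) \<beta>'] Q(4)] id_l[OF iD] by simp
  have dn: "?d (n - 1) \<in> hom ?X ?Y" using extD(2)[OF E n, of "n - 1"] n by simp
  have d'\<nu>: "d' ** q ** inl ?X M = ?d (n - 1)" using reassoc[OF d'(2)] L(2) id_r[OF dn] by simp
  have d'j: "d' ** q ** inr ?X M = z M ?Y" using kernel_in(4)[OF kd'] .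
  define E' where "E' = \<lparr>xob = (\<lambda>i. if i = n then X' else if i = Suc n then M else ?G i),
     xd = (\<lambda>i. if i = n - 1 then d' else if i = n then q ** inr ?X M else ?d i),
     xact = (\<lambda>i. if i = n then \<zeta> else if i = Suc n then \<mu> else ?a i)\<rparr>"
  define w where "w = (\<lambda>i. if i = n then q ** inl ?X M else if i = Suc n then f else idn (?G i))"
  have n': "n - 1 < n" "Suc (n - 1) = n" "n - 1 \<noteq> n" "n \<noteq> n - 1" "n \<noteq> Suc n" "Suc n \<noteq> n" "0 \<noteq> n" "0 \<noteq> Suc n" "1 \<noteq> Suc n" "0 \<noteq> n - 1" "1 \<noteq> n" "1 < n" "2 \<noteq> Suc n"
    using n by auto
  have E'ob: "xob E' n = X'" "xob E' (Suc n) = M" "\<And>i. i < n ==> xob E' i = ?G i"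
    and E'd: "xd E' (n - 1) = d'" "xd E' n = q ** inr ?X M" "\<And>i. Suc i < n ==> xd E' i = ?d i"
    and E'a: "xact E' n = \<zeta>" "xact E' (Suc n) = \<mu>" "\<And>i. i < n ==> xact E' i = ?a i"
    and wv: "w n = q ** inl ?X M" "w (Suc n) = f" "\<And>i. i < n ==> w i = idn (?G i)"
    using n by (auto simp: E'_def w_def)
  have E'0: "xob E' 0 = ?G 0" "xob E' 1 = ?G 1" "xd E' 0 = ?d 0" using E'ob(3)[of 0] E'ob(3)[of 1] E'd(3)[of 0] n by auto
  have D3: "?D = ?G 0" "tact n E M \<mu> = \<mu>" if "n \<noteq> 2"
    using that fl_id[OF actD(1,2)[OF \<mu>(1)]] id_r[OF actD(3)[OF \<mu>(1)]] by (auto simp: tb_def tact_def tp_def)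
  have D2: "?D = ?G 1" "tact n E M \<mu> = \<mu> ** fl (?d 0) (idn M)" if "n = 2"
    using that by (auto simp: tb_def tact_def tp_def)
  have abX': "abelian X'" if "n \<noteq> 2"
  proof -
    have "abelian ?X" using extD(7)[OF E n, of n] n that by (simp add: act_module_def)
    from abelian_quotient[OF abelian_product[OF this \<mu>(2)] Q(1)] show ?thesis .
  qed
  have d0h: "?d 0 \<in> hom (?G 1) (?G 0)" using extD(2)[OF E n, of 0] by simp
  note P = act_product[OF top(2) \<beta>']
  have cases_le: "i < n \<or> i = n \<or> i = Suc n" if "i \<le> n + 1" for i using that by linarith
  have ext: "ext n E'"
  proof (rule extI[OF n])
    show "xob E' i \<in> ob" if "i \<le> n + 1" for i
      using cases_le[OF that] E'ob ob extD(1)[OF E n that] by auto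
    show "xd E' i \<in> hom (xob E' (Suc i)) (xob E' i)" if i: "i \<le> n" for i
    proof -
      consider "i = n" | "i = n - 1" | "Suc i < n" using i by linarith
      then show ?thesis
      proof cases
        case 2 then show ?thesis using E'ob(1) E'ob(3)[of "n - 1"] E'd(1) d'(1) n'(1,2) by simp
      next
        case 3 then show ?thesis using E'ob(3)[of i] E'ob(3)[of "Suc i"] E'd(3)[of i] extD(2)[OF E n i] by simp
      qed (use E'ob E'd j' in simp)
    qed
    show "monic (xd E' n) (xob E' (Suc n)) (xob E' n)" using kernel_in(3)[OF kd'] E'ob E'd by simp
    show "exact (xd E' (Suc i)) (xd E' i) (xob E' (Suc (Suc i))) (xob E' (Suc i)) (xob E' i)" if i: "i < n" for i
    proof -
      consider "i = n - 1" | "Suc (Suc i) = n" | "Suc (Suc i) < n" using i by linarith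
      then show ?thesis
      proof cases
        case 1
        then show ?thesis using kernel_exact[OF kd'] E'ob(1,2) E'ob(3)[of "n - 1"] E'd(1,2) n'(1,2) by simp
      next
        case 2
        then have s: "Suc i = n - 1" "Suc i < n" "i < n" by auto
        have "exact (?d (n - 1)) (?d i) ?X ?Y (?G i)" using extD(3)[OF E n s(3)] s(1) by simp
        from exact_factor_left[OF this Q(1) cp1 d'] have "exact d' (?d i) X' ?Y (?G i)" .
        then show ?thesis using s E'ob(1) E'ob(3)[OF s(2)] E'ob(3)[OF s(3)] E'd(1) E'd(3)[OF s(2)] by simp
      next
        case 3
        then show ?thesis using extD(3)[OF E n i] E'ob(3)[of "Suc (Suc i)"] E'ob(3)[of "Suc i"] E'ob(3)[of i] E'd(3)[of "Suc i"] E'd(3)[of i] by simp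
      qed
    qed
    show "cover (xd E' 0) (xob E' 1) (xob E' 0)" using extD(5)[OF E n] E'0 by simp
    show "crossed_module (xob E' 2) (xob E' 1) (xd E' 1) (xact E' 2)"
    proof (cases "n = 2")
      case True
      have cm: "crossed_module ?X ?D (?d 1) (?a n)" using extD(6)[OF E n] True by (simp add: tb_def)
      have z: "?d 0 ** ?d 1 = z ?X (?G 0)" using extD(10)[OF E n, of 0] True by (simp add: numeral_2_eq_2)
      have d0: "?d 0 \<in> hom ?D (?G 0)" using d0h True by (simp add: tb_def)
      have "crossed_module X' ?D d' \<zeta>"
        by (rule pushforward_crossed_module[OF pf[unfolded D2(2)[OF True]] cm \<mu>(1) d0 z \<mu>(2)])
          (use d' True in \<open>auto simp: tb_def\<close>)
      then show ?thesis using True E'ob(1) E'0 E'd(1) E'a(1) by (simp add: tb_def)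
    next
      case False
      then have "2 < n" using n by simp
      then show ?thesis using extD(6)[OF E n] E'0 E'ob(3)[of 2] E'd(3)[of 1] E'a(3)[of 2] by simp
    qed
    show "act_module (xob E' 0) (xob E' i) (xact E' i)" if i: "3 \<le> i" "i \<le> n + 1" for i
    proof -
      consider "i < n" | "i = n" | "i = Suc n" using i by linarith
      then show ?thesis
      proof cases
        case 1 then show ?thesis using extD(7)[OF E n i] E'ob(3) E'a(3) by simp
      next
        case 2
        then have "n \<noteq> 2" using i by simp
        then show ?thesis using 2 Q(3) D3 abX' E'ob(1) E'0 E'a(1) by (simp add: act_module_def)
      qed (use M E'ob(2) E'0 E'a(2) in simp)
    qed
    show "kernel_equivariant (xob E' 0) (xob E' 1) (xob E' 2) (xd E' 0) (xd E' 1) (xact E' 2) (xob E' 3) (xact E' 3) (xd E' 2)"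
    proof (cases "n = 2")
      case True
      \<comment> \<open>For n = 2 the kernel of \<open>d'\<close> is \<open>M\<close>, so the
        induced action is \<mu> and the corestriction is the identity of \<open>M\<close>.\<close>
      have S: "Suc n = 3" "n - 1 = 1" using True by auto
      have 1: "kernel d' X' (?G 1) M (q ** inr ?X M)" using kd' S by simp
      have 2: "(q ** inr ?X M) ** \<mu> ** fl (?d 0) (idn M) = \<zeta> ** fl (idn (?G 1)) (q ** inr ?X M)"
        using j'a D2[OF True] by (simp add: am_def)
      have 3: "(q ** inr ?X M) ** idn M = q ** inr ?X M" using id_r[OF j'] .
      have "kernel_equivariant (?G 0) (?G 1) X' (?d 0) d' \<zeta> M \<mu> (q ** inr ?X M)"
        unfolding kernel_equivariant_def using 1 2 3 M am_id[OF \<mu>(1)] by blast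
      then show ?thesis using True E'ob(1,2) E'0 E'd(1,2) E'a(1,2) by simp
    next
      case False
      then have n2: "2 < n" using n by simp
      have n3: "n = 3 \<or> 3 < n" using n2 by linarith
      have eqs: "xob E' 2 = ?G 2" "xd E' 1 = ?d 1" "xact E' 2 = ?a 2" using E'ob(3)[of 2] E'd(3)[of 1] E'a(3)[of 2] n2 by auto
      show ?thesis
      proof (cases "n = 3")
        case True
        \<comment> \<open>For n = 3 the map \<open>d'\<close> ends in the crossed module and is
          killed by its boundary, which gives the corestriction \<open>e'\<close>. Equivariance of
          \<open>e'\<close> descends along \<open>q\<close> because e' q = e p1 holds on the
          product.\<close>
        obtain K k \<phi> e where k: "kernel (?d 1) (?G 2) (?G 1) K k" and m: "act_module (?G 0) K \<phi>"
          and eq: "k ** \<phi> ** fl (?d 0) (idn K) = ?a 2 ** fl (idn (?G 1)) k" "k ** e = ?d 2"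
          and e: "am (?G 0) (?G 3) (?a 3) (idn (?G 0)) e (?G 0) K \<phi>"
          using extD(8)[OF E n] by (auto simp: kernel_equivariant_def)
        have \<phi>: "act (?G 0) K \<phi>" using m by (simp add: act_module_def)
        have S: "n - 1 = 2" using True by simp
        have eh: "e \<in> hom ?X K" using e True by (simp add: am_def)
        note ki = kernel_in[OF k]
        have "exact (?d 2) (?d 1) (?G 3) (?G 2) (?G 1)" using extD(3)[OF E n, of 1] True by (simp add: numeral_2_eq_2 numeral_3_eq_3)
        then have "exact (?d (n - 1)) (?d 1) ?X ?Y (?G 1)" using True by simp
        from exact_comp_zero[OF exact_factor_left[OF this Q(1) cp1 d']]
        have "?d 1 ** d' = z X' (?G 1)" .
        moreover have d'2: "d' \<in> hom X' (?G 2)" using d' S by simp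
        ultimately obtain e' where e': "e' \<in> hom X' K" "k ** e' = d'" using kernelE[OF k] by blast
        have "k ** e' ** q = k ** e ** p1 ?X M" using reassoc[OF e'(2)] reassoc[OF eq(2)] d'(2) S by simp
        then have e'q: "e' ** q = e ** p1 ?X M" by (rule monicD[OF ki(3)]) (use e' eh Q pp in blast)+
        have iG: "idn (?G 0) \<in> hom (?G 0) (?G 0)" using actD[OF \<phi>] by blast
        have "am ?D (pd ?X M) (pact ?D ?X (?a n) M (tact n E M \<mu>)) (idn ?D) (e ** p1 ?X M) (?G 0) K \<phi>"
          using am_comp[OF P(2), of "idn (?G 0)" e "?G 0" K \<phi>] e D3(1) True id_l[OF iG] by simp
        from am_factor[OF Q(3,1,4) this e'(1) e'q actD(3)[OF \<phi>]]
        have "am (?G 0) X' \<zeta> (idn (?G 0)) e' (?G 0) K \<phi>" using D3(1) False by simp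
        then have "kernel_equivariant (?G 0) (?G 1) (?G 2) (?d 0) (?d 1) (?a 2) X' \<zeta> d'"
          unfolding kernel_equivariant_def using k m eq(1) e'(2) by blast
        then show ?thesis using True eqs E'0 E'ob(1) E'a(1) E'd(1) by simp
      next
        case False
        then have "3 < n" using n3 by simp
        then show ?thesis using extD(8)[OF E n] eqs E'0 E'ob(3)[of 3] E'a(3)[of 3] E'd(3)[of 2] by simp
      qed
    qed
    show "am (xob E' 0) (xob E' (Suc i)) (xact E' (Suc i)) (idn (xob E' 0)) (xd E' i) (xob E' 0) (xob E' i) (xact E' i)"
      if i: "3 \<le> i" "i \<le> n" for i
    proof -
      have n2: "n \<noteq> 2" using i by simp
      consider "i = n" | "i = n - 1" | "Suc i < n" using i by linarith
      then show ?thesis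
      proof cases
        case 1
        then show ?thesis using j'a D3[OF n2] E'ob(1,2) E'0 E'a(1,2) E'd(2) by simp
      next
        case 2
        have S: "Suc i = n" using 2 n'(2) by simp
        have da: "am (?G 0) ?X (?a n) (idn (?G 0)) (?d i) (?G 0) (?G i) (?a i)" using extD(9)[OF E n i] S by simp
        have iG: "idn (?G 0) \<in> hom (?G 0) (?G 0)" using actD[OF \<mu>(1)] by blast
        have ai: "act (?G 0) (?G i) (?a i)" using ext_act[OF E n i(1)] i by simp
        have "am (?G 0) (pd ?X M) (pact ?D ?X (?a n) M (tact n E M \<mu>)) (idn (?G 0)) (?d i ** p1 ?X M) (?G 0) (?G i) (?a i)"
          using am_comp[OF P(2)[unfolded D3(1)[OF n2]] da] id_l[OF iG] D3(1)[OF n2] by simp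
        from am_factor[OF Q(3)[unfolded D3(1)[OF n2]] Q(1) Q(4)[unfolded D3(1)[OF n2]] this[unfolded D3(1)[OF n2]] _ _ actD(3)[OF ai]]
        have "am (?G 0) X' \<zeta> (idn (?G 0)) d' (?G 0) (?G i) (?a i)" using d' 2 by simp
        then show ?thesis using 2 S E'ob(1) E'ob(3)[of i] E'0 E'a(1) E'a(3)[of i] E'd(1) by simp
      next
        case 3
        then show ?thesis using extD(9)[OF E n i] E'0 E'ob(3)[of i] E'ob(3)[of "Suc i"] E'a(3)[of i] E'a(3)[of "Suc i"] E'd(3)[of i] by simp
      qed
    qed
  qed
  have mor: "ext_mor n E w E'"
  proof (rule ext_morI)
    show "w i \<in> hom (?G i) (xob E' i)" if i: "i \<le> n + 1" for i
      using cases_le[OF i] extD(1)[OF E n i] E'ob wv \<nu> fh by auto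
    show "w i ** ?d i = xd E' i ** w (Suc i)" if i: "i \<le> n" for i
    proof -
      consider "i = n" | "i = n - 1" | "Suc i < n" using i by linarith
      then show ?thesis
      proof cases
        case 1 then show ?thesis using sq wv E'd(2) by simp
      next
        case 2 then show ?thesis using wv(3)[of "n - 1"] wv(1) E'd(1) d'\<nu> id_l[OF dn] n'(1,2) by simp
      next
        case 3 then show ?thesis using wv(3)[of i] wv(3)[of "Suc i"] E'd(3)[of i] id_l[OF extD(2)[OF E n i]] id_r[OF extD(2)[OF E n i]] by simp
      qed
    qed
    show "am (?G 1) (?G 2) (?a 2) (w 1) (w 2) (xob E' 1) (xob E' 2) (xact E' 2)"
    proof (cases "n = 2")
      case True
      then show ?thesis using \<nu>a D2(1) E'ob(1) E'0 E'a(1) wv(1) wv(3)[of 1] by simp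
    next
      case False
      then have "2 < n" using n by simp
      then show ?thesis using am_id[OF ext_act2[OF E n]] E'0 E'ob(3)[of 2] E'a(3)[of 2] wv(3)[of 1] wv(3)[of 2] by simp
    qed
    show "am (?G 0) (?G i) (?a i) (w 0) (w i) (xob E' 0) (xob E' i) (xact E' i)" if i: "3 \<le> i" "i \<le> n + 1" for i
    proof -
      consider "i < n" | "i = n" | "i = Suc n" using i by linarith
      then show ?thesis
      proof cases
        case 1 then show ?thesis using am_id[OF ext_act[OF E n i]] E'0 E'ob(3)[of i] E'a(3)[of i] wv(3)[of 0] wv(3)[of i] by simp
      next
        case 2
        then have "n \<noteq> 2" using i by simp
        then show ?thesis using 2 \<nu>a D3(1) E'ob(1) E'0 E'a(1) wv(1) wv(3)[of 0] n by simp
      next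
        case 3 then show ?thesis using f E'ob(2) E'0 E'a(2) wv(2) wv(3)[of 0] n by simp
      qed
    qed
  qed
  have "isom (w i) (?G i) (xob E' i)" if "i < n" for i
    using wv(3)[OF that] E'ob(3)[OF that] isom_id[OF extD(1)[OF E n]] that by simp
  then have push: "ext_push n E w E'" unfolding ext_push_def using E ext mor E'0 wv(3)[of 0] n by simp
  have je: "u = v" if "u \<in> hom (xob E' n) T" "v \<in> hom (xob E' n) T" "u ** w n = v ** w n" "u ** xd E' n = v ** xd E' n" for T u v
    using pushforward_jointly_epic[OF pf ob(1,2)] that E'ob(1) E'd(2) wv(1) by simp
  have univ: "\<exists>h. ext_mor n E' h F \<and> (\<forall>i\<le>Suc n. h i ** w i = g i) \<and> h (Suc n) = b"
    if F: "ext n F" and g: "ext_mor n E g F" and b: "am (?G 0) M \<mu> (g 0) b (xob F 0) (xob F (Suc n)) (xact F (Suc n))"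
      and bf: "b ** f = g (Suc n)" for F g b
  proof -
    note gm = ext_mor_top[OF E F n g] and tF = ext_top[OF F n]
    \<comment> \<open>In degree \<open>n\<close> the factorization comes from the universal property
      of the pushforward, for which the module has to be centrally included in the top term of
      \<open>F\<close>.\<close>
    obtain cF where cF: "cooperates (xob F n) (xob F (Suc n)) (xd F n) cF" using tF(6) by blast
    obtain mF iF where BF: "abelian_group (xob F (Suc n)) mF iF" using abelian_group_exists[OF tF(7)] .
    have gj: "g n ** ?j = xd F n ** b ** f" using ext_morD(2)[OF g n, of n] bf by simp
    have jh: "?j \<in> hom ?B ?X" using extD(2)[OF E n] by simp
    obtain hn where hn: "am ?D X' \<zeta> (tm n g) hn (tb n F) (xob F n) (xact F n)"
      "hn ** q ** inl ?X M = g n" "hn ** q ** inr ?X M = xd F n ** b"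
      by (rule pushforward_universal[OF pf top(2) \<beta>' fh jh tF(2) tF(4)[OF tF(8)] tF(5) cF BF gm(2) gm(3)[OF b] gj])
    have bh: "b \<in> hom M (xob F (Suc n))" using b by (simp add: am_def)
    have hnh: "hn \<in> hom X' (xob F n)" using hn by (simp add: am_def)
    define h where "h = (\<lambda>i. if i = n then hn else if i = Suc n then b else g i)"
    have hv: "h n = hn" "h (Suc n) = b" "\<And>i. i < n ==> h i = g i" by (auto simp: h_def)
    have gh: "g i \<in> hom (?G i) (xob F i)" if "i \<le> n + 1" for i by (rule ext_morD(1)[OF g n that])
    have dF: "xd F (n - 1) \<in> hom (xob F n) (xob F (n - 1))" "xd F n \<in> hom (xob F (Suc n)) (xob F n)"
      using extD(2)[OF F n, of "n - 1"] extD(2)[OF F n, of n] n by auto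
    have gn1: "g (n - 1) \<in> hom ?Y (xob F (n - 1))" using gh by simp
    \<comment> \<open>Compatibility with the differential out of degree \<open>n\<close> is tested
      on the two parts of the pushforward: on the old top term it is the square of \<open>g\<close>,
      and on \<open>M\<close> both sides vanish.\<close>
    have key: "g (n - 1) ** d' = xd F (n - 1) ** hn"
    proof (rule pushforward_jointly_epic[OF pf ob(1,2)])
      show "(g (n - 1) ** d') ** q ** inl ?X M = (xd F (n - 1) ** hn) ** q ** inl ?X M"
        using d'\<nu> hn(2) ext_morD(2)[OF g n, of "n - 1"] n by simp
      have "xd F (n - 1) ** xd F n = z (xob F (Suc n)) (xob F (n - 1))" using extD(10)[OF F n, of "n - 1"] n by simp
      from reassoc[OF this, of b] show "(g (n - 1) ** d') ** q ** inr ?X M = (xd F (n - 1) ** hn) ** q ** inr ?X M"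
        using d'j hn(3) z_r'[OF gn1 ob(2)] z_l'[OF bh] hom_ob[OF dF(1)] by simp
    qed (use gn1 d' dF hnh in blast)+
    have "ext_mor n E' h F"
    proof (rule ext_morI)
      show "h i \<in> hom (xob E' i) (xob F i)" if i: "i \<le> n + 1" for i
        using cases_le[OF i] gh[OF i] E'ob hv hnh bh by auto
      show "h i ** xd E' i = xd F i ** h (Suc i)" if i: "i \<le> n" for i
      proof -
        consider "i = n" | "i = n - 1" | "Suc i < n" using i by linarith
        then show ?thesis
        proof cases
          case 1 then show ?thesis using hn(3) hv E'd(2) by simp
        next
          case 2 then show ?thesis using key hv(1) hv(3)[of "n - 1"] E'd(1) n'(1,2) by simp
        next
          case 3 then show ?thesis using hv(3)[of i] hv(3)[of "Suc i"] E'd(3)[of i] ext_morD(2)[OF g n i] by simp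
        qed
      qed
      show "am (xob E' 1) (xob E' 2) (xact E' 2) (h 1) (h 2) (xob F 1) (xob F 2) (xact F 2)"
      proof (cases "n = 2")
        case True
        then show ?thesis using hn(1) E'ob(1) E'0 E'a(1) hv(1) hv(3)[of 1] by (simp add: tb_def tm_def)
      next
        case False
        then have "2 < n" using n by simp
        then show ?thesis using ext_morD(3)[OF g n] E'0 E'ob(3)[of 2] E'a(3)[of 2] hv(3)[of 1] hv(3)[of 2] by simp
      qed
      show "am (xob E' 0) (xob E' i) (xact E' i) (h 0) (h i) (xob F 0) (xob F i) (xact F i)" if i: "3 \<le> i" "i \<le> n + 1" for i
      proof -
        have h0: "h 0 = g 0" using hv(3)[of 0] n by simp
        consider "i < n" | "i = n" | "i = Suc n" using i by linarith
        then show ?thesis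
        proof cases
          case 1 then show ?thesis using ext_morD(4)[OF g n i] E'0 E'ob(3)[of i] E'a(3)[of i] h0 hv(3)[of i] by simp
        next
          case 2
          then have "n \<noteq> 2" using i by simp
          then show ?thesis using 2 hn(1) E'ob(1) E'0 E'a(1) hv(1) h0 by (simp add: tb_def tm_def)
        next
          case 3 then show ?thesis using b E'ob(2) E'0 E'a(2) hv(2) h0 by simp
        qed
      qed
    qed
    moreover have "h i ** w i = g i" if i: "i \<le> Suc n" for i
    proof -
      have i': "i \<le> n + 1" using i by simp
      show ?thesis using cases_le[OF i'] hv wv hn(2) bf id_r[OF gh[OF i']] by auto
    qed
    ultimately show ?thesis using hv(2) by blast
  qed
  show ?thesis by (rule that[OF push E'ob(2) E'a(2) wv(2)]) (use je univ in blast)+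
qed

lemma kernel_monic_comp:
  assumes d: "kernel d A Y B j" and s: "monic s Y Y'"
  shows "kernel (s ** d) A Y' B j"
proof -
  note di = kernel_in[OF d] and sh = monic_in[OF s]
  have B: "B \<in> ob" "Y \<in> ob" using hom_ob di by blast+
  show ?thesis unfolding kernel_def
  proof (intro conjI allI impI)
    fix T t assume t: "t \<in> hom T A" "(s ** d) ** t = z T Y'"
    have T: "T \<in> ob" using hom_ob t by blast
    have "s ** d ** t = s ** z T Y" using t z_r'[OF sh T] by simp
    then have "d ** t = z T Y" by (rule monicD[OF s]) (use t di T B in blast)+
    then show "\<exists>h\<in>hom T B. j ** h = t" using kernelE[OF d t(1)] by metis
  qed (use di sh z_r'[OF sh B(1)] in auto)
qed

lemma kernel_monic_cancel:
  assumes d: "kernel d A Y B j" and k: "monic k K Y" and e: "e \<in> hom A K" "k ** e = d"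
  shows "kernel e A K B j"
proof -
  note di = kernel_in[OF d] and kh = monic_in[OF k]
  have B: "B \<in> ob" "K \<in> ob" "Y \<in> ob" using hom_ob di kh by blast+
  show ?thesis unfolding kernel_def
  proof (intro conjI allI impI)
    have "k ** e ** j = k ** z B K" using reassoc[OF e(2)] di(4) z_r'[OF kh B(1)] by simp
    then show "e ** j = z B K" by (rule monicD[OF k]) (use e di B in blast)+
    fix T t assume t: "t \<in> hom T A" "e ** t = z T K"
    have T: "T \<in> ob" using hom_ob t by blast
    have "d ** t = z T Y" using t(2) e(2) z_r'[OF kh T] by (metis assoc)
    then show "\<exists>h\<in>hom T B. j ** h = t" using kernelE[OF d t(1)] by metis
  qed (use di e in auto)
qed

text \<open>Any morphism of extensions that is invertible below degree \<open>n\<close> is isomorphic, by the short five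
  lemma, to the explicitly constructed pushforward, and so inherits its universal property.\<close>

lemma ext_push_compare:
  assumes n: "n \<ge> 2" and w: "ext_push n E w E''"
  obtains E' v s t where "ext_mor n E' t E''" "ext_mor n E'' s E'" "ext n E'"
    "\<And>i. i \<le> Suc n ==> t i ** v i = w i" "\<And>i. i \<le> Suc n ==> t i ** s i = idn (xob E'' i)"
    "\<And>i. i \<le> Suc n ==> s i ** t i = idn (xob E' i)" "xob E' (Suc n) = xob E'' (Suc n)"
    "s (Suc n) = idn (xob E'' (Suc n))" "t (Suc n) = idn (xob E'' (Suc n))"
    "\<forall>T u v'. u \<in> hom (xob E' n) T --> v' \<in> hom (xob E' n) T --> u ** v n = v' ** v n -->
       u ** xd E' n = v' ** xd E' n --> u = v'"
    "\<forall>F g b. ext n F --> ext_mor n E g F -->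
       am (xob E 0) (xob E'' (Suc n)) (xact E'' (Suc n)) (g 0) b (xob F 0) (xob F (Suc n)) (xact F (Suc n)) -->
       b ** w (Suc n) = g (Suc n) -->
       (\<exists>h. ext_mor n E' h F \<and> (\<forall>i\<le>Suc n. h i ** v i = g i) \<and> h (Suc n) = b)"
proof -
  have E: "ext n E" and E'': "ext n E''" and wm: "ext_mor n E w E''" and w0: "w 0 = idn (xob E 0)" and O0: "xob E'' 0 = xob E 0"
    and wi: "\<And>i. i < n ==> isom (w i) (xob E i) (xob E'' i)" using w by (auto simp: ext_push_def)
  let ?M = "xob E'' (Suc n)" and ?\<mu> = "xact E'' (Suc n)"
  have M: "act_module (xob E 0) ?M ?\<mu>" using extD(7)[OF E'' n, of "Suc n"] n O0 by simp
  have \<mu>: "act (xob E 0) ?M ?\<mu>" using M by (simp add: act_module_def)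
  have f: "am (xob E 0) (xob E (Suc n)) (xact E (Suc n)) (idn (xob E 0)) (w (Suc n)) (xob E 0) ?M ?\<mu>"
    using ext_morD(4)[OF wm n, of "Suc n"] n O0 w0 by simp
  obtain E' v where push: "ext_push n E v E'" and M': "xob E' (Suc n) = ?M" "xact E' (Suc n) = ?\<mu>" "v (Suc n) = w (Suc n)"
    and je: "\<forall>T u v'. u \<in> hom (xob E' n) T --> v' \<in> hom (xob E' n) T --> u ** v n = v' ** v n -->
       u ** xd E' n = v' ** xd E' n --> u = v'"
    and univ: "\<forall>F g b. ext n F --> ext_mor n E g F -->
       am (xob E 0) ?M ?\<mu> (g 0) b (xob F 0) (xob F (Suc n)) (xact F (Suc n)) --> b ** w (Suc n) = g (Suc n) -->
       (\<exists>h. ext_mor n E' h F \<and> (\<forall>i\<le>Suc n. h i ** v i = g i) \<and> h (Suc n) = b)"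
    by (rule ext_pushforward[OF E n M f])
  have E': "ext n E'" and vi: "\<And>i. i < n ==> isom (v i) (xob E i) (xob E' i)" using push by (auto simp: ext_push_def)
  have wS: "w (Suc n) \<in> hom (xob E (Suc n)) ?M" using f by (simp add: am_def)
  have "am (xob E 0) ?M ?\<mu> (w 0) (idn ?M) (xob E'' 0) ?M ?\<mu>" using am_id[OF \<mu>] w0 O0 by simp
  then obtain t where t: "ext_mor n E' t E''" "\<And>i. i \<le> Suc n ==> t i ** v i = w i" "t (Suc n) = idn ?M"
    using univ E'' wm id_l[OF wS] by blast
  have th: "t i \<in> hom (xob E' i) (xob E'' i)" if "i \<le> n + 1" for i by (rule ext_morD(1)[OF t(1) n that])
  have t_lt: "isom (t i) (xob E' i) (xob E'' i)" if "i < n" for i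
    by (rule isom_cancel_right[OF _ vi[OF that]]) (use wi[OF that] t(2)[of i] th[of i] that in auto)
  \<comment> \<open>Degrees m and m + 1 lie below \<open>n\<close>, so \<open>t\<close> is
    invertible there. In degree \<open>n\<close> the short five lemma is applied over
    \<open>K\<close>, the kernel of the differential of \<open>E'\<close> out of degree m + 1: both
    top terms are extensions with kernel \<open>?M\<close>, mapping to \<open>K\<close>, once the
    differential of \<open>E''\<close> has been carried to \<open>E'\<close> by the inverse of
    \<open>t\<close> in degree m + 1.\<close>
  obtain m where m: "n = Suc (Suc m)" using n by (metis add_2_eq_Suc le_Suc_ex)
  have ob: "?M \<in> ob" using hom_ob wS by blast
  have "isom (t n) (xob E' n) (xob E'' n)"
  proof -
    obtain K k e where k: "kernel (xd E' m) (xob E' (Suc m)) (xob E' m) K k" and e: "cover e (xob E' n) K" "xd E' (Suc m) = k ** e"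
      using extD(3)[OF E' n, of m] m by (auto simp: exact_def)
    note ki = kernel_in[OF k] and eh = cover_in[OF e(1)]
    obtain s1 where s1: "s1 \<in> hom (xob E'' (Suc m)) (xob E' (Suc m))" "s1 ** t (Suc m) = idn (xob E' (Suc m))"
      "t (Suc m) ** s1 = idn (xob E'' (Suc m))" "isom s1 (xob E'' (Suc m)) (xob E' (Suc m))"
      using isom_inverse[OF t_lt[of "Suc m"]] m by auto
    have d'': "xd E'' (Suc m) \<in> hom (xob E'' n) (xob E'' (Suc m))" using extD(2)[OF E'' n, of "Suc m"] m by simp
    have d': "xd E' m \<in> hom (xob E' (Suc m)) (xob E' m)" "xd E' (Suc m) \<in> hom (xob E' n) (xob E' (Suc m))"
      using extD(2)[OF E' n, of m] extD(2)[OF E' n, of "Suc m"] m by auto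
    have tm: "t m \<in> hom (xob E' m) (xob E'' m)" "t (Suc m) \<in> hom (xob E' (Suc m)) (xob E'' (Suc m))" "t n \<in> hom (xob E' n) (xob E'' n)"
      using th m by auto
    have ob': "xob E'' n \<in> ob" "xob E' m \<in> ob" using hom_ob d'' d' by blast+
    have "t m ** xd E' m ** s1 ** xd E'' (Suc m) = xd E'' m ** t (Suc m) ** s1 ** xd E'' (Suc m)"
      using reassoc[OF ext_morD(2)[OF t(1) n, of m]] m by simp
    also have "\<dots> = t m ** z (xob E'' n) (xob E' m)"
      using reassoc[OF s1(3)] id_l[OF d''] extD(10)[OF E'' n, of m] m z_r'[OF tm(1) ob'(1)] by simp
    finally have eq: "t m ** xd E' m ** s1 ** xd E'' (Suc m) = t m ** z (xob E'' n) (xob E' m)" .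
    have ty: "xd E' m ** s1 ** xd E'' (Suc m) \<in> hom (xob E'' n) (xob E' m)"
      "z (xob E'' n) (xob E' m) \<in> hom (xob E'' n) (xob E' m)" using d'(1) s1(1) d'' ob' by blast+
    have "m < n" using m by simp
    from monicD[OF isom_monic[OF t_lt[OF this]] eq ty]
    have "xd E' m ** s1 ** xd E'' (Suc m) = z (xob E'' n) (xob E' m)" .
    then obtain p where p: "p \<in> hom (xob E'' n) K" "k ** p = s1 ** xd E'' (Suc m)" using kernelE[OF k comp_in[OF d'' s1(1)]] by blast
    have k1: "kernel (xd E' (Suc m)) (xob E' n) (xob E' (Suc m)) ?M (xd E' n)" using ext_top(9)[OF E' n] m M' by simp
    have k2: "kernel (xd E'' (Suc m)) (xob E'' n) (xob E'' (Suc m)) ?M (xd E'' n)" using ext_top(9)[OF E'' n] m by simp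
    have K1: "kernel e (xob E' n) K ?M (xd E' n)" by (rule kernel_monic_cancel[OF k1 ki(3) eh]) (simp add: e)
    have K2: "kernel p (xob E'' n) K ?M (xd E'' n)"
      by (rule kernel_monic_cancel[OF kernel_monic_comp[OF k2 isom_monic[OF s1(4)]] ki(3) p])
    have "k ** p ** t n = s1 ** t (Suc m) ** xd E' (Suc m)"
      using reassoc[OF p(2)] ext_morD(2)[OF t(1) n, of "Suc m"] m by simp
    also have "\<dots> = k ** e" using reassoc[OF s1(2)] id_l[OF d'(2)] e(2) by simp
    finally have pt: "p ** t n = e" by (rule monicD[OF ki(3)]) (use p tm eh in blast)+
    show ?thesis
      by (rule short_five[OF K1 K2 tm(3) isom_id[OF ob] _ pt e(1)]) (use ext_morD(2)[OF t(1) n, of n] t(3) in simp)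
  qed
  moreover have "isom (t (Suc n)) (xob E' (Suc n)) (xob E'' (Suc n))" using t(3) M' isom_id[OF ob] by simp
  ultimately have iso: "isom (t i) (xob E' i) (xob E'' i)" if "i \<le> n + 1" for i
    using t_lt[of i] that by (metis Suc_eq_plus1 le_Suc_eq le_neq_implies_less)
  obtain s where s: "ext_mor n E'' s E'" "\<And>i. i \<le> n + 1 ==> s i \<in> hom (xob E'' i) (xob E' i)"
    "\<And>i. i \<le> n + 1 ==> s i ** t i = idn (xob E' i)" "\<And>i. i \<le> n + 1 ==> t i ** s i = idn (xob E'' i)"
    using ext_mor_inverse[OF E' E'' t(1) n iso] by metis
  have "s (Suc n) ** t (Suc n) = idn (xob E' (Suc n))" using s(3)[of "Suc n"] by simp
  then have sS: "s (Suc n) = idn ?M" using t(3) M'(1) id_r[OF s(2)[of "Suc n"]] by simp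
  show ?thesis
    by (rule that[OF t(1) s(1) E' t(2) _ _ M'(1) sS t(3) je univ]) (use s in auto)
qed

lemma ext_push_cocartesian:
  assumes n: "n \<ge> 2" and w: "ext_push n E w E''" and F: "ext n F" and g: "ext_mor n E g F"
    and b: "am (xob E'' 0) (xob E'' (Suc n)) (xact E'' (Suc n)) (g 0) b (xob F 0) (xob F (Suc n)) (xact F (Suc n))"
    and bw: "b ** w (Suc n) = g (Suc n)"
  obtains h where "ext_mor n E'' h F" "\<And>i. i \<le> Suc n ==> h i ** w i = g i" "h (Suc n) = b"
proof -
  have O0: "xob E'' 0 = xob E 0" using w by (simp add: ext_push_def)
  obtain E' v s t where t: "ext_mor n E' t E''" "ext_mor n E'' s E'" "ext n E'"
    "\<And>i. i \<le> Suc n ==> t i ** v i = w i" "\<And>i. i \<le> Suc n ==> s i ** t i = idn (xob E' i)"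
    "s (Suc n) = idn (xob E'' (Suc n))" "xob E' (Suc n) = xob E'' (Suc n)"
    and univ: "\<forall>F g b. ext n F --> ext_mor n E g F -->
       am (xob E 0) (xob E'' (Suc n)) (xact E'' (Suc n)) (g 0) b (xob F 0) (xob F (Suc n)) (xact F (Suc n)) -->
       b ** w (Suc n) = g (Suc n) -->
       (\<exists>h. ext_mor n E' h F \<and> (\<forall>i\<le>Suc n. h i ** v i = g i) \<and> h (Suc n) = b)"
    by (rule ext_push_compare[OF n w]) blast
  obtain h where h: "ext_mor n E' h F" "\<And>i. i \<le> Suc n ==> h i ** v i = g i" "h (Suc n) = b"
    using univ[THEN spec[of _ F], THEN spec[of _ g], THEN spec[of _ b]] F g b bw O0 by auto
  have hs: "(h i ** s i) ** w i = g i" if i: "i \<le> Suc n" for i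
  proof -
    have hh: "h i \<in> hom (xob E' i) (xob F i)" using ext_morD(1)[OF h(1) n] i by simp
    have "h i ** s i ** t i ** v i = h i ** v i" using reassoc[OF t(5)[OF i]] reassoc[OF id_r[OF hh]] by simp
    then show ?thesis using t(4)[OF i] h(2)[OF i] by simp
  qed
  have bh: "b \<in> hom (xob E'' (Suc n)) (xob F (Suc n))" using b by (simp add: am_def)
  show ?thesis
    by (rule that[OF ext_mor_comp[OF t(2) h(1) n] hs]) (use h(3) t(6) id_r[OF bh] in auto)
qed

text \<open>Below degree \<open>n\<close> the components of \<open>w\<close> are invertible. In
  degree \<open>n\<close> an arrow out of the constructed pushforward is determined on the old top
  term and on the module, and the isomorphism \<open>t\<close> carries this over to
  \<open>E''\<close>.\<close>

lemma ext_push_epic: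
  assumes n: "n \<ge> 2" and w: "ext_push n E w E''" and F: "ext n F"
    and g: "ext_mor n E'' g F" and h: "ext_mor n E'' h F" and eq: "\<And>i. i \<le> Suc n ==> g i ** w i = h i ** w i"
    and S: "g (Suc n) = h (Suc n)" and i: "i \<le> Suc n"
  shows "g i = h i"
proof -
  have wi: "\<And>i. i < n ==> isom (w i) (xob E i) (xob E'' i)" using w by (auto simp: ext_push_def)
  have gh: "g i \<in> hom (xob E'' i) (xob F i)" "h i \<in> hom (xob E'' i) (xob F i)" if "i \<le> Suc n" for i
    using ext_morD(1)[OF g n] ext_morD(1)[OF h n] that by auto
  consider "i < n" | "i = n" | "i = Suc n" using i by linarith
  then show ?thesis
  proof cases
    case 1
    then show ?thesis using coverD[OF isom_cover[OF wi[OF 1]] eq[OF i] gh[OF i]] by simp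
  next
    case 2
    obtain E' v s t where t: "ext_mor n E' t E''"
      "\<And>i. i \<le> Suc n ==> t i ** v i = w i" "\<And>i. i \<le> Suc n ==> t i ** s i = idn (xob E'' i)"
      "t (Suc n) = idn (xob E'' (Suc n))"
      and je: "\<forall>T u v'. u \<in> hom (xob E' n) T --> v' \<in> hom (xob E' n) T --> u ** v n = v' ** v n -->
       u ** xd E' n = v' ** xd E' n --> u = v'" by (rule ext_push_compare[OF n w]) blast
    have tn: "t n \<in> hom (xob E' n) (xob E'' n)" using ext_morD(1)[OF t(1) n] by simp
    have gn: "g n \<in> hom (xob E'' n) (xob F n)" "h n \<in> hom (xob E'' n) (xob F n)" using gh by auto
    have "(g n ** t n) ** v n = (h n ** t n) ** v n" using t(2)[of n] eq[of n] by simp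
    moreover have "(g n ** t n) ** xd E' n = (h n ** t n) ** xd E' n"
      using ext_morD(2)[OF t(1) n, of n] reassoc[OF ext_morD(2)[OF g n, of n]] reassoc[OF ext_morD(2)[OF h n, of n]] S by simp
    ultimately have gt: "g n ** t n = h n ** t n" using je tn gn by blast
    have "g n ** t n ** s n = h n ** t n ** s n" using gt by (metis assoc)
    then show ?thesis using t(3)[of n] id_r[OF gn(1)] id_r[OF gn(2)] 2 by simp
  qed (use S in simp)
qed

end

section \<open>Fibrations and comma objects\<close>

lemma Hom_iff: "f \<in> Hom C A B \<longleftrightarrow> f \<in> Arr C \<and> Dom C f = A \<and> Cod C f = B"
  by (simp add: Hom_def)

lemma Hom_ob:
  assumes "is_category C" "f \<in> Hom C A B"
  shows "A \<in> Obj C" "B \<in> Obj C"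
  using assms by (auto simp: Hom_def is_category_def)

lemma id_Hom: "is_category C ==> A \<in> Obj C ==> Ident C A \<in> Hom C A A"
  by (simp add: is_category_def)

lemma comp_Hom: "is_category C ==> f \<in> Hom C A B ==> g \<in> Hom C B D ==> g \<cdot>\<^bsub>C\<^esub> f \<in> Hom C A D"
  by (auto simp: Hom_def is_category_def)

lemma comp_id_left: "is_category C ==> f \<in> Hom C A B ==> Ident C B \<cdot>\<^bsub>C\<^esub> f = f"
  unfolding Hom_iff is_category_def by blast

lemma comp_id_right: "is_category C ==> f \<in> Hom C A B ==> f \<cdot>\<^bsub>C\<^esub> Ident C A = f"
  unfolding Hom_iff is_category_def by blast

lemma comp_assoc:
  "is_category C ==> f \<in> Hom C A B ==> g \<in> Hom C B D ==> h \<in> Hom C D E ==>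
    h \<cdot>\<^bsub>C\<^esub> g \<cdot>\<^bsub>C\<^esub> f = h \<cdot>\<^bsub>C\<^esub> (g \<cdot>\<^bsub>C\<^esub> f)"
  unfolding Hom_iff is_category_def by force

lemma functor_Hom: "is_functor X Y F ==> f \<in> Hom X a b ==> amap F f \<in> Hom Y (omap F a) (omap F b)"
  by (auto simp: is_functor_def Hom_def)

lemma functor_Obj: "is_functor X Y F ==> a \<in> Obj X ==> omap F a \<in> Obj Y"
  by (auto simp: is_functor_def)

lemma functor_id: "is_functor X Y F ==> a \<in> Obj X ==> amap F (Ident X a) = Ident Y (omap F a)"
  by (auto simp: is_functor_def)

lemma functor_comp:
  "is_functor X Y F ==> f \<in> Hom X a b ==> g \<in> Hom X b c ==> amap F (g \<cdot>\<^bsub>X\<^esub> f) = amap F g \<cdot>\<^bsub>Y\<^esub> amap F f"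
  by (auto simp: is_functor_def Hom_def)

lemma id_functor: "is_functor X X id_fctr"
  by (auto simp: is_functor_def id_fctr_def Hom_def)

lemma cartesianI:
  fixes X :: "('x, 'y) category" (structure)
  assumes "f \<in> Hom X x y"
    and "\<And>w g u. g \<in> Hom X w y ==> u \<in> Hom A (omap F w) (omap F x) ==> amap F f \<cdot>\<^bsub>A\<^esub> u = amap F g ==>
      \<exists>!h. h \<in> Hom X w x \<and> f \<cdot> h = g \<and> amap F h = u"
  shows "cartesian A (X, F) f"
  unfolding cartesian_def prod.case
proof (intro conjI ballI impI)
  have f: "f \<in> Arr X" "Dom X f = x" "Cod X f = y" using assms(1) by (auto simp: Hom_iff)
  show "f \<in> Arr X" by (fact f)
  fix g u assume g: "g \<in> Arr X" "Cod X g = Cod X f" and u: "u \<in> Hom A (omap F (Dom X g)) (omap F (Dom X f))"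
    and e: "amap F f \<cdot>\<^bsub>A\<^esub> u = amap F g"
  have "g \<in> Hom X (Dom X g) y" using f g by (simp add: Hom_iff)
  from assms(2)[OF this _ e] u f
  show "\<exists>!h. h \<in> Hom X (Dom X g) (Dom X f) \<and> f \<cdot> h = g \<and> amap F h = u" by simp
qed

lemma cartesian_ex1:
  fixes X :: "('x, 'y) category" (structure)
  assumes "cartesian A (X, F) f" "f \<in> Hom X x y" "g \<in> Hom X w y" "u \<in> Hom A (omap F w) (omap F x)"
    "amap F f \<cdot>\<^bsub>A\<^esub> u = amap F g"
  shows "\<exists>!h. h \<in> Hom X w x \<and> f \<cdot> h = g \<and> amap F h = u"
proof -
  have 1: "g \<in> Arr X" "Cod X g = Cod X f" "Dom X g = w" "Dom X f = x" using assms(2,3) by (auto simp: Hom_iff)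
  have "\<forall>g\<in>Arr X. Cod X g = Cod X f -->
        (\<forall>u\<in>Hom A (omap F (Dom X g)) (omap F (Dom X f)). amap F f \<cdot>\<^bsub>A\<^esub> u = amap F g -->
           (\<exists>!h. h \<in> Hom X (Dom X g) (Dom X f) \<and> f \<cdot> h = g \<and> amap F h = u))"
    using assms(1) by (simp add: cartesian_def)
  from this[rule_format, OF 1(1,2)] show ?thesis using 1 assms(4,5) by simp
qed

lemma cartesian_unique:
  fixes X :: "('x, 'y) category" (structure)
  assumes "cartesian A (X, F) f" "f \<in> Hom X x y" "h \<in> Hom X w x" "k \<in> Hom X w x"
    "f \<cdot> h = f \<cdot> k" "amap F h = amap F k" and cat: "is_category X" and F: "is_functor X A F"
  shows "h = k"
proof -
  have "\<exists>!k'. k' \<in> Hom X w x \<and> f \<cdot> k' = f \<cdot> h \<and> amap F k' = amap F h"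
    using cartesian_ex1[OF assms(1,2) comp_Hom[OF cat assms(3,2)] functor_Hom[OF F assms(3)]]
      functor_comp[OF F assms(3,2)] by simp
  then show ?thesis using assms by metis
qed

definition inverse_arrows :: "('x, 'y) category => 'x => 'x => 'y => 'y => bool" where
  "inverse_arrows X x y i j \<longleftrightarrow> i \<in> Hom X x y \<and> j \<in> Hom X y x \<and> j \<cdot>\<^bsub>X\<^esub> i = Ident X x \<and> i \<cdot>\<^bsub>X\<^esub> j = Ident X y"

lemma cartesian_comp_iso:
  fixes X :: "('x, 'y) category" (structure)
  assumes cat: "is_category X" "is_category A" and F: "is_functor X A F"
    and f: "cartesian A (X, F) f" "f \<in> Hom X x y" and i: "inverse_arrows X w x i j"
  shows "cartesian A (X, F) (f \<cdot> i)"
proof (rule cartesianI)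
  have ih: "i \<in> Hom X w x" "j \<in> Hom X x w" "j \<cdot> i = Ident X w" "i \<cdot> j = Ident X x"
    using i by (auto simp: inverse_arrows_def)
  show "f \<cdot> i \<in> Hom X w y" by (rule comp_Hom[OF cat(1) ih(1) f(2)])
  fix v g u assume g: "g \<in> Hom X v y" and u: "u \<in> Hom A (omap F v) (omap F w)" and e: "amap F (f \<cdot> i) \<cdot>\<^bsub>A\<^esub> u = amap F g"
  note Fi = functor_Hom[OF F ih(1)] and Fj = functor_Hom[OF F ih(2)] and Ff = functor_Hom[OF F f(2)]
  have e': "amap F f \<cdot>\<^bsub>A\<^esub> (amap F i \<cdot>\<^bsub>A\<^esub> u) = amap F g"
    using e functor_comp[OF F ih(1) f(2)] comp_assoc[OF cat(2) u Fi Ff] by simp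
  from cartesian_ex1[OF f g comp_Hom[OF cat(2) u Fi] e']
  obtain h where h: "h \<in> Hom X v x" "f \<cdot> h = g" "amap F h = amap F i \<cdot>\<^bsub>A\<^esub> u" by blast
  have ob: "w \<in> Obj X" "x \<in> Obj X" using Hom_ob[OF cat(1) ih(1)] by auto
  show "\<exists>!h. h \<in> Hom X v w \<and> f \<cdot> i \<cdot> h = g \<and> amap F h = u"
  proof (intro ex1I conjI)
    show jh: "j \<cdot> h \<in> Hom X v w" by (rule comp_Hom[OF cat(1) h(1) ih(2)])
    show "f \<cdot> i \<cdot> (j \<cdot> h) = g"
      using comp_assoc[OF cat(1) jh ih(1) f(2)] comp_assoc[OF cat(1) h(1) ih(2,1)] ih(4) comp_id_left[OF cat(1) h(1)] h(2) by simp
    have "amap F (j \<cdot> h) = amap F j \<cdot>\<^bsub>A\<^esub> amap F i \<cdot>\<^bsub>A\<^esub> u"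
      using functor_comp[OF F h(1) ih(2)] h(3) comp_assoc[OF cat(2) u Fi Fj] by simp
    then show "amap F (j \<cdot> h) = u"
      using functor_comp[OF F ih(1,2)] ih(3) functor_id[OF F ob(1)] comp_id_left[OF cat(2) u] by simp
    fix k assume k: "k \<in> Hom X v w \<and> f \<cdot> i \<cdot> k = g \<and> amap F k = u"
    then have kh: "k \<in> Hom X v w" by simp
    have "i \<cdot> k = h" by (rule cartesian_unique[OF f comp_Hom[OF cat(1) kh ih(1)] h(1) _ _ cat(1) F])
        (use k h comp_assoc[OF cat(1) kh ih(1) f(2)] functor_comp[OF F kh ih(1)] in auto)
    then show "k = j \<cdot> h" using comp_assoc[OF cat(1) kh ih(1,2)] ih(3) comp_id_left[OF cat(1) kh] by simp
  qed
qed

lemma cartesian_lifts_isomorphic: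
  fixes X :: "('x, 'y) category" (structure)
  assumes cat: "is_category X" "is_category A" and F: "is_functor X A F"
    and f: "cartesian A (X, F) f" "f \<in> Hom X x y" and f': "cartesian A (X, F) f'" "f' \<in> Hom X x' y"
    and eq: "amap F f = amap F f'"
  obtains i j where "inverse_arrows X x' x i j" "f \<cdot> i = f'" "amap F i = Ident A (omap F x)" "omap F x' = omap F x"
proof -
  note Ff = functor_Hom[OF F f(2)] and Ff' = functor_Hom[OF F f'(2)]
  have x: "omap F x' = omap F x" using Ff Ff' eq by (auto simp: Hom_iff)
  note ob = Hom_ob[OF cat(1) f(2)] Hom_ob[OF cat(1) f'(2)]
  have I: "Ident A (omap F x) \<in> Hom A (omap F x) (omap F x)" using Hom_ob[OF cat(2) Ff] id_Hom[OF cat(2)] by auto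
  obtain i where i: "i \<in> Hom X x' x" "f \<cdot> i = f'" "amap F i = Ident A (omap F x)"
    using cartesian_ex1[OF f f'(2), of "Ident A (omap F x)"] I x comp_id_right[OF cat(2) Ff] eq by auto
  obtain j where j: "j \<in> Hom X x x'" "f' \<cdot> j = f" "amap F j = Ident A (omap F x)"
    using cartesian_ex1[OF f' f(2), of "Ident A (omap F x)"] I x comp_id_right[OF cat(2) Ff] eq by auto
  have II: "Ident A (omap F x) \<cdot>\<^bsub>A\<^esub> Ident A (omap F x) = Ident A (omap F x)" by (rule comp_id_left[OF cat(2) I])
  have "j \<cdot> i = Ident X x'"
    by (rule cartesian_unique[OF f' comp_Hom[OF cat(1) i(1) j(1)] id_Hom[OF cat(1) ob(3)] _ _ cat(1) F])
      (use comp_assoc[OF cat(1) i(1) j(1) f'(2)] i j comp_id_right[OF cat(1) f'(2)] functor_comp[OF F i(1) j(1)]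
        functor_id[OF F ob(3)] x II in auto)
  moreover have "i \<cdot> j = Ident X x"
    by (rule cartesian_unique[OF f comp_Hom[OF cat(1) j(1) i(1)] id_Hom[OF cat(1) ob(1)] _ _ cat(1) F])
      (use comp_assoc[OF cat(1) j(1) i(1) f(2)] i j comp_id_right[OF cat(1) f(2)] functor_comp[OF F j(1) i(1)]
        functor_id[OF F ob(1)] x II in auto)
  ultimately show ?thesis using that i j x by (simp add: inverse_arrows_def)
qed

locale fib_map =
  fixes A :: "('o, 'm) category" and X :: "('x, 'y) category" (structure) and F :: "('x, 'y, 'o, 'm) fctr"
    and M :: "('u, 'v) category" and G :: "('u, 'v, 'o, 'm) fctr" and P :: "('x, 'y, 'u, 'v) fctr"
  assumes XF: "fib_object A (X, F)" and MG: "fib_object A (M, G)" and P1: "fib_1cell A (X, F) (M, G) P"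
begin

lemma cats: "is_category A" "is_category X" "is_category M" "is_functor X A F" "is_functor M A G" "is_functor X M P"
  using XF MG P1 by (auto simp: fib_object_def fib_1cell_def)

lemmas catA = cats(1) and catX = cats(2) and catM = cats(3) and fF = cats(4) and fG = cats(5) and fP = cats(6)

lemma GP: "x \<in> Obj X ==> omap G (omap P x) = omap F x" "f \<in> Hom X x y ==> amap G (amap P f) = amap F f"
  using P1 by (auto simp: fib_1cell_def Hom_iff)

lemma P_cartesian: "cartesian A (X, F) f ==> cartesian A (M, G) (amap P f)"
  using P1 by (auto simp: fib_1cell_def)

lemma lift_X: "y \<in> Obj X ==> a \<in> Hom A c (omap F y) ==>
    \<exists>x f. f \<in> Hom X x y \<and> cartesian A (X, F) f \<and> amap F f = a \<and> omap F x = c"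
proof -
  assume y: "y \<in> Obj X" and a: "a \<in> Hom A c (omap F y)"
  then obtain f where f: "cartesian A (X, F) f" "Cod X f = y" "amap F f = a"
    using XF unfolding fib_object_def Hom_iff by blast
  then have fh: "f \<in> Hom X (Dom X f) y" by (auto simp: cartesian_def Hom_iff)
  have "omap F (Dom X f) = c" using functor_Hom[OF fF fh] f(3) a by (auto simp: Hom_iff)
  then show ?thesis using f fh by blast
qed

lemma lift_M: "y \<in> Obj M ==> a \<in> Hom A c (omap G y) ==>
    \<exists>x f. f \<in> Hom M x y \<and> cartesian A (M, G) f \<and> amap G f = a \<and> omap G x = c"
proof -
  assume y: "y \<in> Obj M" and a: "a \<in> Hom A c (omap G y)"
  then obtain f where f: "cartesian A (M, G) f" "Cod M f = y" "amap G f = a"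
    using MG unfolding fib_object_def Hom_iff by blast
  then have fh: "f \<in> Hom M (Dom M f) y" by (auto simp: cartesian_def Hom_iff)
  have "omap G (Dom M f) = c" using functor_Hom[OF fG fh] f(3) a by (auto simp: Hom_iff)
  then show ?thesis using f fh by blast
qed

section \<open>The comma category and its cartesian arrows\<close>

definition K where "K = fst (fib_comma A (X, F) (M, G) P)"
definition Q where "Q = snd (fib_comma A (X, F) (M, G) P)"

lemma fib_comma_KQ: "fib_comma A (X, F) (M, G) P = (K, Q)"
  by (simp add: K_def Q_def)

lemma K_Obj: "(x, \<beta>, m) \<in> Obj K \<longleftrightarrow>
    x \<in> Obj X \<and> m \<in> Obj M \<and> \<beta> \<in> Hom M (omap P x) m \<and> amap G \<beta> = Ident A (omap F x)"
  by (simp add: K_def fib_comma_def Let_def)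

lemma K_Hom: "t \<in> Hom K (x, \<beta>, m) (x', \<beta>', m') \<longleftrightarrow>
    (\<exists>a b. t = ((x, \<beta>, m), (a, b), (x', \<beta>', m')) \<and> (x, \<beta>, m) \<in> Obj K \<and> (x', \<beta>', m') \<in> Obj K \<and>
      a \<in> Hom X x x' \<and> b \<in> Hom M m m' \<and> \<beta>' \<cdot>\<^bsub>M\<^esub> amap P a = b \<cdot>\<^bsub>M\<^esub> \<beta>)"
  by (auto simp: K_def fib_comma_def Let_def Hom_iff)

lemma K_Arr: "((x, \<beta>, m), (a, b), (x', \<beta>', m')) \<in> Arr K \<longleftrightarrow>
   (x, \<beta>, m) \<in> Obj K \<and> (x', \<beta>', m') \<in> Obj K \<and>
      a \<in> Hom X x x' \<and> b \<in> Hom M m m' \<and> \<beta>' \<cdot>\<^bsub>M\<^esub> amap P a = b \<cdot>\<^bsub>M\<^esub> \<beta>"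
  by (auto simp: K_def fib_comma_def Let_def)

lemma K_ArrE:
  assumes "t \<in> Arr K"
  obtains x \<beta> m a b x' \<beta>' m' where "t = ((x, \<beta>, m), (a, b), (x', \<beta>', m'))" "(x, \<beta>, m) \<in> Obj K" "(x', \<beta>', m') \<in> Obj K"
    "a \<in> Hom X x x'" "b \<in> Hom M m m'" "\<beta>' \<cdot>\<^bsub>M\<^esub> amap P a = b \<cdot>\<^bsub>M\<^esub> \<beta>"
  using assms by (auto simp: K_def fib_comma_def Let_def)

lemma K_ops: "Dom K (s, h, t) = s" "Cod K (s, h, t) = t"
  "Ident K (x, \<beta>, m) = ((x, \<beta>, m), (Ident X x, Ident M m), (x, \<beta>, m))"
  "(s', (a', b'), t') \<cdot>\<^bsub>K\<^esub> (s, (a, b), t) = (s, (a' \<cdot> a, b' \<cdot>\<^bsub>M\<^esub> b), t')"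
  by (simp_all add: K_def fib_comma_def Let_def)

lemma Q_maps: "omap Q (x, \<beta>, m) = omap F x" "amap Q (s, (a, b), t) = amap F a"
  by (simp_all add: Q_def fib_comma_def Let_def)

lemma K_ObjD:
  assumes "(x, \<beta>, m) \<in> Obj K"
  shows "x \<in> Obj X" "m \<in> Obj M" "\<beta> \<in> Hom M (omap P x) m" "amap G \<beta> = Ident A (omap F x)" "omap G m = omap F x"
proof -
  show x: "x \<in> Obj X" and "m \<in> Obj M" and b: "\<beta> \<in> Hom M (omap P x) m" and g: "amap G \<beta> = Ident A (omap F x)"
    using assms by (auto simp: K_Obj)
  have "Ident A (omap F x) \<in> Hom A (omap F x) (omap F x)" using id_Hom[OF catA functor_Obj[OF fF x]] .
  then show "omap G m = omap F x" using functor_Hom[OF fG b] g by (auto simp: Hom_iff)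
qed

text \<open>\<open>G\<close> sends the structure arrows \<beta> and \<beta>' to identities, so
  applying it to the commuting square leaves just these two arrows.\<close>

lemma K_amap_eq:
  assumes "((x, \<beta>, m), (a, b), (x', \<beta>', m')) \<in> Arr K"
  shows "amap G b = amap F a"
proof -
  have o: "(x, \<beta>, m) \<in> Obj K" "(x', \<beta>', m') \<in> Obj K" and a: "a \<in> Hom X x x'" and b: "b \<in> Hom M m m'"
    and e: "\<beta>' \<cdot>\<^bsub>M\<^esub> amap P a = b \<cdot>\<^bsub>M\<^esub> \<beta>" using assms by (auto simp: K_Arr)
  note d = K_ObjD[OF o(1)] and d' = K_ObjD[OF o(2)]
  have Fa: "amap F a \<in> Hom A (omap F x) (omap F x')" by (rule functor_Hom[OF fF a])
  have Gb: "amap G b \<in> Hom A (omap F x) (omap F x')" using functor_Hom[OF fG b] d(5) d'(5) by simp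
  have "amap G (\<beta>' \<cdot>\<^bsub>M\<^esub> amap P a) = amap F a"
    using functor_comp[OF fG functor_Hom[OF fP a] d'(3)] d'(4) GP(2)[OF a] comp_id_left[OF catA Fa] by simp
  moreover have "amap G (b \<cdot>\<^bsub>M\<^esub> \<beta>) = amap G b"
    using functor_comp[OF fG d(3) b] d(4) comp_id_right[OF catA Gb] by simp
  ultimately show ?thesis using e by simp
qed

lemma K_category: "is_category K"
  unfolding is_category_def
proof (intro conjI ballI impI)
  fix t assume "t \<in> Arr K"
  then obtain x \<beta> m a b x' \<beta>' m' where t: "t = ((x, \<beta>, m), (a, b), (x', \<beta>', m'))" and o: "(x, \<beta>, m) \<in> Obj K" "(x', \<beta>', m') \<in> Obj K"
    and a: "a \<in> Hom X x x'" and b: "b \<in> Hom M m m'" by (rule K_ArrE)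
  show "Dom K t \<in> Obj K" "Cod K t \<in> Obj K" using t o by (auto simp: K_ops)
  show "t \<cdot>\<^bsub>K\<^esub> Ident K (Dom K t) = t" "Ident K (Cod K t) \<cdot>\<^bsub>K\<^esub> t = t"
    using t comp_id_left[OF catX a] comp_id_left[OF catM b] comp_id_right[OF catX a] comp_id_right[OF catM b]
    by (auto simp: K_ops)
next
  fix d assume "d \<in> Obj K"
  moreover obtain x \<beta> m where d: "d = (x, \<beta>, m)" by (cases d)
  ultimately have o: "(x, \<beta>, m) \<in> Obj K" by simp
  note d' = K_ObjD[OF o]
  show "Ident K d \<in> Hom K d d" unfolding d K_Hom K_ops
    using o id_Hom[OF catX d'(1)] id_Hom[OF catM d'(2)] functor_id[OF fP d'(1)] comp_id_left[OF catM d'(3)]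
      comp_id_right[OF catM d'(3)] by auto
next
  fix t t' assume "t \<in> Arr K" "t' \<in> Arr K" and c: "Cod K t = Dom K t'"
  then obtain x \<beta> m a b x' \<beta>' m' x0 \<beta>0 m0 a' b' x'' \<beta>'' m''
    where t: "t = ((x, \<beta>, m), (a, b), (x', \<beta>', m'))" and o: "(x, \<beta>, m) \<in> Obj K" "(x', \<beta>', m') \<in> Obj K"
      and a: "a \<in> Hom X x x'" and b: "b \<in> Hom M m m'" and e: "\<beta>' \<cdot>\<^bsub>M\<^esub> amap P a = b \<cdot>\<^bsub>M\<^esub> \<beta>"
      and t': "t' = ((x0, \<beta>0, m0), (a', b'), (x'', \<beta>'', m''))" and o': "(x'', \<beta>'', m'') \<in> Obj K"
      and a': "a' \<in> Hom X x0 x''" and b': "b' \<in> Hom M m0 m''" and e': "\<beta>'' \<cdot>\<^bsub>M\<^esub> amap P a' = b' \<cdot>\<^bsub>M\<^esub> \<beta>0"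
    by (elim K_ArrE) blast
  have 0: "x0 = x'" "\<beta>0 = \<beta>'" "m0 = m'" using c t t' by (auto simp: K_ops)
  note a' = a'[unfolded 0] and b' = b'[unfolded 0] and e' = e'[unfolded 0]
  note d = K_ObjD[OF o(1)] and d1 = K_ObjD[OF o(2)] and d2 = K_ObjD[OF o']
  note Pa = functor_Hom[OF fP a] and Pa' = functor_Hom[OF fP a']
  have "\<beta>'' \<cdot>\<^bsub>M\<^esub> amap P (a' \<cdot> a) = b' \<cdot>\<^bsub>M\<^esub> b \<cdot>\<^bsub>M\<^esub> \<beta>"
    using functor_comp[OF fP a a'] comp_assoc[OF catM Pa Pa' d2(3)] e' comp_assoc[OF catM Pa d1(3) b'] e
      comp_assoc[OF catM d(3) b b'] by simp
  then show "t' \<cdot>\<^bsub>K\<^esub> t \<in> Hom K (Dom K t) (Cod K t')"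
    unfolding t t' K_ops K_Hom using o o' comp_Hom[OF catX a a'] comp_Hom[OF catM b b'] by auto
next
  fix t t' t'' assume "t \<in> Arr K" "t' \<in> Arr K" "t'' \<in> Arr K" and c: "Cod K t = Dom K t'" "Cod K t' = Dom K t''"
  from \<open>t \<in> Arr K\<close> obtain x \<beta> m a b x' \<beta>' m'
    where t: "t = ((x, \<beta>, m), (a, b), (x', \<beta>', m'))" and a: "a \<in> Hom X x x'" and b: "b \<in> Hom M m m'"
    by (rule K_ArrE)
  from \<open>t' \<in> Arr K\<close> obtain x0 \<beta>0 m0 a' b' x'' \<beta>'' m''
    where t': "t' = ((x0, \<beta>0, m0), (a', b'), (x'', \<beta>'', m''))" and a': "a' \<in> Hom X x0 x''" and b': "b' \<in> Hom M m0 m''"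
    by (rule K_ArrE)
  from \<open>t'' \<in> Arr K\<close> obtain x1 \<beta>1 m1 a'' b'' x3 \<beta>3 m3
    where t'': "t'' = ((x1, \<beta>1, m1), (a'', b''), (x3, \<beta>3, m3))" and a'': "a'' \<in> Hom X x1 x3" and b'': "b'' \<in> Hom M m1 m3"
    by (rule K_ArrE)
  have 0: "x0 = x'" "m0 = m'" "x1 = x''" "m1 = m''" using c t t' t'' by (auto simp: K_ops)
  show "t'' \<cdot>\<^bsub>K\<^esub> (t' \<cdot>\<^bsub>K\<^esub> t) = t'' \<cdot>\<^bsub>K\<^esub> t' \<cdot>\<^bsub>K\<^esub> t"
    using t t' t'' comp_assoc[OF catX a a'[unfolded 0] a''[unfolded 0]] comp_assoc[OF catM b b'[unfolded 0] b''[unfolded 0]]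
    by (simp add: K_ops)
qed

lemma Q_functor: "is_functor K A Q"
  unfolding is_functor_def
proof (intro conjI ballI impI)
  fix d assume "d \<in> Obj K"
  moreover obtain x \<beta> m where d: "d = (x, \<beta>, m)" by (cases d)
  ultimately have o: "(x, \<beta>, m) \<in> Obj K" by simp
  then show "omap Q d \<in> Obj A" "amap Q (Ident K d) = Ident A (omap Q d)"
    using functor_Obj[OF fF] functor_id[OF fF] K_ObjD(1)[OF o] by (auto simp: d Q_maps K_ops)
next
  fix t assume "t \<in> Arr K"
  then show "amap Q t \<in> Hom A (omap Q (Dom K t)) (omap Q (Cod K t))"
    by (elim K_ArrE) (use functor_Hom[OF fF] in \<open>simp add: Q_maps K_ops\<close>)
next
  fix t t' assume "t \<in> Arr K" "t' \<in> Arr K" and c: "Cod K t = Dom K t'"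
  then show "amap Q (t' \<cdot>\<^bsub>K\<^esub> t) = amap Q t' \<cdot>\<^bsub>A\<^esub> amap Q t"
    by (elim K_ArrE) (use functor_comp[OF fF] in \<open>auto simp: Q_maps K_ops\<close>)
qed

text \<open>The factorization is taken in each component. The two factors commute with the structure
  arrows because both composites agree after the cartesian arrow \<open>b\<close> and have the same
  image under \<open>G\<close>.\<close>

lemma K_cartesianI:
  assumes t: "((x, \<beta>, m), (a, b), (x', \<beta>', m')) \<in> Arr K" and ca: "cartesian A (X, F) a" and cb: "cartesian A (M, G) b"
  shows "cartesian A (K, Q) ((x, \<beta>, m), (a, b), (x', \<beta>', m'))"
proof (rule cartesianI)
  have o: "(x, \<beta>, m) \<in> Obj K" "(x', \<beta>', m') \<in> Obj K" and a: "a \<in> Hom X x x'" and b: "b \<in> Hom M m m'"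
    and e: "\<beta>' \<cdot>\<^bsub>M\<^esub> amap P a = b \<cdot>\<^bsub>M\<^esub> \<beta>" using t by (auto simp: K_Arr)
  note d = K_ObjD[OF o(1)] and d' = K_ObjD[OF o(2)]
  show "((x, \<beta>, m), (a, b), (x', \<beta>', m')) \<in> Hom K (x, \<beta>, m) (x', \<beta>', m')" using t by (auto simp: K_Hom K_Arr)
  fix w0 g u assume g0: "g \<in> Hom K w0 (x', \<beta>', m')" and u0: "u \<in> Hom A (omap Q w0) (omap Q (x, \<beta>, m))"
    and q0: "amap Q ((x, \<beta>, m), (a, b), (x', \<beta>', m')) \<cdot>\<^bsub>A\<^esub> u = amap Q g"
  obtain y \<gamma> n where w0: "w0 = (y, \<gamma>, n)" by (cases w0)
  then obtain c k where g: "g = ((y, \<gamma>, n), (c, k), (x', \<beta>', m'))" and o2: "(y, \<gamma>, n) \<in> Obj K"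
    and c: "c \<in> Hom X y x'" and k: "k \<in> Hom M n m'" and e2: "\<beta>' \<cdot>\<^bsub>M\<^esub> amap P c = k \<cdot>\<^bsub>M\<^esub> \<gamma>" using g0 by (auto simp: K_Hom)
  note d2 = K_ObjD[OF o2]
  have u: "u \<in> Hom A (omap F y) (omap F x)" and q: "amap F a \<cdot>\<^bsub>A\<^esub> u = amap F c" using u0 q0 w0 g by (auto simp: Q_maps)
  have gArr: "((y, \<gamma>, n), (c, k), (x', \<beta>', m')) \<in> Arr K" using g0 w0 g by (auto simp: K_Arr K_Hom)
  obtain h1 where h1: "h1 \<in> Hom X y x" "a \<cdot> h1 = c" "amap F h1 = u" using cartesian_ex1[OF ca a c u q] by blast
  have u': "u \<in> Hom A (omap G n) (omap G m)" using u d(5) d2(5) by simp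
  have q': "amap G b \<cdot>\<^bsub>A\<^esub> u = amap G k" using q K_amap_eq[OF t] K_amap_eq[OF gArr] by simp
  obtain h2 where h2: "h2 \<in> Hom M n m" "b \<cdot>\<^bsub>M\<^esub> h2 = k" "amap G h2 = u" using cartesian_ex1[OF cb b k u' q'] by blast
  note Ph = functor_Hom[OF fP h1(1)] and Pa = functor_Hom[OF fP a]
  have "\<beta> \<cdot>\<^bsub>M\<^esub> amap P h1 = h2 \<cdot>\<^bsub>M\<^esub> \<gamma>"
  proof (rule cartesian_unique[OF cb b comp_Hom[OF catM Ph d(3)] comp_Hom[OF catM d2(3) h2(1)] _ _ catM fG])
    show "b \<cdot>\<^bsub>M\<^esub> (\<beta> \<cdot>\<^bsub>M\<^esub> amap P h1) = b \<cdot>\<^bsub>M\<^esub> (h2 \<cdot>\<^bsub>M\<^esub> \<gamma>)"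
      using comp_assoc[OF catM Ph d(3) b] e comp_assoc[OF catM Ph Pa d'(3)] functor_comp[OF fP h1(1) a] h1(2) e2
        comp_assoc[OF catM d2(3) h2(1) b] h2(2) by simp
    have "Ident A (omap F x) \<cdot>\<^bsub>A\<^esub> u = u" "u \<cdot>\<^bsub>A\<^esub> Ident A (omap F y) = u" using comp_id_left[OF catA u] comp_id_right[OF catA u] by auto
    then show "amap G (\<beta> \<cdot>\<^bsub>M\<^esub> amap P h1) = amap G (h2 \<cdot>\<^bsub>M\<^esub> \<gamma>)"
      using functor_comp[OF fG Ph d(3)] functor_comp[OF fG d2(3) h2(1)] d(4) d2(4) GP(2)[OF h1(1)] h1(3) h2(3) by simp
  qed
  then have h: "((y, \<gamma>, n), (h1, h2), (x, \<beta>, m)) \<in> Hom K w0 (x, \<beta>, m)" using h1 h2 o o2 by (auto simp: K_Hom w0)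
  show "\<exists>!h. h \<in> Hom K w0 (x, \<beta>, m) \<and> ((x, \<beta>, m), (a, b), (x', \<beta>', m')) \<cdot>\<^bsub>K\<^esub> h = g \<and> amap Q h = u"
  proof (rule ex1I[of _ "((y, \<gamma>, n), (h1, h2), (x, \<beta>, m))"], intro conjI)
    fix h' assume h': "h' \<in> Hom K w0 (x, \<beta>, m) \<and> ((x, \<beta>, m), (a, b), (x', \<beta>', m')) \<cdot>\<^bsub>K\<^esub> h' = g \<and> amap Q h' = u"
    then obtain p1 p2 where p: "h' = ((y, \<gamma>, n), (p1, p2), (x, \<beta>, m))" "p1 \<in> Hom X y x" "p2 \<in> Hom M n m"
      by (auto simp: K_Hom w0)
    have hA: "((y, \<gamma>, n), (p1, p2), (x, \<beta>, m)) \<in> Arr K" using h' p by (auto simp: Hom_iff)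
    have eqs: "a \<cdot> p1 = c" "b \<cdot>\<^bsub>M\<^esub> p2 = k" "amap F p1 = u" using h' p g by (auto simp: K_ops Q_maps)
    have "p1 = h1" by (rule cartesian_unique[OF ca a p(2) h1(1) _ _ catX fF]) (use eqs h1 in auto)
    moreover have "p2 = h2" by (rule cartesian_unique[OF cb b p(3) h2(1) _ _ catM fG]) (use eqs h2 K_amap_eq[OF hA] in auto)
    ultimately show "h' = ((y, \<gamma>, n), (h1, h2), (x, \<beta>, m))" using p by simp
  qed (use h h1 h2 g in \<open>auto simp: K_ops Q_maps\<close>)
qed

text \<open>\<alpha> is lifted separately in \<open>X\<close> and in \<open>M\<close>; the structure
  arrow of the new object is the factorization of \<beta>' after P a through the cartesian lift
  \<open>b\<close>.\<close>

lemma K_lift: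
  assumes o: "(x', \<beta>', m') \<in> Obj K" and al: "\<alpha> \<in> Hom A c (omap F x')"
  obtains x \<beta> m a b where "((x, \<beta>, m), (a, b), (x', \<beta>', m')) \<in> Arr K" "cartesian A (X, F) a" "cartesian A (M, G) b"
    "amap F a = \<alpha>"
proof -
  note d' = K_ObjD[OF o]
  obtain x a where a: "a \<in> Hom X x x'" "cartesian A (X, F) a" "amap F a = \<alpha>" "omap F x = c" using lift_X[OF d'(1) al] by blast
  have al': "\<alpha> \<in> Hom A c (omap G m')" using al d'(5) by simp
  obtain m b where b: "b \<in> Hom M m m'" "cartesian A (M, G) b" "amap G b = \<alpha>" "omap G m = c" using lift_M[OF d'(2) al'] by blast
  note Pa = functor_Hom[OF fP a(1)]
  have x: "x \<in> Obj X" "m \<in> Obj M" using Hom_ob[OF catX a(1)] Hom_ob[OF catM b(1)] by auto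
  have I: "Ident A c \<in> Hom A c c" using Hom_ob[OF catA al] id_Hom[OF catA] by auto
  have I': "Ident A c \<in> Hom A (omap G (omap P x)) (omap G m)" using I GP(1)[OF x(1)] a(4) b(4) by simp
  have "amap G b \<cdot>\<^bsub>A\<^esub> Ident A c = amap G (\<beta>' \<cdot>\<^bsub>M\<^esub> amap P a)"
    using functor_comp[OF fG Pa d'(3)] d'(4) GP(2)[OF a(1)] b(3) a(3) comp_id_right[OF catA al] comp_id_left[OF catA al] by simp
  from cartesian_ex1[OF b(2,1) comp_Hom[OF catM Pa d'(3)] I' this]
  obtain \<beta> where \<beta>: "\<beta> \<in> Hom M (omap P x) m" "b \<cdot>\<^bsub>M\<^esub> \<beta> = \<beta>' \<cdot>\<^bsub>M\<^esub> amap P a" "amap G \<beta> = Ident A c" by blast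
  have "(x, \<beta>, m) \<in> Obj K" using x \<beta> a by (simp add: K_Obj)
  then have "((x, \<beta>, m), (a, b), (x', \<beta>', m')) \<in> Arr K" using o a b \<beta> by (simp add: K_Arr)
  then show ?thesis using that a b by blast
qed

lemma comma_fib_object: "fib_object A (K, Q)"
  unfolding fib_object_def prod.case
proof (intro conjI ballI impI)
  fix d \<alpha> assume "d \<in> Obj K" and a: "\<alpha> \<in> Arr A" "Cod A \<alpha> = omap Q d"
  moreover obtain x \<beta> m where d: "d = (x, \<beta>, m)" by (cases d)
  ultimately have o: "(x, \<beta>, m) \<in> Obj K" by simp
  have al: "\<alpha> \<in> Hom A (Dom A \<alpha>) (omap F x)" using a d by (simp add: Hom_iff Q_maps)
  obtain x0 \<beta>0 m0 a b where t: "((x0, \<beta>0, m0), (a, b), (x, \<beta>, m)) \<in> Arr K" "cartesian A (X, F) a" "cartesian A (M, G) b"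
    "amap F a = \<alpha>" by (rule K_lift[OF o al])
  show "\<exists>f. cartesian A (K, Q) f \<and> Cod K f = d \<and> amap Q f = \<alpha>"
    using K_cartesianI[OF t(1-3)] t(4) d
    by (intro exI[of _ "((x0, \<beta>0, m0), (a, b), (x, \<beta>, m))"]) (simp add: K_ops Q_maps)
qed (fact catA K_category Q_functor)+

text \<open>A cartesian arrow differs by an isomorphism from the componentwise lift of the same base
  arrow, and cartesian arrows are stable under composition with isomorphisms.\<close>

lemma K_cartesianD:
  assumes t: "((x, \<beta>, m), (a, b), (x', \<beta>', m')) \<in> Arr K" and ct: "cartesian A (K, Q) ((x, \<beta>, m), (a, b), (x', \<beta>', m'))"
  shows "cartesian A (X, F) a" "cartesian A (M, G) b"
proof -
  have o: "(x, \<beta>, m) \<in> Obj K" "(x', \<beta>', m') \<in> Obj K" and a: "a \<in> Hom X x x'" and b: "b \<in> Hom M m m'" using t by (auto simp: K_Arr)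
  obtain x0 \<beta>0 m0 a0 b0 where s: "((x0, \<beta>0, m0), (a0, b0), (x', \<beta>', m')) \<in> Arr K" and cs: "cartesian A (X, F) a0" "cartesian A (M, G) b0"
    and eq: "amap F a0 = amap F a" by (rule K_lift[OF o(2) functor_Hom[OF fF a]])
  have a0: "a0 \<in> Hom X x0 x'" and b0: "b0 \<in> Hom M m0 m'" using s by (auto simp: K_Arr)
  have sH: "((x0, \<beta>0, m0), (a0, b0), (x', \<beta>', m')) \<in> Hom K (x0, \<beta>0, m0) (x', \<beta>', m')" using s by (auto simp: K_Hom K_Arr)
  have tH: "((x, \<beta>, m), (a, b), (x', \<beta>', m')) \<in> Hom K (x, \<beta>, m) (x', \<beta>', m')" using t by (auto simp: K_Hom K_Arr)
  obtain i j where ij: "inverse_arrows K (x, \<beta>, m) (x0, \<beta>0, m0) i j"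
    and it: "((x0, \<beta>0, m0), (a0, b0), (x', \<beta>', m')) \<cdot>\<^bsub>K\<^esub> i = ((x, \<beta>, m), (a, b), (x', \<beta>', m'))"
    by (rule cartesian_lifts_isomorphic[OF K_category catA Q_functor K_cartesianI[OF s cs] sH ct tH]) (use eq in \<open>simp_all add: Q_maps\<close>)
  obtain i1 i2 where i: "i = ((x, \<beta>, m), (i1, i2), (x0, \<beta>0, m0))" "i1 \<in> Hom X x x0" "i2 \<in> Hom M m m0"
    using ij by (auto simp: inverse_arrows_def K_Hom)
  obtain j1 j2 where j: "j = ((x0, \<beta>0, m0), (j1, j2), (x, \<beta>, m))" "j1 \<in> Hom X x0 x" "j2 \<in> Hom M m0 m"
    using ij by (auto simp: inverse_arrows_def K_Hom)
  have 1: "inverse_arrows X x x0 i1 j1" "inverse_arrows M m m0 i2 j2" using ij i j by (auto simp: inverse_arrows_def K_ops)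
  have 2: "a = a0 \<cdot> i1" "b = b0 \<cdot>\<^bsub>M\<^esub> i2" using it i by (auto simp: K_ops)
  show "cartesian A (X, F) a" "cartesian A (M, G) b"
    using cartesian_comp_iso[OF catX catA fF cs(1) a0 1(1)] cartesian_comp_iso[OF catM catA fG cs(2) b0 1(2)] 2 by auto
qed

end

section \<open>A criterion for opfibrations of fibrations\<close>

lemma fib_1cell_id: "fib_object A (X, F) ==> fib_1cell A (X, F) (X, F) id_fctr"
  using id_functor by (auto simp: fib_1cell_def id_fctr_def)

text \<open>A class \<open>W\<close> of vertical arrows that are cocartesian for \<open>P\<close>, contains a lift of every vertical
  arrow \<open>P x \<rightarrow> m\<close> and is stable under reindexing yields an opfibration in \<open>Fib(A)\<close>; stability is what
  makes the left adjoint preserve cartesian arrows.\<close>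

locale cocartesian_lifts = fib_map A X F M G P
  for A :: "('o, 'm) category" and X :: "('x, 'y) category" (structure) and F and M :: "('u, 'v) category" and G and P +
  fixes W :: "'y set"
  assumes W_vertical: "w \<in> W ==> w \<in> Hom X x y ==> amap F w = Ident A (omap F x)"
    and W_arr: "w \<in> W ==> w \<in> Arr X"
    and W_lift: "x \<in> Obj X ==> \<beta> \<in> Hom M (omap P x) m ==> amap G \<beta> = Ident A (omap F x) ==>
      \<exists>w\<in>W. Dom X w = x \<and> amap P w = \<beta>"
    and W_cocartesian: "w \<in> W ==> w \<in> Hom X x y ==> g \<in> Hom X x z ==> b \<in> Hom M (omap P y) (omap P z) ==>
      b \<cdot>\<^bsub>M\<^esub> amap P w = amap P g ==> \<exists>!h. h \<in> Hom X y z \<and> h \<cdot> w = g \<and> amap P h = b"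
    and W_base_change: "w \<in> W ==> w \<in> Hom X x y ==> f \<in> Hom X x' x ==> cartesian A (X, F) f ==>
      f' \<in> Hom X y' y ==> cartesian A (X, F) f' ==> v \<in> Hom X x' y' ==>
      amap F v = Ident A (omap F x') ==> f' \<cdot> v = w \<cdot> f ==> v \<in> W"
begin

text \<open>With the identity 1-cell the construction yields the comma object of (X, F) with itself,
  available as \<open>E.K\<close> and \<open>E.Q\<close>.\<close>

sublocale E: fib_map A X F X F id_fctr by unfold_locales (use XF fib_1cell_id in blast)+

lemma idf: "omap id_fctr x = x" "amap id_fctr f = f"
  by (simp_all add: id_fctr_def)

definition wl :: "'x \<times> 'v \<times> 'u => 'y" where "wl d = (case d of (x, \<beta>, m) => (SOME w. w \<in> W \<and> Dom X w = x \<and> amap P w = \<beta>))"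

lemma wl:
  assumes "(x, \<beta>, m) \<in> Obj K"
  shows "wl (x, \<beta>, m) \<in> W" "wl (x, \<beta>, m) \<in> Hom X x (Cod X (wl (x, \<beta>, m)))" "amap P (wl (x, \<beta>, m)) = \<beta>"
    "omap P (Cod X (wl (x, \<beta>, m))) = m" "omap F (Cod X (wl (x, \<beta>, m))) = omap F x"
    "amap F (wl (x, \<beta>, m)) = Ident A (omap F x)"
proof -
  note d = K_ObjD[OF assms]
  have "\<exists>w. w \<in> W \<and> Dom X w = x \<and> amap P w = \<beta>" using W_lift[OF d(1,3,4)] by blast
  from someI_ex[OF this] have w: "wl (x, \<beta>, m) \<in> W" "Dom X (wl (x, \<beta>, m)) = x" "amap P (wl (x, \<beta>, m)) = \<beta>"
    by (auto simp: wl_def)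
  show "wl (x, \<beta>, m) \<in> W" "amap P (wl (x, \<beta>, m)) = \<beta>" by (fact w)+
  show h: "wl (x, \<beta>, m) \<in> Hom X x (Cod X (wl (x, \<beta>, m)))" using w(2) W_arr[OF w(1)] by (simp add: Hom_iff)
  show v: "amap F (wl (x, \<beta>, m)) = Ident A (omap F x)" by (rule W_vertical[OF w(1) h])
  show "omap P (Cod X (wl (x, \<beta>, m))) = m" using functor_Hom[OF fP h] w(3) d(3) by (simp add: Hom_iff)
  have "Ident A (omap F x) \<in> Hom A (omap F x) (omap F x)" by (rule id_Hom[OF catA functor_Obj[OF fF d(1)]])
  then show "omap F (Cod X (wl (x, \<beta>, m))) = omap F x" using functor_Hom[OF fF h] v by (simp add: Hom_iff)
qed

lemma W_eqI:
  assumes "w \<in> W" "w \<in> Hom X x y" "h \<in> Hom X y v" "k \<in> Hom X y v" "h \<cdot> w = k \<cdot> w" "amap P h = amap P k"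
  shows "h = k"
proof -
  have "\<exists>!h'. h' \<in> Hom X y v \<and> h' \<cdot> w = h \<cdot> w \<and> amap P h' = amap P h"
    by (rule W_cocartesian[OF assms(1,2) comp_Hom[OF catX assms(2,3)] functor_Hom[OF fP assms(3)]])
      (simp add: functor_comp[OF fP assms(2,3)])
  then show ?thesis using assms by metis
qed

section \<open>The left adjoint\<close>

text \<open>The left adjoint \<open>L\<close> sends an object to the chosen lift of its structure
  arrow, which is \<open>lo\<close>. On an arrow (a, b) it keeps \<open>a\<close>, while
  \<open>lc\<close> is the arrow between the codomains of the lifts that cocartesianness
  induces.\<close>

definition lo where "lo d = (case d of (x, \<beta>, m) => (x, wl d, Cod X (wl d)))"
definition lc where "lc d a b d' = (THE h. h \<in> Hom X (Cod X (wl d)) (Cod X (wl d')) \<and>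
   h \<cdot> wl d = wl d' \<cdot> a \<and> amap P h = b)"
definition L where "L = \<lparr>omap = lo, amap = (\<lambda>(d, (a, b), d'). (lo d, (a, lc d a b d'), lo d'))\<rparr>"

lemma lo: "(x, \<beta>, m) \<in> Obj K ==> lo (x, \<beta>, m) = (x, wl (x, \<beta>, m), Cod X (wl (x, \<beta>, m)))"
  by (simp add: lo_def)

lemma lo_Obj: "(x, \<beta>, m) \<in> Obj K ==> lo (x, \<beta>, m) \<in> Obj E.K"
  using wl[of x \<beta> m] Hom_ob[OF catX wl(2)] by (simp add: lo E.K_Obj idf)

lemma lc:
  assumes t: "((x, \<beta>, m), (a, b), (x', \<beta>', m')) \<in> Arr K"
  shows "lc (x, \<beta>, m) a b (x', \<beta>', m') \<in> Hom X (Cod X (wl (x, \<beta>, m))) (Cod X (wl (x', \<beta>', m')))"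
    "lc (x, \<beta>, m) a b (x', \<beta>', m') \<cdot> wl (x, \<beta>, m) = wl (x', \<beta>', m') \<cdot> a"
    "amap P (lc (x, \<beta>, m) a b (x', \<beta>', m')) = b"
proof -
  have o: "(x, \<beta>, m) \<in> Obj K" "(x', \<beta>', m') \<in> Obj K" and a: "a \<in> Hom X x x'" and b: "b \<in> Hom M m m'"
    and e: "\<beta>' \<cdot>\<^bsub>M\<^esub> amap P a = b \<cdot>\<^bsub>M\<^esub> \<beta>" using t by (auto simp: K_Arr)
  note w = wl[OF o(1)] and w' = wl[OF o(2)]
  have "\<exists>!h. h \<in> Hom X (Cod X (wl (x, \<beta>, m))) (Cod X (wl (x', \<beta>', m'))) \<and>
      h \<cdot> wl (x, \<beta>, m) = wl (x', \<beta>', m') \<cdot> a \<and> amap P h = b"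
    by (rule W_cocartesian[OF w(1,2) comp_Hom[OF catX a w'(2)]])
      (use b w w' e functor_comp[OF fP a w'(2)] in simp_all)
  from theI'[OF this] show "lc (x, \<beta>, m) a b (x', \<beta>', m') \<in> Hom X (Cod X (wl (x, \<beta>, m))) (Cod X (wl (x', \<beta>', m')))"
    "lc (x, \<beta>, m) a b (x', \<beta>', m') \<cdot> wl (x, \<beta>, m) = wl (x', \<beta>', m') \<cdot> a"
    "amap P (lc (x, \<beta>, m) a b (x', \<beta>', m')) = b" by (auto simp: lc_def)
qed

lemma lc_eqI:
  assumes t: "((x, \<beta>, m), (a, b), (x', \<beta>', m')) \<in> Arr K"
    and h: "h \<in> Hom X (Cod X (wl (x, \<beta>, m))) (Cod X (wl (x', \<beta>', m')))"
      "h \<cdot> wl (x, \<beta>, m) = wl (x', \<beta>', m') \<cdot> a" "amap P h = b"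
  shows "lc (x, \<beta>, m) a b (x', \<beta>', m') = h"
proof -
  have o: "(x, \<beta>, m) \<in> Obj K" using t by (simp add: K_Arr)
  note w = wl[OF o]
  show ?thesis by (rule W_eqI[OF w(1,2) lc(1)[OF t] h(1)]) (use lc[OF t] h in simp_all)
qed

lemma L_Arr:
  assumes t: "((x, \<beta>, m), (a, b), (x', \<beta>', m')) \<in> Arr K"
  shows "amap L ((x, \<beta>, m), (a, b), (x', \<beta>', m')) =
      ((x, wl (x, \<beta>, m), Cod X (wl (x, \<beta>, m))), (a, lc (x, \<beta>, m) a b (x', \<beta>', m')), (x', wl (x', \<beta>', m'), Cod X (wl (x', \<beta>', m'))))"
    "amap L ((x, \<beta>, m), (a, b), (x', \<beta>', m')) \<in> Arr E.K"
proof -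
  have o: "(x, \<beta>, m) \<in> Obj K" "(x', \<beta>', m') \<in> Obj K" and a: "a \<in> Hom X x x'" using t by (auto simp: K_Arr)
  show 1: "amap L ((x, \<beta>, m), (a, b), (x', \<beta>', m')) =
      ((x, wl (x, \<beta>, m), Cod X (wl (x, \<beta>, m))), (a, lc (x, \<beta>, m) a b (x', \<beta>', m')), (x', wl (x', \<beta>', m'), Cod X (wl (x', \<beta>', m'))))"
    using lo[OF o(1)] lo[OF o(2)] by (simp add: L_def)
  show "amap L ((x, \<beta>, m), (a, b), (x', \<beta>', m')) \<in> Arr E.K"
    unfolding 1 E.K_Arr using lo_Obj[OF o(1)] lo_Obj[OF o(2)] lo[OF o(1)] lo[OF o(2)] a lc[OF t] by (simp add: idf)
qed

lemma L_functor: "is_functor K E.K L"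
  unfolding is_functor_def
proof (intro conjI ballI impI)
  fix d assume "d \<in> Obj K"
  moreover obtain x \<beta> m where d: "d = (x, \<beta>, m)" by (cases d)
  ultimately have o: "(x, \<beta>, m) \<in> Obj K" by simp
  show "omap L d \<in> Obj E.K" using lo_Obj[OF o] d by (simp add: L_def)
  note w = wl[OF o]
  have IA: "((x, \<beta>, m), (Ident X x, Ident M m), (x, \<beta>, m)) \<in> Arr K"
    using id_Hom[OF K_category o] by (simp add: K_ops Hom_iff)
  have y: "Cod X (wl (x, \<beta>, m)) \<in> Obj X" using Hom_ob[OF catX w(2)] by simp
  have "lc (x, \<beta>, m) (Ident X x) (Ident M m) (x, \<beta>, m) = Ident X (Cod X (wl (x, \<beta>, m)))"
    by (rule lc_eqI[OF IA id_Hom[OF catX y]])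
      (use comp_id_left[OF catX w(2)] comp_id_right[OF catX w(2)] functor_id[OF fP y] w(4) in simp_all)
  then show "amap L (Ident K d) = Ident E.K (omap L d)" using L_Arr(1)[OF IA] by (simp add: d K_ops E.K_ops L_def)
next
  fix t assume t0: "t \<in> Arr K"
  then obtain x \<beta> m a b x' \<beta>' m' where t: "t = ((x, \<beta>, m), (a, b), (x', \<beta>', m'))" and o: "(x, \<beta>, m) \<in> Obj K" "(x', \<beta>', m') \<in> Obj K"
    by (rule K_ArrE)
  note t1 = t0[unfolded t]
  show "amap L t \<in> Hom E.K (omap L (Dom K t)) (omap L (Cod K t))"
    using L_Arr[OF t1] by (simp add: t Hom_iff K_ops E.K_ops L_def)
next
  fix t s assume t0: "t \<in> Arr K" and s0: "s \<in> Arr K" and c: "Cod K t = Dom K s"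
  obtain x \<beta> m a b x' \<beta>' m' where t: "t = ((x, \<beta>, m), (a, b), (x', \<beta>', m'))" and a: "a \<in> Hom X x x'" and b: "b \<in> Hom M m m'"
    and o: "(x, \<beta>, m) \<in> Obj K" "(x', \<beta>', m') \<in> Obj K" using t0 by (rule K_ArrE)
  obtain x1 \<beta>1 m1 a' b' x'' \<beta>'' m'' where s: "s = ((x1, \<beta>1, m1), (a', b'), (x'', \<beta>'', m''))" and a': "a' \<in> Hom X x1 x''" and b': "b' \<in> Hom M m1 m''"
    and o'': "(x'', \<beta>'', m'') \<in> Obj K" using s0 by (rule K_ArrE)
  have 0: "x1 = x'" "\<beta>1 = \<beta>'" "m1 = m'" using c t s by (auto simp: K_ops)
  note t1 = t0[unfolded t] and s1 = s0[unfolded s 0] and a' = a'[unfolded 0] and b' = b'[unfolded 0]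
  have "s \<cdot>\<^bsub>K\<^esub> t \<in> Arr K" using K_category t0 s0 c by (auto simp: is_category_def Hom_iff)
  then have st: "((x, \<beta>, m), (a' \<cdot> a, b' \<cdot>\<^bsub>M\<^esub> b), (x'', \<beta>'', m'')) \<in> Arr K" by (simp add: t s K_ops)
  note w = wl[OF o(1)] and w' = wl[OF o(2)] and w'' = wl[OF o'']
  note l1 = lc[OF t1] and l2 = lc[OF s1]
  have "lc (x, \<beta>, m) (a' \<cdot> a) (b' \<cdot>\<^bsub>M\<^esub> b) (x'', \<beta>'', m'') =
      lc (x', \<beta>', m') a' b' (x'', \<beta>'', m'') \<cdot> lc (x, \<beta>, m) a b (x', \<beta>', m')"
    by (rule lc_eqI[OF st comp_Hom[OF catX l1(1) l2(1)]])
      (use comp_assoc[OF catX w(2) l1(1) l2(1)] l1(2,3) l2(2,3) comp_assoc[OF catX a w'(2) l2(1)]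
        comp_assoc[OF catX a a' w''(2)] functor_comp[OF fP l1(1) l2(1)] in simp_all)
  then show "amap L (s \<cdot>\<^bsub>K\<^esub> t) = amap L s \<cdot>\<^bsub>E.K\<^esub> amap L t"
    using L_Arr(1)[OF t1] L_Arr(1)[OF s1] L_Arr(1)[OF st] by (simp add: t s 0 K_ops E.K_ops)
qed

lemma L_base: "d \<in> Obj K ==> omap E.Q (omap L d) = omap Q d" "t \<in> Arr K ==> amap E.Q (amap L t) = amap Q t"
proof -
  show "omap E.Q (omap L d) = omap Q d" if "d \<in> Obj K"
    using that by (cases d) (auto simp: L_def lo E.Q_maps Q_maps)
  show "amap E.Q (amap L t) = amap Q t" if t0: "t \<in> Arr K"
  proof -
    obtain x \<beta> m a b x' \<beta>' m' where t: "t = ((x, \<beta>, m), (a, b), (x', \<beta>', m'))" using t0 by (rule K_ArrE)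
    show ?thesis using L_Arr(1)[OF t0[unfolded t]] by (simp add: t E.Q_maps Q_maps)
  qed
qed

text \<open>Let f : v \<rightarrow> y' be a cartesian lift of F a at the codomain of the chosen lift
  of \<beta>'. The induced arrow u : x \<rightarrow> v lies in \<open>W\<close> by stability, and P
  u is \<beta> followed by an isomorphism \<open>i\<close>, because P f and \<open>b\<close> are
  cartesian over the same arrow. So \<open>u\<close> and the chosen lift of \<beta> are cocartesian
  over isomorphic arrows; their codomains are isomorphic, and \<open>lc\<close> is \<open>f\<close>
  composed with that isomorphism.\<close>

lemma lc_cartesian:
  assumes t: "((x, \<beta>, m), (a, b), (x', \<beta>', m')) \<in> Arr K" and ca: "cartesian A (X, F) a" and cb: "cartesian A (M, G) b"
  shows "cartesian A (X, F) (lc (x, \<beta>, m) a b (x', \<beta>', m'))"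
proof -
  have o: "(x, \<beta>, m) \<in> Obj K" "(x', \<beta>', m') \<in> Obj K" and a: "a \<in> Hom X x x'" and b: "b \<in> Hom M m m'"
    and e: "\<beta>' \<cdot>\<^bsub>M\<^esub> amap P a = b \<cdot>\<^bsub>M\<^esub> \<beta>" using t by (auto simp: K_Arr)
  note d = K_ObjD[OF o(1)]
  note w = wl[OF o(1)] and w' = wl[OF o(2)]
  let ?w = "wl (x, \<beta>, m)" and ?w' = "wl (x', \<beta>', m')"
  let ?y = "Cod X ?w" and ?y' = "Cod X ?w'"
  note Fa = functor_Hom[OF fF a]
  have y': "?y' \<in> Obj X" using Hom_ob[OF catX w'(2)] by simp
  obtain v f where f: "f \<in> Hom X v ?y'" "cartesian A (X, F) f" "amap F f = amap F a" "omap F v = omap F x"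
    using lift_X[OF y', of "amap F a" "omap F x"] Fa w'(5) by auto
  have wa: "?w' \<cdot> a \<in> Hom X x ?y'" by (rule comp_Hom[OF catX a w'(2)])
  have I: "Ident A (omap F x) \<in> Hom A (omap F x) (omap F v)" using id_Hom[OF catA functor_Obj[OF fF d(1)]] f(4) by simp
  have "amap F f \<cdot>\<^bsub>A\<^esub> Ident A (omap F x) = amap F (?w' \<cdot> a)"
    using f(3) comp_id_right[OF catA Fa] functor_comp[OF fF a w'(2)] w'(6) comp_id_left[OF catA Fa] by simp
  from cartesian_ex1[OF f(2,1) wa I this]
  obtain u where u: "u \<in> Hom X x v" "f \<cdot> u = ?w' \<cdot> a" "amap F u = Ident A (omap F x)" by blast
  have uW: "u \<in> W" by (rule W_base_change[OF w'(1,2) a ca f(1,2) u(1,3,2)])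
  note Pf = functor_Hom[OF fP f(1), unfolded w'(4)] and cPf = P_cartesian[OF f(2)] and Pu = functor_Hom[OF fP u(1)]
  have "amap G (amap P f) = amap G b" using GP(2)[OF f(1)] f(3) K_amap_eq[OF t] by simp
  then obtain i j where ij: "inverse_arrows M m (omap P v) i j" "amap P f \<cdot>\<^bsub>M\<^esub> i = b"
    "amap G i = Ident A (omap G (omap P v))" by (rule cartesian_lifts_isomorphic[OF catM catA fG cPf Pf cb b])
  have i: "i \<in> Hom M m (omap P v)" "j \<in> Hom M (omap P v) m" "j \<cdot>\<^bsub>M\<^esub> i = Ident M m" "i \<cdot>\<^bsub>M\<^esub> j = Ident M (omap P v)"
    using ij by (auto simp: inverse_arrows_def)
  have v: "v \<in> Obj X" using Hom_ob[OF catX u(1)] by simp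
  have Gi: "amap G i = Ident A (omap F x)" using ij(3) GP(1)[OF v] f(4) by simp
  have II: "Ident A (omap F x) \<cdot>\<^bsub>A\<^esub> Ident A (omap F x) = Ident A (omap F x)"
    using comp_id_left[OF catA id_Hom[OF catA functor_Obj[OF fF d(1)]]] .
  have Pui: "amap P u = i \<cdot>\<^bsub>M\<^esub> \<beta>"
  proof (rule cartesian_unique[OF cPf Pf Pu comp_Hom[OF catM d(3) i(1)] _ _ catM fG])
    show "amap P f \<cdot>\<^bsub>M\<^esub> amap P u = amap P f \<cdot>\<^bsub>M\<^esub> (i \<cdot>\<^bsub>M\<^esub> \<beta>)"
      using functor_comp[OF fP u(1) f(1)] u(2) functor_comp[OF fP a w'(2)] w'(3) e comp_assoc[OF catM d(3) i(1) Pf] ij(2) by simp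
    show "amap G (amap P u) = amap G (i \<cdot>\<^bsub>M\<^esub> \<beta>)"
      using GP(2)[OF u(1)] u(3) functor_comp[OF fG d(3) i(1)] Gi d(4) II by simp
  qed
  have i': "i \<in> Hom M (omap P ?y) (omap P v)" "j \<in> Hom M (omap P v) (omap P ?y)" using i w(4) by auto
  have "i \<cdot>\<^bsub>M\<^esub> amap P ?w = amap P u" using Pui w(3) by simp
  from W_cocartesian[OF w(1,2) u(1) i'(1) this]
  obtain k where k: "k \<in> Hom X ?y v" "k \<cdot> ?w = u" "amap P k = i" by blast
  have "j \<cdot>\<^bsub>M\<^esub> amap P u = amap P ?w"
    using Pui comp_assoc[OF catM d(3) i(1,2)] i(3) comp_id_left[OF catM d(3)] w(3) by simp
  from W_cocartesian[OF uW u(1) w(2) i'(2) this]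
  obtain k' where k': "k' \<in> Hom X v ?y" "k' \<cdot> u = ?w" "amap P k' = j" by blast
  have y: "?y \<in> Obj X" using Hom_ob[OF catX w(2)] by simp
  have "k' \<cdot> k = Ident X ?y" by (rule W_eqI[OF w(1,2) comp_Hom[OF catX k(1) k'(1)] id_Hom[OF catX y]])
      (use comp_assoc[OF catX w(2) k(1) k'(1)] k k' comp_id_left[OF catX w(2)] functor_comp[OF fP k(1) k'(1)] i(3)
        functor_id[OF fP y] w(4) in simp_all)
  moreover have "k \<cdot> k' = Ident X v" by (rule W_eqI[OF uW u(1) comp_Hom[OF catX k'(1) k(1)] id_Hom[OF catX v]])
      (use comp_assoc[OF catX u(1) k'(1) k(1)] k k' comp_id_left[OF catX u(1)] functor_comp[OF fP k'(1) k(1)] i(4)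
        functor_id[OF fP v] in simp_all)
  ultimately have "inverse_arrows X ?y v k k'" using k k' by (simp add: inverse_arrows_def)
  from cartesian_comp_iso[OF catX catA fF f(2,1) this] have c: "cartesian A (X, F) (f \<cdot> k)" .
  have "lc (x, \<beta>, m) a b (x', \<beta>', m') = f \<cdot> k" by (rule lc_eqI[OF t comp_Hom[OF catX k(1) f(1)]])
      (use comp_assoc[OF catX w(2) k(1) f(1)] k u(2) functor_comp[OF fP k(1) f(1)] ij(2) in simp_all)
  then show ?thesis using c by simp
qed

lemma L_1cell: "fib_1cell A (K, Q) (E.K, E.Q) L"
  unfolding fib_1cell_def prod.case
proof (intro conjI ballI allI impI)
  fix t assume c: "cartesian A (K, Q) t"
  then have t0: "t \<in> Arr K" by (simp add: cartesian_def)
  obtain x \<beta> m a b x' \<beta>' m' where t: "t = ((x, \<beta>, m), (a, b), (x', \<beta>', m'))" using t0 by (rule K_ArrE)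
  note t1 = t0[unfolded t]
  note ab = K_cartesianD[OF t1 c[unfolded t]]
  show "cartesian A (E.K, E.Q) (amap L t)"
    using E.K_cartesianI[OF L_Arr(2)[OF t1, unfolded L_Arr(1)[OF t1]] ab(1) lc_cartesian[OF t1 ab]] L_Arr(1)[OF t1] t by simp
qed (use L_functor L_base in blast)+

section \<open>Unit, counit and the adjunction\<close>

abbreviation R where "R \<equiv> fib_comma_r P"

lemma R_maps: "omap R (x, \<nu>, y) = (x, amap P \<nu>, omap P y)"
  "amap R ((x, \<nu>, y), (a, b), (x', \<nu>', y')) = ((x, amap P \<nu>, omap P y), (a, amap P b), (x', amap P \<nu>', omap P y'))"
  by (simp_all add: fib_comma_r_def Let_def)

lemma R_Obj: "(x, \<nu>, y) \<in> Obj E.K ==> (x, amap P \<nu>, omap P y) \<in> Obj K"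
  using functor_Hom[OF fP] functor_Obj[OF fP] GP by (auto simp: E.K_Obj K_Obj idf)

lemma R_Arr:
  assumes "((x, \<nu>, y), (a, b), (x', \<nu>', y')) \<in> Arr E.K"
  shows "((x, amap P \<nu>, omap P y), (a, amap P b), (x', amap P \<nu>', omap P y')) \<in> Arr K"
proof -
  have o: "(x, \<nu>, y) \<in> Obj E.K" "(x', \<nu>', y') \<in> Obj E.K" and a: "a \<in> Hom X x x'" and b: "b \<in> Hom X y y'"
    and e: "\<nu>' \<cdot> a = b \<cdot> \<nu>" using assms by (auto simp: E.K_Arr idf)
  have n: "\<nu> \<in> Hom X x y" "\<nu>' \<in> Hom X x' y'" using o by (auto simp: E.K_Obj idf)
  show ?thesis unfolding K_Arr
    using R_Obj[OF o(1)] R_Obj[OF o(2)] a functor_Hom[OF fP b] functor_comp[OF fP a n(2)] functor_comp[OF fP n(1) b] e by simp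
qed

lemma R_1cell: "fib_1cell A (E.K, E.Q) (K, Q) R"
  unfolding fib_1cell_def prod.case is_functor_def
proof (intro conjI ballI allI impI)
  fix d assume "d \<in> Obj E.K"
  moreover obtain x \<nu> y where d: "d = (x, \<nu>, y)" by (cases d)
  ultimately have o: "(x, \<nu>, y) \<in> Obj E.K" by simp
  show "omap R d \<in> Obj K" using R_Obj[OF o] by (simp add: d R_maps)
  show "omap Q (omap R d) = omap E.Q d" by (simp add: d R_maps Q_maps E.Q_maps)
  show "amap R (Ident E.K d) = Ident K (omap R d)"
    using functor_id[OF fP E.K_ObjD(2)[OF o]] by (simp add: d R_maps K_ops E.K_ops)
next
  fix t assume t0: "t \<in> Arr E.K"
  obtain x \<nu> y a b x' \<nu>' y' where t: "t = ((x, \<nu>, y), (a, b), (x', \<nu>', y'))" using t0 by (rule E.K_ArrE)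
  show "amap R t \<in> Hom K (omap R (Dom E.K t)) (omap R (Cod E.K t))"
    using R_Arr[OF t0[unfolded t]] by (simp add: t R_maps Hom_iff K_ops E.K_ops)
  show "amap Q (amap R t) = amap E.Q t" by (simp add: t R_maps Q_maps E.Q_maps)
next
  fix t s assume t0: "t \<in> Arr E.K" and s0: "s \<in> Arr E.K" and c: "Cod E.K t = Dom E.K s"
  obtain x \<nu> y a b x' \<nu>' y' where t: "t = ((x, \<nu>, y), (a, b), (x', \<nu>', y'))" and b: "b \<in> Hom X y y'" using t0 by (rule E.K_ArrE)
  obtain x1 \<nu>1 y1 a' b' x'' \<nu>'' y'' where s: "s = ((x1, \<nu>1, y1), (a', b'), (x'', \<nu>'', y''))" and b': "b' \<in> Hom X y1 y''" using s0 by (rule E.K_ArrE)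
  have "y1 = y'" using c t s by (simp add: E.K_ops)
  then show "amap R (s \<cdot>\<^bsub>E.K\<^esub> t) = amap R s \<cdot>\<^bsub>K\<^esub> amap R t"
    using functor_comp[OF fP b] b' by (simp add: t s R_maps K_ops E.K_ops)
next
  fix t assume c: "cartesian A (E.K, E.Q) t"
  then have t0: "t \<in> Arr E.K" by (simp add: cartesian_def)
  obtain x \<nu> y a b x' \<nu>' y' where t: "t = ((x, \<nu>, y), (a, b), (x', \<nu>', y'))" using t0 by (rule E.K_ArrE)
  note ab = E.K_cartesianD[OF t0[unfolded t] c[unfolded t]]
  show "cartesian A (K, Q) (amap R t)"
    using K_cartesianI[OF R_Arr[OF t0[unfolded t]] ab(1) P_cartesian[OF ab(2)]] by (simp add: t R_maps)
qed

text \<open>The essential component of the counit: the comparison from the chosen lift of P \<nu> to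
  \<nu> itself.\<close>

definition cu where "cu d = (case d of (x, \<nu>, y) => (THE h. h \<in> Hom X (Cod X (wl (x, amap P \<nu>, omap P y))) y \<and>
   h \<cdot> wl (x, amap P \<nu>, omap P y) = \<nu> \<and> amap P h = Ident M (omap P y)))"
definition eps where "eps d = (case d of (x, \<nu>, y) => (lo (x, amap P \<nu>, omap P y), (Ident X x, cu d), (x, \<nu>, y)))"

lemma cu:
  assumes o: "(x, \<nu>, y) \<in> Obj E.K"
  shows "cu (x, \<nu>, y) \<in> Hom X (Cod X (wl (x, amap P \<nu>, omap P y))) y"
    "cu (x, \<nu>, y) \<cdot> wl (x, amap P \<nu>, omap P y) = \<nu>" "amap P (cu (x, \<nu>, y)) = Ident M (omap P y)"
proof -
  note w = wl[OF R_Obj[OF o]]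
  have n: "\<nu> \<in> Hom X x y" "y \<in> Obj X" using o by (auto simp: E.K_Obj idf)
  note Pn = functor_Hom[OF fP n(1)]
  have "\<exists>!h. h \<in> Hom X (Cod X (wl (x, amap P \<nu>, omap P y))) y \<and>
   h \<cdot> wl (x, amap P \<nu>, omap P y) = \<nu> \<and> amap P h = Ident M (omap P y)"
    by (rule W_cocartesian[OF w(1,2) n(1)])
      (use id_Hom[OF catM functor_Obj[OF fP n(2)]] w comp_id_left[OF catM Pn] in simp_all)
  from theI'[OF this] show "cu (x, \<nu>, y) \<in> Hom X (Cod X (wl (x, amap P \<nu>, omap P y))) y"
    "cu (x, \<nu>, y) \<cdot> wl (x, amap P \<nu>, omap P y) = \<nu>" "amap P (cu (x, \<nu>, y)) = Ident M (omap P y)"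
    by (auto simp: cu_def)
qed

lemma eps:
  assumes o: "(x, \<nu>, y) \<in> Obj E.K"
  shows "eps (x, \<nu>, y) = ((x, wl (x, amap P \<nu>, omap P y), Cod X (wl (x, amap P \<nu>, omap P y))), (Ident X x, cu (x, \<nu>, y)), (x, \<nu>, y))"
    "eps (x, \<nu>, y) \<in> Arr E.K"
proof -
  note o' = R_Obj[OF o]
  show 1: "eps (x, \<nu>, y) = ((x, wl (x, amap P \<nu>, omap P y), Cod X (wl (x, amap P \<nu>, omap P y))), (Ident X x, cu (x, \<nu>, y)), (x, \<nu>, y))"
    using lo[OF o'] by (simp add: eps_def)
  have n: "\<nu> \<in> Hom X x y" "x \<in> Obj X" using o by (auto simp: E.K_Obj idf)
  show "eps (x, \<nu>, y) \<in> Arr E.K"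
    unfolding 1 E.K_Arr using lo_Obj[OF o'] lo[OF o'] o id_Hom[OF catX n(2)] cu[OF o] comp_id_right[OF catX n(1)] by (simp add: idf)
qed

text \<open>The chosen lifts lie above \<beta> on the nose and not only up to isomorphism, which is
  why the unit can be an identity.\<close>

lemma R_L:
  shows "d \<in> Obj K ==> omap R (omap L d) = d" "t \<in> Arr K ==> amap R (amap L t) = t"
proof -
  have 1: "omap R (lo (x, \<beta>, m)) = (x, \<beta>, m)" if "(x, \<beta>, m) \<in> Obj K" for x \<beta> m
    using lo[OF that] wl(3,4)[OF that] by (simp add: R_maps)
  show "d \<in> Obj K ==> omap R (omap L d) = d" using 1 by (cases d) (simp add: L_def)
  show "amap R (amap L t) = t" if t0: "t \<in> Arr K"
  proof -
    obtain x \<beta> m a b x' \<beta>' m' where t: "t = ((x, \<beta>, m), (a, b), (x', \<beta>', m'))" and o: "(x, \<beta>, m) \<in> Obj K" "(x', \<beta>', m') \<in> Obj K"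
      using t0 by (rule K_ArrE)
    show ?thesis using L_Arr(1)[OF t0[unfolded t]] wl(3,4)[OF o(1)] wl(3,4)[OF o(2)] lc(3)[OF t0[unfolded t]] by (simp add: t R_maps)
  qed
qed

lemma comp_maps: "omap (S \<circ>\<^sub>F T) x = omap S (omap T x)" "amap (S \<circ>\<^sub>F T) f = amap S (amap T f)"
  by (simp_all add: comp_fctr_def)

lemma unit_2cell: "fib_2cell A (K, Q) (K, Q) id_fctr (R \<circ>\<^sub>F L) (Ident K)"
  unfolding fib_2cell_def prod.case is_nat_trans_def
proof (intro conjI ballI)
  fix d assume d0: "d \<in> Obj K"
  then show "Ident K d \<in> Hom K (omap id_fctr d) (omap (R \<circ>\<^sub>F L) d)"
    using id_Hom[OF K_category d0] R_L(1)[OF d0] by (simp add: idf comp_maps)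
  show "amap Q (Ident K d) = Ident A (omap Q d)" using functor_id[OF Q_functor d0] .
next
  fix t assume t0: "t \<in> Arr K"
  then have t: "t \<in> Hom K (Dom K t) (Cod K t)" by (simp add: Hom_iff)
  show "Ident K (Cod K t) \<cdot>\<^bsub>K\<^esub> amap id_fctr t = amap (R \<circ>\<^sub>F L) t \<cdot>\<^bsub>K\<^esub> Ident K (Dom K t)"
    using R_L(2)[OF t0] comp_id_left[OF K_category t] comp_id_right[OF K_category t] by (simp add: idf comp_maps)
qed

lemma counit_2cell: "fib_2cell A (E.K, E.Q) (E.K, E.Q) (L \<circ>\<^sub>F R) id_fctr eps"
  unfolding fib_2cell_def prod.case is_nat_trans_def
proof (intro conjI ballI)
  fix d assume "d \<in> Obj E.K"
  moreover obtain x \<nu> y where d: "d = (x, \<nu>, y)" by (cases d)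
  ultimately have o: "(x, \<nu>, y) \<in> Obj E.K" by simp
  show "eps d \<in> Hom E.K (omap (L \<circ>\<^sub>F R) d) (omap id_fctr d)"
    using eps[OF o] lo[OF R_Obj[OF o]] by (simp add: d Hom_iff E.K_ops comp_maps idf R_maps L_def)
  show "amap E.Q (eps d) = Ident A (omap E.Q d)"
    using eps(1)[OF o] functor_id[OF fF E.K_ObjD(1)[OF o]] by (simp add: d E.Q_maps)
next
  fix t assume t0: "t \<in> Arr E.K"
  obtain x \<nu> y a b x' \<nu>' y' where t: "t = ((x, \<nu>, y), (a, b), (x', \<nu>', y'))" and o: "(x, \<nu>, y) \<in> Obj E.K" "(x', \<nu>', y') \<in> Obj E.K"
    and a: "a \<in> Hom X x x'" and b: "b \<in> Hom X y y'" and e: "\<nu>' \<cdot> a = b \<cdot> \<nu>"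
    using t0 by (rule E.K_ArrE) (simp add: idf)
  note rA = R_Arr[OF t0[unfolded t]]
  note w = wl[OF R_Obj[OF o(1)]] and w' = wl[OF R_Obj[OF o(2)]] and c = cu[OF o(1)] and c' = cu[OF o(2)] and l = lc[OF rA]
  let ?d = "(x, amap P \<nu>, omap P y)" and ?d' = "(x', amap P \<nu>', omap P y')"
  have "cu (x', \<nu>', y') \<cdot> lc ?d a (amap P b) ?d' = b \<cdot> cu (x, \<nu>, y)"
  proof (rule W_eqI[OF w(1,2) comp_Hom[OF catX l(1) c'(1)] comp_Hom[OF catX c(1) b]])
    show "cu (x', \<nu>', y') \<cdot> lc ?d a (amap P b) ?d' \<cdot> wl ?d = b \<cdot> cu (x, \<nu>, y) \<cdot> wl ?d"
      using comp_assoc[OF catX w(2) l(1) c'(1)] l(2) comp_assoc[OF catX a w'(2) c'(1)] c'(2) e comp_assoc[OF catX w(2) c(1) b] c(2) by simp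
    note Pb = functor_Hom[OF fP b]
    show "amap P (cu (x', \<nu>', y') \<cdot> lc ?d a (amap P b) ?d') = amap P (b \<cdot> cu (x, \<nu>, y))"
      using functor_comp[OF fP l(1) c'(1)] functor_comp[OF fP c(1) b] l(3) c(3) c'(3) comp_id_left[OF catM Pb] comp_id_right[OF catM Pb] by simp
  qed
  then show "eps (Cod E.K t) \<cdot>\<^bsub>E.K\<^esub> amap (L \<circ>\<^sub>F R) t = amap id_fctr t \<cdot>\<^bsub>E.K\<^esub> eps (Dom E.K t)"
    using eps(1)[OF o(1)] eps(1)[OF o(2)] L_Arr(1)[OF rA] comp_id_left[OF catX a] comp_id_right[OF catX a]
    by (simp add: t E.K_ops comp_maps idf R_maps)
qed

theorem opfibration: "opfibration_in_Fib A (X, F) (M, G) P"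
proof -
  have "fib_adjunction A (E.K, E.Q) (K, Q) L R (Ident K) eps" unfolding fib_adjunction_def fst_conv
  proof (intro conjI ballI)
    show "fib_object A (E.K, E.Q)" "fib_object A (K, Q)" by (rule E.comma_fib_object, rule comma_fib_object)
    show "fib_1cell A (K, Q) (E.K, E.Q) L" "fib_1cell A (E.K, E.Q) (K, Q) R" by (rule L_1cell, rule R_1cell)
    show "fib_2cell A (K, Q) (K, Q) id_fctr (R \<circ>\<^sub>F L) (Ident K)" "fib_2cell A (E.K, E.Q) (E.K, E.Q) (L \<circ>\<^sub>F R) id_fctr eps"
      by (rule unit_2cell, rule counit_2cell)
  next
    fix d assume "d \<in> Obj E.K"
    moreover obtain x \<nu> y where d: "d = (x, \<nu>, y)" by (cases d)
    ultimately have o: "(x, \<nu>, y) \<in> Obj E.K" by simp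
    note o' = R_Obj[OF o]
    have "amap R (eps d) = Ident K (omap R d)" using eps(1)[OF o] cu(3)[OF o] wl(3,4)[OF o'] by (simp add: d R_maps K_ops)
    moreover have "Ident K (omap R d) \<in> Hom K (omap R d) (omap R d)" using id_Hom[OF K_category o'] by (simp add: d R_maps)
    ultimately show "amap R (eps d) \<cdot>\<^bsub>K\<^esub> Ident K (omap R d) = Ident K (omap R d)"
      using comp_id_left[OF K_category] by simp
  next
    fix d assume "d \<in> Obj K"
    moreover obtain x \<beta> m where d: "d = (x, \<beta>, m)" by (cases d)
    ultimately have o: "(x, \<beta>, m) \<in> Obj K" by simp
    note w = wl[OF o] and oL = lo_Obj[OF o, unfolded lo[OF o]]
    note c = cu[OF oL, unfolded w(3,4)]
    have y: "Cod X (wl (x, \<beta>, m)) \<in> Obj X" using Hom_ob[OF catX w(2)] by simp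
    \<comment> \<open>At a chosen lift the comparison \<open>cu\<close> is the identity, since the
      identity has the same composite with the lift and the same image under
      \<open>P\<close>.\<close>
    have cI: "cu (x, wl (x, \<beta>, m), Cod X (wl (x, \<beta>, m))) = Ident X (Cod X (wl (x, \<beta>, m)))"
      by (rule W_eqI[OF w(1,2) c(1) id_Hom[OF catX y]])
        (use c comp_id_left[OF catX w(2)] functor_id[OF fP y] w(4) in simp_all)
    have "eps (omap L d) = Ident E.K (omap L d)" using eps(1)[OF oL] cI w(3,4) lo[OF o] by (simp add: d L_def E.K_ops)
    moreover have "amap L (Ident K d) = Ident E.K (omap L d)" using functor_id[OF L_functor] o d by simp
    moreover have "Ident E.K (omap L d) \<in> Hom E.K (omap L d) (omap L d)"
      using id_Hom[OF E.K_category functor_Obj[OF L_functor o]] d by simp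
    ultimately show "eps (omap L d) \<cdot>\<^bsub>E.K\<^esub> amap L (Ident K d) = Ident E.K (omap L d)"
      using comp_id_left[OF E.K_category] by simp
  qed
  then show ?thesis unfolding opfibration_in_Fib_def using XF MG P1 fib_comma_KQ E.fib_comma_KQ by auto
qed

end

section \<open>Strongly semi-abelian categories\<close>

text \<open>Partial composition, with \<open>None\<close> for the undefined composites, is associative without any
  side conditions.\<close>

definition ohom :: "('o, 'm) category => 'o => 'o => 'm option set" where
  "ohom C A B = Some ` Hom C A B"

definition ocmp :: "('o, 'm) category => 'm option => 'm option => 'm option" where
  "ocmp C g f = (case (g, f) of (Some g', Some f') =>
     if f' \<in> Arr C \<and> g' \<in> Arr C \<and> Cod C f' = Dom C g' then Some (g' \<cdot>\<^bsub>C\<^esub> f') else None | _ => None)"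

definition oidn :: "('o, 'm) category => 'o => 'm option" where "oidn C A = Some (Ident C A)"

definition oz :: "('o, 'm) category => 'o => 'o => 'm option" where "oz C A B = Some (zero_mor C A B)"

lemma ohomI: "f \<in> Hom C A B ==> Some f \<in> ohom C A B"
  by (simp add: ohom_def)

lemma ohom_Some [simp]: "Some f \<in> ohom C A B \<longleftrightarrow> f \<in> Hom C A B"
  by (auto simp: ohom_def)

lemma ohomE:
  assumes "t \<in> ohom C A B"
  obtains f where "t = Some f" "f \<in> Hom C A B" using assms by (auto simp: ohom_def)

lemma ohom_bex: "(\<exists>t\<in>ohom C A B. Q t) \<longleftrightarrow> (\<exists>f\<in>Hom C A B. Q (Some f))"
  by (auto simp: ohom_def)

lemma ocmp_Some: "f \<in> Hom C A B ==> g \<in> Hom C B D ==> ocmp C (Some g) (Some f) = Some (g \<cdot>\<^bsub>C\<^esub> f)"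
  by (auto simp: ocmp_def Hom_iff)

lemma option_category:
  assumes C: "is_category C"
  shows "partial_category (Obj C) (ohom C) (ocmp C) (oidn C)"
proof
  fix h g f :: "'b option"
  show "ocmp C (ocmp C h g) f = ocmp C h (ocmp C g f)"
  proof (cases "\<exists>h' g' f'. h = Some h' \<and> g = Some g' \<and> f = Some f'")
    case False
    then show ?thesis by (auto simp: ocmp_def split: option.splits)
  next
    case True
    then obtain h' g' f' where hgf: "h = Some h'" "g = Some g'" "f = Some f'" by blast
    have c: "a \<in> Arr C ==> b \<in> Arr C ==> Cod C a = Dom C b ==>
        b \<cdot>\<^bsub>C\<^esub> a \<in> Arr C \<and> Dom C (b \<cdot>\<^bsub>C\<^esub> a) = Dom C a \<and> Cod C (b \<cdot>\<^bsub>C\<^esub> a) = Cod C b" for a b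
      using comp_Hom[OF C, of a "Dom C a" "Cod C a" b "Cod C b"] by (simp add: Hom_iff)
    show ?thesis
    proof (cases "f' \<in> Arr C \<and> g' \<in> Arr C \<and> h' \<in> Arr C \<and> Cod C f' = Dom C g' \<and> Cod C g' = Dom C h'")
      case True
      then have "h' \<cdot>\<^bsub>C\<^esub> g' \<cdot>\<^bsub>C\<^esub> f' = h' \<cdot>\<^bsub>C\<^esub> (g' \<cdot>\<^bsub>C\<^esub> f')"
        using comp_assoc[OF C, of f' "Dom C f'" "Cod C f'" g' "Cod C g'" h' "Cod C h'"] by (simp add: Hom_iff)
      then show ?thesis using c[of f' g'] c[of g' h'] by (simp add: hgf ocmp_def)
    next
      case False
      then show ?thesis using c[of f' g'] c[of g' h'] by (auto simp: hgf ocmp_def)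
    qed
  qed
next
  fix f g A B D assume "f \<in> ohom C A B" "g \<in> ohom C B D"
  then show "ocmp C g f \<in> ohom C A D" using comp_Hom[OF C] by (auto elim!: ohomE simp: ocmp_Some)
next
  fix f A B assume f: "f \<in> ohom C A B"
  then show "A \<in> Obj C \<and> B \<in> Obj C" using Hom_ob[OF C] by (auto elim!: ohomE)
  then have "Ident C A \<in> Hom C A A" "Ident C B \<in> Hom C B B" using id_Hom[OF C] by auto
  then show "ocmp C (oidn C B) f = f" "ocmp C f (oidn C A) = f"
    using f comp_id_left[OF C] comp_id_right[OF C] by (auto elim!: ohomE simp: ocmp_Some oidn_def)
next
  fix f A B A' B' assume "f \<in> ohom C A B" "f \<in> ohom C A' B'"
  then show "A = A' \<and> B = B'" by (auto elim!: ohomE simp: Hom_iff)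
next
  fix A assume "A \<in> Obj C"
  then show "oidn C A \<in> ohom C A A" using id_Hom[OF C] by (simp add: oidn_def)
qed

lemma finite_limit_pullback:
  assumes C: "is_category C" and fc: "finitely_complete C" and f: "f \<in> Hom C A D" and g: "g \<in> Hom C B D"
  shows "\<exists>P p q. is_pullback C f g P p q"
proof -
  \<comment> \<open>The cospan shape: arrows 0, 1, 2 are the identities, 3 goes from 0 to 2 and 4
    from 1 to 2. In every composite one factor is an identity, which explains the rule for
    \<open>Comp\<close>.\<close>
  define J :: "(nat, nat) category" where
    "J = \<lparr>Obj = {0, 1, 2}, Arr = {0, 1, 2, 3, 4}, Dom = (\<lambda>u. if u = 3 then 0 else if u = 4 then 1 else u),
      Cod = (\<lambda>u. if u = 3 \<or> u = 4 then 2 else u), Ident = (\<lambda>i. i), Comp = (\<lambda>v u. if v \<le> 2 then u else v)\<rparr>"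
  define F :: "(nat, nat, 'a, 'b) fctr" where
    "F = \<lparr>omap = (\<lambda>i. if i = 0 then A else if i = 1 then B else D),
      amap = (\<lambda>u. if u = 0 then Ident C A else if u = 1 then Ident C B else if u = 2 then Ident C D
        else if u = 3 then f else g)\<rparr>"
  note ob = Hom_ob[OF C f] Hom_ob[OF C g]
  note idH = id_Hom[OF C ob(1)] id_Hom[OF C ob(2)] id_Hom[OF C ob(3)]
  have J: "is_category J" unfolding is_category_def by (simp add: J_def Hom_def)
  have F: "is_functor J C F"
    unfolding is_functor_def using ob idH f g comp_id_left[OF C idH(1)] comp_id_left[OF C idH(2)] comp_id_left[OF C idH(3)]
      comp_id_left[OF C f] comp_id_left[OF C g] comp_id_right[OF C f] comp_id_right[OF C g] by (simp add: J_def F_def)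
  have "finite (Obj J)" "finite (Arr J)" by (simp_all add: J_def)
  then obtain L \<pi> where L: "is_limit J C F L \<pi>" using fc J F unfolding finitely_complete_def by blast
  have \<pi>: "\<pi> 0 \<in> Hom C L A" "\<pi> 1 \<in> Hom C L B" "\<pi> 2 \<in> Hom C L D" "f \<cdot>\<^bsub>C\<^esub> \<pi> 0 = \<pi> 2" "g \<cdot>\<^bsub>C\<^esub> \<pi> 1 = \<pi> 2"
    using L by (auto simp: is_limit_def is_cone_def J_def F_def)
  have "is_pullback C f g L (\<pi> 0) (\<pi> 1)" unfolding is_pullback_def
  proof (intro conjI allI impI)
    fix T a b assume a: "a \<in> Hom C T (Dom C f)" and b: "b \<in> Hom C T (Dom C g)" and e: "f \<cdot>\<^bsub>C\<^esub> a = g \<cdot>\<^bsub>C\<^esub> b"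
    have a': "a \<in> Hom C T A" and b': "b \<in> Hom C T B" using a b f g by (auto simp: Hom_iff)
    have fa: "f \<cdot>\<^bsub>C\<^esub> a \<in> Hom C T D" by (rule comp_Hom[OF C a' f])
    have T: "T \<in> Obj C" using Hom_ob[OF C a'] by simp
    have "is_cone J C F T (\<lambda>i. if i = 0 then a else if i = 1 then b else f \<cdot>\<^bsub>C\<^esub> a)"
      unfolding is_cone_def using T a' b' fa e comp_id_left[OF C a'] comp_id_left[OF C b'] comp_id_left[OF C fa]
      by (simp add: J_def F_def)
    then have ex: "\<exists>!h. h \<in> Hom C T L \<and> (\<forall>i\<in>Obj J. \<pi> i \<cdot>\<^bsub>C\<^esub> h = (if i = 0 then a else if i = 1 then b else f \<cdot>\<^bsub>C\<^esub> a))"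
      using L unfolding is_limit_def by blast
    \<comment> \<open>The leg at the corner 2 is \<open>f\<close> after the leg at 0, so mediating
      arrows for the cone and for the commuting square are the same.\<close>
    have "h \<in> Hom C T L \<and> (\<forall>i\<in>Obj J. \<pi> i \<cdot>\<^bsub>C\<^esub> h = (if i = 0 then a else if i = 1 then b else f \<cdot>\<^bsub>C\<^esub> a)) \<longleftrightarrow>
        h \<in> Hom C T L \<and> \<pi> 0 \<cdot>\<^bsub>C\<^esub> h = a \<and> \<pi> 1 \<cdot>\<^bsub>C\<^esub> h = b" for h
      using comp_assoc[OF C _ \<pi>(1) f, of h T] \<pi>(4) by (auto simp: J_def)
    then show "\<exists>!h. h \<in> Hom C T L \<and> \<pi> 0 \<cdot>\<^bsub>C\<^esub> h = a \<and> \<pi> 1 \<cdot>\<^bsub>C\<^esub> h = b" using ex by simp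
  qed (use f g \<pi> in \<open>auto simp: Hom_iff\<close>)
  then show ?thesis by blast
qed

locale ssa_category =
  fixes C :: "('o, 'm) category" (structure)
  assumes ssa: "strongly_semi_abelian C"
begin

abbreviation ocomp (infixr "**" 70) where "g ** f \<equiv> ocmp C g f"

lemma cat: "is_category C" and pt: "pointed C" and fincomp: "finitely_complete C" and be: "barr_exact C"
  and cop: "has_finite_coproducts C" and sp: "strongly_protomodular C" and regC: "regular_category C"
  using ssa by (auto simp: strongly_semi_abelian_def barr_exact_def)

sublocale S: partial_category "Obj C" "ohom C" "ocmp C" "oidn C" by (rule option_category[OF cat])

lemma zero_object: "is_zero_object C (zero_obj C)"
  unfolding zero_obj_def using pt someI_ex[of "is_zero_object C"] by (simp add: pointed_def)

lemma zero_mor: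
  assumes "A \<in> Obj C" "B \<in> Obj C"
  shows "zero_mor C A B \<in> Hom C A B"
    and "g \<in> Hom C A (zero_obj C) ==> h \<in> Hom C (zero_obj C) B ==> h \<cdot> g = zero_mor C A B"
proof -
  have ex: "\<exists>!f. f \<in> Hom C A (zero_obj C)" "\<exists>!f. f \<in> Hom C (zero_obj C) B"
    using zero_object assms by (auto simp: is_zero_object_def)
  then obtain g0 h0 where g0: "g0 \<in> Hom C A (zero_obj C)" and h0: "h0 \<in> Hom C (zero_obj C) B" by blast
  have "zero_mor C A B = h0 \<cdot> g0" unfolding zero_mor_def by (rule the_equality) (use ex g0 h0 in blast)+
  then show "zero_mor C A B \<in> Hom C A B" "g \<in> Hom C A (zero_obj C) ==> h \<in> Hom C (zero_obj C) B ==> h \<cdot> g = zero_mor C A B"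
    using comp_Hom[OF cat g0 h0] ex g0 h0 by (simp, metis)
qed

lemma zero_arrows:
  assumes "A \<in> Obj C"
  obtains g h where "g \<in> Hom C A (zero_obj C)" "h \<in> Hom C (zero_obj C) A"
proof -
  have "\<exists>!f. f \<in> Hom C A (zero_obj C)" "\<exists>!f. f \<in> Hom C (zero_obj C) A"
    using zero_object assms by (auto simp: is_zero_object_def)
  then show ?thesis using that by blast
qed

lemma zero_comp:
  assumes "f \<in> Hom C A B" "D \<in> Obj C"
  shows "zero_mor C B D \<cdot> f = zero_mor C A D" "f \<cdot> zero_mor C D A = zero_mor C D B"
proof -
  have ob: "A \<in> Obj C" "B \<in> Obj C" using Hom_ob[OF cat assms(1)] by auto
  obtain g h where g: "g \<in> Hom C B (zero_obj C)" and h: "h \<in> Hom C (zero_obj C) D"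
    using zero_arrows[OF ob(2)] zero_arrows[OF assms(2)] by metis
  show "zero_mor C B D \<cdot> f = zero_mor C A D"
    using zero_mor(2)[OF ob(2) assms(2) g h] zero_mor(2)[OF ob(1) assms(2) comp_Hom[OF cat assms(1) g] h]
      comp_assoc[OF cat assms(1) g h] by simp
  obtain g' h' where g': "g' \<in> Hom C D (zero_obj C)" and h': "h' \<in> Hom C (zero_obj C) A"
    using zero_arrows[OF ob(1)] zero_arrows[OF assms(2)] by metis
  show "f \<cdot> zero_mor C D A = zero_mor C D B"
    using zero_mor(2)[OF assms(2) ob(1) g' h'] zero_mor(2)[OF assms(2) ob(2) g' comp_Hom[OF cat h' assms(1)]]
      comp_assoc[OF cat g' h' assms(1)] by simp
qed

lemma cmp: "f \<in> Hom C A B ==> g \<in> Hom C B D ==> Some g ** Some f = Some (g \<cdot> f)"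
  by (rule ocmp_Some)

section \<open>Pullbacks, covers and kernels translated to arrows of \<open>C\<close>\<close>

lemma pullback_iff:
  assumes f: "f \<in> Hom C A D" and g: "g \<in> Hom C B D"
  shows "is_pullback C f g P p q \<longleftrightarrow> S.pullback (Some f) (Some g) A B D P (Some p) (Some q)"
proof
  assume l: "is_pullback C f g P p q"
  have p: "p \<in> Hom C P A" and q: "q \<in> Hom C P B" and e: "f \<cdot> p = g \<cdot> q"
    and u: "\<And>T a b. a \<in> Hom C T A ==> b \<in> Hom C T B ==> f \<cdot> a = g \<cdot> b ==>
        (\<exists>!h. h \<in> Hom C T P \<and> p \<cdot> h = a \<and> q \<cdot> h = b)"
    using l f g by (auto simp: is_pullback_def Hom_iff)
  show "S.pullback (Some f) (Some g) A B D P (Some p) (Some q)"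
    unfolding S.pullback_def
  proof (intro conjI allI impI)
    fix T a0 b0 assume "a0 \<in> ohom C T A" "b0 \<in> ohom C T B" and eq: "Some f ** a0 = Some g ** b0"
    then obtain a b where a: "a0 = Some a" "a \<in> Hom C T A" and b: "b0 = Some b" "b \<in> Hom C T B" by (auto elim!: ohomE)
    obtain h where h: "h \<in> Hom C T P" "p \<cdot> h = a" "q \<cdot> h = b"
      using u[OF a(2) b(2)] cmp[OF a(2) f] cmp[OF b(2) g] a(1) b(1) eq by auto
    then show "\<exists>h\<in>ohom C T P. Some p ** h = a0 \<and> Some q ** h = b0"
      using cmp[OF h(1) p] cmp[OF h(1) q] a(1) b(1) by (intro bexI[of _ "Some h"]) auto
  next
    fix T x0 y0 assume "x0 \<in> ohom C T P" "y0 \<in> ohom C T P"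
      and 1: "Some p ** x0 = Some p ** y0" and 2: "Some q ** x0 = Some q ** y0"
    then obtain x y where xy: "x0 = Some x" "y0 = Some y" and x: "x \<in> Hom C T P" and y: "y \<in> Hom C T P" by (auto elim!: ohomE)
    have e1: "p \<cdot> x = p \<cdot> y" "q \<cdot> x = q \<cdot> y"
      using 1 2 xy cmp[OF x p] cmp[OF y p] cmp[OF x q] cmp[OF y q] by auto
    have "f \<cdot> (p \<cdot> y) = g \<cdot> (q \<cdot> y)" using comp_assoc[OF cat y p f] comp_assoc[OF cat y q g] e by simp
    from u[OF comp_Hom[OF cat y p] comp_Hom[OF cat y q] this] show "x0 = y0" using e1 x y xy by auto
  qed (use f g p q e cmp[OF p f] cmp[OF q g] in auto)
next
  assume r: "S.pullback (Some f) (Some g) A B D P (Some p) (Some q)"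
  have p: "p \<in> Hom C P A" and q: "q \<in> Hom C P B" using S.pullback_in[OF r] by auto
  have fg: "f \<in> Arr C" "g \<in> Arr C" "Dom C f = A" "Dom C g = B" "Cod C f = D" "Cod C g = D" using f g by (auto simp: Hom_iff)
  show "is_pullback C f g P p q" unfolding is_pullback_def fg
  proof (intro conjI allI impI)
    show "f \<cdot> p = g \<cdot> q" using S.pullback_in(5)[OF r] cmp[OF p f] cmp[OF q g] by simp
    fix T a b assume a: "a \<in> Hom C T A" and b: "b \<in> Hom C T B" and eq: "f \<cdot> a = g \<cdot> b"
    then have eq': "Some f ** Some a = Some g ** Some b" using cmp[OF a f] cmp[OF b g] by simp
    obtain h0 where h0: "h0 \<in> ohom C T P" "Some p ** h0 = Some a" "Some q ** h0 = Some b"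
      by (rule S.pullbackE[OF r ohomI[OF a] ohomI[OF b] eq'])
    then obtain h where h1: "h0 = Some h" and h2: "h \<in> Hom C T P" by (elim ohomE)
    note h = h2 h0(2,3)[unfolded h1]
    show "\<exists>!h. h \<in> Hom C T P \<and> p \<cdot> h = a \<and> q \<cdot> h = b"
    proof (rule ex1I[of _ h])
      show "h \<in> Hom C T P \<and> p \<cdot> h = a \<and> q \<cdot> h = b" using h cmp[OF h(1) p] cmp[OF h(1) q] by simp
      fix k assume k: "k \<in> Hom C T P \<and> p \<cdot> k = a \<and> q \<cdot> k = b"
      then have kh: "k \<in> Hom C T P" by simp
      have "Some p ** Some k = Some p ** Some h" "Some q ** Some k = Some q ** Some h"
        using h k cmp[OF kh p] cmp[OF kh q] by auto
      then have "Some k = Some h" by (rule S.pullback_eqI[OF r _ _ ohomI[OF kh] ohomI[OF h(1)]])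
      then show "k = h" by simp
    qed
  qed (use p q fg in auto)
qed

lemma pullback_exists: "f \<in> Hom C A D ==> g \<in> Hom C B D ==> \<exists>P p q. is_pullback C f g P p q \<and> p \<in> Hom C P A \<and> q \<in> Hom C P B"
  using finite_limit_pullback[OF cat fincomp, of f A D g B] by (auto simp: is_pullback_def Hom_iff)

lemma kernel_pair_eq:
  assumes pb: "is_pullback C f f P p q" and f: "f \<in> Hom C A D" and x: "x \<in> Hom C S A" and y: "y \<in> Hom C S A"
    and e: "f \<cdot> x = f \<cdot> y" and t: "t \<in> Hom C A T" and tt: "t \<cdot> p = t \<cdot> q"
  shows "t \<cdot> x = t \<cdot> y"
proof -
  have p: "p \<in> Hom C P A" "q \<in> Hom C P A" using pb f by (auto simp: is_pullback_def Hom_iff)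
  obtain h where h: "h \<in> Hom C S P" "p \<cdot> h = x" "q \<cdot> h = y"
    using pb f x y e unfolding is_pullback_def by (metis Hom_iff)
  then show ?thesis using comp_assoc[OF cat h(1) p(1) t] comp_assoc[OF cat h(1) p(2) t] tt by metis
qed

lemma coequalizer_cover:
  assumes c: "is_coequalizer C f g e" and e: "e \<in> Hom C A B"
  shows "S.cover (Some e) A B"
proof -
  have f: "f \<in> Hom C (Dom C f) A" and g: "g \<in> Hom C (Dom C f) A" and eq: "e \<cdot> f = e \<cdot> g"
    and u: "\<And>T t. t \<in> Hom C A T ==> t \<cdot> f = t \<cdot> g ==> \<exists>!h. h \<in> Hom C B T \<and> h \<cdot> e = t"
    using c e by (auto simp: is_coequalizer_def Hom_iff)
  show ?thesis unfolding S.cover_def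
  proof (intro conjI allI impI)
    show "Some e \<in> ohom C A B" using e by simp
    fix T x0 y0 assume "x0 \<in> ohom C B T" "y0 \<in> ohom C B T" and eq0: "x0 ** Some e = y0 ** Some e"
    then obtain x y where xy: "x0 = Some x" "y0 = Some y" and x: "x \<in> Hom C B T" and y: "y \<in> Hom C B T" by (auto elim!: ohomE)
    have xe: "x \<cdot> e = y \<cdot> e" using eq0 xy cmp[OF e x] cmp[OF e y] by simp
    have "y \<cdot> e \<cdot> f = y \<cdot> e \<cdot> g" using comp_assoc[OF cat f e y] comp_assoc[OF cat g e y] eq by simp
    from u[OF comp_Hom[OF cat e y] this] show "x0 = y0" using x y xe xy by auto
  next
    fix T t0 assume "t0 \<in> ohom C A T" and r: "\<forall>S x y. x \<in> ohom C S A --> y \<in> ohom C S A -->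
       Some e ** x = Some e ** y --> t0 ** x = t0 ** y"
    then obtain t where t0: "t0 = Some t" and t: "t \<in> Hom C A T" by (auto elim!: ohomE)
    have "Some e ** Some f = Some e ** Some g" using cmp[OF f e] cmp[OF g e] eq by simp
    then have "Some t ** Some f = Some t ** Some g" using r ohomI[OF f] ohomI[OF g] t0 by blast
    then have "t \<cdot> f = t \<cdot> g" using cmp[OF f t] cmp[OF g t] by simp
    from u[OF t this] obtain h where "h \<in> Hom C B T" "h \<cdot> e = t" by blast
    then show "\<exists>h\<in>ohom C B T. h ** Some e = t0" using cmp[OF e] t0 by (intro bexI[of _ "Some h"]) auto
  qed
qed

text \<open>A cover is the coequalizer of its kernel pair. Conversely, if \<open>e\<close>
  coequalizes some f and g, then e f = e g, so an arrow respecting the kernel pair of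
  \<open>e\<close> identifies f and g and factors.\<close>

lemma regular_epi_iff:
  assumes e: "e \<in> Hom C A B"
  shows "regular_epi C e \<longleftrightarrow> S.cover (Some e) A B"
proof
  assume "regular_epi C e"
  then show "S.cover (Some e) A B" using coequalizer_cover e by (auto simp: regular_epi_def)
next
  assume c: "S.cover (Some e) A B"
  obtain P p q where pb: "is_pullback C e e P p q" and p: "p \<in> Hom C P A" and q: "q \<in> Hom C P A"
    using pullback_exists[OF e e] by blast
  have eq: "e \<cdot> p = e \<cdot> q" using pb by (simp add: is_pullback_def)
  have "is_coequalizer C p q e" unfolding is_coequalizer_def
  proof (intro conjI allI impI)
    fix T t assume t: "t \<in> Hom C (Cod C p) T" and tt: "t \<cdot> p = t \<cdot> q"
    have t': "t \<in> Hom C A T" using t p by (simp add: Hom_iff)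
    have resp: "Some t ** x = Some t ** y"
      if x: "x \<in> ohom C S A" and y: "y \<in> ohom C S A" and ex: "Some e ** x = Some e ** y" for S x y
    proof -
      obtain x' y' where xy: "x = Some x'" "y = Some y'" "x' \<in> Hom C S A" "y' \<in> Hom C S A" using x y by (auto elim!: ohomE)
      have "e \<cdot> x' = e \<cdot> y'" using ex cmp[OF xy(3) e] cmp[OF xy(4) e] xy by simp
      from kernel_pair_eq[OF pb e xy(3,4) this t' tt] show ?thesis using cmp[OF xy(3) t'] cmp[OF xy(4) t'] xy by simp
    qed
    obtain h where h: "h \<in> ohom C B T" "h ** Some e = Some t" by (rule S.cover_factor[OF c ohomI[OF t'] resp])
    then obtain h' where h': "h = Some h'" "h' \<in> Hom C B T" by (elim ohomE)
    have he: "h' \<cdot> e = t" using h h' cmp[OF e h'(2)] by simp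
    have B: "Cod C e = B" using e by (simp add: Hom_iff)
    show "\<exists>!h. h \<in> Hom C (Cod C e) T \<and> h \<cdot> e = t" unfolding B
    proof (rule ex1I[of _ h'])
      fix k assume k: "k \<in> Hom C B T \<and> k \<cdot> e = t"
      then have kh: "k \<in> Hom C B T" by simp
      have "Some k ** Some e = Some h' ** Some e" using k he cmp[OF e kh] cmp[OF e h'(2)] by simp
      then have "Some k = Some h'" by (rule S.coverD[OF c, of _ _ T]) (use k h' in auto)
      then show "k = h'" by simp
    qed (use he h' in simp)
  qed (use p q e eq in \<open>auto simp: Hom_iff\<close>)
  then show "regular_epi C e" by (auto simp: regular_epi_def)
qed

lemma exact_axioms: "pointed_exact (Obj C) (ohom C) (ocmp C) (oidn C) (zero_obj C) (oz C)"
proof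
  note zo = zero_object[unfolded is_zero_object_def]
  show "oz C A B \<in> ohom C A B" if "A \<in> Obj C" "B \<in> Obj C" for A B using zero_mor(1)[OF that] by (simp add: oz_def)
  show Z: "zero_obj C \<in> Obj C" using zo by simp
  show "oz C B D ** f = oz C A D" if f: "f \<in> ohom C A B" and D: "D \<in> Obj C" for f A B D
  proof -
    obtain f' where f': "f = Some f'" "f' \<in> Hom C A B" using f by (elim ohomE)
    have "zero_mor C B D \<in> Hom C B D" using zero_mor(1) Hom_ob[OF cat f'(2)] D by blast
    then show ?thesis using cmp[OF f'(2)] zero_comp(1)[OF f'(2) D] f'(1) by (simp add: oz_def)
  qed
  show "f ** oz C A B = oz C A D" if f: "f \<in> ohom C B D" and A: "A \<in> Obj C" for f A B D
  proof -
    obtain f' where f': "f = Some f'" "f' \<in> Hom C B D" using f by (elim ohomE)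
    have "zero_mor C A B \<in> Hom C A B" using zero_mor(1) Hom_ob[OF cat f'(2)] A by blast
    then show ?thesis using cmp[OF _ f'(2)] zero_comp(2)[OF f'(2) A] f'(1) by (simp add: oz_def)
  qed
  show "f = oz C (zero_obj C) A" if f: "f \<in> ohom C (zero_obj C) A" for f A
  proof -
    obtain f' where f': "f = Some f'" "f' \<in> Hom C (zero_obj C) A" using f by (elim ohomE)
    have A: "A \<in> Obj C" using Hom_ob[OF cat f'(2)] by simp
    show ?thesis using f' zo A zero_mor(1)[OF Z A] by (auto simp: oz_def)
  qed
  show "f = oz C A (zero_obj C)" if f: "f \<in> ohom C A (zero_obj C)" for f A
  proof -
    obtain f' where f': "f = Some f'" "f' \<in> Hom C A (zero_obj C)" using f by (elim ohomE)
    have A: "A \<in> Obj C" using Hom_ob[OF cat f'(2)] by simp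
    show ?thesis using f' zo A zero_mor(1)[OF A Z] by (auto simp: oz_def)
  qed
  show "\<exists>P p q. S.pullback f g A B D P p q" if f: "f \<in> ohom C A D" and g: "g \<in> ohom C B D" for f g A B D
  proof -
    obtain f' g' where fg: "f = Some f'" "f' \<in> Hom C A D" "g = Some g'" "g' \<in> Hom C B D" using f g by (elim ohomE)
    then show ?thesis using pullback_exists[OF fg(2,4)] pullback_iff[OF fg(2,4)] by blast
  qed
  show "\<exists>I e. S.cover e A I \<and> (\<forall>S x y. x \<in> ohom C S A --> y \<in> ohom C S A -->
      (e ** x = e ** y) = (f ** x = f ** y))" if f: "f \<in> ohom C A B" for f A B
  proof -
    obtain f' where f': "f = Some f'" "f' \<in> Hom C A B" using f by (elim ohomE)
    obtain P p q where pb: "is_pullback C f' f' P p q" and p: "p \<in> Hom C P A" and q: "q \<in> Hom C P A"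
      using pullback_exists[OF f'(2) f'(2)] by blast
    obtain e where e: "is_coequalizer C p q e" using regC pb unfolding regular_category_def by blast
    have eh: "e \<in> Hom C A (Cod C e)" and ee: "e \<cdot> p = e \<cdot> q" using e p by (auto simp: is_coequalizer_def Hom_iff)
    have fp: "f' \<cdot> p = f' \<cdot> q" using pb by (simp add: is_pullback_def)
    have "f' \<in> Hom C (Cod C p) B" using f' p by (simp add: Hom_iff)
    then obtain h where h: "h \<in> Hom C (Cod C e) B" "h \<cdot> e = f'" using e fp unfolding is_coequalizer_def by blast
    have "(Some e ** Some x = Some e ** Some y) = (f ** Some x = f ** Some y)"
      if x: "x \<in> Hom C S A" and y: "y \<in> Hom C S A" for S x y
    proof -
      have "f' \<cdot> x = f' \<cdot> y" if "e \<cdot> x = e \<cdot> y"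
        using that h comp_assoc[OF cat x eh h(1)] comp_assoc[OF cat y eh h(1)] by simp
      moreover have "e \<cdot> x = e \<cdot> y" if "f' \<cdot> x = f' \<cdot> y"
        by (rule kernel_pair_eq[OF pb f'(2) x y that eh ee])
      ultimately show ?thesis using cmp[OF x eh] cmp[OF y eh] cmp[OF x f'(2)] cmp[OF y f'(2)] f'(1) by auto
    qed
    then show ?thesis using coequalizer_cover[OF e eh] by (intro exI[of _ "Cod C e"] exI[of _ "Some e"]) (auto elim!: ohomE)
  qed
  show "S.cover q P B" if pb: "S.pullback f g A B D P p q" and c: "S.cover f A D" for f g A B D P p q
  proof -
    note pin = S.pullback_in[OF pb]
    obtain f' g' p' q' where s: "f = Some f'" "f' \<in> Hom C A D" "g = Some g'" "g' \<in> Hom C B D"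
      "p = Some p'" "p' \<in> Hom C P A" "q = Some q'" "q' \<in> Hom C P B" using pin(1-4) by (elim ohomE)
    have "is_pullback C f' g' P p' q'" using pullback_iff[OF s(2,4)] pb s by simp
    moreover have "regular_epi C f'" using regular_epi_iff[OF s(2)] c s by simp
    ultimately have "regular_epi C q'" using regC unfolding regular_category_def by blast
    then show ?thesis using regular_epi_iff[OF s(8)] s by simp
  qed
  show "\<exists>Y f. f \<in> ohom C X Y \<and> (\<forall>T x y. x \<in> ohom C T X --> y \<in> ohom C T X -->
      (f ** x = f ** y) = (\<exists>t\<in>ohom C T R. r ** t = x \<and> s ** t = y))"
    if r: "r \<in> ohom C R X" and s: "s \<in> ohom C R X"
      and jm: "\<And>T x y. x \<in> ohom C T R ==> y \<in> ohom C T R ==> r ** x = r ** y ==> s ** x = s ** y ==> x = y"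
      and refl: "\<And>T x. x \<in> ohom C T X ==> \<exists>t\<in>ohom C T R. r ** t = x \<and> s ** t = x"
      and sym: "\<And>T t. t \<in> ohom C T R ==> \<exists>t'\<in>ohom C T R. r ** t' = s ** t \<and> s ** t' = r ** t"
      and trans: "\<And>T t t'. t \<in> ohom C T R ==> t' \<in> ohom C T R ==> s ** t = r ** t' ==>
         \<exists>u\<in>ohom C T R. r ** u = r ** t \<and> s ** u = s ** t'"
    for r s R X
  proof -
    obtain r' s' where rs: "r = Some r'" "r' \<in> Hom C R X" "s = Some s'" "s' \<in> Hom C R X" using r s by (elim ohomE)
    have ob: "R \<in> Obj C" "X \<in> Obj C" using Hom_ob[OF cat rs(2)] by auto
    \<comment> \<open>The structure arrows come from the elementwise conditions at universal stages:
      the identity of \<open>X\<close> for reflexivity, the identity of \<open>R\<close> for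
      symmetry, and the two projections of a pullback for transitivity.\<close>
    have "internal_equivalence_relation C X R r' s'" unfolding internal_equivalence_relation_def
    proof (intro conjI allI impI)
      fix T a b assume a: "a \<in> Hom C T R" and b: "b \<in> Hom C T R" and 1: "r' \<cdot> a = r' \<cdot> b" and 2: "s' \<cdot> a = s' \<cdot> b"
      have "Some a = Some b"
        by (rule jm[of _ T]) (use a b 1 2 cmp[OF a rs(2)] cmp[OF b rs(2)] cmp[OF a rs(4)] cmp[OF b rs(4)] rs in auto)
      then show "a = b" by simp
    next
      obtain t where t: "t \<in> ohom C X R" "r ** t = Some (Ident C X)" "s ** t = Some (Ident C X)"
        using refl[of "Some (Ident C X)" X] id_Hom[OF cat ob(2)] by auto
      then obtain t' where "t = Some t'" "t' \<in> Hom C X R" by (elim ohomE)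
      then show "\<exists>\<delta>\<in>Hom C X R. r' \<cdot> \<delta> = Ident C X \<and> s' \<cdot> \<delta> = Ident C X"
        using t rs cmp[of t' X R] by (intro bexI[of _ t']) auto
    next
      obtain t where t: "t \<in> ohom C R R" "r ** t = s ** oidn C R" "s ** t = r ** oidn C R"
        using sym[of "oidn C R" R] id_Hom[OF cat ob(1)] by (auto simp: oidn_def)
      then obtain t' where t': "t = Some t'" "t' \<in> Hom C R R" by (elim ohomE)
      then show "\<exists>\<sigma>\<in>Hom C R R. r' \<cdot> \<sigma> = s' \<and> s' \<cdot> \<sigma> = r'"
        using t rs cmp[OF t'(2)] S.id_r[OF r] S.id_r[OF s] by (intro bexI[of _ t']) auto
    next
      fix P p q assume pb: "is_pullback C s' r' P p q"
      have p: "p \<in> Hom C P R" and q: "q \<in> Hom C P R" and e: "s' \<cdot> p = r' \<cdot> q" using pb rs by (auto simp: is_pullback_def Hom_iff)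
      obtain u where u: "u \<in> ohom C P R" "r ** u = r ** Some p" "s ** u = s ** Some q"
        using trans[of "Some p" P "Some q"] p q e cmp[OF p rs(4)] cmp[OF q rs(2)] rs by auto
      then obtain u' where u': "u = Some u'" "u' \<in> Hom C P R" by (elim ohomE)
      then show "\<exists>\<theta>\<in>Hom C P R. r' \<cdot> \<theta> = r' \<cdot> p \<and> s' \<cdot> \<theta> = s' \<cdot> q"
        using u rs cmp[OF u'(2)] cmp[OF p] cmp[OF q] by (intro bexI[of _ u']) auto
    qed (fact rs)+
    then obtain f where pb: "is_pullback C f f R r' s'" using be unfolding barr_exact_def by blast
    have fh: "f \<in> Hom C X (Cod C f)" using pb rs by (auto simp: is_pullback_def Hom_iff)
    note pb' = pb[unfolded pullback_iff[OF fh fh], folded rs(1,3)]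
    have "Some f ** x = Some f ** y \<longleftrightarrow> (\<exists>t\<in>ohom C T R. r ** t = x \<and> s ** t = y)"
      if x: "x \<in> ohom C T X" and y: "y \<in> ohom C T X" for T x y
    proof
      assume "Some f ** x = Some f ** y"
      then show "\<exists>t\<in>ohom C T R. r ** t = x \<and> s ** t = y" using S.pullbackE[OF pb' x y] by metis
    next
      assume "\<exists>t\<in>ohom C T R. r ** t = x \<and> s ** t = y"
      then show "Some f ** x = Some f ** y" using S.pullback_in(5)[OF pb'] by (metis S.assoc)
    qed
    then show ?thesis using fh by (intro exI[of _ "Cod C f"] exI[of _ "Some f"]) simp
  qed
qed

sublocale S: pointed_exact "Obj C" "ohom C" "ocmp C" "oidn C" "zero_obj C" "oz C" by (rule exact_axioms)

lemma kernel_iff: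
  assumes f: "f \<in> Hom C A B"
  shows "is_kernel C f K k \<longleftrightarrow> S.kernel (Some f) A B K (Some k)"
proof
  have fd: "Dom C f = A" "Cod C f = B" using f by (auto simp: Hom_iff)
  note ob = Hom_ob[OF cat f]
  {
    assume l: "is_kernel C f K k"
    have k: "k \<in> Hom C K A" and fk: "f \<cdot> k = zero_mor C K B"
      and u: "\<And>T t. t \<in> Hom C T A ==> f \<cdot> t = zero_mor C T B ==> \<exists>!h. h \<in> Hom C T K \<and> k \<cdot> h = t"
      using l by (auto simp: is_kernel_def fd)
    have "S.monic (Some k) K A" unfolding S.monic_def
    proof (intro conjI allI impI)
      fix T x0 y0 assume "x0 \<in> ohom C T K" "y0 \<in> ohom C T K" and e0: "Some k ** x0 = Some k ** y0"
      then obtain x y where xy: "x0 = Some x" "y0 = Some y" and x: "x \<in> Hom C T K" and y: "y \<in> Hom C T K" by (auto elim!: ohomE)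
      have e: "k \<cdot> x = k \<cdot> y" using e0 xy cmp[OF x k] cmp[OF y k] by simp
      have "f \<cdot> (k \<cdot> y) = zero_mor C T B" using comp_assoc[OF cat y k f] fk zero_comp(1)[OF y ob(2)] by simp
      from u[OF comp_Hom[OF cat y k] this] show "x0 = y0" using x y e xy by auto
    qed (use k in simp)
    moreover have "Some f ** Some k = oz C K B" using cmp[OF k f] fk by (simp add: oz_def)
    moreover have "\<exists>h\<in>ohom C T K. Some k ** h = t" if t: "t \<in> ohom C T A" "Some f ** t = oz C T B" for T t
    proof -
      obtain t' where t': "t = Some t'" "t' \<in> Hom C T A" using t(1) by (elim ohomE)
      then have "f \<cdot> t' = zero_mor C T B" using t cmp[OF t'(2) f] by (simp add: oz_def)
      from u[OF t'(2) this] obtain h where "h \<in> Hom C T K" "k \<cdot> h = t'" by blast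
      then show ?thesis using cmp[OF _ k] t'(1) by (intro bexI[of _ "Some h"]) auto
    qed
    ultimately show "S.kernel (Some f) A B K (Some k)" using f unfolding S.kernel_def by simp
  next
    assume r: "S.kernel (Some f) A B K (Some k)"
    note ki = S.kernel_def[THEN iffD1, OF r]
    have k: "k \<in> Hom C K A" using ki by (auto dest!: S.monic_in)
    show "is_kernel C f K k" unfolding is_kernel_def fd
    proof (intro conjI allI impI)
      show "f \<cdot> k = zero_mor C K B" using ki cmp[OF k f] by (simp add: oz_def)
      fix T t assume t: "t \<in> Hom C T A" and ft: "f \<cdot> t = zero_mor C T B"
      have "Some f ** Some t = oz C T B" using cmp[OF t f] ft by (simp add: oz_def)
      then obtain h where h: "h \<in> ohom C T K" "Some k ** h = Some t" using ki ohomI[OF t] by blast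
      then obtain h' where h': "h = Some h'" "h' \<in> Hom C T K" by (elim ohomE)
      show "\<exists>!h. h \<in> Hom C T K \<and> k \<cdot> h = t"
      proof (rule ex1I[of _ h'])
        show "h' \<in> Hom C T K \<and> k \<cdot> h' = t" using h h' cmp[OF h'(2) k] by simp
        fix x assume x: "x \<in> Hom C T K \<and> k \<cdot> x = t"
        then have xh: "x \<in> Hom C T K" by simp
        have "Some k ** Some x = Some k ** Some h'" using x h h' cmp[OF xh k] by simp
        then have "Some x = Some h'" using ki xh h' S.monicD by (metis ohom_Some)
        then show "x = h'" by simp
      qed
    qed (use f k in \<open>auto simp: Hom_iff\<close>)
  }
qed

lemma iso_iff:
  assumes f: "f \<in> Hom C A B"
  shows "is_iso C f \<longleftrightarrow> S.isom (Some f) A B"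
proof -
  have fd: "f \<in> Arr C" "Dom C f = A" "Cod C f = B" using f by (auto simp: Hom_iff)
  show ?thesis unfolding is_iso_def S.isom_def ohom_bex fd
    using f fd(1) cmp[OF f] cmp[OF _ f] by (auto simp: oidn_def)
qed

lemma normal_iff:
  assumes k: "k \<in> Hom C K A"
  shows "normal_mono C k \<longleftrightarrow> S.normal (Some k) K A"
proof
  have kd: "Dom C k = K" "Cod C k = A" using k by (auto simp: Hom_iff)
  {
    assume "normal_mono C k"
    then obtain f where f: "is_kernel C f K k" by (auto simp: normal_mono_def kd)
    then have "f \<in> Hom C A (Cod C f)" using kd by (auto simp: is_kernel_def Hom_iff)
    then show "S.normal (Some k) K A" using f kernel_iff unfolding S.normal_def by blast
  next
    assume "S.normal (Some k) K A"
    then obtain f B where f: "S.kernel f A B K (Some k)" by (auto simp: S.normal_def)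
    then have "f \<in> ohom C A B" by (simp add: S.kernel_def)
    then obtain f' where f': "f = Some f'" "f' \<in> Hom C A B" by (elim ohomE)
    then have "is_kernel C f' K k" using f kernel_iff[OF f'(2)] by simp
    then show "normal_mono C k" unfolding normal_mono_def kd by blast
  }
qed

lemma split_ext_iff:
  assumes "p \<in> Hom C A B" "s \<in> Hom C B A"
  shows "split_ses C X k A p s B \<longleftrightarrow> S.split_ext X (Some k) A (Some p) (Some s) B"
  unfolding split_ses_def S.split_ext_def using kernel_iff[OF assms(1)] cmp[OF assms(2,1)] by (auto simp: oidn_def)

lemma protomodular_axioms: "exact_protomodular (Obj C) (ohom C) (ocmp C) (oidn C) (zero_obj C) (oz C)"
proof -
  have *: "(S.isom \<psi> X X' --> S.isom \<phi> A A') \<and> (S.normal \<psi> X X' --> S.normal (\<phi> ** k) X A')"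
    if e: "S.split_ext X k A p s B" "S.split_ext X' k' A' p' s' B" and \<phi>: "\<phi> \<in> ohom C A A'" and \<psi>: "\<psi> \<in> ohom C X X'"
      and sq: "\<phi> ** k = k' ** \<psi>" "p' ** \<phi> = p" "\<phi> ** s = s'"
    for X k A p s B X' k' A' p' s' \<phi> \<psi>
  proof -
    have h: "p \<in> ohom C A B" "s \<in> ohom C B A" "k \<in> ohom C X A" "p' \<in> ohom C A' B" "s' \<in> ohom C B A'" "k' \<in> ohom C X' A'"
      using e unfolding S.split_ext_def S.kernel_def by (auto dest!: S.monic_in)
    obtain p0 s0 k0 p1 s1 k1 f g where a: "p = Some p0" "p0 \<in> Hom C A B" "s = Some s0" "s0 \<in> Hom C B A" "k = Some k0" "k0 \<in> Hom C X A"
      "p' = Some p1" "p1 \<in> Hom C A' B" "s' = Some s1" "s1 \<in> Hom C B A'" "k' = Some k1" "k1 \<in> Hom C X' A'"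
      "\<phi> = Some f" "f \<in> Hom C A A'" "\<psi> = Some g" "g \<in> Hom C X X'"
      using h \<phi> \<psi> by (elim ohomE) blast
    have "split_ses C X k0 A p0 s0 B" "split_ses C X' k1 A' p1 s1 B"
      using e a split_ext_iff[OF a(2,4)] split_ext_iff[OF a(8,10)] by auto
    moreover have "f \<cdot> k0 = k1 \<cdot> g" "p1 \<cdot> f = p0" "f \<cdot> s0 = s1"
      using sq a cmp[OF a(6,14)] cmp[OF a(16,12)] cmp[OF a(14,8)] cmp[OF a(4,14)] by auto
    ultimately have "(is_iso C g --> is_iso C f) \<and> (normal_mono C g --> normal_mono C (f \<cdot> k0))"
      using sp a(14,16) unfolding strongly_protomodular_def by blast
    then show ?thesis
      using iso_iff[OF a(16)] iso_iff[OF a(14)] normal_iff[OF a(16)] normal_iff[OF comp_Hom[OF cat a(6,14)]] a cmp[OF a(6,14)] by simp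
  qed
  show ?thesis by unfold_locales (use * in blast)+
qed

sublocale S: exact_protomodular "Obj C" "ohom C" "ocmp C" "oidn C" "zero_obj C" "oz C" by (rule protomodular_axioms)

section \<open>Sums and the objects B \<flat> X in \<open>C\<close>\<close>

lemma sums:
  assumes A: "A \<in> Obj C" and B: "B \<in> Obj C"
  shows "is_binary_coproduct C A B (sum_obj C A B) (in1 C A B) (in2 C A B)"
proof -
  let ?X = "\<lambda>i::nat. if i = 0 then A else B"
  obtain S \<iota> where S: "is_coproduct C {0, 1} ?X S \<iota>"
    using cop A B unfolding has_finite_coproducts_def by (metis (mono_tags, lifting) finite.intros)
  have "is_binary_coproduct C A B S (\<iota> 0) (\<iota> 1)" unfolding is_binary_coproduct_def
  proof (intro conjI allI impI)
    show "\<iota> 0 \<in> Hom C A S" "\<iota> 1 \<in> Hom C B S" using S by (auto simp: is_coproduct_def)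
    fix T f g assume f: "f \<in> Hom C A T" and g: "g \<in> Hom C B T"
    have T: "T \<in> Obj C" using Hom_ob[OF cat f] by simp
    have all: "\<forall>f. (\<forall>i\<in>{0, 1}. f i \<in> Hom C (?X i) T) --> (\<exists>!h. h \<in> Hom C S T \<and> (\<forall>i\<in>{0, 1}. h \<cdot> \<iota> i = f i))"
      using S T unfolding is_coproduct_def by blast
    show "\<exists>!h. h \<in> Hom C S T \<and> h \<cdot> \<iota> 0 = f \<and> h \<cdot> \<iota> 1 = g" using spec[OF all, of "\<lambda>i. if i = 0 then f else g"] f g by simp
  qed
  then have "\<exists>t. case t of (S, i, j) => is_binary_coproduct C A B S i j" by auto
  from someI_ex[OF this] show ?thesis by (simp add: sum_obj_def in1_def in2_def csum_def case_prod_unfold)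
qed

lemma in_Hom:
  assumes "A \<in> Obj C" "B \<in> Obj C"
  shows "in1 C A B \<in> Hom C A (sum_obj C A B)" "in2 C A B \<in> Hom C B (sum_obj C A B)"
  using sums[OF assms] by (auto simp: is_binary_coproduct_def)

lemma copair:
  assumes f: "f \<in> Hom C A T" and g: "g \<in> Hom C B T"
  shows "copair C f g \<in> Hom C (sum_obj C A B) T" "copair C f g \<cdot> in1 C A B = f" "copair C f g \<cdot> in2 C A B = g"
proof -
  have d: "Dom C f = A" "Dom C g = B" "Cod C f = T" using f g by (auto simp: Hom_iff)
  have ob: "A \<in> Obj C" "B \<in> Obj C" using Hom_ob[OF cat f] Hom_ob[OF cat g] by auto
  have "\<exists>!h. h \<in> Hom C (sum_obj C A B) T \<and> h \<cdot> in1 C A B = f \<and> h \<cdot> in2 C A B = g"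
    using sums[OF ob] f g by (auto simp: is_binary_coproduct_def)
  from theI'[OF this] show "copair C f g \<in> Hom C (sum_obj C A B) T" "copair C f g \<cdot> in1 C A B = f" "copair C f g \<cdot> in2 C A B = g"
    by (auto simp: copair_def d Let_def)
qed

lemma flat_kernel:
  assumes "B \<in> Obj C" "X \<in> Obj C"
  shows "is_kernel C (copair C (Ident C B) (zero_mor C X B)) (flat_obj C B X) (flat_ker C B X)"
proof -
  have c: "copair C (Ident C B) (zero_mor C X B) \<in> Hom C (sum_obj C B X) B"
    by (rule copair(1)[OF id_Hom[OF cat assms(1)] zero_mor(1)[OF assms(2,1)]])
  obtain K k where K: "S.kernel (Some (copair C (Ident C B) (zero_mor C X B))) (sum_obj C B X) B K k"
    using S.kernels[OF ohomI[OF c]] by blast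
  obtain k' where "k = Some k'" using S.kernel_in(2)[OF K] by (elim ohomE)
  then have "is_kernel C (copair C (Ident C B) (zero_mor C X B)) K k'" using K kernel_iff[OF c] by simp
  then have "\<exists>t. case t of (K, k) => is_kernel C (copair C (Ident C B) (zero_mor C X B)) K k" by auto
  from someI_ex[OF this] show ?thesis by (simp add: flat_obj_def flat_ker_def cflat_def case_prod_unfold)
qed

definition ofl :: "'m option => 'm option => 'm option" where "ofl f g = Some (flat_mor C (the f) (the g))"
definition ocp :: "'m option => 'm option => 'm option" where "ocp f g = Some (copair C (the f) (the g))"

lemma kernel_Hom: "is_kernel C f K k ==> f \<in> Hom C A B ==> k \<in> Hom C K A"
  by (auto simp: is_kernel_def Hom_iff)

lemma kernel_ex1:
  assumes k: "is_kernel C f K k" and f: "f \<in> Hom C A B" and t: "t \<in> Hom C T A" "f \<cdot> t = zero_mor C T B"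
  shows "\<exists>!h. h \<in> Hom C T K \<and> k \<cdot> h = t"
proof -
  have "Dom C f = A" "Cod C f = B" using f by (auto simp: Hom_iff)
  then show ?thesis using k t unfolding is_kernel_def by blast
qed

lemma flat_ker_Hom:
  assumes "B \<in> Obj C" "X \<in> Obj C"
  shows "flat_ker C B X \<in> Hom C (flat_obj C B X) (sum_obj C B X)"
  by (rule kernel_Hom[OF flat_kernel[OF assms] copair(1)[OF id_Hom[OF cat assms(1)] zero_mor(1)[OF assms(2,1)]]])

lemma flat_ker_kernel:
  assumes "B \<in> Obj C" "X \<in> Obj C"
  shows "S.kernel (ocp (oidn C B) (oz C X B)) (sum_obj C B X) B (flat_obj C B X) (Some (flat_ker C B X))"
  using flat_kernel[OF assms] kernel_iff[OF copair(1)[OF id_Hom[OF cat assms(1)] zero_mor(1)[OF assms(2,1)]]]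
  by (simp add: ocp_def oidn_def oz_def)

text \<open>f + g is compatible with the projections [1, 0] to \<open>B\<close> and
  \<open>B'\<close>, so it restricts to their kernels in exactly one way; this justifies the
  definite description of f \<flat> g.\<close>

lemma flat_mor:
  assumes f: "f \<in> Hom C B B'" and g: "g \<in> Hom C X X'"
  shows "flat_mor C f g \<in> Hom C (flat_obj C B X) (flat_obj C B' X')"
    "flat_ker C B' X' \<cdot> flat_mor C f g = copair C (in1 C B' X' \<cdot> f) (in2 C B' X' \<cdot> g) \<cdot> flat_ker C B X"
proof -
  have d: "Dom C f = B" "Dom C g = X" "Cod C f = B'" "Cod C g = X'" using f g by (auto simp: Hom_iff)
  have ob: "B \<in> Obj C" "B' \<in> Obj C" "X \<in> Obj C" "X' \<in> Obj C" using Hom_ob[OF cat f] Hom_ob[OF cat g] by auto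
  note i = in_Hom[OF ob(2,4)] and k = flat_ker_Hom[OF ob(1,3)]
  note fi = comp_Hom[OF cat f i(1)] and gi = comp_Hom[OF cat g i(2)]
  let ?s = "copair C (in1 C B' X' \<cdot> f) (in2 C B' X' \<cdot> g)"
  note s = copair[OF fi gi]
  note sk = comp_Hom[OF cat k s(1)]
  let ?p = "copair C (Ident C B) (zero_mor C X B)" and ?p' = "copair C (Ident C B') (zero_mor C X' B')"
  note IB = id_Hom[OF cat ob(1)] id_Hom[OF cat ob(2)] and Z = zero_mor(1)[OF ob(3,1)] zero_mor(1)[OF ob(4,2)]
  note p = copair[OF IB(1) Z(1)] and p' = copair[OF IB(2) Z(2)]
  have "?p' \<cdot> ?s = f \<cdot> ?p"
  proof -
    have b: "is_binary_coproduct C B X (sum_obj C B X) (in1 C B X) (in2 C B X)" by (rule sums[OF ob(1,3)])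
    note j = in_Hom[OF ob(1,3)]
    have "?p' \<cdot> ?s \<cdot> in1 C B X = f" "?p' \<cdot> ?s \<cdot> in2 C B X = zero_mor C X B'"
      using comp_assoc[OF cat j(1) s(1) p'(1)] comp_assoc[OF cat j(2) s(1) p'(1)] s(2,3) comp_assoc[OF cat f i(1) p'(1)]
        comp_assoc[OF cat g i(2) p'(1)] p'(2,3) comp_id_left[OF cat f] zero_comp(1)[OF g ob(2)] by simp_all
    moreover have "f \<cdot> ?p \<cdot> in1 C B X = f" "f \<cdot> ?p \<cdot> in2 C B X = zero_mor C X B'"
      using comp_assoc[OF cat j(1) p(1) f] comp_assoc[OF cat j(2) p(1) f] p(2,3) comp_id_right[OF cat f] zero_comp(2)[OF f ob(3)] by simp_all
    moreover have "\<exists>!h. h \<in> Hom C (sum_obj C B X) B' \<and> h \<cdot> in1 C B X = f \<and> h \<cdot> in2 C B X = zero_mor C X B'"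
      using b f zero_mor(1)[OF ob(3,2)] by (simp add: is_binary_coproduct_def)
    ultimately show ?thesis using comp_Hom[OF cat s(1) p'(1)] comp_Hom[OF cat p(1) f] by blast
  qed
  then have "?p' \<cdot> (?s \<cdot> flat_ker C B X) = f \<cdot> (?p \<cdot> flat_ker C B X)"
    using comp_assoc[OF cat k s(1) p'(1)] comp_assoc[OF cat k p(1) f] by simp
  also have "\<dots> = zero_mor C (flat_obj C B X) B'"
    using flat_kernel[OF ob(1,3)] p(1) zero_comp(2)[OF f, of "flat_obj C B X"] Hom_ob[OF cat k] by (simp add: is_kernel_def Hom_iff)
  finally have "\<exists>!h. h \<in> Hom C (flat_obj C B X) (flat_obj C B' X') \<and> flat_ker C B' X' \<cdot> h = ?s \<cdot> flat_ker C B X"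
    by (rule kernel_ex1[OF flat_kernel[OF ob(2,4)] p'(1) sk])
  from theI'[OF this] show "flat_mor C f g \<in> Hom C (flat_obj C B X) (flat_obj C B' X')"
    "flat_ker C B' X' \<cdot> flat_mor C f g = ?s \<cdot> flat_ker C B X" by (auto simp: flat_mor_def sum_mor_def d)
qed

lemma semi_abelian_axioms:
  "semi_abelian (Obj C) (ohom C) (ocmp C) (oidn C) (zero_obj C) (oz C) (sum_obj C) (\<lambda>A B. Some (in1 C A B))
     (\<lambda>A B. Some (in2 C A B)) ocp (flat_obj C) (\<lambda>B X. Some (flat_ker C B X)) ofl"
proof unfold_locales
  show "Some (in1 C A B) \<in> ohom C A (sum_obj C A B)" "Some (in2 C A B) \<in> ohom C B (sum_obj C A B)"
    if "A \<in> Obj C" "B \<in> Obj C" for A B using in_Hom[OF that] by auto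
  show "ocp f g \<in> ohom C (sum_obj C A B) T" "ocp f g ** Some (in1 C A B) = f" "ocp f g ** Some (in2 C A B) = g"
    if f: "f \<in> ohom C A T" and g: "g \<in> ohom C B T" for f A T g B
  proof -
    obtain f' g' where a: "f = Some f'" "f' \<in> Hom C A T" "g = Some g'" "g' \<in> Hom C B T" using f g by (elim ohomE)
    note c = copair[OF a(2,4)] and i = in_Hom[OF Hom_ob(1)[OF cat a(2)] Hom_ob(1)[OF cat a(4)]]
    show "ocp f g \<in> ohom C (sum_obj C A B) T" "ocp f g ** Some (in1 C A B) = f" "ocp f g ** Some (in2 C A B) = g"
      using a c cmp[OF i(1) c(1)] cmp[OF i(2) c(1)] by (auto simp: ocp_def)
  qed
  show "x = y" if x: "x \<in> ohom C (sum_obj C A B) T" and y: "y \<in> ohom C (sum_obj C A B) T" and ob: "A \<in> Obj C" "B \<in> Obj C"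
      and 1: "x ** Some (in1 C A B) = y ** Some (in1 C A B)" and 2: "x ** Some (in2 C A B) = y ** Some (in2 C A B)"
    for x A B T y
  proof -
    obtain x' y' where a: "x = Some x'" "x' \<in> Hom C (sum_obj C A B) T" "y = Some y'" "y' \<in> Hom C (sum_obj C A B) T" using x y by (elim ohomE)
    note i = in_Hom[OF ob]
    have e: "x' \<cdot> in1 C A B = y' \<cdot> in1 C A B" "x' \<cdot> in2 C A B = y' \<cdot> in2 C A B"
      using 1 2 a cmp[OF i(1)] cmp[OF i(2)] by auto
    have "\<exists>!h. h \<in> Hom C (sum_obj C A B) T \<and> h \<cdot> in1 C A B = y' \<cdot> in1 C A B \<and> h \<cdot> in2 C A B = y' \<cdot> in2 C A B"
      using sums[OF ob] comp_Hom[OF cat i(1) a(4)] comp_Hom[OF cat i(2) a(4)] by (simp add: is_binary_coproduct_def)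
    then show ?thesis using a e by blast
  qed
  show "S.kernel (ocp (oidn C B) (oz C X B)) (sum_obj C B X) B (flat_obj C B X) (Some (flat_ker C B X))"
    if "B \<in> Obj C" "X \<in> Obj C" for B X by (rule flat_ker_kernel[OF that])
  show "ofl f g \<in> ohom C (flat_obj C B X) (flat_obj C B' X')"
    "Some (flat_ker C B' X') ** ofl f g =
      (ocp (Some (in1 C B' X') ** f) (Some (in2 C B' X') ** g)) ** Some (flat_ker C B X)"
    if f: "f \<in> ohom C B B'" and g: "g \<in> ohom C X X'" for f B B' g X X'
  proof -
    obtain f' g' where a: "f = Some f'" "f' \<in> Hom C B B'" "g = Some g'" "g' \<in> Hom C X X'" using f g by (elim ohomE)
    have ob: "B \<in> Obj C" "B' \<in> Obj C" "X \<in> Obj C" "X' \<in> Obj C" using Hom_ob[OF cat a(2)] Hom_ob[OF cat a(4)] by auto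
    note m = flat_mor[OF a(2,4)] and i = in_Hom[OF ob(2,4)]
    note c = copair(1)[OF comp_Hom[OF cat a(2) i(1)] comp_Hom[OF cat a(4) i(2)]]
    show "ofl f g \<in> ohom C (flat_obj C B X) (flat_obj C B' X')" using m a by (simp add: ofl_def)
    show "Some (flat_ker C B' X') ** ofl f g =
      (ocp (Some (in1 C B' X') ** f) (Some (in2 C B' X') ** g)) ** Some (flat_ker C B X)"
      using a m cmp[OF m(1) flat_ker_Hom[OF ob(2,4)]] cmp[OF a(2) i(1)] cmp[OF a(4) i(2)] cmp[OF flat_ker_Hom[OF ob(1,3)] c]
      by (simp add: ofl_def ocp_def)
  qed
qed

sublocale S: semi_abelian "Obj C" "ohom C" "ocmp C" "oidn C" "zero_obj C" "oz C" "sum_obj C" "\<lambda>A B. Some (in1 C A B)"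
  "\<lambda>A B. Some (in2 C A B)" ocp "flat_obj C" "\<lambda>B X. Some (flat_ker C B X)" ofl by (rule semi_abelian_axioms)

section \<open>Exactness, actions, modules and extensions translated to \<open>C\<close>\<close>

lemma exact_iff:
  assumes f: "f \<in> Hom C A B" and g: "g \<in> Hom C B D"
  shows "exact_at C f g \<longleftrightarrow> S.exact (Some f) (Some g) A B D"
proof -
  have d: "f \<in> Arr C" "g \<in> Arr C" "Dom C f = A" "Cod C f = B" "Dom C g = B" using f g by (auto simp: Hom_iff)
  show ?thesis
  proof
    assume "exact_at C f g"
    then obtain K k e where k: "is_kernel C g K k" and e: "e \<in> Hom C A K" "regular_epi C e" "f = k \<cdot> e"
      unfolding exact_at_def d by blast
    have "S.kernel (Some g) B D K (Some k)" "S.cover (Some e) A K" "Some f = Some k ** Some e"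
      using k kernel_iff[OF g] e regular_epi_iff[OF e(1)] cmp[OF e(1) kernel_Hom[OF k g]] by auto
    then show "S.exact (Some f) (Some g) A B D" unfolding S.exact_def using ohomI[OF f] ohomI[OF g] by blast
  next
    assume "S.exact (Some f) (Some g) A B D"
    then obtain K k e where k: "S.kernel (Some g) B D K k" and e: "S.cover e A K" "Some f = k ** e"
      unfolding S.exact_def by blast
    obtain k' e' where a: "k = Some k'" "k' \<in> Hom C K B" "e = Some e'" "e' \<in> Hom C A K"
      using S.kernel_in(2)[OF k] S.cover_in[OF e(1)] by (auto elim!: ohomE)
    have "is_kernel C g K k'" "regular_epi C e'" "f = k' \<cdot> e'"
      using k kernel_iff[OF g] e regular_epi_iff[OF a(4)] cmp[OF a(4,2)] a by auto
    then show "exact_at C f g" unfolding exact_at_def d using a d by blast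
  qed
qed

text \<open>\<open>S.eta\<close> and \<open>S.mu\<close> are choices, while \<open>flat_unit\<close>
  and \<open>flat_mult\<close> are definite descriptions; as the kernel inclusion is monic, there is
  only one candidate and they coincide.\<close>

lemma the_flat_arrow:
  assumes ob: "B \<in> Obj C" "X \<in> Obj C" and h: "h \<in> ohom C Y (flat_obj C B X)" "Some (flat_ker C B X) ** h = Some g"
  shows "h = Some (THE x. x \<in> Hom C Y (flat_obj C B X) \<and> flat_ker C B X \<cdot> x = g)"
proof -
  note k = flat_ker_Hom[OF ob]
  obtain h' where h': "h = Some h'" "h' \<in> Hom C Y (flat_obj C B X)" using h(1) by (elim ohomE)
  have "(THE x. x \<in> Hom C Y (flat_obj C B X) \<and> flat_ker C B X \<cdot> x = g) = h'"
  proof (rule the_equality)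
    show "h' \<in> Hom C Y (flat_obj C B X) \<and> flat_ker C B X \<cdot> h' = g" using h h' cmp[OF h'(2) k] by simp
    fix x assume x: "x \<in> Hom C Y (flat_obj C B X) \<and> flat_ker C B X \<cdot> x = g"
    then have xh: "x \<in> Hom C Y (flat_obj C B X)" by simp
    have "Some x = h" by (rule S.ka_eqI[OF _ ohomI[OF xh] h(1) ob]) (use h x cmp[OF xh k] in simp)
    then show "x = h'" using h' by simp
  qed
  then show ?thesis using h' by simp
qed

lemma eta_eq:
  assumes "B \<in> Obj C" "X \<in> Obj C"
  shows "S.eta B X = Some (flat_unit C B X)"
  unfolding flat_unit_def by (rule the_flat_arrow[OF assms S.eta[OF assms]])

lemma mu_eq:
  assumes "B \<in> Obj C" "X \<in> Obj C"
  shows "S.mu B X = Some (flat_mult C B X)"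
  unfolding flat_mult_def by (rule the_flat_arrow[OF assms S.mu(1)[OF assms]])
    (use S.mu(2)[OF assms] cmp[OF flat_ker_Hom[OF assms(1) S.fo_ob[OF assms]] copair(1)[OF in_Hom(1)[OF assms] flat_ker_Hom[OF assms]]]
      in \<open>simp add: ocp_def\<close>)

lemma act_iff: "internal_action C B X \<xi> \<longleftrightarrow> S.act B X (Some \<xi>)"
proof (cases "B \<in> Obj C \<and> X \<in> Obj C \<and> \<xi> \<in> Hom C (flat_obj C B X) X")
  case True
  then have ob: "B \<in> Obj C" "X \<in> Obj C" and x: "\<xi> \<in> Hom C (flat_obj C B X) X" by auto
  have u: "flat_unit C B X \<in> Hom C X (flat_obj C B X)" "flat_mult C B X \<in> Hom C (flat_obj C B (flat_obj C B X)) (flat_obj C B X)"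
    using S.eta(1)[OF ob] S.mu(1)[OF ob] eta_eq[OF ob] mu_eq[OF ob] by auto
  show ?thesis
    unfolding internal_action_def S.act_def eta_eq[OF ob] mu_eq[OF ob] using cmp[OF u(1) x] cmp[OF u(2) x] cmp[OF flat_mor(1)[OF id_Hom[OF cat ob(1)] x] x] by (simp add: oidn_def ofl_def)
next
  case False
  then show ?thesis by (auto simp: internal_action_def S.act_def)
qed

lemma act_Hom: "internal_action C B X \<xi> ==> \<xi> \<in> Hom C (flat_obj C B X) X"
  by (simp add: internal_action_def)

lemma am_iff:
  assumes x: "\<xi> \<in> Hom C (flat_obj C B X) X" and x': "\<xi>' \<in> Hom C (flat_obj C B' X') X'"
  shows "action_morphism C (B, X, \<xi>) (f, h) (B', X', \<xi>') \<longleftrightarrow> S.am B X (Some \<xi>) (Some f) (Some h) B' X' (Some \<xi>')"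
proof (cases "f \<in> Hom C B B' \<and> h \<in> Hom C X X'")
  case True
  then have f: "f \<in> Hom C B B'" and h: "h \<in> Hom C X X'" by auto
  show ?thesis using cmp[OF x h] cmp[OF flat_mor(1)[OF f h] x'] by (simp add: action_morphism_def S.am_def ofl_def)
next
  case False
  then show ?thesis by (auto simp: action_morphism_def S.am_def)
qed

lemma equivariant_iff:
  assumes x: "\<xi> \<in> Hom C (flat_obj C B X) X" and x': "\<xi>' \<in> Hom C (flat_obj C B X') X'"
  shows "equivariant C B X \<xi> h X' \<xi>' \<longleftrightarrow> S.am B X (Some \<xi>) (oidn C B) (Some h) B X' (Some \<xi>')"
  unfolding equivariant_def oidn_def by (rule am_iff[OF assms])

lemma conj_eq: "X \<in> Obj C ==> S.conj X = Some (conjugation C X)"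
  unfolding S.conj_def conjugation_def
  using cmp[OF flat_ker_Hom[of X X] copair(1)[OF id_Hom[OF cat, of X] id_Hom[OF cat, of X]]] by (simp add: ocp_def oidn_def)

lemma conj_Hom: "X \<in> Obj C ==> conjugation C X \<in> Hom C (flat_obj C X X) X"
  using S.conj_in[of X] conj_eq[of X] by simp

lemma crossed_module_iff: "internal_crossed_module C X D d \<xi> \<longleftrightarrow> S.crossed_module X D (Some d) (Some \<xi>)"
proof (cases "d \<in> Hom C X D \<and> internal_action C D X \<xi>")
  case True
  then have d: "d \<in> Hom C X D" and x: "\<xi> \<in> Hom C (flat_obj C D X) X" using act_Hom by auto
  note ob = Hom_ob[OF cat d]
  note i = id_Hom[OF cat ob(1)] id_Hom[OF cat ob(2)]
  show ?thesis
    unfolding internal_crossed_module_def S.crossed_module_def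
    using act_iff[of D X \<xi>] cmp[OF x d] cmp[OF flat_mor(1)[OF i(2) d] conj_Hom[OF ob(2)]] cmp[OF flat_mor(1)[OF d i(1)] x] conj_eq ob by (simp add: ofl_def oidn_def)
next
  case False
  then show ?thesis unfolding internal_crossed_module_def S.crossed_module_def using act_iff[of D X \<xi>] by auto
qed

lemma product_components:
  assumes X: "X \<in> Obj C"
  obtains p q where "S.p1 X X = Some p" "S.p2 X X = Some q" "p \<in> Hom C (S.pd X X) X" "q \<in> Hom C (S.pd X X) X"
  using S.p_in(1,2)[OF X X] by (auto elim!: ohomE)

lemma pair_component:
  assumes X: "X \<in> Obj C" and pq: "S.p1 X X = Some p" "S.p2 X X = Some q" and a: "a \<in> Hom C T X" and b: "b \<in> Hom C T X"
  obtains h where "S.pair X X (Some a) (Some b) = Some h" "h \<in> Hom C T (S.pd X X)" "p \<cdot> h = a" "q \<cdot> h = b"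
    "\<exists>!h. h \<in> Hom C T (S.pd X X) \<and> p \<cdot> h = a \<and> q \<cdot> h = b"
proof -
  note r = S.pair[OF ohomI[OF a] ohomI[OF b]] and pqh = S.p_in(1,2)[OF X X, unfolded pq ohom_Some]
  obtain h where h: "S.pair X X (Some a) (Some b) = Some h" "h \<in> Hom C T (S.pd X X)" using r(1) by (elim ohomE)
  show ?thesis
  proof (rule that[OF h])
    show ph: "p \<cdot> h = a" "q \<cdot> h = b" using r(2,3) h pq cmp[OF h(2) pqh(1)] cmp[OF h(2) pqh(2)] by auto
    have "x = h" if x: "x \<in> Hom C T (S.pd X X)" "p \<cdot> x = a" "q \<cdot> x = b" for x
    proof -
      have "Some x = S.pair X X (Some a) (Some b)"
        by (rule S.pair_eqI[OF ohomI[OF x(1)] X X]) (use pq x cmp[OF x(1) pqh(1)] cmp[OF x(1) pqh(2)] in auto)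
      then show ?thesis using h by simp
    qed
    then show "\<exists>!h. h \<in> Hom C T (S.pd X X) \<and> p \<cdot> h = a \<and> q \<cdot> h = b" using h ph by blast
  qed
qed

lemma zero_through: "T \<in> Obj C ==> u \<in> Hom C (zero_obj C) X ==> u \<cdot> zero_mor C T (zero_obj C) = zero_mor C T X"
  using zero_comp(2) by blast

text \<open>A group structure on any product \<open>P\<close> gives, after transport along the
  comparison \<open>t\<close> from the chosen product, an arrow satisfying the two unit laws; they
  only have to be read at the stage \<open>X\<close>. Conversely the unit laws already produce an
  associative, commutative addition with negatives.\<close>

lemma abelian_iff: "abelian_object C X \<longleftrightarrow> S.abelian X"
proof
  assume l: "abelian_object C X"
  then obtain P p q m u where X: "X \<in> Obj C" and P: "is_binary_product C X X P p q" and m: "m \<in> Hom C P X"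
    and u: "u \<in> Hom C (zero_obj C) X"
    and ax: "\<forall>T\<in>Obj C. \<forall>a\<in>Hom C T X. \<forall>b\<in>Hom C T X.
       m \<cdot> (THE h. h \<in> Hom C T P \<and> p \<cdot> h = a \<and> q \<cdot> h = b) = m \<cdot> (THE h. h \<in> Hom C T P \<and> p \<cdot> h = b \<and> q \<cdot> h = a)"
      "\<forall>T\<in>Obj C. \<forall>a\<in>Hom C T X.
       m \<cdot> (THE h. h \<in> Hom C T P \<and> p \<cdot> h = u \<cdot> zero_mor C T (zero_obj C) \<and> q \<cdot> h = a) = a"
    unfolding abelian_object_def Let_def by blast
  have pq: "p \<in> Hom C P X" "q \<in> Hom C P X" and un: "\<And>T f g. f \<in> Hom C T X ==> g \<in> Hom C T X ==>
      \<exists>!h. h \<in> Hom C T P \<and> p \<cdot> h = f \<and> q \<cdot> h = g" using P by (auto simp: is_binary_product_def)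
  obtain p' q' where pq': "S.p1 X X = Some p'" "S.p2 X X = Some q'" "p' \<in> Hom C (S.pd X X) X" "q' \<in> Hom C (S.pd X X) X"
    by (rule product_components[OF X])
  obtain t where t: "t \<in> Hom C (S.pd X X) P" "p \<cdot> t = p'" "q \<cdot> t = q'" using un[OF pq'(3,4)] by blast
  note i = id_Hom[OF cat X] and z = zero_mor(1)[OF X X]
  have unit: "m \<cdot> (THE h. h \<in> Hom C X P \<and> p \<cdot> h = zero_mor C X X \<and> q \<cdot> h = Ident C X) = Ident C X"
    using ax(2)[rule_format, OF X i] unfolding zero_through[OF X u] .
  have unit': "m \<cdot> (THE h. h \<in> Hom C X P \<and> p \<cdot> h = Ident C X \<and> q \<cdot> h = zero_mor C X X) = Ident C X"
    using ax(1)[rule_format, OF X i z] unit by (rule trans)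
  have *: "Some (m \<cdot> t) ** S.pair X X (Some a) (Some b) = Some (m \<cdot> (THE h. h \<in> Hom C X P \<and> p \<cdot> h = a \<and> q \<cdot> h = b))"
    if a: "a \<in> Hom C X X" and b: "b \<in> Hom C X X" for a b
  proof -
    obtain h where h: "S.pair X X (Some a) (Some b) = Some h" "h \<in> Hom C X (S.pd X X)" "p' \<cdot> h = a" "q' \<cdot> h = b"
      by (rule pair_component[OF X pq'(1,2) a b])
    have th: "t \<cdot> h \<in> Hom C X P" "p \<cdot> (t \<cdot> h) = a" "q \<cdot> (t \<cdot> h) = b"
      using comp_Hom[OF cat h(2) t(1)] comp_assoc[OF cat h(2) t(1) pq(1)] comp_assoc[OF cat h(2) t(1) pq(2)] t h by auto
    then have "(THE h. h \<in> Hom C X P \<and> p \<cdot> h = a \<and> q \<cdot> h = b) = t \<cdot> h"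
      by (intro the1_equality[OF un[OF a b]]) simp
    then show ?thesis using h(1) cmp[OF h(2) comp_Hom[OF cat t(1) m]] comp_assoc[OF cat h(2) t(1) m] by simp
  qed
  have "S.cooperates X X (oidn C X) (Some (m \<cdot> t))"
    unfolding S.cooperates_def using *[OF i z] *[OF z i] unit unit' i comp_Hom[OF cat t(1) m] by (simp add: oidn_def oz_def)
  then show "S.abelian X" by (auto simp: S.abelian_def)
next
  assume "S.abelian X"
  then obtain m0 i0 where g: "S.abelian_group X m0 i0" using S.abelian_group_exists by blast
  note G = S.abelian_groupD[OF g]
  note c = G(1) and X = G(3)
  note co = S.cooperatesD[OF c]
  obtain p q where pq: "S.p1 X X = Some p" "S.p2 X X = Some q" "p \<in> Hom C (S.pd X X) X" "q \<in> Hom C (S.pd X X) X"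
    by (rule product_components[OF X])
  obtain m i where m: "m0 = Some m" "m \<in> Hom C (S.pd X X) X" and i: "i0 = Some i" "i \<in> Hom C X X"
    using G(2,4) by (auto elim!: ohomE)
  let ?mul = "\<lambda>T a b. m \<cdot> (THE h. h \<in> Hom C T (S.pd X X) \<and> p \<cdot> h = a \<and> q \<cdot> h = b)"
  have bp: "is_binary_product C X X (S.pd X X) p q" unfolding is_binary_product_def
  proof (intro conjI allI impI)
    fix T f g assume fg: "f \<in> Hom C T X" "g \<in> Hom C T X"
    show "\<exists>!h. h \<in> Hom C T (S.pd X X) \<and> p \<cdot> h = f \<and> q \<cdot> h = g" by (rule pair_component[OF X pq(1,2) fg])
  qed (use pq in auto)
  have mul: "Some (?mul T a b) = m0 ** S.pair X X (Some a) (Some b)" "?mul T a b \<in> Hom C T X"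
    if a: "a \<in> Hom C T X" and b: "b \<in> Hom C T X" for T a b
  proof -
    obtain h where h: "S.pair X X (Some a) (Some b) = Some h" "h \<in> Hom C T (S.pd X X)" "p \<cdot> h = a" "q \<cdot> h = b"
      "\<exists>!h. h \<in> Hom C T (S.pd X X) \<and> p \<cdot> h = a \<and> q \<cdot> h = b" by (rule pair_component[OF X pq(1,2) a b])
    have "(THE h. h \<in> Hom C T (S.pd X X) \<and> p \<cdot> h = a \<and> q \<cdot> h = b) = h"
      by (rule the1_equality[OF h(5)]) (use h in simp)
    then show "Some (?mul T a b) = m0 ** S.pair X X (Some a) (Some b)" "?mul T a b \<in> Hom C T X"
      using h(1) cmp[OF h(2) m(2)] m(1) comp_Hom[OF cat h(2) m(2)] by auto
  qed
  let ?u = "zero_mor C (zero_obj C) X"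
  have u: "?u \<in> Hom C (zero_obj C) X" using zero_mor(1) X by blast
  have 1: "?mul T (?mul T a b) d = ?mul T a (?mul T b d)" if a: "a \<in> Hom C T X" and b: "b \<in> Hom C T X" and d: "d \<in> Hom C T X" for T a b d
  proof (rule option.inject[THEN iffD1])
    show "Some (?mul T (?mul T a b) d) = Some (?mul T a (?mul T b d))"
    unfolding mul(1)[OF mul(2)[OF a b] d] mul(1)[OF a mul(2)[OF b d]] mul(1)[OF a b] mul(1)[OF b d]
      by (rule S.cooperates_assoc[OF c c ohomI[OF a] ohomI[OF b] ohomI[OF d]])
  qed
  have 2: "?mul T a b = ?mul T b a" if a: "a \<in> Hom C T X" and b: "b \<in> Hom C T X" for T a b
  proof (rule option.inject[THEN iffD1])
    show "Some (?mul T a b) = Some (?mul T b a)"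
      unfolding mul(1)[OF a b] mul(1)[OF b a] by (rule S.cooperates_commute[OF c ohomI[OF a] ohomI[OF b]])
  qed
  have 3: "?mul T (?u \<cdot> zero_mor C T (zero_obj C)) a = a" if a: "a \<in> Hom C T X" for T a
  proof -
    have T: "T \<in> Obj C" using Hom_ob[OF cat a] by simp
    show ?thesis unfolding zero_through[OF T u]
      using mul(1)[OF zero_mor(1)[OF T X] a] co(6)[OF ohomI[OF a]] S.id_l[OF ohomI[OF a]] by (simp add: oz_def)
  qed
  have 4: "?mul T (i \<cdot> a) a = ?u \<cdot> zero_mor C T (zero_obj C)" if a: "a \<in> Hom C T X" for T a
  proof -
    have T: "T \<in> Obj C" using Hom_ob[OF cat a] by simp
    show ?thesis unfolding zero_through[OF T u]
      using mul(1)[OF comp_Hom[OF cat a i(2)] a] G(6)[OF ohomI[OF a]] i(1) cmp[OF a i(2)] by (simp add: oz_def)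
  qed
  show "abelian_object C X" unfolding abelian_object_def Let_def
    by (intro conjI X exI[of _ "S.pd X X"] exI[of _ p] exI[of _ q] exI[of _ m] exI[of _ ?u] exI[of _ i] bp m i u ballI 1 2 3 4)
qed

lemma module_iff: "is_module C A B \<xi> \<longleftrightarrow> S.act_module A B (Some \<xi>)"
  by (simp add: is_module_def S.act_module_def abelian_iff act_iff)

lemma module_Hom: "is_module C A B \<xi> ==> \<xi> \<in> Hom C (flat_obj C A B) B"
  by (simp add: is_module_def act_Hom)

text \<open>The existential statements are matched witness by witness: the typings force each
  optional witness to have the form \<open>Some\<close>.\<close>

lemma kernel_equivariant_iff:
  assumes p: "p \<in> Hom C G1 A" and d: "d \<in> Hom C G2 G1" and x: "\<xi> \<in> Hom C (flat_obj C G1 G2) G2" and b: "\<beta> \<in> Hom C (flat_obj C A B) B"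
  shows "corestriction_equivariant C A G1 p d \<xi> B \<beta> c \<longleftrightarrow>
    S.kernel_equivariant A G1 G2 (Some p) (Some d) (Some \<xi>) B (Some \<beta>) (Some c)"
proof -
  note ob = Hom_ob[OF cat p]
  have *: "is_kernel C d K k \<and> is_module C A K \<phi> \<and> k \<cdot> \<phi> \<cdot> flat_mor C p (Ident C K) = \<xi> \<cdot> flat_mor C (Ident C G1) k \<and>
        k \<cdot> e = c \<and> equivariant C A B \<beta> e K \<phi> \<longleftrightarrow>
      S.kernel (Some d) G2 G1 K (Some k) \<and> S.act_module A K (Some \<phi>) \<and>
        Some k ** (Some \<phi> ** ofl (Some p) (oidn C K)) = Some \<xi> ** ofl (oidn C G1) (Some k) \<and>
        Some k ** Some e = Some c \<and> S.am A B (Some \<beta>) (oidn C A) (Some e) A K (Some \<phi>)" for K k \<phi> e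
  proof (cases "is_kernel C d K k \<and> is_module C A K \<phi> \<and> e \<in> Hom C B K")
    case True
    then have k: "k \<in> Hom C K G2" and f: "\<phi> \<in> Hom C (flat_obj C A K) K" and e: "e \<in> Hom C B K" using kernel_Hom d module_Hom by auto
    note iK = id_Hom[OF cat Hom_ob(1)[OF cat k]] and i1 = id_Hom[OF cat ob(1)]
    note f1 = flat_mor(1)[OF p iK] and f2 = flat_mor(1)[OF i1 k]
    have 1: "Some k ** (Some \<phi> ** ofl (Some p) (oidn C K)) = Some (k \<cdot> \<phi> \<cdot> flat_mor C p (Ident C K))"
      using cmp[OF f1 f] cmp[OF comp_Hom[OF cat f1 f] k] comp_assoc[OF cat f1 f k] by (simp add: ofl_def oidn_def)
    have 2: "Some \<xi> ** ofl (oidn C G1) (Some k) = Some (\<xi> \<cdot> flat_mor C (Ident C G1) k)"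
      using cmp[OF f2 x] by (simp add: ofl_def oidn_def)
    show ?thesis unfolding 1 2 using kernel_iff[OF d] module_iff cmp[OF e k] equivariant_iff[OF b f] by simp
  next
    case False
    then show ?thesis using kernel_iff[OF d] module_iff by (auto simp: equivariant_def action_morphism_def S.am_def)
  qed
  show ?thesis
  proof
    assume "corestriction_equivariant C A G1 p d \<xi> B \<beta> c"
    then show "S.kernel_equivariant A G1 G2 (Some p) (Some d) (Some \<xi>) B (Some \<beta>) (Some c)"
      unfolding corestriction_equivariant_def S.kernel_equivariant_def * by blast
  next
    assume "S.kernel_equivariant A G1 G2 (Some p) (Some d) (Some \<xi>) B (Some \<beta>) (Some c)"
    then obtain K k \<phi> e where r: "S.kernel (Some d) G2 G1 K k" "S.act_module A K \<phi>"
        "k ** (\<phi> ** ofl (Some p) (oidn C K)) = Some \<xi> ** ofl (oidn C G1) k"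
        "k ** e = Some c" "S.am A B (Some \<beta>) (oidn C A) e A K \<phi>" unfolding S.kernel_equivariant_def by blast
    obtain k' \<phi>' e' where "k = Some k'" "\<phi> = Some \<phi>'" "e = Some e'"
      using S.kernel_in(2)[OF r(1)] r(2,5) by (auto simp: S.act_module_def S.act_def S.am_def elim!: ohomE)
    then show "corestriction_equivariant C A G1 p d \<xi> B \<beta> c"
      unfolding corestriction_equivariant_def * using r by blast
  qed
qed

definition oE :: "('o, 'm) xext => ('o, 'm option) xext" where
  "oE E = \<lparr>xob = xob E, xd = (\<lambda>i. Some (xd E i)), xact = (\<lambda>i. Some (xact E i))\<rparr>"

lemma oE_simps [simp]: "xob (oE E) = xob E" "xd (oE E) i = Some (xd E i)" "xact (oE E) i = Some (xact E i)"
  by (simp_all add: oE_def)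

lemma ext_iff:
  assumes n: "n \<ge> 2"
  shows "is_xext C n E \<longleftrightarrow> xob E \<in> extensional {0..n+1} \<and> xd E \<in> extensional {0..n} \<and> xact E \<in> extensional {2..n+1} \<and>
    S.ext n (oE E)"
proof -
  \<comment> \<open>The clauses are translated one by one, which requires typings: those of objects
    and differentials are assumed, and those of the actions in the last two clauses are supplied by
    the crossed module and module clauses.\<close>
  have main: "(exact_at C (zero_mor C (zero_obj C) (xob E (n+1))) (xd E n) \<and>
     (\<forall>i\<in>{1..n}. exact_at C (xd E i) (xd E (i-1))) \<and>
     exact_at C (xd E 0) (zero_mor C (xob E 0) (zero_obj C)) \<and>
     internal_crossed_module C (xob E 2) (xob E 1) (xd E 1) (xact E 2) \<and>
     (\<forall>i\<in>{3..n+1}. is_module C (xob E 0) (xob E i) (xact E i)) \<and>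
     corestriction_equivariant C (xob E 0) (xob E 1) (xd E 0) (xd E 1) (xact E 2) (xob E 3) (xact E 3) (xd E 2) \<and>
     (\<forall>i\<in>{3..n}. equivariant C (xob E 0) (xob E (i+1)) (xact E (i+1)) (xd E i) (xob E i) (xact E i))) \<longleftrightarrow>
     (S.exact (oz C (zero_obj C) (xob E (n+1))) (Some (xd E n)) (zero_obj C) (xob E (n+1)) (xob E n) \<and>
     (\<forall>i\<in>{1..n}. S.exact (Some (xd E i)) (Some (xd E (i-1))) (xob E (i+1)) (xob E i) (xob E (i-1))) \<and>
     S.exact (Some (xd E 0)) (oz C (xob E 0) (zero_obj C)) (xob E 1) (xob E 0) (zero_obj C) \<and>
     S.crossed_module (xob E 2) (xob E 1) (Some (xd E 1)) (Some (xact E 2)) \<and>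
     (\<forall>i\<in>{3..n+1}. S.act_module (xob E 0) (xob E i) (Some (xact E i))) \<and>
     S.kernel_equivariant (xob E 0) (xob E 1) (xob E 2) (Some (xd E 0)) (Some (xd E 1)) (Some (xact E 2)) (xob E 3)
       (Some (xact E 3)) (Some (xd E 2)) \<and>
     (\<forall>i\<in>{3..n}. S.am (xob E 0) (xob E (i+1)) (Some (xact E (i+1))) (oidn C (xob E 0)) (Some (xd E i)) (xob E 0)
        (xob E i) (Some (xact E i))))"
    (is "(?a \<and> ?b \<and> ?c \<and> ?d \<and> ?e \<and> ?f \<and> ?g) \<longleftrightarrow> (?a' \<and> ?b' \<and> ?c' \<and> ?d' \<and> ?e' \<and> ?f' \<and> ?g')")
    if ob: "\<forall>i\<in>{0..n+1}. xob E i \<in> Obj C" and d: "\<forall>i\<in>{0..n}. xd E i \<in> Hom C (xob E (i+1)) (xob E i)"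
  proof -
    have d': "i \<le> n ==> xd E i \<in> Hom C (xob E (Suc i)) (xob E i)" for i using d by simp
    have "?a \<longleftrightarrow> ?a'" using exact_iff[OF zero_mor(1) d'[of n]] ob by (simp add: oz_def)
    moreover have "exact_at C (xd E i) (xd E (i-1)) \<longleftrightarrow>
        S.exact (Some (xd E i)) (Some (xd E (i-1))) (xob E (i+1)) (xob E i) (xob E (i-1))" if i: "i \<in> {1..n}" for i
    proof -
      have "xd E (i-1) \<in> Hom C (xob E i) (xob E (i-1))" using d'[of "i-1"] i by force
      then show ?thesis using exact_iff[OF d'[of i]] i by simp
    qed
    then have "?b \<longleftrightarrow> ?b'" by blast
    moreover have "?c \<longleftrightarrow> ?c'" using exact_iff[OF d'[of 0] zero_mor(1)] ob by (simp add: oz_def)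
    moreover have "?d \<longleftrightarrow> ?d'" by (rule crossed_module_iff)
    moreover have "?e \<longleftrightarrow> ?e'" using module_iff by blast
    moreover have "?f \<longleftrightarrow> ?f'" if D: ?d and e: ?e
    proof -
      have "xact E 2 \<in> Hom C (flat_obj C (xob E 1) (xob E 2)) (xob E 2)" "xact E 3 \<in> Hom C (flat_obj C (xob E 0) (xob E 3)) (xob E 3)"
        "xd E 0 \<in> Hom C (xob E 1) (xob E 0)" "xd E 1 \<in> Hom C (xob E 2) (xob E 1)"
        using act_Hom[of "xob E 1" "xob E 2" "xact E 2"] module_Hom[of "xob E 0" "xob E 3" "xact E 3"] D e n d'[of 0]
        by (auto simp: internal_crossed_module_def numeral_2_eq_2)
      then show ?thesis using kernel_equivariant_iff by blast
    qed
    moreover have "?g \<longleftrightarrow> ?g'" if e: ?e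
    proof -
      have h: "xact E i \<in> Hom C (flat_obj C (xob E 0) (xob E i)) (xob E i)" if "i \<in> {3..n+1}" for i using e module_Hom that by blast
      show ?thesis using equivariant_iff[OF h h] by (intro ball_cong refl) simp
    qed
    ultimately show ?thesis by blast
  qed
  show ?thesis unfolding is_xext_def S.ext_def oE_simps ohom_Some using main by blast
qed

lemma ext_mor_iff:
  assumes n: "n \<ge> 2" and E: "is_xext C n E" "is_xext C n E'"
  shows "xext_morphism C n E f E' \<longleftrightarrow> f \<in> extensional {0..n+1} \<and> S.ext_mor n (oE E) (\<lambda>i. Some (f i)) (oE E')"
proof -
  have d: "xd F i \<in> Hom C (xob F (Suc i)) (xob F i)" if "is_xext C n F" "i \<le> n" for F i
    using that by (simp add: is_xext_def)
  have x: "xact F i \<in> Hom C (flat_obj C (xob F 0) (xob F i)) (xob F i)" if "is_xext C n F" "i \<in> {3..n+1}" for F i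
    using that module_Hom by (simp add: is_xext_def)
  have x2: "xact F 2 \<in> Hom C (flat_obj C (xob F 1) (xob F 2)) (xob F 2)" if "is_xext C n F" for F
    using that act_Hom by (simp add: is_xext_def internal_crossed_module_def)
  have sq: "f i \<cdot> xd E i = xd E' i \<cdot> f (i+1) \<longleftrightarrow> Some (f i) ** Some (xd E i) = Some (xd E' i) ** Some (f (i+1))"
    if "\<forall>i\<in>{0..n+1}. f i \<in> Hom C (xob E i) (xob E' i)" "i \<in> {0..n}" for i
  proof -
    have f: "f i \<in> Hom C (xob E i) (xob E' i)" "f (Suc i) \<in> Hom C (xob E (Suc i)) (xob E' (Suc i))" and i: "i \<le> n"
      using that by auto
    show ?thesis using cmp[OF d[OF E(1) i] f(1)] cmp[OF f(2) d[OF E(2) i]] by simp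
  qed
  have am: "action_morphism C (xob E 0, xob E i, xact E i) (f 0, f i) (xob E' 0, xob E' i, xact E' i) \<longleftrightarrow>
      S.am (xob E 0) (xob E i) (Some (xact E i)) (Some (f 0)) (Some (f i)) (xob E' 0) (xob E' i) (Some (xact E' i))"
    if "i \<in> {3..n+1}" for i by (rule am_iff[OF x[OF E(1) that] x[OF E(2) that]])
  show ?thesis unfolding xext_morphism_def S.ext_mor_def oE_simps ohom_Some am_iff[OF x2[OF E(1)] x2[OF E(2)]]
    using sq am by (auto simp del: One_nat_def)
qed

end

section \<open>The fibrations of modules and of crossed extensions\<close>

context semi_abelian
begin

lemma pullback_isom:
  assumes pb: "pullback f g A B D P p q" and i: "isom i P' P"
  shows "pullback f g A B D P' (p ** i) (q ** i)"
proof -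
  obtain j where j: "i \<in> hom P' P" "j \<in> hom P P'" "j ** i = idn P'" "i ** j = idn P" using i by (auto simp: isom_def)
  note P = pullback_in[OF pb]
  show ?thesis unfolding pullback_def
  proof (intro conjI allI impI)
    show "f ** p ** i = g ** q ** i" using reassoc[OF P(5)] by simp
    fix T a b assume ab: "a \<in> hom T A" "b \<in> hom T B" "f ** a = g ** b"
    obtain h where h: "h \<in> hom T P" "p ** h = a" "q ** h = b" by (rule pullbackE[OF pb ab])
    then show "\<exists>h\<in>hom T P'. (p ** i) ** h = a \<and> (q ** i) ** h = b"
      using j reassoc[OF j(4)] id_l[OF h(1)] by (intro bexI[of _ "j ** h"]) auto
  next
    fix T x y assume xy: "x \<in> hom T P'" "y \<in> hom T P'" and e: "(p ** i) ** x = (p ** i) ** y" "(q ** i) ** x = (q ** i) ** y"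
    have "i ** x = i ** y" by (rule pullback_eqI[OF pb _ _ comp_in[OF xy(1) j(1)] comp_in[OF xy(2) j(1)]]) (use e in auto)
    then show "x = y" by (rule monicD[OF isom_monic[OF i]]) (use xy in auto)
  qed (use P j in blast)+
qed

text \<open>The functions of an extension in \<open>C\<close> are fixed outside the index range,
  those of an extension built in the locale are not, so agreement on the range takes the place of
  equality.\<close>

definition agree :: "nat => ('o, 'a) xext => ('o, 'a) xext => bool" where
  "agree n E F \<longleftrightarrow> (\<forall>i\<le>Suc n. xob E i = xob F i) \<and> (\<forall>i\<le>n. xd E i = xd F i) \<and> (\<forall>i\<le>Suc n. 2 \<le> i --> xact E i = xact F i)"

lemma agreeD:
  assumes "agree n E F" "n \<ge> 2"
  shows "i \<le> Suc n ==> xob E i = xob F i" "i \<le> n ==> xd E i = xd F i" "i \<le> Suc n ==> 2 \<le> i ==> xact E i = xact F i"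
  using assms by (auto simp: agree_def)

lemma ext_cong:
  assumes a: "agree n E F" and n: "n \<ge> 2" and E: "ext n E"
  shows "ext n F"
  using E n unfolding ext_def by (auto simp: agreeD[OF a n, symmetric])

lemma ext_mor_cong:
  assumes a: "agree n E E'" and b: "agree n F F'" and n: "n \<ge> 2" and f: "ext_mor n E f F" and g: "\<And>i. i \<le> Suc n ==> f i = g i"
  shows "ext_mor n E' g F'"
  using f n unfolding ext_mor_def by (auto simp: agreeD[OF a n, symmetric] agreeD[OF b n, symmetric] g[symmetric])

lemma ext_cartesian_isom:
  assumes f: "ext_cartesian n E' f E" and n: "n \<ge> 2" and E'': "ext n E''" and g: "ext_mor n E'' g E" and i: "ext_mor n E'' i E'"
    and iis: "\<And>k. k \<le> Suc n ==> isom (i k) (xob E'' k) (xob E' k)" and i0: "i 0 = idn (xob E' 0)" "xob E'' 0 = xob E' 0"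
    and fi: "\<And>k. k \<le> Suc n ==> f k ** i k = g k"
  shows "ext_cartesian n E'' g E"
proof -
  have E: "ext n E" and iso: "\<And>k. 2 \<le> k ==> k \<le> n + 1 ==> isom (f k) (xob E' k) (xob E k)" and fm: "ext_mor n E' f E"
    and pb: "pullback (xd E 0) (f 0) (xob E 1) (xob E' 0) (xob E 0) (xob E' 1) (f 1) (xd E' 0)"
    using f by (auto simp: ext_cartesian_def)
  have "isom (g k) (xob E'' k) (xob E k)" if k: "2 \<le> k" "k \<le> n + 1" for k
    using isom_comp[OF iis iso[OF k]] fi[of k] k by simp
  moreover have "xd E' 0 ** i 1 = xd E'' 0" using ext_morD(2)[OF i n, of 0] i0 id_l extD(2)[OF E'' n, of 0] by simp
  moreover have "g 0 = f 0" using fi[of 0] i0 id_r ext_morD(1)[OF fm n, of 0] by simp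
  ultimately show ?thesis using pullback_isom[OF pb iis[of 1]] fi[of 1] i0 E E'' g by (simp add: ext_cartesian_def)
qed

end

context ssa_category
begin

section \<open>The fibration of modules\<close>

lemma Mod_Obj: "(A, B, \<xi>) \<in> Obj (Mod_cat C) \<longleftrightarrow> S.act_module A B (Some \<xi>)"
  by (simp add: Mod_cat_def Let_def module_iff)

lemma Mod_Hom: "t \<in> Hom (Mod_cat C) (A, B, \<xi>) (A', B', \<xi>') \<longleftrightarrow>
    (\<exists>\<gamma> \<beta>. t = ((A, B, \<xi>), (\<gamma>, \<beta>), (A', B', \<xi>')) \<and> S.act_module A B (Some \<xi>) \<and> S.act_module A' B' (Some \<xi>') \<and>
      S.am A B (Some \<xi>) (Some \<gamma>) (Some \<beta>) A' B' (Some \<xi>'))"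
proof -
  have "is_module C A B \<xi> ==> is_module C A' B' \<xi>' ==>
      action_morphism C (A, B, \<xi>) (\<gamma>, \<beta>) (A', B', \<xi>') \<longleftrightarrow> S.am A B (Some \<xi>) (Some \<gamma>) (Some \<beta>) A' B' (Some \<xi>')" for \<gamma> \<beta>
    by (rule am_iff[OF module_Hom module_Hom])
  then show ?thesis by (auto simp: Mod_cat_def Let_def Hom_iff module_iff)
qed

lemma Mod_ops: "Dom (Mod_cat C) (M, f, M') = M" "Cod (Mod_cat C) (M, f, M') = M'"
  "Ident (Mod_cat C) (A, B, \<xi>) = ((A, B, \<xi>), (Ident C A, Ident C B), (A, B, \<xi>))"
  "Comp (Mod_cat C) (M0, (\<gamma>', \<beta>'), M'') (M, (\<gamma>, \<beta>), M1) = (M, (\<gamma>' \<cdot> \<gamma>, \<beta>' \<cdot> \<beta>), M'')"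
  by (simp_all add: Mod_cat_def Let_def)

lemma Mod_base_maps: "omap Mod_base (A, B, \<xi>) = A" "amap Mod_base (M, (\<gamma>, \<beta>), M') = \<gamma>"
  by (simp_all add: Mod_base_def)

lemma Mod_ArrE:
  assumes "t \<in> Arr (Mod_cat C)"
  obtains A B \<xi> \<gamma> \<beta> A' B' \<xi>' where "t = ((A, B, \<xi>), (\<gamma>, \<beta>), (A', B', \<xi>'))" "t \<in> Hom (Mod_cat C) (A, B, \<xi>) (A', B', \<xi>')"
    "\<gamma> \<in> Hom C A A'" "\<beta> \<in> Hom C B B'" "S.act_module A B (Some \<xi>)" "S.act_module A' B' (Some \<xi>')"
    "S.am A B (Some \<xi>) (Some \<gamma>) (Some \<beta>) A' B' (Some \<xi>')"
proof -
  obtain A B \<xi> A' B' \<xi>' where t: "Dom (Mod_cat C) t = (A, B, \<xi>)" "Cod (Mod_cat C) t = (A', B', \<xi>')"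
    using prod_cases3 by metis
  then have h: "t \<in> Hom (Mod_cat C) (A, B, \<xi>) (A', B', \<xi>')" using assms by (simp add: Hom_iff)
  then obtain \<gamma> \<beta> where "t = ((A, B, \<xi>), (\<gamma>, \<beta>), (A', B', \<xi>'))" "S.act_module A B (Some \<xi>)" "S.act_module A' B' (Some \<xi>')"
    "S.am A B (Some \<xi>) (Some \<gamma>) (Some \<beta>) A' B' (Some \<xi>')" by (auto simp: Mod_Hom)
  with h that show ?thesis by (simp add: S.am_def)
qed

lemma Mod_category: "is_category (Mod_cat C)"
  unfolding is_category_def
proof (intro conjI ballI impI)
  fix t assume "t \<in> Arr (Mod_cat C)"
  then obtain A B \<xi> \<gamma> \<beta> A' B' \<xi>' where t: "t = ((A, B, \<xi>), (\<gamma>, \<beta>), (A', B', \<xi>'))"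
    and g: "\<gamma> \<in> Hom C A A'" and b: "\<beta> \<in> Hom C B B'" and m: "S.act_module A B (Some \<xi>)" "S.act_module A' B' (Some \<xi>')"
    by (rule Mod_ArrE)
  show "Dom (Mod_cat C) t \<in> Obj (Mod_cat C)" "Cod (Mod_cat C) t \<in> Obj (Mod_cat C)" using m by (auto simp: t Mod_ops Mod_Obj)
  show "Comp (Mod_cat C) t (Ident (Mod_cat C) (Dom (Mod_cat C) t)) = t"
    "Comp (Mod_cat C) (Ident (Mod_cat C) (Cod (Mod_cat C) t)) t = t"
    using comp_id_left[OF cat g] comp_id_left[OF cat b] comp_id_right[OF cat g] comp_id_right[OF cat b] by (auto simp: t Mod_ops)
next
  fix M assume M: "M \<in> Obj (Mod_cat C)"
  obtain A B \<xi> where "M = (A, B, \<xi>)" by (cases M)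
  then show "Ident (Mod_cat C) M \<in> Hom (Mod_cat C) M M"
    using M S.am_id[of A B "Some \<xi>"] by (simp add: Mod_Obj Mod_ops Mod_Hom S.act_module_def oidn_def)
next
  fix t t' assume "t \<in> Arr (Mod_cat C)" "t' \<in> Arr (Mod_cat C)" and c: "Cod (Mod_cat C) t = Dom (Mod_cat C) t'"
  from this(1) obtain A B \<xi> \<gamma> \<beta> A' B' \<xi>' where t: "t = ((A, B, \<xi>), (\<gamma>, \<beta>), (A', B', \<xi>'))"
    and g: "\<gamma> \<in> Hom C A A'" "\<beta> \<in> Hom C B B'" and m: "S.act_module A B (Some \<xi>)" "S.am A B (Some \<xi>) (Some \<gamma>) (Some \<beta>) A' B' (Some \<xi>')"
    by (rule Mod_ArrE)
  from \<open>t' \<in> _\<close> obtain A1 B1 \<xi>1 \<gamma>' \<beta>' A'' B'' \<xi>'' where t': "t' = ((A1, B1, \<xi>1), (\<gamma>', \<beta>'), (A'', B'', \<xi>''))"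
    and g': "\<gamma>' \<in> Hom C A1 A''" "\<beta>' \<in> Hom C B1 B''" and m': "S.act_module A'' B'' (Some \<xi>'')" "S.am A1 B1 (Some \<xi>1) (Some \<gamma>') (Some \<beta>') A'' B'' (Some \<xi>'')"
    by (rule Mod_ArrE)
  have 0: "A1 = A'" "B1 = B'" "\<xi>1 = \<xi>'" using c t t' by (auto simp: Mod_ops)
  show "Comp (Mod_cat C) t' t \<in> Hom (Mod_cat C) (Dom (Mod_cat C) t) (Cod (Mod_cat C) t')"
    using S.am_comp[OF m(2) m'(2)[unfolded 0]] cmp[OF g(1) g'(1)[unfolded 0]] cmp[OF g(2) g'(2)[unfolded 0]] m m'
    by (simp add: t t' Mod_ops Mod_Hom)
next
  fix t t' t'' assume "t \<in> Arr (Mod_cat C)" "t' \<in> Arr (Mod_cat C)" "t'' \<in> Arr (Mod_cat C)"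
    and c: "Cod (Mod_cat C) t = Dom (Mod_cat C) t'" "Cod (Mod_cat C) t' = Dom (Mod_cat C) t''"
  from this(1) obtain A B \<xi> \<gamma> \<beta> A' B' \<xi>' where t: "t = ((A, B, \<xi>), (\<gamma>, \<beta>), (A', B', \<xi>'))"
    and g: "\<gamma> \<in> Hom C A A'" "\<beta> \<in> Hom C B B'" by (rule Mod_ArrE)
  from \<open>t' \<in> _\<close> obtain A1 B1 \<xi>1 \<gamma>' \<beta>' A'' B'' \<xi>'' where t': "t' = ((A1, B1, \<xi>1), (\<gamma>', \<beta>'), (A'', B'', \<xi>''))"
    and g': "\<gamma>' \<in> Hom C A1 A''" "\<beta>' \<in> Hom C B1 B''" by (rule Mod_ArrE)
  from \<open>t'' \<in> _\<close> obtain A2 B2 \<xi>2 \<gamma>'' \<beta>'' A3 B3 \<xi>3 where t'': "t'' = ((A2, B2, \<xi>2), (\<gamma>'', \<beta>''), (A3, B3, \<xi>3))"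
    and g'': "\<gamma>'' \<in> Hom C A2 A3" "\<beta>'' \<in> Hom C B2 B3" by (rule Mod_ArrE)
  have 0: "A1 = A'" "B1 = B'" "A2 = A''" "B2 = B''" using c t t' t'' by (auto simp: Mod_ops)
  show "Comp (Mod_cat C) t'' (Comp (Mod_cat C) t' t) = Comp (Mod_cat C) (Comp (Mod_cat C) t'' t') t"
    using comp_assoc[OF cat g(1) g'(1)[unfolded 0] g''(1)[unfolded 0]] comp_assoc[OF cat g(2) g'(2)[unfolded 0] g''(2)[unfolded 0]]
    by (simp add: t t' t'' Mod_ops)
qed

lemma Mod_base_functor: "is_functor (Mod_cat C) C Mod_base"
  unfolding is_functor_def
proof (intro conjI ballI impI)
  fix M assume M: "M \<in> Obj (Mod_cat C)"
  obtain A B \<xi> where "M = (A, B, \<xi>)" by (cases M)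
  then show "omap Mod_base M \<in> Obj C" "amap Mod_base (Ident (Mod_cat C) M) = Ident C (omap Mod_base M)"
    using M by (auto simp: Mod_Obj Mod_ops Mod_base_maps S.act_module_def S.act_def)
next
  fix t assume "t \<in> Arr (Mod_cat C)"
  then show "amap Mod_base t \<in> Hom C (omap Mod_base (Dom (Mod_cat C) t)) (omap Mod_base (Cod (Mod_cat C) t))"
    by (elim Mod_ArrE) (simp add: Mod_ops Mod_base_maps)
next
  fix t t' assume "t \<in> Arr (Mod_cat C)" "t' \<in> Arr (Mod_cat C)"
  then show "amap Mod_base (Comp (Mod_cat C) t' t) = amap Mod_base t' \<cdot> amap Mod_base t"
    by (elim Mod_ArrE) (simp add: Mod_ops Mod_base_maps)
qed

text \<open>As \<beta> is invertible, the module component of a factorization is forced to be the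
  inverse of \<beta> after \<nu>, and its equivariance follows by cancelling \<beta>.\<close>

lemma Mod_cartesian:
  assumes t: "((A, B, \<xi>), (\<gamma>, \<beta>), (A', B', \<xi>')) \<in> Arr (Mod_cat C)" and i: "S.isom (Some \<beta>) B B'"
  shows "cartesian C (Mod_cat C, Mod_base) ((A, B, \<xi>), (\<gamma>, \<beta>), (A', B', \<xi>'))"
proof (rule cartesianI)
  show tH: "((A, B, \<xi>), (\<gamma>, \<beta>), (A', B', \<xi>')) \<in> Hom (Mod_cat C) (A, B, \<xi>) (A', B', \<xi>')"
    using t by (simp add: Hom_iff Mod_ops)
  have m: "S.act_module A B (Some \<xi>)" "S.act_module A' B' (Some \<xi>')" and am: "S.am A B (Some \<xi>) (Some \<gamma>) (Some \<beta>) A' B' (Some \<xi>')"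
    using tH by (auto simp: Mod_Hom)
  have gh: "\<gamma> \<in> Hom C A A'" "\<beta> \<in> Hom C B B'" using am by (auto simp: S.am_def)
  fix w g u assume g0: "g \<in> Hom (Mod_cat C) w (A', B', \<xi>')" and u0: "u \<in> Hom C (omap Mod_base w) (omap Mod_base (A, B, \<xi>))"
    and e0: "amap Mod_base ((A, B, \<xi>), (\<gamma>, \<beta>), (A', B', \<xi>')) \<cdot> u = amap Mod_base g"
  obtain D N \<omega> where w: "w = (D, N, \<omega>)" by (cases w)
  obtain \<delta> \<nu> where g: "g = ((D, N, \<omega>), (\<delta>, \<nu>), (A', B', \<xi>'))" and mw: "S.act_module D N (Some \<omega>)"
    and ga: "S.am D N (Some \<omega>) (Some \<delta>) (Some \<nu>) A' B' (Some \<xi>')" using g0 unfolding w Mod_Hom by blast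
  have u: "u \<in> Hom C D A" and e: "\<gamma> \<cdot> u = \<delta>" using u0 e0 by (auto simp: w g Mod_base_maps)
  have \<nu>: "\<nu> \<in> Hom C N B'" using ga by (simp add: S.am_def)
  obtain b where b: "b \<in> ohom C B' B" "Some \<beta> ** b = oidn C B'" by (rule S.isom_inverse[OF i])
  obtain b' where b': "b = Some b'" "b' \<in> Hom C B' B" using b(1) by (elim ohomE)
  define h where "h = b' \<cdot> \<nu>"
  have hh: "h \<in> Hom C N B" unfolding h_def by (rule comp_Hom[OF cat \<nu> b'(2)])
  have "Some \<beta> ** Some h = Some \<nu>"
    unfolding h_def cmp[OF \<nu> b'(2), symmetric] using S.reassoc[OF b(2), of "Some \<nu>"] b'(1) S.id_l[OF ohomI[OF \<nu>]] by simp
  then have bh: "\<beta> \<cdot> h = \<nu>" using cmp[OF hh gh(2)] by simp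
  have ah: "S.am D N (Some \<omega>) (Some u) (Some h) A B (Some \<xi>)" by (rule S.am_cancel[OF S.isom_monic[OF i] am])
      (use ga cmp[OF u gh(1)] cmp[OF hh gh(2)] e bh u hh m mw in \<open>auto simp: S.act_module_def dest: S.actD(3)\<close>)
  show "\<exists>!h. h \<in> Hom (Mod_cat C) w (A, B, \<xi>) \<and> Comp (Mod_cat C) ((A, B, \<xi>), (\<gamma>, \<beta>), (A', B', \<xi>')) h = g \<and> amap Mod_base h = u"
  proof (rule ex1I[of _ "((D, N, \<omega>), (u, h), (A, B, \<xi>))"])
    show "((D, N, \<omega>), (u, h), (A, B, \<xi>)) \<in> Hom (Mod_cat C) w (A, B, \<xi>) \<and>
      Comp (Mod_cat C) ((A, B, \<xi>), (\<gamma>, \<beta>), (A', B', \<xi>')) ((D, N, \<omega>), (u, h), (A, B, \<xi>)) = g \<and>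
      amap Mod_base ((D, N, \<omega>), (u, h), (A, B, \<xi>)) = u"
      using ah m mw e bh by (simp add: w g Mod_Hom Mod_ops Mod_base_maps)
    fix k assume k: "k \<in> Hom (Mod_cat C) w (A, B, \<xi>) \<and> Comp (Mod_cat C) ((A, B, \<xi>), (\<gamma>, \<beta>), (A', B', \<xi>')) k = g \<and> amap Mod_base k = u"
    then obtain a c where k': "k = ((D, N, \<omega>), (a, c), (A, B, \<xi>))" and ac: "S.am D N (Some \<omega>) (Some a) (Some c) A B (Some \<xi>)"
      unfolding w Mod_Hom by blast
    have c: "c \<in> Hom C N B" and e1: "a = u" "\<beta> \<cdot> c = \<nu>" using ac k by (auto simp: S.am_def k' g Mod_ops Mod_base_maps)
    have "Some \<beta> ** Some c = Some \<beta> ** Some h" using cmp[OF c gh(2)] cmp[OF hh gh(2)] e1 bh by simp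
    then have "Some c = Some h" by (rule S.monicD[OF S.isom_monic[OF i]]) (use c hh in auto)
    then show "k = ((D, N, \<omega>), (u, h), (A, B, \<xi>))" using k' e1 by simp
  qed
qed

lemma Mod_fib_object: "fib_object C (Mod_cat C, Mod_base)"
  unfolding fib_object_def prod.case
proof (intro conjI ballI impI cat Mod_category Mod_base_functor)
  fix M a assume M: "M \<in> Obj (Mod_cat C)" and a: "a \<in> Arr C" "Cod C a = omap Mod_base M"
  obtain A B \<xi> where Meq: "M = (A, B, \<xi>)" by (cases M)
  have m: "S.act_module A B (Some \<xi>)" using M by (simp add: Meq Mod_Obj)
  then have act: "S.act A B (Some \<xi>)" and ab: "S.abelian B" by (auto simp: S.act_module_def)
  have ah: "a \<in> Hom C (Dom C a) A" using a by (simp add: Hom_iff Meq Mod_base_maps)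
  note r = S.act_restrict[OF act ohomI[OF ah]]
  obtain \<xi>' where x: "Some \<xi> ** ofl (Some a) (oidn C B) = Some \<xi>'" using S.actD(3)[OF r(1)] by (elim ohomE)
  have B: "B \<in> Obj C" using S.actD(2)[OF act] .
  have t: "((Dom C a, B, \<xi>'), (a, Ident C B), (A, B, \<xi>)) \<in> Hom (Mod_cat C) (Dom C a, B, \<xi>') (A, B, \<xi>)"
    using r m x by (simp add: Mod_Hom S.act_module_def oidn_def)
  then have "((Dom C a, B, \<xi>'), (a, Ident C B), (A, B, \<xi>)) \<in> Arr (Mod_cat C)" by (simp add: Hom_iff)
  then have "cartesian C (Mod_cat C, Mod_base) ((Dom C a, B, \<xi>'), (a, Ident C B), (A, B, \<xi>))"
    by (rule Mod_cartesian) (use S.isom_id[OF B] in \<open>simp add: oidn_def\<close>)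
  then show "\<exists>f. cartesian C (Mod_cat C, Mod_base) f \<and> Cod (Mod_cat C) f = M \<and> amap Mod_base f = a"
    by (intro exI[of _ "((Dom C a, B, \<xi>'), (a, Ident C B), (A, B, \<xi>))"]) (simp add: Mod_ops Mod_base_maps Meq)
qed

end

lemma comp_functor:
  assumes F: "is_functor X Y F" and G: "is_functor Y Z G"
  shows "is_functor X Z (G \<circ>\<^sub>F F)"
  unfolding is_functor_def
proof (intro conjI ballI impI)
  fix f assume "f \<in> Arr X"
  then have f: "f \<in> Hom X (Dom X f) (Cod X f)" by (simp add: Hom_iff)
  show "amap (G \<circ>\<^sub>F F) f \<in> Hom Z (omap (G \<circ>\<^sub>F F) (Dom X f)) (omap (G \<circ>\<^sub>F F) (Cod X f))"
    using functor_Hom[OF G functor_Hom[OF F f]] by (simp add: comp_fctr_def)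
next
  fix f g assume "f \<in> Arr X" "g \<in> Arr X" "Cod X f = Dom X g"
  then have fg: "f \<in> Hom X (Dom X f) (Dom X g)" "g \<in> Hom X (Dom X g) (Cod X g)" by (auto simp: Hom_iff)
  show "amap (G \<circ>\<^sub>F F) (Comp X g f) = Comp Z (amap (G \<circ>\<^sub>F F) g) (amap (G \<circ>\<^sub>F F) f)"
    using functor_comp[OF F fg] functor_comp[OF G functor_Hom[OF F fg(1)] functor_Hom[OF F fg(2)]] by (simp add: comp_fctr_def)
qed (simp_all add: comp_fctr_def functor_Obj[OF F] functor_Obj[OF G] functor_id[OF F] functor_id[OF G])

section \<open>The fibration of crossed extensions\<close>

locale crossed_extensions = ssa_category C for C :: "('o, 'm) category" (structure) +
  fixes n :: nat
  assumes n2: "n \<ge> 2"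
begin

abbreviation X where "X \<equiv> XExt_cat C n"
abbreviation F where "F \<equiv> Mod_base \<circ>\<^sub>F XExt_Pi n"

definition mor :: "('o, 'm) xext => (nat => 'm) => ('o, 'm) xext => bool" where
  "mor E f E' \<longleftrightarrow> f \<in> extensional {0..n+1} \<and> S.ext_mor n (oE E) (\<lambda>i. Some (f i)) (oE E')"

lemma X_Obj: "E \<in> Obj X \<longleftrightarrow> is_xext C n E"
  by (simp add: XExt_cat_def)

lemma X_ext: "is_xext C n E ==> S.ext n (oE E)"
  using ext_iff[OF n2] by blast

lemma X_Hom: "t \<in> Hom X E E' \<longleftrightarrow> (\<exists>f. t = (E, f, E') \<and> is_xext C n E \<and> is_xext C n E' \<and> mor E f E')"
  using ext_mor_iff[OF n2, of E E'] by (auto simp: XExt_cat_def Hom_iff mor_def)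

lemma X_ops: "Dom X (E, f, E') = E" "Cod X (E, f, E') = E'"
  "Ident X E = (E, (\<lambda>i\<in>{0..n+1}. Ident C (xob E i)), E)"
  "Comp X (E0, g, E'') (E, f, E1) = (E, (\<lambda>i\<in>{0..n+1}. g i \<cdot> f i), E'')" by (simp_all add: XExt_cat_def)

lemma Pi_maps: "omap (XExt_Pi n) E = (xob E 0, xob E (Suc n), xact E (Suc n))"
  "amap (XExt_Pi n) (E, f, E') =
    ((xob E 0, xob E (Suc n), xact E (Suc n)), (f 0, f (Suc n)), (xob E' 0, xob E' (Suc n), xact E' (Suc n)))"
  by (simp_all add: XExt_Pi_def xext_module_def)

lemma F_maps: "omap F E = xob E 0" "amap F (E, f, E') = f 0"
  by (simp_all add: comp_fctr_def Pi_maps Mod_base_maps)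

lemma X_ArrE:
  assumes "t \<in> Arr X"
  obtains E f E' where "t = (E, f, E')" "t \<in> Hom X E E'" "is_xext C n E" "is_xext C n E'" "mor E f E'"
proof -
  have "t \<in> Hom X (Dom X t) (Cod X t)" using assms by (simp add: Hom_iff)
  with that show ?thesis by (auto simp: X_Hom)
qed

lemma mor_Hom: "mor E f E' ==> i \<le> Suc n ==> f i \<in> Hom C (xob E i) (xob E' i)"
  using S.ext_morD(1)[OF _ n2, of "oE E" "\<lambda>i. Some (f i)" "oE E'"] by (simp add: mor_def)

lemma mor_comp:
  assumes "mor E f E'" "mor E' g E''" "i \<le> Suc n"
  shows "Some (g i) ** Some (f i) = Some (g i \<cdot> f i)"
  by (rule cmp[OF mor_Hom[OF assms(1,3)] mor_Hom[OF assms(2,3)]])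

lemma mor_eqI:
  assumes "mor E f E'" "mor D g D'" "\<And>i. i \<le> Suc n ==> f i = g i"
  shows "f = g"
  by (rule extensionalityI[of _ "{0..n+1}"]) (use assms in \<open>auto simp: mor_def\<close>)

text \<open>On the index range the components have the form \<open>Some\<close> and can be
  unwrapped; restricting the family makes it extensional and leaves all conditions on the range
  intact.\<close>

lemma realize_mor:
  assumes "S.ext_mor n (oE E) h (oE E')"
  obtains f where "mor E f E'" "\<And>i. i \<le> Suc n ==> Some (f i) = h i"
proof
  let ?f = "\<lambda>i\<in>{0..n+1}. the (h i)"
  show f: "Some (?f i) = h i" if "i \<le> Suc n" for i
    using S.ext_morD(1)[OF assms n2, of i] that by (auto elim!: ohomE)
  have "S.ext_mor n (oE E) (\<lambda>i. Some (?f i)) (oE E')"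
    by (rule S.ext_mor_cong[OF _ _ n2 assms]) (use f in \<open>auto simp: S.agree_def\<close>)
  then show "mor E ?f E'" by (simp add: mor_def)
qed

lemma realize_ext:
  assumes E: "S.ext n E"
  obtains E' where "is_xext C n E'" "S.agree n E (oE E')"
proof
  let ?E = "\<lparr>xob = restrict (xob E) {0..n+1}, xd = \<lambda>i\<in>{0..n}. the (xd E i), xact = \<lambda>i\<in>{2..n+1}. the (xact E i)\<rparr>"
  have d: "Some (the (xd E i)) = xd E i" if "i \<le> n" for i using S.extD(2)[OF E n2 that] by (auto elim!: ohomE)
  have a: "Some (the (xact E i)) = xact E i" if i: "2 \<le> i" "i \<le> n + 1" for i
  proof (cases "i = 2")
    case True
    then show ?thesis using S.actD(3)[OF S.ext_act2[OF E n2]] by (auto elim!: ohomE)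
  next
    case False
    then show ?thesis using S.actD(3)[OF S.ext_act[OF E n2, of i]] i by (auto elim!: ohomE)
  qed
  show ag: "S.agree n E (oE ?E)" using d a by (auto simp: S.agree_def)
  from S.ext_cong[OF this n2 E] show "is_xext C n ?E" by (simp add: ext_iff[OF n2] del: oE_simps)
qed

lemma X_category: "is_category X"
  unfolding is_category_def
proof (intro conjI ballI impI)
  fix t assume "t \<in> Arr X"
  then obtain E f E' where t: "t = (E, f, E')" and E: "is_xext C n E" "is_xext C n E'" and f: "mor E f E'" by (rule X_ArrE)
  show "Dom X t \<in> Obj X" "Cod X t \<in> Obj X" using E by (auto simp: t X_ops X_Obj)
  have "(\<lambda>i\<in>{0..n+1}. f i) = f" using f by (auto simp: mor_def intro: extensional_restrict)
  moreover have "(\<lambda>i\<in>{0..n+1}. f i \<cdot> (\<lambda>i\<in>{0..n+1}. Ident C (xob E i)) i) = (\<lambda>i\<in>{0..n+1}. f i)"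
    "(\<lambda>i\<in>{0..n+1}. (\<lambda>i\<in>{0..n+1}. Ident C (xob E' i)) i \<cdot> f i) = (\<lambda>i\<in>{0..n+1}. f i)"
    using comp_id_left[OF cat mor_Hom[OF f]] comp_id_right[OF cat mor_Hom[OF f]] by (auto intro!: restrict_ext)
  ultimately show "Comp X t (Ident X (Dom X t)) = t" "Comp X (Ident X (Cod X t)) t = t" by (simp_all add: t X_ops)
next
  fix E assume "E \<in> Obj X"
  then have E: "is_xext C n E" by (simp add: X_Obj)
  have "S.ext_mor n (oE E) (\<lambda>i. Some ((\<lambda>i\<in>{0..n+1}. Ident C (xob E i)) i)) (oE E)"
    by (rule S.ext_mor_cong[OF _ _ n2 S.ext_mor_id[OF X_ext[OF E] n2]]) (auto simp: S.agree_def oidn_def)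
  then show "Ident X E \<in> Hom X E E" using E by (simp add: X_ops X_Hom mor_def)
next
  fix t t' assume "t \<in> Arr X" "t' \<in> Arr X" and c: "Cod X t = Dom X t'"
  from this(1) obtain E f E' where t: "t = (E, f, E')" and E: "is_xext C n E" and f: "mor E f E'" by (rule X_ArrE)
  from \<open>t' \<in> _\<close> obtain E1 f' E'' where t': "t' = (E1, f', E'')" and E': "is_xext C n E''" and f': "mor E1 f' E''" by (rule X_ArrE)
  have 0: "E1 = E'" using c by (simp add: t t' X_ops)
  note f' = f'[unfolded 0]
  have "S.ext_mor n (oE E) (\<lambda>i. Some ((\<lambda>i\<in>{0..n+1}. f' i \<cdot> f i) i)) (oE E'')"
    by (rule S.ext_mor_cong[OF _ _ n2 S.ext_mor_comp[OF _ _ n2, of "oE E" "\<lambda>i. Some (f i)" "oE E'" "\<lambda>i. Some (f' i)" "oE E''"]])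
      (use f f' mor_comp[OF f f'] in \<open>auto simp: S.agree_def mor_def\<close>)
  then show "Comp X t' t \<in> Hom X (Dom X t) (Cod X t')" using E E' by (simp add: t t' X_ops X_Hom mor_def)
next
  fix t t' t'' assume "t \<in> Arr X" "t' \<in> Arr X" "t'' \<in> Arr X" and c: "Cod X t = Dom X t'" "Cod X t' = Dom X t''"
  from this(1) obtain E f E' where t: "t = (E, f, E')" and f: "mor E f E'" by (rule X_ArrE)
  from \<open>t' \<in> _\<close> obtain E1 f' E'' where t': "t' = (E1, f', E'')" and f': "mor E1 f' E''" by (rule X_ArrE)
  from \<open>t'' \<in> _\<close> obtain E2 f'' E3 where t'': "t'' = (E2, f'', E3)" and f'': "mor E2 f'' E3" by (rule X_ArrE)
  have 0: "E1 = E'" "E2 = E''" using c by (auto simp: t t' t'' X_ops)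
  note f' = f'[unfolded 0] and f'' = f''[unfolded 0]
  have "f'' i \<cdot> (f' i \<cdot> f i) = f'' i \<cdot> f' i \<cdot> f i" if "i \<le> Suc n" for i
    by (rule comp_assoc[OF cat mor_Hom[OF f that] mor_Hom[OF f' that] mor_Hom[OF f'' that], symmetric])
  then show "Comp X t'' (Comp X t' t) = Comp X (Comp X t'' t') t" by (auto simp: t t' t'' X_ops intro!: restrict_ext)
qed

lemma Pi_functor: "is_functor X (Mod_cat C) (XExt_Pi n)"
  unfolding is_functor_def
proof (intro conjI ballI impI)
  have m: "S.act_module (xob E 0) (xob E (Suc n)) (Some (xact E (Suc n)))" if "is_xext C n E" for E
    using S.extD(7)[OF X_ext[OF that] n2, of "Suc n"] n2 by simp
  {
    fix E assume "E \<in> Obj X"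
    then have "is_xext C n E" by (simp add: X_Obj)
    from m[OF this] show "omap (XExt_Pi n) E \<in> Obj (Mod_cat C)" by (simp add: Pi_maps Mod_Obj)
    show "amap (XExt_Pi n) (Ident X E) = Ident (Mod_cat C) (omap (XExt_Pi n) E)" by (simp add: X_ops Pi_maps Mod_ops)
  next
    fix t assume "t \<in> Arr X"
    then obtain E f E' where t: "t = (E, f, E')" and E: "is_xext C n E" "is_xext C n E'" and f: "mor E f E'" by (rule X_ArrE)
    have "S.am (xob E 0) (xob E (Suc n)) (Some (xact E (Suc n))) (Some (f 0)) (Some (f (Suc n))) (xob E' 0) (xob E' (Suc n))
        (Some (xact E' (Suc n)))"
      using f S.ext_morD(4)[OF _ n2, of "oE E" "\<lambda>i. Some (f i)" "oE E'" "Suc n"] n2 by (simp add: mor_def)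
    then show "amap (XExt_Pi n) t \<in> Hom (Mod_cat C) (omap (XExt_Pi n) (Dom X t)) (omap (XExt_Pi n) (Cod X t))"
      using m[OF E(1)] m[OF E(2)] by (simp add: t Pi_maps X_ops Mod_Hom)
  next
    fix t t' assume "t \<in> Arr X" "t' \<in> Arr X"
    then show "amap (XExt_Pi n) (Comp X t' t) = Comp (Mod_cat C) (amap (XExt_Pi n) t') (amap (XExt_Pi n) t)"
      by (elim X_ArrE) (simp add: Pi_maps X_ops Mod_ops)
  }
qed

lemma F_functor: "is_functor X C F"
  by (rule comp_functor[OF Pi_functor Mod_base_functor])

lemma ext_cartesian_cartesian:
  assumes t: "(E', f, E) \<in> Arr X" and c: "S.ext_cartesian n (oE E') (\<lambda>i. Some (f i)) (oE E)"
  shows "cartesian C (X, F) (E', f, E)"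
proof (rule cartesianI)
  show tH: "(E', f, E) \<in> Hom X E' E" using t by (simp add: Hom_iff X_ops)
  then have E: "is_xext C n E'" "is_xext C n E" and f: "mor E' f E" by (auto simp: X_Hom)
  fix D g0 u assume g0: "g0 \<in> Hom X D E" and u0: "u \<in> Hom C (omap F D) (omap F E')" and e0: "amap F (E', f, E) \<cdot> u = amap F g0"
  obtain g where g0': "g0 = (D, g, E)" and D: "is_xext C n D" and g: "mor D g E" using g0 unfolding X_Hom by blast
  have u: "u \<in> Hom C (xob D 0) (xob E' 0)" and e: "f 0 \<cdot> u = g 0" using u0 e0 by (auto simp: g0' F_maps)
  have gm: "S.ext_mor n (oE D) (\<lambda>i. Some (g i)) (oE E)" using g by (simp add: mor_def)
  have e': "Some (f 0) ** Some u = Some (g 0)" using cmp[OF u mor_Hom[OF f, of 0]] e by simp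
  obtain h0 where h0: "S.ext_mor n (oE D) h0 (oE E')" "h0 0 = Some u" "\<And>i. i \<le> n + 1 ==> Some (f i) ** h0 i = Some (g i)"
    by (rule S.ext_cartesian_factor[OF c n2 X_ext[OF D] gm, of "Some u"]) (use u e' in auto)
  obtain h where h: "mor D h E'" and hh0: "\<And>i. i \<le> Suc n ==> Some (h i) = h0 i" by (rule realize_mor[OF h0(1)]) blast
  have fh: "f i \<cdot> h i = g i" if i: "i \<le> Suc n" for i using h0(3)[of i] hh0[OF i] mor_comp[OF h f i] i by simp
  show "\<exists>!h. h \<in> Hom X D E' \<and> Comp X (E', f, E) h = g0 \<and> amap F h = u"
  proof (rule ex1I[of _ "(D, h, E')"])
    have "(\<lambda>i\<in>{0..n+1}. f i \<cdot> h i) = g"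
      by (rule extensionalityI[of _ "{0..n+1}"]) (use fh g in \<open>auto simp: mor_def\<close>)
    then show "(D, h, E') \<in> Hom X D E' \<and> Comp X (E', f, E) (D, h, E') = g0 \<and> amap F (D, h, E') = u"
      using D E h hh0[of 0] h0(2) by (simp add: X_Hom X_ops F_maps g0')
    fix k0 assume k0: "k0 \<in> Hom X D E' \<and> Comp X (E', f, E) k0 = g0 \<and> amap F k0 = u"
    then obtain k where k': "k0 = (D, k, E')" and k: "mor D k E'" unfolding X_Hom by blast
    have k00: "k 0 = u" and kg: "(\<lambda>i\<in>{0..n+1}. f i \<cdot> k i) = g" using k0 by (auto simp: k' F_maps X_ops g0')
    have fk: "f i \<cdot> k i = g i" if "i \<le> Suc n" for i using that fun_cong[OF kg, of i] by simp
    have "Some (k i) = Some (h i)" if i: "i \<le> Suc n" for i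
    proof (rule S.ext_cartesian_unique[OF c n2])
      show "S.ext_mor n (oE D) (\<lambda>i. Some (k i)) (oE E')" "S.ext_mor n (oE D) (\<lambda>i. Some (h i)) (oE E')" using k h by (auto simp: mor_def)
      show "Some (k 0) = Some (h 0)" using k00 hh0[of 0] h0(2) by simp
      show "Some (f i) ** Some (k i) = Some (f i) ** Some (h i)" if "i \<le> n + 1" for i
        using that fk[of i] fh[of i] mor_comp[OF k f, of i] mor_comp[OF h f, of i] by simp
    qed (use X_ext[OF D] i in auto)
    then have "k = h" by (intro mor_eqI[OF k h]) simp
    then show "k0 = (D, h, E')" using k' by simp
  qed
qed

lemma cartesian_lift:
  assumes E: "is_xext C n E" and a: "a \<in> Hom C A (xob E 0)"
  obtains E' f where "(E', f, E) \<in> Hom X E' E" "S.ext_cartesian n (oE E') (\<lambda>i. Some (f i)) (oE E)" "f 0 = a" "xob E' 0 = A"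
proof -
  have a': "Some a \<in> ohom C A (xob (oE E) 0)" using a by simp
  obtain E0 f0 where c: "S.ext_cartesian n E0 f0 (oE E)" and f0: "f0 0 = Some a" and A: "xob E0 0 = A"
    by (rule S.ext_pullback[OF X_ext[OF E] n2 a'])
  have c': "S.ext n E0" "S.ext_mor n E0 f0 (oE E)" "\<And>i. 2 \<le> i ==> i \<le> n + 1 ==> S.isom (f0 i) (xob E0 i) (xob E i)"
    "S.pullback (Some (xd E 0)) (f0 0) (xob E 1) (xob E0 0) (xob E 0) (xob E0 1) (f0 1) (xd E0 0)"
    using c by (auto simp: S.ext_cartesian_def)
  obtain E' where E': "is_xext C n E'" and ag: "S.agree n E0 (oE E')" by (rule realize_ext[OF c'(1)])
  have "S.ext_mor n (oE E') f0 (oE E)" by (rule S.ext_mor_cong[OF ag _ n2 c'(2)]) (auto simp: S.agree_def)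
  then obtain f where f: "mor E' f E" and ff: "\<And>i. i \<le> Suc n ==> Some (f i) = f0 i" by (rule realize_mor) blast
  have o: "xob E' i = xob E0 i" if "i \<le> Suc n" for i using S.agreeD(1)[OF ag n2 that] by simp
  have "S.ext_cartesian n (oE E') (\<lambda>i. Some (f i)) (oE E)"
    unfolding S.ext_cartesian_def using X_ext[OF E'] X_ext[OF E] f c'(3,4) ff o S.agreeD(2)[OF ag n2, of 0]
    by (auto simp: mor_def)
  moreover have "(E', f, E) \<in> Hom X E' E" using E E' f by (simp add: X_Hom)
  moreover have "f 0 = a" "xob E' 0 = A" using ff[of 0] f0 o[of 0] A by auto
  ultimately show ?thesis using that by blast
qed

lemma X_fib_object: "fib_object C (X, F)"
  unfolding fib_object_def prod.case
proof (intro conjI ballI impI cat X_category F_functor)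
  fix E a assume "E \<in> Obj X" and a: "a \<in> Arr C" "Cod C a = omap F E"
  then have E: "is_xext C n E" and ah: "a \<in> Hom C (Dom C a) (xob E 0)" by (auto simp: X_Obj F_maps Hom_iff)
  obtain E' f where f: "(E', f, E) \<in> Hom X E' E" "S.ext_cartesian n (oE E') (\<lambda>i. Some (f i)) (oE E)" "f 0 = a"
    by (rule cartesian_lift[OF E ah])
  have "cartesian C (X, F) (E', f, E)" by (rule ext_cartesian_cartesian[OF _ f(2)]) (use f in \<open>simp add: Hom_iff\<close>)
  then show "\<exists>f. cartesian C (X, F) f \<and> Cod X f = E \<and> amap F f = a" using f(3) by (intro exI[of _ "(E', f, E)"]) (simp add: X_ops F_maps)
qed

text \<open>A cartesian arrow is isomorphic, over an identity of the base, to the pullback lift of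
  the same arrow, and the explicit description of that lift is invariant under such
  isomorphisms.\<close>

lemma cartesian_ext_cartesian:
  assumes c: "cartesian C (X, F) (E', f, E)" and t: "(E', f, E) \<in> Hom X E' E"
  shows "S.ext_cartesian n (oE E') (\<lambda>i. Some (f i)) (oE E)"
proof -
  have E: "is_xext C n E'" "is_xext C n E" and f: "mor E' f E" using t by (auto simp: X_Hom)
  obtain E0 g where g: "(E0, g, E) \<in> Hom X E0 E" "S.ext_cartesian n (oE E0) (\<lambda>i. Some (g i)) (oE E)" "g 0 = f 0"
    by (rule cartesian_lift[OF E(2) mor_Hom[OF f, of 0]]) simp
  have gm: "mor E0 g E" using g(1) by (simp add: X_Hom)
  have cg: "cartesian C (X, F) (E0, g, E)" by (rule ext_cartesian_cartesian[OF _ g(2)]) (use g in \<open>simp add: Hom_iff\<close>)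
  obtain i0 j0 where ij: "inverse_arrows X E' E0 i0 j0" "Comp X (E0, g, E) i0 = (E', f, E)" "amap F i0 = Ident C (omap F E0)"
    "omap F E' = omap F E0"
    by (rule cartesian_lifts_isomorphic[OF X_category cat F_functor cg g(1) c t]) (use g(3) in \<open>simp add: F_maps\<close>)
  obtain i j where i: "i0 = (E', i, E0)" "mor E' i E0" and j: "j0 = (E0, j, E')" "mor E0 j E'"
    using ij(1) unfolding inverse_arrows_def X_Hom by blast
  have r: "(\<lambda>k\<in>{0..n+1}. j k \<cdot> i k) = (\<lambda>k\<in>{0..n+1}. Ident C (xob E' k))" "(\<lambda>k\<in>{0..n+1}. i k \<cdot> j k) = (\<lambda>k\<in>{0..n+1}. Ident C (xob E0 k))"
    "(\<lambda>k\<in>{0..n+1}. g k \<cdot> i k) = f" using ij(1,2) by (auto simp: inverse_arrows_def i j X_ops)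
  have r': "j k \<cdot> i k = Ident C (xob E' k)" "i k \<cdot> j k = Ident C (xob E0 k)" "g k \<cdot> i k = f k" if "k \<le> Suc n" for k
    using fun_cong[OF r(1), of k] fun_cong[OF r(2), of k] fun_cong[OF r(3), of k] that by auto
  show ?thesis
  proof (rule S.ext_cartesian_isom[OF g(2) n2 X_ext[OF E(1)]])
    show "S.ext_mor n (oE E') (\<lambda>k. Some (f k)) (oE E)" "S.ext_mor n (oE E') (\<lambda>k. Some (i k)) (oE E0)" using f i by (auto simp: mor_def)
    fix k assume k: "k \<le> Suc n"
    have "Some (j k) \<in> ohom C (xob E0 k) (xob E' k)" "Some (i k) \<in> ohom C (xob E' k) (xob E0 k)"
      using mor_Hom[OF j(2) k] mor_Hom[OF i(2) k] by auto
    moreover have "Some (j k) ** Some (i k) = oidn C (xob E' k)" "Some (i k) ** Some (j k) = oidn C (xob E0 k)"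
      using mor_comp[OF i(2) j(2) k] mor_comp[OF j(2) i(2) k] r'(1,2)[OF k] by (auto simp: oidn_def)
    ultimately show "S.isom (Some (i k)) (xob (oE E') k) (xob (oE E0) k)" unfolding S.isom_def by auto
    show "Some (g k) ** Some (i k) = Some (f k)" using mor_comp[OF i(2) gm k] r'(3)[OF k] by simp
  qed (use ij(3,4) in \<open>auto simp: i F_maps oidn_def\<close>)
qed

lemma Pi_1cell: "fib_1cell C (X, F) (Mod_cat C, Mod_base) (XExt_Pi n)"
  unfolding fib_1cell_def prod.case
proof (intro conjI allI impI ballI Pi_functor)
  fix t assume c: "cartesian C (X, F) t"
  then have "t \<in> Arr X" by (simp add: cartesian_def)
  then obtain E' f E where t: "t = (E', f, E)" and h: "t \<in> Hom X E' E" by (rule X_ArrE)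
  have e: "S.ext_cartesian n (oE E') (\<lambda>i. Some (f i)) (oE E)" by (rule cartesian_ext_cartesian) (use c h t in auto)
  then have i: "S.isom (Some (f (Suc n))) (xob E' (Suc n)) (xob E (Suc n))" using n2 by (simp add: S.ext_cartesian_def)
  have "amap (XExt_Pi n) t \<in> Arr (Mod_cat C)" using functor_Hom[OF Pi_functor h] by (simp add: Hom_iff)
  then show "cartesian C (Mod_cat C, Mod_base) (amap (XExt_Pi n) t)" unfolding t Pi_maps by (rule Mod_cartesian[OF _ i])
qed (simp_all add: comp_fctr_def)

section \<open>Cocartesian arrows of crossed extensions\<close>

definition pushes :: "('o, 'm) xext_arr set" where
  "pushes = {t \<in> Arr X. \<exists>E w E'. t = (E, w, E') \<and> S.ext_push n (oE E) (\<lambda>i. Some (w i)) (oE E')}"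

lemma pushes_Hom:
  assumes "t \<in> pushes" "t \<in> Hom X E E'"
  obtains w where "t = (E, w, E')" "S.ext_push n (oE E) (\<lambda>i. Some (w i)) (oE E')" "mor E w E'" "is_xext C n E" "is_xext C n E'"
  using assms by (auto simp: pushes_def X_Hom)

lemma push_lift:
  assumes E: "is_xext C n E" and \<beta>: "\<beta> \<in> Hom (Mod_cat C) (omap (XExt_Pi n) E) m" and v: "amap Mod_base \<beta> = Ident C (omap F E)"
  shows "\<exists>w\<in>pushes. Dom X w = E \<and> amap (XExt_Pi n) w = \<beta>"
proof -
  obtain A M \<mu> where m: "m = (A, M, \<mu>)" by (cases m)
  obtain \<gamma> f where b: "\<beta> = (omap (XExt_Pi n) E, (\<gamma>, f), (A, M, \<mu>))" and mM: "S.act_module A M (Some \<mu>)"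
    and am: "S.am (xob E 0) (xob E (Suc n)) (Some (xact E (Suc n))) (Some \<gamma>) (Some f) A M (Some \<mu>)"
    using \<beta> unfolding m Pi_maps Mod_Hom by blast
  have g: "\<gamma> = Ident C (xob E 0)" using v by (simp add: b Pi_maps Mod_base_maps F_maps)
  \<comment> \<open>Verticality of \<beta> forces its target to be a module over the same base
    object.\<close>
  have "\<gamma> \<in> Hom C (xob E 0) A" "\<gamma> \<in> Hom C (xob E 0) (xob E 0)"
    using am id_Hom[OF cat, of "xob E 0"] S.extD(1)[OF X_ext[OF E] n2, of 0] by (auto simp: S.am_def g)
  then have A: "A = xob E 0" by (simp add: Hom_iff)
  obtain E0 w0 where p: "S.ext_push n (oE E) w0 E0" "xob E0 (Suc n) = M" "xact E0 (Suc n) = Some \<mu>" "w0 (Suc n) = Some f"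
    by (rule S.ext_pushforward[OF X_ext[OF E] n2, of M "Some \<mu>" "Some f"]) (use mM am A g in \<open>auto simp: oidn_def\<close>)
  have p': "S.ext n E0" "S.ext_mor n (oE E) w0 E0" "xob E0 0 = xob E 0" "w0 0 = Some (Ident C (xob E 0))"
    "\<And>i. i < n ==> S.isom (w0 i) (xob E i) (xob E0 i)" using p(1) by (auto simp: S.ext_push_def oidn_def)
  obtain E' where E': "is_xext C n E'" and ag: "S.agree n E0 (oE E')" by (rule realize_ext[OF p'(1)])
  have "S.ext_mor n (oE E) w0 (oE E')" by (rule S.ext_mor_cong[OF _ ag n2 p'(2)]) (auto simp: S.agree_def)
  then obtain w where w: "mor E w E'" and ww: "\<And>i. i \<le> Suc n ==> Some (w i) = w0 i" by (rule realize_mor) blast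
  have o: "xob E' i = xob E0 i" if "i \<le> Suc n" for i using S.agreeD(1)[OF ag n2 that] by simp
  have x: "Some (xact E' (Suc n)) = xact E0 (Suc n)" using S.agreeD(3)[OF ag n2, of "Suc n"] n2 by simp
  have "S.ext_push n (oE E) (\<lambda>i. Some (w i)) (oE E')"
    unfolding S.ext_push_def using X_ext[OF E] X_ext[OF E'] w p' o ww by (auto simp: mor_def oidn_def)
  then have "(E, w, E') \<in> pushes" using E E' w X_Hom[of "(E, w, E')" E E'] by (auto simp: pushes_def Hom_iff)
  moreover have "amap (XExt_Pi n) (E, w, E') = \<beta>"
    using ww[of 0] ww[of "Suc n"] o[of 0] o[of "Suc n"] x p p' by (simp add: b Pi_maps A g)
  ultimately show ?thesis by (intro bexI[of _ "(E, w, E')"]) (simp add: X_ops)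
qed

lemma push_cocartesian:
  assumes t: "t \<in> pushes" "t \<in> Hom X E E'" and s: "s \<in> Hom X E D"
    and b: "b \<in> Hom (Mod_cat C) (omap (XExt_Pi n) E') (omap (XExt_Pi n) D)"
    and e: "Comp (Mod_cat C) b (amap (XExt_Pi n) t) = amap (XExt_Pi n) s"
  shows "\<exists>!h. h \<in> Hom X E' D \<and> Comp X h t = s \<and> amap (XExt_Pi n) h = b"
proof -
  obtain w where t': "t = (E, w, E')" and p: "S.ext_push n (oE E) (\<lambda>i. Some (w i)) (oE E')" and w: "mor E w E'"
    and E: "is_xext C n E" "is_xext C n E'" by (rule pushes_Hom[OF t])
  obtain g where s': "s = (E, g, D)" and D: "is_xext C n D" and g: "mor E g D" using s unfolding X_Hom by blast
  obtain \<gamma> \<beta> where b': "b = (omap (XExt_Pi n) E', (\<gamma>, \<beta>), omap (XExt_Pi n) D)"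
    and am: "S.am (xob E' 0) (xob E' (Suc n)) (Some (xact E' (Suc n))) (Some \<gamma>) (Some \<beta>) (xob D 0) (xob D (Suc n)) (Some (xact D (Suc n)))"
    using b unfolding Pi_maps Mod_Hom by blast
  have e': "\<gamma> \<cdot> w 0 = g 0" "\<beta> \<cdot> w (Suc n) = g (Suc n)" using e by (auto simp: b' t' s' Pi_maps Mod_ops)
  have \<gamma>: "\<gamma> \<in> Hom C (xob E' 0) (xob D 0)" and \<beta>: "\<beta> \<in> Hom C (xob E' (Suc n)) (xob D (Suc n))" using am by (auto simp: S.am_def)
  \<comment> \<open>\<open>w\<close> is an identity in degree 0, so the base component of
    \<open>b\<close> equals that of \<open>s\<close>; this is the form of the hypothesis in
    \<open>ext_push_cocartesian\<close>.\<close>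
  have w0: "w 0 = Ident C (xob E' 0)" using p by (simp add: S.ext_push_def oidn_def)
  have \<gamma>0: "\<gamma> = g 0" using e'(1) w0 comp_id_right[OF cat \<gamma>] by simp
  have gm: "S.ext_mor n (oE E) (\<lambda>i. Some (g i)) (oE D)" using g by (simp add: mor_def)
  obtain h0 where h0: "S.ext_mor n (oE E') h0 (oE D)" "\<And>i. i \<le> Suc n ==> h0 i ** Some (w i) = Some (g i)" "h0 (Suc n) = Some \<beta>"
    by (rule S.ext_push_cocartesian[OF n2 p X_ext[OF D] gm, of "Some \<beta>"])
      (use am \<gamma>0 e'(2) cmp[OF mor_Hom[OF w, of "Suc n"] \<beta>] in auto)
  obtain h where h: "mor E' h D" and hh0: "\<And>i. i \<le> Suc n ==> Some (h i) = h0 i" by (rule realize_mor[OF h0(1)]) blast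
  have hw: "h i \<cdot> w i = g i" if i: "i \<le> Suc n" for i using h0(2)[OF i] hh0[OF i] mor_comp[OF w h i] by simp
  have h1: "h 0 = \<gamma>" "h (Suc n) = \<beta>"
    using hw[of 0] w0 comp_id_right[OF cat mor_Hom[OF h, of 0]] \<gamma>0 hh0[of "Suc n"] h0(3) by auto
  show ?thesis
  proof (rule ex1I[of _ "(E', h, D)"])
    have "(\<lambda>i\<in>{0..n+1}. h i \<cdot> w i) = g"
      by (rule extensionalityI[of _ "{0..n+1}"]) (use hw g in \<open>auto simp: mor_def\<close>)
    then show "(E', h, D) \<in> Hom X E' D \<and> Comp X (E', h, D) t = s \<and> amap (XExt_Pi n) (E', h, D) = b"
      using D E h h1 by (simp add: X_Hom X_ops t' s' b' Pi_maps)
    fix k0 assume k0: "k0 \<in> Hom X E' D \<and> Comp X k0 t = s \<and> amap (XExt_Pi n) k0 = b"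
    then obtain k where k': "k0 = (E', k, D)" and k: "mor E' k D" unfolding X_Hom by blast
    have k1: "k (Suc n) = \<beta>" and kg: "(\<lambda>i\<in>{0..n+1}. k i \<cdot> w i) = g" using k0 by (auto simp: k' t' s' b' Pi_maps X_ops)
    have kw: "k i \<cdot> w i = g i" if "i \<le> Suc n" for i using that fun_cong[OF kg, of i] by simp
    have "Some (k i) = Some (h i)" if i: "i \<le> Suc n" for i
    proof (rule S.ext_push_epic[OF n2 p X_ext[OF D]])
      show "S.ext_mor n (oE E') (\<lambda>i. Some (k i)) (oE D)" "S.ext_mor n (oE E') (\<lambda>i. Some (h i)) (oE D)" using k h by (auto simp: mor_def)
      show "Some (k i) ** Some (w i) = Some (h i) ** Some (w i)" if "i \<le> Suc n" for i
        using that kw[of i] hw[of i] mor_comp[OF w k, of i] mor_comp[OF w h, of i] by simp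
    qed (use k1 h1 i in auto)
    then have "k = h" by (intro mor_eqI[OF k h]) simp
    then show "k0 = (E', h, D)" using k' by simp
  qed
qed

lemma push_base_change:
  assumes t: "t \<in> pushes" "t \<in> Hom X E E'" and f0: "f0 \<in> Hom X D E" "cartesian C (X, F) f0"
    and f0': "f0' \<in> Hom X D' E'" "cartesian C (X, F) f0'" and v0: "v0 \<in> Hom X D D'" "amap F v0 = Ident C (omap F D)"
    and e: "Comp X f0' v0 = Comp X t f0"
  shows "v0 \<in> pushes"
proof -
  obtain w where t': "t = (E, w, E')" and p: "S.ext_push n (oE E) (\<lambda>i. Some (w i)) (oE E')" and w: "mor E w E'"
    and E: "is_xext C n E" "is_xext C n E'" by (rule pushes_Hom[OF t])
  obtain f where f: "f0 = (D, f, E)" "is_xext C n D" "mor D f E" using f0(1) unfolding X_Hom by blast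
  obtain f' where f': "f0' = (D', f', E')" "is_xext C n D'" "mor D' f' E'" using f0'(1) unfolding X_Hom by blast
  obtain v where v: "v0 = (D, v, D')" "mor D v D'" using v0(1) unfolding X_Hom by blast
  have c: "S.ext_cartesian n (oE D) (\<lambda>i. Some (f i)) (oE E)" "S.ext_cartesian n (oE D') (\<lambda>i. Some (f' i)) (oE E')"
    using cartesian_ext_cartesian f0 f0' f(1) f'(1) by auto
  have vv: "v 0 = Ident C (xob D 0)" using v0(2) by (simp add: v F_maps)
  have "v 0 \<in> Hom C (xob D 0) (xob D 0)" using vv id_Hom[OF cat] S.extD(1)[OF X_ext[OF f(2)] n2, of 0] by simp
  then have D0: "xob D' 0 = xob D 0" using mor_Hom[OF v(2), of 0] by (simp add: Hom_iff)
  have e': "(\<lambda>i\<in>{0..n+1}. f' i \<cdot> v i) = (\<lambda>i\<in>{0..n+1}. w i \<cdot> f i)" using e by (simp add: f f' v t' X_ops)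
  have "S.ext_push n (oE D) (\<lambda>i. Some (v i)) (oE D')"
  proof (rule S.ext_push_base_change[OF n2 p c])
    show "S.ext_mor n (oE D) (\<lambda>i. Some (v i)) (oE D')" using v by (simp add: mor_def)
    show "Some (f' i) ** Some (v i) = Some (w i) ** Some (f i)" if "i \<le> n + 1" for i
      using fun_cong[OF e', of i] that mor_comp[OF v(2) f'(3), of i] mor_comp[OF f(3) w, of i] by simp
  qed (use vv D0 in \<open>auto simp: oidn_def\<close>)
  then show ?thesis using v0(1) by (auto simp: pushes_def v Hom_iff)
qed

lemma opfibration_XExt: "opfibration_in_Fib C (X, F) (Mod_cat C, Mod_base) (XExt_Pi n)"
proof -
  interpret cocartesian_lifts C X F "Mod_cat C" Mod_base "XExt_Pi n" pushes
  proof unfold_locales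
    show "fib_object C (X, F)" "fib_object C (Mod_cat C, Mod_base)" "fib_1cell C (X, F) (Mod_cat C, Mod_base) (XExt_Pi n)"
      by (rule X_fib_object Mod_fib_object Pi_1cell)+
    show "amap F w = Ident C (omap F E)" if w: "w \<in> pushes" "w \<in> Hom X E E'" for w E E'
      by (rule pushes_Hom[OF w]) (simp add: F_maps S.ext_push_def oidn_def)
    show "w \<in> Arr X" if "w \<in> pushes" for w using that by (simp add: pushes_def)
  qed (fact push_lift[folded X_Obj] push_cocartesian push_base_change)+
  show ?thesis by (rule opfibration)
qed

end

theorem proposition4p12:
  fixes C :: "('o, 'm) category" and n :: nat
  assumes "strongly_semi_abelian C" and "n \<ge> 2"
  shows "opfibration_in_Fib C (XExt_cat C n, Mod_base \<circ>\<^sub>F XExt_Pi n) (Mod_cat C, Mod_base) (XExt_Pi n)"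
proof -
  interpret crossed_extensions C n by unfold_locales (fact assms)+
  show ?thesis by (rule opfibration_XExt)
qed

end
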